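(* Let $X_0$ be a finite measure on $\mathbb{R}$ and $\xi\in(0,1)$. For any $K\in\mathbb{N}$ there is a random variable $\rho(K,\xi,\omega)>0$ a.s. such that for all $(t,x)$ with $X(t,x)=0$ and $t\ge K^{-1}$, and all $(t',x')$ with $t'>0$ and $d((t',x'),(t,x))\le\rho$, we have $X(t',x')\le d((t',x'),(t,x))^\xi$.
   Context: $X(t,x)$ ($t>0$, $x\in\mathbb{R}$) is the jointly continuous density of one-dimensional super-Brownian motion started at $X_0$, i.e. the nonnegative solution of $\partial_tX=\frac12\partial_x^2X+\sqrt X\dot W$ with $\dot W$ a space-time white noise, under its law $P_{X_0}$. For $(t_i,x_i)\in\mathbb{R}_+\times\mathbb{R}$, $d((t_1,x_1),(t_2,x_2))=\sqrt{|t_1-t_2|}+|x_1-x_2|$. *)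

theory Defs
  imports "HOL-Probability.Probability"
begin

definition pdist :: "real \<times> real \<Rightarrow> real \<times> real \<Rightarrow> real" where
  "pdist p q = sqrt \<bar>fst p - fst q\<bar> + \<bar>snd p - snd q\<bar>"

definition test_fun :: "(real \<Rightarrow> real) \<Rightarrow> (real \<Rightarrow> real) \<Rightarrow> (real \<Rightarrow> real) \<Rightarrow> bool" where
  "test_fun \<phi> \<phi>1 \<phi>2 \<longleftrightarrow>
     (\<forall>x. (\<phi> has_real_derivative \<phi>1 x) (at x)) \<and>
     (\<forall>x. (\<phi>1 has_real_derivative \<phi>2 x) (at x)) \<and>
     continuous_on UNIV \<phi>2 \<and> bounded (range \<phi>) \<and> bounded (range \<phi>2)"

definition cont_martingale :: "'a measure \<Rightarrow> (real \<Rightarrow> 'a measure) \<Rightarrow> (real \<Rightarrow> 'a \<Rightarrow> real) \<Rightarrow> bool" where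
  "cont_martingale M F Y \<longleftrightarrow>
     (\<forall>t\<ge>0. Y t \<in> borel_measurable (F t) \<and> integrable M (Y t)) \<and>
     (\<forall>s t. 0 \<le> s \<and> s \<le> t \<longrightarrow> (AE \<omega> in M. real_cond_exp M (F s) (Y t) \<omega> = Y s \<omega>)) \<and>
     (AE \<omega> in M. continuous_on {0..} (\<lambda>t. Y t \<omega>))"

definition pair_dens :: "(real \<Rightarrow> real) \<Rightarrow> (real \<Rightarrow> real) \<Rightarrow> real" where
  "pair_dens f \<phi> = (LINT x|lborel. f x * \<phi> x)"

definition sbm_mart :: "'a measure \<Rightarrow> ('a \<Rightarrow> real \<Rightarrow> real \<Rightarrow> real) \<Rightarrow> real measure
      \<Rightarrow> (real \<Rightarrow> real) \<Rightarrow> (real \<Rightarrow> real) \<Rightarrow> real \<Rightarrow> 'a \<Rightarrow> real" where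
  "sbm_mart M X X0 \<phi> \<phi>2 t \<omega> =
     (if t = 0 then 0 else
        pair_dens (X \<omega> t) \<phi> - (\<integral>x. \<phi> x \<partial>X0)
        - (LINT s:{0<..t}|lborel. pair_dens (X \<omega> s) (\<lambda>x. \<phi>2 x / 2)))"

text \<open>X is (a jointly continuous version of) the density of super-Brownian motion
  started at X0 (branching rate 1, i.e. dX = 1/2 X'' dt + sqrt X dW), on the filtered probability
  space (M, F): characterised by the (well-posed) martingale problem.\<close>
definition sbm_density :: "'a measure \<Rightarrow> (real \<Rightarrow> 'a measure) \<Rightarrow> real measure
      \<Rightarrow> ('a \<Rightarrow> real \<Rightarrow> real \<Rightarrow> real) \<Rightarrow> bool" where
  "sbm_density M F X0 X \<longleftrightarrow>
     prob_space M \<and> filtration (space M) F \<and> (\<forall>t. subalgebra M (F t)) \<and>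
     (\<forall>\<omega>\<in>space M. continuous_on ({0<..} \<times> UNIV) (\<lambda>(t, x). X \<omega> t x)) \<and>
     (\<forall>\<omega>\<in>space M. \<forall>t>0. \<forall>x. 0 \<le> X \<omega> t x) \<and>
     (\<forall>\<omega>\<in>space M. \<forall>t>0. integrable lborel (X \<omega> t)) \<and>
     (\<forall>\<omega>\<in>space M. \<forall>t>0. set_integrable lborel {0<..t} (\<lambda>s. LINT x|lborel. X \<omega> s x)) \<and>
     (\<forall>t>0. \<forall>x. (\<lambda>\<omega>. X \<omega> t x) \<in> borel_measurable (F t)) \<and>
     (\<forall>\<phi> \<phi>1 \<phi>2. test_fun \<phi> \<phi>1 \<phi>2 \<longrightarrow>
        cont_martingale M F (sbm_mart M X X0 \<phi> \<phi>2) \<and>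
        cont_martingale M F (\<lambda>t \<omega>. (sbm_mart M X X0 \<phi> \<phi>2 t \<omega>)\<^sup>2
             - (if t = 0 then 0 else LINT s:{0<..t}|lborel. pair_dens (X \<omega> s) (\<lambda>x. (\<phi> x)\<^sup>2))))"

end

theory Submission
  imports Defs "HOL-Real_Asymp.Real_Asymp"
begin

text \<open>Write \<open>J s v\<close> for the integral of \<open>v\<close> against \<open>X s\<close>. If \<open>\<partial>\<^sub>s v + v'' / 2 + v\<^sup>2 / 2 \<le> 0\<close>, then
  \<open>exp (J s v)\<close> is a supermartingale, and reversing the inequality for \<open>v \<le> 0\<close> gives a submartingale. This needs
  no stochastic integral: the Ito formula is only used in expectation, where it follows from the two
  martingales of the martingale problem and their path continuity. Taking for \<open>v\<close> a multiple of the heat kernel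
  with pole \<open>(t, x)\<close> compares \<open>X t x\<close> with its conditional mean \<open>U s t x\<close>, the heat flow of
  \<open>X s\<close>: outside an event of probability at most \<open>E (U s t x) / r\<close> times a multiple of \<open>exp (- b / 4)\<close>,
  they agree up to a factor \<open>1 + 1 / b\<close> and an additive error \<open>b ^ 4 * r\<close>, where \<open>t - s\<close> is about \<open>b ^ 4 * r\<^sup>2\<close>. Because \<open>U\<close>
  itself varies by a factor \<open>1 + O(1 / b)\<close> between neighbours of the grid of mesh \<open>r\<^sup>2\<close> in time and \<open>r\<close>
  in space, so does \<open>X\<close>, up to an additive \<open>O(b ^ 4 * r)\<close>.

  Let \<open>r = 2 powr (- n)\<close> and let \<open>b = b n\<close> have fourth power about \<open>2 powr (n * \<eta>)\<close>. The expected
  number of exceptional grid points is summable in \<open>n\<close>, since the sum of \<open>U\<close> over a spatial grid is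
  controlled by the total mass, and late times are covered by extinction. As \<open>1 / b n\<close> is summable, the factors
  multiply up to a constant along dyadic approximations. Hence a chain from a zero to a point at distance \<open>d\<close>
  collects only the additive errors, a geometric sum of order \<open>d powr (1 - \<eta>)\<close>.\<close>

section \<open>Joint measurability and integrals of the density\<close>

text \<open>The zero set is random, so no probability can be estimated at its points; all estimates
  are made at deterministic grid points, which do not know whether a zero is near. Neighbours must
  therefore be compared wherever \<open>X\<close> happens to be large, and there a purely additive
  bound fails: over a parabolic box of size \<open>r\<close> a value \<open>X\<close> fluctuates by
  about \<open>sqrt (r * X)\<close>, which is of order \<open>r\<close> only where \<open>X\<close>
  is. A factor 1 + O(1/b) repairs this, since \<open>sqrt (r * X) \<le> X / b + b * r\<close>.

  The powers of \<open>b\<close> come from the heat kernel. The lag \<open>b ^ 4 * r ^ 2\<close>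
  gives it the width \<open>b ^ 2 * r\<close>, so a shift by \<open>r\<close> changes it by a factor
  1 + O(1/b) as far as \<open>b ^ 3 * r\<close> from its centre, and beyond that only a Gaussian
  tail is left. Over this lag the fluctuation is about
  \<open>sqrt (b ^ 2 * r * X) \<le> X / b + b ^ 3 * r\<close>; one more factor \<open>b\<close> in
  the additive error makes large deviations exponentially rare in \<open>b\<close>.

  Each time carries infinitely many grid points, so a uniform probability per point would be
  useless. Subtracting 1 from the exponential before taking expectations makes the bound
  proportional to the mean of \<open>U\<close>.\<close>

lemma measurable_pair_discretize:
  fixes f :: "'a \<Rightarrow> 'b \<Rightarrow> real" and d :: "nat \<Rightarrow> 'i::countable \<Rightarrow> 'b" and e :: "nat \<Rightarrow> 'b \<Rightarrow> 'i"
  assumes e: "\<And>n. e n \<in> B \<rightarrow>\<^sub>M count_space UNIV"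
    and f: "\<And>n i. (\<lambda>\<omega>. f \<omega> (d n i)) \<in> borel_measurable N"
    and lim: "\<And>\<omega> b. \<omega> \<in> space N \<Longrightarrow> b \<in> space B \<Longrightarrow> (\<lambda>n. f \<omega> (d n (e n b))) \<longlonglongrightarrow> h \<omega> b"
  shows "(\<lambda>(\<omega>, b). h \<omega> b) \<in> borel_measurable (N \<Otimes>\<^sub>M B)"
proof -
  \<comment> \<open>\<open>f\<close> is known to be measurable only for each fixed second argument.
    Once that argument takes values in a countable type, measurability holds piece by piece, and the
    limit recovers \<open>h\<close>.\<close>
  have 1: "(\<lambda>p. f (fst p) (d n (e n (snd p)))) \<in> borel_measurable (N \<Otimes>\<^sub>M B)" for n
  proof (rule measurable_compose_countable)
    show "(\<lambda>p. f (fst p) (d n i)) \<in> borel_measurable (N \<Otimes>\<^sub>M B)" for i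
      using f[of n i] by measurable
    show "(\<lambda>p. e n (snd p)) \<in> N \<Otimes>\<^sub>M B \<rightarrow>\<^sub>M count_space UNIV"
      using e[of n] by measurable
  qed
  have "(\<lambda>p. h (fst p) (snd p)) \<in> borel_measurable (N \<Otimes>\<^sub>M B)"
    by (rule borel_measurable_LIMSEQ_real[OF _ 1]) (auto simp: space_pair_measure intro: lim)
  then show ?thesis by (simp add: case_prod_beta')
qed

lemma LIMSEQ_floor_grid: "(\<lambda>n. of_int \<lfloor>real (Suc n) * x\<rfloor> / real (Suc n)) \<longlonglongrightarrow> x"
proof (rule real_tendsto_sandwich[of "\<lambda>n. x - 1 / real (Suc n)" _ _ "\<lambda>n. x"])
  show "(\<lambda>n. x - 1 / real (Suc n)) \<longlonglongrightarrow> x" by real_asymp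
  have "x - 1 / real (Suc n) = (real (Suc n) * x - 1) / real (Suc n)" for n
    by (simp add: diff_divide_distrib del: of_nat_Suc)
  moreover have "real (Suc n) * x - 1 \<le> of_int \<lfloor>real (Suc n) * x\<rfloor>" "of_int \<lfloor>real (Suc n) * x\<rfloor> \<le> real (Suc n) * x" for n
    by linarith+
  ultimately have "x - 1 / real (Suc n) \<le> of_int \<lfloor>real (Suc n) * x\<rfloor> / real (Suc n)"
    "of_int \<lfloor>real (Suc n) * x\<rfloor> / real (Suc n) \<le> x" for n
    by (simp_all add: divide_right_mono pos_divide_le_eq mult.commute del: of_nat_Suc)
  then show "\<forall>\<^sub>F n in sequentially. x - 1 / real (Suc n) \<le> of_int \<lfloor>real (Suc n) * x\<rfloor> / real (Suc n)"
    "\<forall>\<^sub>F n in sequentially. of_int \<lfloor>real (Suc n) * x\<rfloor> / real (Suc n) \<le> x"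
    by auto
qed simp

lemma LIMSEQ_ceiling_grid: "(\<lambda>n. of_int \<lceil>real (Suc n) * x\<rceil> / real (Suc n)) \<longlonglongrightarrow> x"
proof (rule real_tendsto_sandwich[of "\<lambda>n. x" _ _ "\<lambda>n. x + 1 / real (Suc n)"])
  show "(\<lambda>n. x + 1 / real (Suc n)) \<longlonglongrightarrow> x" by real_asymp
  have "of_int \<lceil>real (Suc n) * x\<rceil> \<le> real (Suc n) * x + 1" "real (Suc n) * x \<le> of_int \<lceil>real (Suc n) * x\<rceil>" for n
    by linarith+
  then show "\<forall>\<^sub>F n in sequentially. of_int \<lceil>real (Suc n) * x\<rceil> / real (Suc n) \<le> x + 1 / real (Suc n)"
    "\<forall>\<^sub>F n in sequentially. x \<le> of_int \<lceil>real (Suc n) * x\<rceil> / real (Suc n)"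
    by (auto simp: field_simps simp del: of_nat_Suc intro!: always_eventually)
qed simp

locale sbm_process =
  fixes M :: "'a measure" and F :: "real \<Rightarrow> 'a measure" and X0 :: "real measure"
    and X :: "'a \<Rightarrow> real \<Rightarrow> real \<Rightarrow> real"
  assumes finite_X0: "finite_measure X0" and sets_X0: "sets X0 = sets borel"
    and sbm: "sbm_density M F X0 X"
begin

sublocale prob_space M
  using sbm unfolding sbm_density_def by blast

lemma filt: "filtration (space M) F"
  and subalg: "subalgebra M (F t)"
  and cont: "\<omega> \<in> space M \<Longrightarrow> continuous_on ({0<..} \<times> UNIV) (\<lambda>(t, x). X \<omega> t x)"
  and nonneg: "\<omega> \<in> space M \<Longrightarrow> 0 < t \<Longrightarrow> 0 \<le> X \<omega> t x"
  and integ: "\<omega> \<in> space M \<Longrightarrow> 0 < t \<Longrightarrow> integrable lborel (X \<omega> t)"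
  and mass_integ: "\<omega> \<in> space M \<Longrightarrow> 0 < t \<Longrightarrow> set_integrable lborel {0<..t} (\<lambda>s. LINT x|lborel. X \<omega> s x)"
  and adapted: "0 < t \<Longrightarrow> (\<lambda>\<omega>. X \<omega> t x) \<in> borel_measurable (F t)"
  and mart1: "test_fun \<phi> \<phi>1 \<phi>2 \<Longrightarrow> cont_martingale M F (sbm_mart M X X0 \<phi> \<phi>2)"
  and mart2: "test_fun \<phi> \<phi>1 \<phi>2 \<Longrightarrow> cont_martingale M F (\<lambda>t \<omega>. (sbm_mart M X X0 \<phi> \<phi>2 t \<omega>)\<^sup>2
             - (if t = 0 then 0 else LINT s:{0<..t}|lborel. pair_dens (X \<omega> s) (\<lambda>x. (\<phi> x)\<^sup>2)))"
  using sbm unfolding sbm_density_def by blast+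

lemma space_F [simp]: "space (F t) = space M"
  using filt filtration.space_F by blast

lemma F_mono: "s \<le> t \<Longrightarrow> f \<in> borel_measurable (F s) \<Longrightarrow> f \<in> borel_measurable (F t)"
  using filtration.sets_F_mono[OF filt, of s t] unfolding measurable_def by auto

lemma F_M: "f \<in> borel_measurable (F s) \<Longrightarrow> f \<in> borel_measurable M"
  using measurable_from_subalg[OF subalg] by blast

lemma X_measurable_F:
  assumes "0 < t"
  shows "(\<lambda>(\<omega>, x). X \<omega> t x) \<in> borel_measurable (F t \<Otimes>\<^sub>M borel)"
proof (rule measurable_pair_discretize[where f = "\<lambda>\<omega> x. X \<omega> t x" and e = "\<lambda>n x. \<lfloor>real (Suc n) * x\<rfloor>" and d = "\<lambda>n i. of_int i / real (Suc n)"])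
  show "(\<lambda>x. \<lfloor>real (Suc n) * x\<rfloor>) \<in> borel \<rightarrow>\<^sub>M count_space UNIV" for n by measurable
  show "(\<lambda>\<omega>. X \<omega> t (of_int i / real (Suc n))) \<in> borel_measurable (F t)" for i n
    by (rule adapted[OF assms])
  fix \<omega> b assume "\<omega> \<in> space (F t)"
  then have c: "continuous_on ({0<..} \<times> UNIV) (\<lambda>(t, x). X \<omega> t x)" using cont by simp
  have "(\<lambda>n. (\<lambda>(t, x). X \<omega> t x) (t, of_int \<lfloor>real (Suc n) * b\<rfloor> / real (Suc n))) \<longlonglongrightarrow> (\<lambda>(t, x). X \<omega> t x) (t, b)"
    by (rule continuous_on_tendsto_compose[OF c]) (use assms in \<open>auto intro!: tendsto_Pair LIMSEQ_floor_grid simp del: of_nat_Suc\<close>)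
  then show "(\<lambda>n. X \<omega> t (of_int \<lfloor>real (Suc n) * b\<rfloor> / real (Suc n))) \<longlonglongrightarrow> X \<omega> t b" by simp
qed

text \<open>Nothing is known about \<open>X\<close> at times that are not positive; extension by
  zero gives a function that is jointly measurable on the whole product space.\<close>

definition Xp :: "'a \<Rightarrow> real \<Rightarrow> real \<Rightarrow> real" where "Xp \<omega> t x = (if 0 < t then X \<omega> t x else 0)"

lemma Xp_measurable: "(\<lambda>(\<omega>, t, x). Xp \<omega> t x) \<in> borel_measurable (M \<Otimes>\<^sub>M (borel \<Otimes>\<^sub>M borel))"
proof -
  have "(\<lambda>(\<omega>, p). Xp \<omega> (fst p) (snd p)) \<in> borel_measurable (M \<Otimes>\<^sub>M (borel \<Otimes>\<^sub>M borel))"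
  \<comment> \<open>Time is rounded up and space down: the rounded time is positive exactly when the
    time is, so the approximations never cross the cut of \<open>Xp\<close> at 0.\<close>
  proof (rule measurable_pair_discretize[where f = "\<lambda>\<omega> p. Xp \<omega> (fst p) (snd p)"
      and e = "\<lambda>n p. (\<lceil>real (Suc n) * fst p\<rceil>, \<lfloor>real (Suc n) * snd p\<rfloor>)" and d = "\<lambda>n i. (of_int (fst i) / real (Suc n), of_int (snd i) / real (Suc n))"])
    show "(\<lambda>p. (\<lceil>real (Suc n) * fst p\<rceil>, \<lfloor>real (Suc n) * snd p\<rfloor>)) \<in> borel \<Otimes>\<^sub>M borel \<rightarrow>\<^sub>M count_space UNIV" for n
      by measurable
    show "(\<lambda>\<omega>. Xp \<omega> (fst (of_int (fst i) / real (Suc n), of_int (snd i) / real (Suc n))) (snd (of_int (fst i) / real (Suc n), of_int (snd i) / real (Suc n)))) \<in> borel_measurable M" for i :: "int \<times> int" and n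
      unfolding Xp_def fst_conv snd_conv using F_M[OF adapted]
      by (cases "0 < real_of_int (fst i) / real (Suc n)") (simp_all del: of_nat_Suc)
    fix \<omega> and p :: "real \<times> real" assume "\<omega> \<in> space M"
    then have c: "continuous_on ({0<..} \<times> UNIV) (\<lambda>(t, x). X \<omega> t x)" using cont by simp
    let ?q = "\<lambda>n. (of_int \<lceil>real (Suc n) * fst p\<rceil> / real (Suc n), of_int \<lfloor>real (Suc n) * snd p\<rfloor> / real (Suc n))"
    have "(\<lambda>n. Xp \<omega> (fst (?q n)) (snd (?q n))) \<longlonglongrightarrow> Xp \<omega> (fst p) (snd p)"
    proof (cases "0 < fst p")
      case True
      then have pos: "0 < fst (?q n)" for n by simp
      have "(\<lambda>n. (\<lambda>(t, x). X \<omega> t x) (?q n)) \<longlonglongrightarrow> (\<lambda>(t, x). X \<omega> t x) (fst p, snd p)"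
        by (rule continuous_on_tendsto_compose[OF c]) (use True in \<open>auto simp: mem_Times_iff intro!: tendsto_Pair LIMSEQ_floor_grid LIMSEQ_ceiling_grid simp del: of_nat_Suc prod.collapse\<close>)
      then show ?thesis using True pos unfolding Xp_def by (simp add: case_prod_beta)
    next
      case False
      then have "\<not> 0 < fst (?q n)" for n
        by (simp add: not_less divide_le_0_iff mult_le_0_iff)
      then show ?thesis using False unfolding Xp_def by simp
    qed
    then show "(\<lambda>n. Xp \<omega> (fst (of_int (fst (\<lceil>real (Suc n) * fst p\<rceil>, \<lfloor>real (Suc n) * snd p\<rfloor>)) / real (Suc n),
                         of_int (snd (\<lceil>real (Suc n) * fst p\<rceil>, \<lfloor>real (Suc n) * snd p\<rfloor>)) / real (Suc n)))
              (snd (of_int (fst (\<lceil>real (Suc n) * fst p\<rceil>, \<lfloor>real (Suc n) * snd p\<rfloor>)) / real (Suc n),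
                    of_int (snd (\<lceil>real (Suc n) * fst p\<rceil>, \<lfloor>real (Suc n) * snd p\<rfloor>)) / real (Suc n))))
         \<longlonglongrightarrow> Xp \<omega> (fst p) (snd p)" by simp
  qed
  then show ?thesis by (simp add: case_prod_beta')
qed

abbreviation J :: "real \<Rightarrow> (real \<Rightarrow> real) \<Rightarrow> 'a \<Rightarrow> real" where
  "J t \<phi> \<omega> \<equiv> pair_dens (X \<omega> t) \<phi>"

abbreviation mass :: "real \<Rightarrow> 'a \<Rightarrow> real" where
  "mass t \<equiv> J t (\<lambda>_. 1)"

definition m0 :: real where "m0 = measure X0 (space X0)"

lemma m0_nonneg [simp]: "0 \<le> m0" by (simp add: m0_def)

lemma mass_nonneg: "\<omega> \<in> space M \<Longrightarrow> 0 < t \<Longrightarrow> 0 \<le> mass t \<omega>"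
  unfolding pair_dens_def using nonneg by (intro integral_nonneg_AE) auto

lemma integ_mult:
  assumes "\<omega> \<in> space M" "0 < t" and [measurable]: "\<phi> \<in> borel_measurable borel" and "\<And>x. \<bar>\<phi> x\<bar> \<le> L"
  shows "integrable lborel (\<lambda>x. X \<omega> t x * \<phi> x)"
proof (rule Bochner_Integration.integrable_bound)
  show "integrable lborel (\<lambda>x. L * X \<omega> t x)" using integ[OF assms(1,2)] by simp
  show "(\<lambda>x. X \<omega> t x * \<phi> x) \<in> borel_measurable lborel" using integ[OF assms(1,2)] by simp
  have "0 \<le> L" using assms(4)[of 0] by linarith
  then show "AE x in lborel. norm (X \<omega> t x * \<phi> x) \<le> norm (L * X \<omega> t x)"
    using assms(4) nonneg[OF assms(1,2)]
    by (auto simp: abs_mult mult.commute intro!: mult_right_mono always_eventually)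
qed

lemma J_bound:
  assumes "\<omega> \<in> space M" "0 < t" "\<phi> \<in> borel_measurable borel" "\<And>x. \<bar>\<phi> x\<bar> \<le> L"
  shows "\<bar>J t \<phi> \<omega>\<bar> \<le> L * mass t \<omega>"
proof -
  have "\<bar>J t \<phi> \<omega>\<bar> \<le> (\<integral>x. \<bar>X \<omega> t x * \<phi> x\<bar> \<partial>lborel)"
    unfolding pair_dens_def using integral_abs_bound by blast
  also have "\<dots> \<le> (\<integral>x. L * X \<omega> t x \<partial>lborel)"
  proof (intro integral_mono)
    show "\<bar>X \<omega> t x * \<phi> x\<bar> \<le> L * X \<omega> t x" for x
      using assms(4)[of x] nonneg[OF assms(1,2), of x] by (auto simp: abs_mult mult.commute intro!: mult_right_mono)
  qed (use integrable_abs[OF integ_mult[OF assms]] integ[OF assms(1,2)] in auto)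
  finally show ?thesis unfolding pair_dens_def by simp
qed

lemma J_mono:
  assumes "\<omega> \<in> space M" "0 < t" "\<phi> \<in> borel_measurable borel" "\<And>x. \<bar>\<phi> x\<bar> \<le> L"
    "\<psi> \<in> borel_measurable borel" "\<And>x. \<bar>\<psi> x\<bar> \<le> L'" "\<And>x. \<phi> x \<le> \<psi> x"
  shows "J t \<phi> \<omega> \<le> J t \<psi> \<omega>"
  unfolding pair_dens_def
  by (intro integral_mono integ_mult[OF assms(1-4)] integ_mult[OF assms(1,2,5,6)] mult_left_mono assms(7) nonneg assms(1,2))

lemma J_nonneg:
  assumes "\<omega> \<in> space M" "0 < t" "\<And>x. 0 \<le> \<phi> x"
  shows "0 \<le> J t \<phi> \<omega>"
  unfolding pair_dens_def using assms nonneg by (intro integral_nonneg_AE) auto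

lemma J_add:
  assumes "\<omega> \<in> space M" "0 < t" "\<phi> \<in> borel_measurable borel" "\<And>x. \<bar>\<phi> x\<bar> \<le> L"
    "\<psi> \<in> borel_measurable borel" "\<And>x. \<bar>\<psi> x\<bar> \<le> L'"
  shows "J t (\<lambda>x. \<phi> x + \<psi> x) \<omega> = J t \<phi> \<omega> + J t \<psi> \<omega>"
  unfolding pair_dens_def
  by (simp add: distrib_left Bochner_Integration.integral_add[OF integ_mult[OF assms(1-4)] integ_mult[OF assms(1,2,5,6)]])

lemma J_diff:
  assumes "\<omega> \<in> space M" "0 < t" "\<phi> \<in> borel_measurable borel" "\<And>x. \<bar>\<phi> x\<bar> \<le> L"
    "\<psi> \<in> borel_measurable borel" "\<And>x. \<bar>\<psi> x\<bar> \<le> L'"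
  shows "J t (\<lambda>x. \<phi> x - \<psi> x) \<omega> = J t \<phi> \<omega> - J t \<psi> \<omega>"
  unfolding pair_dens_def
  by (simp add: right_diff_distrib Bochner_Integration.integral_diff[OF integ_mult[OF assms(1-4)] integ_mult[OF assms(1,2,5,6)]])

lemma J_cmult: "J t (\<lambda>x. c * \<phi> x) \<omega> = c * J t \<phi> \<omega>"
  unfolding pair_dens_def by (simp add: mult.left_commute)

lemma J_measurable_F:
  assumes "0 < t" and [measurable]: "\<phi> \<in> borel_measurable borel"
  shows "J t \<phi> \<in> borel_measurable (F t)"
  unfolding pair_dens_def
proof (rule lborel.borel_measurable_lebesgue_integral)
  have [measurable]: "(\<lambda>p. X (fst p) t (snd p)) \<in> borel_measurable (F t \<Otimes>\<^sub>M borel)"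
    using X_measurable_F[OF assms(1)] by (simp add: case_prod_beta')
  show "(\<lambda>(\<omega>, x). X \<omega> t x * \<phi> x) \<in> borel_measurable (F t \<Otimes>\<^sub>M lborel)"
    unfolding case_prod_beta' by measurable
qed

lemma J_measurable [measurable]:
  assumes "0 < t" "\<phi> \<in> borel_measurable borel"
  shows "J t \<phi> \<in> borel_measurable M"
  using F_M[OF J_measurable_F[OF assms]] .

lemma Jp_measurable:
  assumes [measurable]: "\<phi> \<in> borel_measurable borel"
  shows "(\<lambda>(\<omega>, s). pair_dens (Xp \<omega> s) \<phi>) \<in> borel_measurable (M \<Otimes>\<^sub>M borel)"
  unfolding pair_dens_def case_prod_beta'
proof (rule lborel.borel_measurable_lebesgue_integral)
  have [measurable]: "(\<lambda>p. Xp (fst p) (fst (snd p)) (snd (snd p))) \<in> borel_measurable (M \<Otimes>\<^sub>M (borel \<Otimes>\<^sub>M borel))"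
    using Xp_measurable by (simp add: case_prod_beta')
  have "(\<lambda>p. (fst (fst p), snd (fst p), snd p)) \<in> (M \<Otimes>\<^sub>M borel) \<Otimes>\<^sub>M lborel \<rightarrow>\<^sub>M (M \<Otimes>\<^sub>M (borel \<Otimes>\<^sub>M borel))"
    by measurable
  from measurable_compose[OF this, of "\<lambda>p. Xp (fst p) (fst (snd p)) (snd (snd p))" borel]
  have [measurable]: "(\<lambda>p. Xp (fst (fst p)) (snd (fst p)) (snd p)) \<in> borel_measurable ((M \<Otimes>\<^sub>M borel) \<Otimes>\<^sub>M lborel)"
    by simp
  show "(\<lambda>(p, x). Xp (fst p) (snd p) x * \<phi> x) \<in> borel_measurable ((M \<Otimes>\<^sub>M borel) \<Otimes>\<^sub>M lborel)"
    unfolding case_prod_beta' by measurable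
qed

lemma Jp_eq: "0 < s \<Longrightarrow> pair_dens (Xp \<omega> s) \<phi> = J s \<phi> \<omega>"
  unfolding Xp_def by simp

lemma cond_finite: "sigma_finite_subalgebra M (F s)"
proof -
  interpret finite_measure_subalgebra M "F s"
    by unfold_locales (rule subalg)
  show ?thesis by (rule finite_measure_subalgebra_is_sigma_finite) unfold_locales
qed

text \<open>The form in which every martingale property is used: information from the past enters as
  a weight \<open>V\<close>, and conditional expectations do not appear again. Asking for
  integrability of the product, not for a bound on \<open>V\<close>, admits the unbounded weight in
  \<open>Y_increment_sq\<close>.\<close>

lemma cont_martingale_expectation:
  assumes Y: "cont_martingale M F Y" and st: "0 \<le> s" "s \<le> t"
    and V: "V \<in> borel_measurable (F s)" and int: "integrable M (\<lambda>\<omega>. V \<omega> * Y t \<omega>)"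
  shows "integrable M (\<lambda>\<omega>. V \<omega> * Y s \<omega>)"
    and "(\<integral>\<omega>. V \<omega> * Y t \<omega> \<partial>M) = (\<integral>\<omega>. V \<omega> * Y s \<omega> \<partial>M)"
proof -
  interpret C: sigma_finite_subalgebra M "F s" by (rule cond_finite)
  have [measurable]: "Y t \<in> borel_measurable M" "Y s \<in> borel_measurable M"
    using Y st F_M[of "Y s" s] F_M[of "Y t" t] order_trans[OF st] unfolding cont_martingale_def by auto
  have [measurable]: "V \<in> borel_measurable M" using F_M[OF V] .
  have "AE \<omega> in M. real_cond_exp M (F s) (Y t) \<omega> = Y s \<omega>"
    using Y st unfolding cont_martingale_def by blast
  then have ae: "AE \<omega> in M. V \<omega> * real_cond_exp M (F s) (Y t) \<omega> = V \<omega> * Y s \<omega>"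
    by eventually_elim simp
  note i = C.real_cond_exp_intg[OF int V, simplified]
  show "integrable M (\<lambda>\<omega>. V \<omega> * Y s \<omega>)"
    using i(1) ae by (subst integrable_cong_AE[OF _ _ ae, symmetric]) auto
  show "(\<integral>\<omega>. V \<omega> * Y t \<omega> \<partial>M) = (\<integral>\<omega>. V \<omega> * Y s \<omega> \<partial>M)"
    using i(2) by (subst integral_cong_AE[OF _ _ ae, symmetric]) auto
qed

lemma test_fun_1: "test_fun (\<lambda>_. 1) (\<lambda>_. 0) (\<lambda>_. 0)"
  unfolding test_fun_def by auto

lemma sbm_mart_1: "sbm_mart M X X0 (\<lambda>_. 1) (\<lambda>_. 0) t \<omega> = (if t = 0 then 0 else mass t \<omega> - m0)"
  unfolding sbm_mart_def m0_def pair_dens_def by (simp add: set_lebesgue_integral_def)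

lemma mass_integrable: "0 < t \<Longrightarrow> integrable M (mass t)"
  and mass_expectation: "0 < t \<Longrightarrow> (\<integral>\<omega>. mass t \<omega> \<partial>M) = m0"
proof -
  assume t: "0 < t"
  have Y: "cont_martingale M F (sbm_mart M X X0 (\<lambda>_. 1) (\<lambda>_. 0))"
    by (rule mart1[OF test_fun_1])
  have "integrable M (sbm_mart M X X0 (\<lambda>_. 1) (\<lambda>_. 0) t)"
    using Y t unfolding cont_martingale_def by auto
  then have i: "integrable M (\<lambda>\<omega>. mass t \<omega> - m0)" using t by (simp add: sbm_mart_1[abs_def])
  have "integrable M (\<lambda>\<omega>. (mass t \<omega> - m0) + m0)" by (rule Bochner_Integration.integrable_add[OF i]) simp
  then show i2: "integrable M (mass t)" by simp
  have "(\<integral>\<omega>. 1 * sbm_mart M X X0 (\<lambda>_. 1) (\<lambda>_. 0) t \<omega> \<partial>M) = (\<integral>\<omega>. 1 * sbm_mart M X X0 (\<lambda>_. 1) (\<lambda>_. 0) 0 \<omega> \<partial>M)"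
    by (rule cont_martingale_expectation(2)[OF Y]) (use t i in \<open>auto simp: sbm_mart_1\<close>)
  then have "(\<integral>\<omega>. mass t \<omega> - m0 \<partial>M) = 0" using t by (simp add: sbm_mart_1)
  then show "(\<integral>\<omega>. mass t \<omega> \<partial>M) = m0"
    by (simp add: Bochner_Integration.integral_diff[OF i2] prob_space)
qed

lemma mass_nn_expectation: "0 < t \<Longrightarrow> (\<integral>\<^sup>+\<omega>. ennreal (mass t \<omega>) \<partial>M) = ennreal m0"
  using nn_integral_eq_integral[OF mass_integrable] mass_expectation mass_nonneg
  by (auto simp: AE_I2)

lemma J_integrable:
  assumes "0 < t" "\<phi> \<in> borel_measurable borel" "\<And>x. \<bar>\<phi> x\<bar> \<le> L"
  shows "integrable M (J t \<phi>)"
proof (rule Bochner_Integration.integrable_bound)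
  show "integrable M (\<lambda>\<omega>. L * mass t \<omega>)" using mass_integrable[OF assms(1)] by simp
  show "J t \<phi> \<in> borel_measurable M" using assms by measurable
  show "AE \<omega> in M. norm (J t \<phi> \<omega>) \<le> norm (L * mass t \<omega>)"
    using J_bound[OF _ assms] by (auto intro!: AE_I2 order_trans[OF _ abs_ge_self])
qed

sublocale PM: pair_sigma_finite M lborel ..

lemma X_measurable_pair: "0 < t \<Longrightarrow> (\<lambda>p. X (fst p) t (snd p)) \<in> borel_measurable (M \<Otimes>\<^sub>M lborel)"
proof -
  assume t: "0 < t"
  have "(\<lambda>p. (fst p, t, snd p)) \<in> (M \<Otimes>\<^sub>M lborel) \<rightarrow>\<^sub>M (M \<Otimes>\<^sub>M (borel \<Otimes>\<^sub>M borel))"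
    by measurable
  from measurable_compose[OF this Xp_measurable] show ?thesis
    using t by (simp add: Xp_def)
qed

text \<open>Along \<open>u\<close> the densities converge pointwise by continuity and all have the
  same expected total mass \<open>m0\<close>, so Scheffe's lemma yields convergence in L1 of the
  product space. Continuity in time of the later expectations rests on this.\<close>

lemma J_tendsto_L1:
  assumes u: "\<And>n. 0 < u n" "0 < s" "u \<longlonglongrightarrow> s"
    and m: "\<And>n. \<psi>s n \<in> borel_measurable borel" "\<psi> \<in> borel_measurable borel"
    and b: "\<And>n x. \<bar>\<psi>s n x\<bar> \<le> L" "\<And>x. \<bar>\<psi> x\<bar> \<le> L" and l: "\<And>x. (\<lambda>n. \<psi>s n x) \<longlonglongrightarrow> \<psi> x"
  shows "(\<lambda>n. \<integral>\<omega>. \<bar>J (u n) (\<psi>s n) \<omega> - J s \<psi> \<omega>\<bar> \<partial>M) \<longlonglongrightarrow> 0"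
proof -
  have L: "0 \<le> L" using b(2)[of 0] by linarith
  let ?P = "M \<Otimes>\<^sub>M (lborel :: real measure)"
  note [measurable] = m
  have Xm: "(\<lambda>p. X (fst p) t (snd p)) \<in> borel_measurable ?P" if "0 < t" for t
    using X_measurable_pair[OF that] .
  note [measurable] = Xm[OF u(1)] Xm[OF u(2)]
  have nn: "(\<integral>\<^sup>+ p. ennreal (X (fst p) t (snd p)) \<partial>?P) = ennreal m0" if t: "0 < t" for t
  proof -
    note [measurable] = Xm[OF t]
    have "(\<integral>\<^sup>+ p. ennreal (X (fst p) t (snd p)) \<partial>?P) = (\<integral>\<^sup>+\<omega>. \<integral>\<^sup>+x. ennreal (X \<omega> t x) \<partial>lborel \<partial>M)"
      by (subst lborel.nn_integral_fst[symmetric]) auto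
    also have "\<dots> = (\<integral>\<^sup>+\<omega>. ennreal (mass t \<omega>) \<partial>M)"
      using nonneg t by (intro nn_integral_cong) (simp add: pair_dens_def nn_integral_eq_integral[OF integ[OF _ t]])
    finally show ?thesis using mass_nn_expectation[OF t] by simp
  qed
  have pos: "0 \<le> X (fst p) t (snd p)" if "p \<in> space ?P" "0 < t" for p t
    using nonneg that by (auto simp: space_pair_measure)
  have N: "(\<lambda>n. \<integral>\<^sup>+ p. norm (X (fst p) (u n) (snd p) - X (fst p) s (snd p)) \<partial>?P) \<longlonglongrightarrow> 0"
  proof (rule Scheffe_lemma2)
    have nrm: "(\<integral>\<^sup>+ p. norm (X (fst p) t (snd p)) \<partial>?P) = ennreal m0" if "0 < t" for t
      using nn[OF that] pos[OF _ that] by (simp cong: nn_integral_cong)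
    show "integrable ?P (\<lambda>p. X (fst p) s (snd p))"
      by (rule integrableI_bounded) (use nrm[OF u(2)] in \<open>auto\<close>)
    show "(\<integral>\<^sup>+ p. norm (X (fst p) (u n) (snd p)) \<partial>?P) \<le> (\<integral>\<^sup>+ p. norm (X (fst p) s (snd p)) \<partial>?P)" for n
      using nrm u by simp
    show "AE p in ?P. (\<lambda>n. X (fst p) (u n) (snd p)) \<longlonglongrightarrow> X (fst p) s (snd p)"
    proof (intro AE_I2)
      fix p :: "'a \<times> real" assume "p \<in> space ?P"
      then have c: "continuous_on ({0<..} \<times> UNIV) (\<lambda>(t, x). X (fst p) t x)" by (auto intro!: cont simp: space_pair_measure)
      have "(\<lambda>n. (\<lambda>(t, x). X (fst p) t x) (u n, snd p)) \<longlonglongrightarrow> (\<lambda>(t, x). X (fst p) t x) (s, snd p)"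
        by (rule continuous_on_tendsto_compose[OF c]) (use u in \<open>auto intro!: tendsto_Pair\<close>)
      then show "(\<lambda>n. X (fst p) (u n) (snd p)) \<longlonglongrightarrow> X (fst p) s (snd p)" by simp
    qed
  qed auto
  have D: "(\<lambda>n. \<integral>\<^sup>+ p. ennreal (X (fst p) s (snd p) * \<bar>\<psi>s n (snd p) - \<psi> (snd p)\<bar>) \<partial>?P) \<longlonglongrightarrow> (\<integral>\<^sup>+ p. 0 \<partial>?P)"
  proof (rule nn_integral_dominated_convergence)
    show "AE p in ?P. ennreal (X (fst p) s (snd p) * \<bar>\<psi>s n (snd p) - \<psi> (snd p)\<bar>) \<le> ennreal (2 * L) * ennreal (X (fst p) s (snd p))" for n
    proof (intro AE_I2)
      fix p assume p: "p \<in> space ?P"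
      have "\<bar>\<psi>s n (snd p) - \<psi> (snd p)\<bar> \<le> 2 * L" using b(1)[of n "snd p"] b(2)[of "snd p"] by linarith
      from mult_left_mono[OF this pos[OF p u(2)]]
      have "X (fst p) s (snd p) * \<bar>\<psi>s n (snd p) - \<psi> (snd p)\<bar> \<le> (2 * L) * X (fst p) s (snd p)"
        by (simp only: mult.commute)
      then show "ennreal (X (fst p) s (snd p) * \<bar>\<psi>s n (snd p) - \<psi> (snd p)\<bar>) \<le> ennreal (2 * L) * ennreal (X (fst p) s (snd p))"
        using L pos[OF p u(2)] by (simp add: ennreal_mult[symmetric] ennreal_leI)
    qed
    show "(\<integral>\<^sup>+ p. ennreal (2 * L) * ennreal (X (fst p) s (snd p)) \<partial>?P) < \<infinity>"
      using nn[OF u(2)] by (simp add: nn_integral_cmult ennreal_mult_less_top)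
    show "AE p in ?P. (\<lambda>n. ennreal (X (fst p) s (snd p) * \<bar>\<psi>s n (snd p) - \<psi> (snd p)\<bar>)) \<longlonglongrightarrow> 0"
    proof (intro AE_I2)
      fix p
      have "(\<lambda>n. X (fst p) s (snd p) * \<bar>\<psi>s n (snd p) - \<psi> (snd p)\<bar>) \<longlonglongrightarrow> X (fst p) s (snd p) * \<bar>\<psi> (snd p) - \<psi> (snd p)\<bar>"
        by (intro tendsto_intros l)
      from tendsto_ennrealI[OF this] show "(\<lambda>n. ennreal (X (fst p) s (snd p) * \<bar>\<psi>s n (snd p) - \<psi> (snd p)\<bar>)) \<longlonglongrightarrow> 0"
        by simp
    qed
  qed auto
  have bnd: "ennreal (\<integral>\<omega>. \<bar>J (u n) (\<psi>s n) \<omega> - J s \<psi> \<omega>\<bar> \<partial>M) \<le>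
      ennreal L * (\<integral>\<^sup>+ p. norm (X (fst p) (u n) (snd p) - X (fst p) s (snd p)) \<partial>?P)
      + (\<integral>\<^sup>+ p. ennreal (X (fst p) s (snd p) * \<bar>\<psi>s n (snd p) - \<psi> (snd p)\<bar>) \<partial>?P)" for n
  proof -
    have "ennreal (\<integral>\<omega>. \<bar>J (u n) (\<psi>s n) \<omega> - J s \<psi> \<omega>\<bar> \<partial>M) = (\<integral>\<^sup>+\<omega>. ennreal \<bar>J (u n) (\<psi>s n) \<omega> - J s \<psi> \<omega>\<bar> \<partial>M)"
      by (rule nn_integral_eq_integral[symmetric])
        (auto intro!: integrable_abs Bochner_Integration.integrable_diff J_integrable[where L=L] m b u)
    also have "\<dots> \<le> (\<integral>\<^sup>+\<omega>. \<integral>\<^sup>+x. ennreal (L * norm (X \<omega> (u n) x - X \<omega> s x)) + ennreal (X \<omega> s x * \<bar>\<psi>s n x - \<psi> x\<bar>) \<partial>lborel \<partial>M)"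
    proof (intro nn_integral_mono)
      fix \<omega> assume \<omega>: "\<omega> \<in> space M"
      note i = integ_mult[OF \<omega> u(1) m(1) b(1)] integ_mult[OF \<omega> u(2) m(2) b(2)]
      have "J (u n) (\<psi>s n) \<omega> - J s \<psi> \<omega> = (\<integral>x. X \<omega> (u n) x * \<psi>s n x - X \<omega> s x * \<psi> x \<partial>lborel)"
        unfolding pair_dens_def by (rule Bochner_Integration.integral_diff[OF i, symmetric])
      then have "ennreal \<bar>J (u n) (\<psi>s n) \<omega> - J s \<psi> \<omega>\<bar> \<le> (\<integral>\<^sup>+x. ennreal \<bar>X \<omega> (u n) x * \<psi>s n x - X \<omega> s x * \<psi> x\<bar> \<partial>lborel)"
        using integral_norm_bound_ennreal[OF Bochner_Integration.integrable_diff[OF i, of n]] by simp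
      also have "\<dots> \<le> (\<integral>\<^sup>+x. ennreal (L * norm (X \<omega> (u n) x - X \<omega> s x)) + ennreal (X \<omega> s x * \<bar>\<psi>s n x - \<psi> x\<bar>) \<partial>lborel)"
      proof (intro nn_integral_mono)
        fix x :: real
        have X0: "0 \<le> X \<omega> s x" by (rule nonneg[OF \<omega> u(2)])
        \<comment> \<open>In this splitting the bounded \<open>\<psi>s n\<close> multiplies the
          difference that is small in L1, and the second term keeps the density at time
          \<open>s\<close>, so that dominated convergence applies to it.\<close>
        have "X \<omega> (u n) x * \<psi>s n x - X \<omega> s x * \<psi> x = (X \<omega> (u n) x - X \<omega> s x) * \<psi>s n x + X \<omega> s x * (\<psi>s n x - \<psi> x)"
          by (simp add: algebra_simps)
        also have "\<bar>\<dots>\<bar> \<le> \<bar>X \<omega> (u n) x - X \<omega> s x\<bar> * \<bar>\<psi>s n x\<bar> + X \<omega> s x * \<bar>\<psi>s n x - \<psi> x\<bar>"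
          using X0 by (metis abs_mult abs_of_nonneg abs_triangle_ineq)
        also have "\<dots> \<le> L * norm (X \<omega> (u n) x - X \<omega> s x) + X \<omega> s x * \<bar>\<psi>s n x - \<psi> x\<bar>"
          using b(1)[of n x] by (simp add: mult.commute mult_right_mono)
        finally show "ennreal \<bar>X \<omega> (u n) x * \<psi>s n x - X \<omega> s x * \<psi> x\<bar> \<le> ennreal (L * norm (X \<omega> (u n) x - X \<omega> s x)) + ennreal (X \<omega> s x * \<bar>\<psi>s n x - \<psi> x\<bar>)"
          using L X0 by (simp flip: ennreal_plus add: ennreal_leI)
      qed
      finally show "ennreal \<bar>J (u n) (\<psi>s n) \<omega> - J s \<psi> \<omega>\<bar> \<le> (\<integral>\<^sup>+x. ennreal (L * norm (X \<omega> (u n) x - X \<omega> s x)) + ennreal (X \<omega> s x * \<bar>\<psi>s n x - \<psi> x\<bar>) \<partial>lborel)" .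
    qed
    also have "\<dots> = (\<integral>\<^sup>+p. ennreal (L * norm (X (fst p) (u n) (snd p) - X (fst p) s (snd p))) + ennreal (X (fst p) s (snd p) * \<bar>\<psi>s n (snd p) - \<psi> (snd p)\<bar>) \<partial>?P)"
      by (subst lborel.nn_integral_fst[symmetric]) auto
    also have "\<dots> = (\<integral>\<^sup>+p. ennreal (L * norm (X (fst p) (u n) (snd p) - X (fst p) s (snd p))) \<partial>?P)
        + (\<integral>\<^sup>+p. ennreal (X (fst p) s (snd p) * \<bar>\<psi>s n (snd p) - \<psi> (snd p)\<bar>) \<partial>?P)"
      by (rule nn_integral_add) auto
    also have "(\<integral>\<^sup>+p. ennreal (L * norm (X (fst p) (u n) (snd p) - X (fst p) s (snd p))) \<partial>?P) =
        ennreal L * (\<integral>\<^sup>+p. norm (X (fst p) (u n) (snd p) - X (fst p) s (snd p)) \<partial>?P)"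
      using L by (simp add: ennreal_mult nn_integral_cmult)
    finally show ?thesis .
  qed
  have "(\<lambda>n. ennreal L * (\<integral>\<^sup>+ p. norm (X (fst p) (u n) (snd p) - X (fst p) s (snd p)) \<partial>?P)
      + (\<integral>\<^sup>+ p. ennreal (X (fst p) s (snd p) * \<bar>\<psi>s n (snd p) - \<psi> (snd p)\<bar>) \<partial>?P)) \<longlonglongrightarrow> ennreal L * 0 + 0"
    by (intro tendsto_add ennreal_tendsto_cmult N) (use D in auto)
  then have lim: "(\<lambda>n. ennreal L * (\<integral>\<^sup>+ p. norm (X (fst p) (u n) (snd p) - X (fst p) s (snd p)) \<partial>?P)
      + (\<integral>\<^sup>+ p. ennreal (X (fst p) s (snd p) * \<bar>\<psi>s n (snd p) - \<psi> (snd p)\<bar>) \<partial>?P)) \<longlonglongrightarrow> 0"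
    by simp
  have "(\<lambda>n. ennreal (\<integral>\<omega>. \<bar>J (u n) (\<psi>s n) \<omega> - J s \<psi> \<omega>\<bar> \<partial>M)) \<longlonglongrightarrow> 0"
    by (rule tendsto_sandwich[OF always_eventually always_eventually tendsto_const lim])
      (use bnd in \<open>blast intro: zero_le\<close>)+
  then show ?thesis by (subst (asm) ennreal_tendsto_0_iff) (auto intro!: integral_nonneg_AE)
qed

section \<open>Integrals over time and Fubini's theorem\<close>

definition I :: "(real \<Rightarrow> real) \<Rightarrow> real \<Rightarrow> real \<Rightarrow> 'a \<Rightarrow> real" where
  "I \<psi> a b \<omega> = (LINT s:{a<..b}|lborel. J s \<psi> \<omega>)"

lemma J_section_measurable:
  assumes "\<omega> \<in> space M" "0 \<le> a" and [measurable]: "\<psi> \<in> borel_measurable borel"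
  shows "set_borel_measurable lborel {a<..b} (\<lambda>s. J s \<psi> \<omega>)"
proof -
  have [measurable]: "(\<lambda>s. pair_dens (Xp \<omega> s) \<psi>) \<in> borel_measurable borel"
    using measurable_compose[OF measurable_Pair1'[OF assms(1)] Jp_measurable[of \<psi>]] by simp
  have "(\<lambda>s. indicator {a<..b} s *\<^sub>R pair_dens (Xp \<omega> s) \<psi>) \<in> borel_measurable borel" by measurable
  also have "(\<lambda>s. indicator {a<..b} s *\<^sub>R pair_dens (Xp \<omega> s) \<psi>) = (\<lambda>s. indicator {a<..b} s *\<^sub>R J s \<psi> \<omega>)"
    using assms(2) by (intro ext) (auto simp: indicator_def Jp_eq)
  finally show ?thesis unfolding set_borel_measurable_def by simp
qed

lemma J_set_integrable:
  assumes \<omega>: "\<omega> \<in> space M" "0 \<le> a" and m: "\<psi> \<in> borel_measurable borel" and b: "\<And>x. \<bar>\<psi> x\<bar> \<le> L"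
  shows "set_integrable lborel {a<..b} (\<lambda>s. J s \<psi> \<omega>)"
proof (cases "b \<le> 0")
  case True
  then have "{a<..b} = {}" using assms(2) by auto
  then show ?thesis by (simp add: set_integrable_def)
next
  case False
  have "set_integrable lborel {0<..b} (\<lambda>s. L * mass s \<omega>)"
    using mass_integ[OF \<omega>(1), of b] False unfolding pair_dens_def by simp
  then have "set_integrable lborel {a<..b} (\<lambda>s. L * mass s \<omega>)"
    by (rule set_integrable_subset) (use \<omega> in auto)
  then show ?thesis
  proof (rule set_integrable_bound[OF _ J_section_measurable[OF \<omega> m]])
    show "AE s in lborel. s \<in> {a<..b} \<longrightarrow> norm (J s \<psi> \<omega>) \<le> norm (L * mass s \<omega>)"
      using J_bound[OF \<omega>(1) _ m b] \<omega>(2) by (intro AE_I2) (auto intro: order_trans[OF _ abs_ge_self])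
  qed
qed

lemma I_split:
  assumes "\<omega> \<in> space M" "0 \<le> a" "a \<le> b" "b \<le> c" "\<psi> \<in> borel_measurable borel" "\<And>x. \<bar>\<psi> x\<bar> \<le> L"
  shows "I \<psi> a c \<omega> = I \<psi> a b \<omega> + I \<psi> b c \<omega>"
proof -
  have "{a<..c} = {a<..b} \<union> {b<..c}" using assms by auto
  then show ?thesis unfolding I_def
    using set_integral_Un[of "{a<..b}" "{b<..c}" lborel "\<lambda>s. J s \<psi> \<omega>"]
    J_set_integrable[OF assms(1,2,5,6)] J_set_integrable[OF assms(1) _ assms(5,6), of b] assms(2,3)
    by auto
qed

text \<open>The expected mass is \<open>m0\<close> at every time, so the integral of the absolute
  value is at most \<open>C * L * m0 * (b - a)\<close>; this is what Fubini's theorem asks for in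
  \<open>I_integrable\<close>.\<close>

lemma J_pair_integrable:
  assumes ab: "0 \<le> a" "a \<le> b" and m[measurable]: "\<psi> \<in> borel_measurable borel" "V \<in> borel_measurable M"
    and b: "\<And>x. \<bar>\<psi> x\<bar> \<le> L" "\<And>\<omega>. \<omega> \<in> space M \<Longrightarrow> \<bar>V \<omega>\<bar> \<le> C"
  shows "integrable (M \<Otimes>\<^sub>M lborel) (\<lambda>(\<omega>, s). V \<omega> * (indicator {a<..b} s *\<^sub>R J s \<psi> \<omega>))"
proof -
  have L: "0 \<le> L" using b(1)[of 0] by linarith
  obtain \<omega>0 where "\<omega>0 \<in> space M" using not_empty by blast
  then have C: "0 \<le> C" using b(2)[of \<omega>0] by linarith
  have [measurable]: "(\<lambda>p. pair_dens (Xp (fst p) (snd p)) \<psi>) \<in> borel_measurable (M \<Otimes>\<^sub>M lborel)"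
    using Jp_measurable[of \<psi>] by (simp add: case_prod_beta')
  have eq: "(\<lambda>(\<omega>, s). V \<omega> * (indicator {a<..b} s *\<^sub>R J s \<psi> \<omega>)) = (\<lambda>p. V (fst p) * (indicator {a<..b} (snd p) * pair_dens (Xp (fst p) (snd p)) \<psi>))"
    using ab by (intro ext) (auto simp: Jp_eq indicator_def split: prod.splits)
  let ?f = "(\<lambda>p. V (fst p) * (indicator {a<..b} (snd p) * pair_dens (Xp (fst p) (snd p)) \<psi>))"
  have [measurable]: "?f \<in> borel_measurable (M \<Otimes>\<^sub>M lborel)" by measurable
  have "(\<integral>\<^sup>+p. norm (?f p) \<partial>(M \<Otimes>\<^sub>M lborel)) = (\<integral>\<^sup>+s. \<integral>\<^sup>+\<omega>. norm (?f (\<omega>, s)) \<partial>M \<partial>lborel)"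
    by (rule PM.nn_integral_snd[symmetric]) measurable
  also have "\<dots> \<le> (\<integral>\<^sup>+s. indicator {a<..b} s * ennreal (C * L * m0) \<partial>lborel)"
  proof (intro nn_integral_mono)
    fix s :: real
    show "(\<integral>\<^sup>+\<omega>. norm (?f (\<omega>, s)) \<partial>M) \<le> indicator {a<..b} s * ennreal (C * L * m0)"
    proof (cases "s \<in> {a<..b}")
      case True
      then have s: "0 < s" using ab by auto
      have "(\<integral>\<^sup>+\<omega>. norm (?f (\<omega>, s)) \<partial>M) \<le> (\<integral>\<^sup>+\<omega>. ennreal (C * L) * ennreal (mass s \<omega>) \<partial>M)"
      proof (intro nn_integral_mono)
        fix \<omega> assume \<omega>: "\<omega> \<in> space M"
        have "norm (?f (\<omega>, s)) = \<bar>V \<omega>\<bar> * \<bar>J s \<psi> \<omega>\<bar>" using True s by (simp add: abs_mult Jp_eq)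
        also have "\<dots> \<le> C * (L * mass s \<omega>)"
          by (intro mult_mono b J_bound \<omega> s C m) auto
        finally show "ennreal (norm (?f (\<omega>, s))) \<le> ennreal (C * L) * ennreal (mass s \<omega>)"
          using C L mass_nonneg[OF \<omega> s] by (simp add: ennreal_mult[symmetric] ennreal_leI mult.assoc)
      qed
      also have "\<dots> = ennreal (C * L) * ennreal m0"
        using s by (subst nn_integral_cmult) (auto simp: mass_nn_expectation)
      finally show ?thesis using True C L by (simp add: ennreal_mult[symmetric])
    qed simp
  qed
  also have "\<dots> = ennreal (C * L * m0) * emeasure lborel {a<..b}"
    by (subst nn_integral_multc) (auto simp: mult.commute)
  also have "\<dots> < \<infinity>" using ab by (simp add: ennreal_mult_less_top)
  finally show ?thesis unfolding eq by (intro integrableI_bounded) auto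
qed

lemma I_integrable:
  assumes "0 \<le> a" "a \<le> b" "\<psi> \<in> borel_measurable borel" "V \<in> borel_measurable M"
    "\<And>x. \<bar>\<psi> x\<bar> \<le> L" "\<And>\<omega>. \<omega> \<in> space M \<Longrightarrow> \<bar>V \<omega>\<bar> \<le> C"
  shows "integrable M (\<lambda>\<omega>. V \<omega> * I \<psi> a b \<omega>)"
    and "set_integrable lborel {a<..b} (\<lambda>s. \<integral>\<omega>. V \<omega> * J s \<psi> \<omega> \<partial>M)"
    and "(\<integral>\<omega>. V \<omega> * I \<psi> a b \<omega> \<partial>M) = (LINT s:{a<..b}|lborel. \<integral>\<omega>. V \<omega> * J s \<psi> \<omega> \<partial>M)"
proof -
  note i = J_pair_integrable[OF assms, simplified]
  have e: "V \<omega> * (indicat_real {a<..b} s * J s \<psi> \<omega>) = indicat_real {a<..b} s * (V \<omega> * J s \<psi> \<omega>)" for \<omega> s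
    by (rule mult.left_commute)
  have "integrable M (\<lambda>\<omega>. \<integral>s. V \<omega> * (indicator {a<..b} s * J s \<psi> \<omega>) \<partial>lborel)"
    by (rule PM.integrable_fst[OF i])
  also have "(\<lambda>\<omega>. \<integral>s. V \<omega> * (indicator {a<..b} s * J s \<psi> \<omega>) \<partial>lborel) = (\<lambda>\<omega>. V \<omega> * I \<psi> a b \<omega>)"
    by (simp add: I_def set_lebesgue_integral_def)
  finally show "integrable M (\<lambda>\<omega>. V \<omega> * I \<psi> a b \<omega>)" .
  have "integrable lborel (\<lambda>s. \<integral>\<omega>. V \<omega> * (indicator {a<..b} s * J s \<psi> \<omega>) \<partial>M)"
    by (rule PM.integrable_snd[OF i])
  also have "(\<lambda>s. \<integral>\<omega>. V \<omega> * (indicator {a<..b} s * J s \<psi> \<omega>) \<partial>M) = (\<lambda>s. indicator {a<..b} s * (\<integral>\<omega>. V \<omega> * J s \<psi> \<omega> \<partial>M))"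
    by (simp add: e)
  finally show "set_integrable lborel {a<..b} (\<lambda>s. \<integral>\<omega>. V \<omega> * J s \<psi> \<omega> \<partial>M)"
    by (simp add: set_integrable_def)
  have "(\<integral>s. \<integral>\<omega>. V \<omega> * (indicator {a<..b} s * J s \<psi> \<omega>) \<partial>M \<partial>lborel) = (\<integral>\<omega>. \<integral>s. V \<omega> * (indicator {a<..b} s * J s \<psi> \<omega>) \<partial>lborel \<partial>M)"
    by (rule PM.Fubini_integral[OF i])
  then show "(\<integral>\<omega>. V \<omega> * I \<psi> a b \<omega> \<partial>M) = (LINT s:{a<..b}|lborel. \<integral>\<omega>. V \<omega> * J s \<psi> \<omega> \<partial>M)"
    by (simp add: I_def set_lebesgue_integral_def e[symmetric]) (simp add: e)
qed

section \<open>Quadratic variation along partitions\<close>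

lemma integrable_bdd_mult:
  fixes f :: "'a \<Rightarrow> real"
  assumes "integrable M f" "V \<in> borel_measurable M" "\<And>\<omega>. \<omega> \<in> space M \<Longrightarrow> \<bar>V \<omega>\<bar> \<le> C"
  shows "integrable M (\<lambda>\<omega>. V \<omega> * f \<omega>)"
proof (rule Bochner_Integration.integrable_bound[of M "\<lambda>\<omega>. C * f \<omega>"])
  show "AE \<omega> in M. norm (V \<omega> * f \<omega>) \<le> norm (C * f \<omega>)"
    using assms(3) by (auto simp: abs_mult intro!: AE_I2 mult_right_mono intro: order_trans[OF _ abs_ge_self])
qed (use assms in auto)

lemma test_fun_bdd:
  assumes "test_fun \<phi> \<phi>1 \<phi>2"
  shows "\<phi> \<in> borel_measurable borel" "\<phi>2 \<in> borel_measurable borel"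
    "\<exists>L\<ge>0. (\<forall>x. \<bar>\<phi> x\<bar> \<le> L) \<and> (\<forall>x. \<bar>\<phi>2 x\<bar> \<le> L)"
proof -
  have "continuous_on UNIV \<phi>"
    using assms unfolding test_fun_def by (meson DERIV_continuous continuous_at_imp_continuous_on)
  then show "\<phi> \<in> borel_measurable borel" by (rule borel_measurable_continuous_onI)
  show "\<phi>2 \<in> borel_measurable borel" using assms unfolding test_fun_def by (auto intro: borel_measurable_continuous_onI)
  obtain L1 L2 where "\<And>x. \<bar>\<phi> x\<bar> \<le> L1" "\<And>x. \<bar>\<phi>2 x\<bar> \<le> L2"
    using assms unfolding test_fun_def bounded_iff by (metis rangeI real_norm_def)
  then show "\<exists>L\<ge>0. (\<forall>x. \<bar>\<phi> x\<bar> \<le> L) \<and> (\<forall>x. \<bar>\<phi>2 x\<bar> \<le> L)"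
    by (intro exI[of _ "max 0 (max L1 L2)"]) (auto simp: max.coboundedI1 max.coboundedI2 le_max_iff_disj)
qed

abbreviation Y :: "(real \<Rightarrow> real) \<Rightarrow> (real \<Rightarrow> real) \<Rightarrow> real \<Rightarrow> 'a \<Rightarrow> real" where
  "Y \<phi> \<phi>2 \<equiv> sbm_mart M X X0 \<phi> \<phi>2"

lemma I_mono:
  assumes "\<omega> \<in> space M" "0 \<le> a" "\<psi> \<in> borel_measurable borel" "\<And>x. \<bar>\<psi> x\<bar> \<le> L" "\<And>x. 0 \<le> \<psi> x"
  shows "0 \<le> I \<psi> a b \<omega>"
  unfolding I_def set_lebesgue_integral_def using assms
  by (intro integral_nonneg_AE AE_I2) (auto simp: indicator_def intro!: J_nonneg)

context
  fixes \<phi> \<phi>1 \<phi>2 :: "real \<Rightarrow> real"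
  assumes tf: "test_fun \<phi> \<phi>1 \<phi>2"
begin

lemmas \<phi>_meas = test_fun_bdd(1,2)[OF tf]

lemma sq_bdd: "\<exists>L\<ge>0. \<forall>x. \<bar>(\<phi> x)\<^sup>2\<bar> \<le> L"
  using test_fun_bdd(3)[OF tf] by (metis abs_power2 power2_abs power_mono abs_ge_zero zero_le_power2)

lemma sq_meas: "(\<lambda>x. (\<phi> x)\<^sup>2) \<in> borel_measurable borel" using \<phi>_meas(1) by measurable

lemma Y_measurable_F: "0 \<le> t \<Longrightarrow> Y \<phi> \<phi>2 t \<in> borel_measurable (F t)"
  using mart1[OF tf] unfolding cont_martingale_def by blast

lemma Y_measurable: "0 \<le> t \<Longrightarrow> Y \<phi> \<phi>2 t \<in> borel_measurable M"
  using F_M[OF Y_measurable_F] .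

lemma Y_integrable: "0 \<le> t \<Longrightarrow> integrable M (Y \<phi> \<phi>2 t)"
  using mart1[OF tf] unfolding cont_martingale_def by blast

lemma I_sq_integrable:
  assumes "0 \<le> a" "a \<le> b" "V \<in> borel_measurable M" "\<And>\<omega>. \<omega> \<in> space M \<Longrightarrow> \<bar>V \<omega>\<bar> \<le> C"
  shows "integrable M (\<lambda>\<omega>. V \<omega> * I (\<lambda>x. (\<phi> x)\<^sup>2) a b \<omega>)"
proof -
  obtain L where L: "\<forall>x. \<bar>(\<phi> x)\<^sup>2\<bar> \<le> L" using sq_bdd by blast
  show ?thesis by (rule I_integrable(1)[OF assms(1,2) sq_meas assms(3) _ assms(4)]) (use L in auto)
qed

lemma I_sq_integrable1: "0 \<le> a \<Longrightarrow> a \<le> b \<Longrightarrow> integrable M (I (\<lambda>x. (\<phi> x)\<^sup>2) a b)"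
  using I_sq_integrable[of a b "\<lambda>_. 1" 1] by simp

lemma I_sq_nonneg: "\<omega> \<in> space M \<Longrightarrow> 0 \<le> a \<Longrightarrow> 0 \<le> I (\<lambda>x. (\<phi> x)\<^sup>2) a b \<omega>"
  using sq_bdd I_mono[OF _ _ sq_meas] by auto

lemma I_sq_split:
  assumes "\<omega> \<in> space M" "0 \<le> a" "a \<le> b" "b \<le> c"
  shows "I (\<lambda>x. (\<phi> x)\<^sup>2) a c \<omega> = I (\<lambda>x. (\<phi> x)\<^sup>2) a b \<omega> + I (\<lambda>x. (\<phi> x)\<^sup>2) b c \<omega>"
  using sq_bdd I_split[OF assms sq_meas] by blast

lemma mart2': "cont_martingale M F (\<lambda>t \<omega>. (Y \<phi> \<phi>2 t \<omega>)\<^sup>2 - I (\<lambda>x. (\<phi> x)\<^sup>2) 0 t \<omega>)"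
proof -
  have "(if t = 0 then 0 else LINT s:{0<..t}|lborel. pair_dens (X \<omega> s) (\<lambda>x. (\<phi> x)\<^sup>2)) = I (\<lambda>x. (\<phi> x)\<^sup>2) 0 t \<omega>" for t \<omega>
    by (auto simp: I_def set_lebesgue_integral_def)
  then show ?thesis using mart2[OF tf] by simp
qed

lemma Y_sq_integrable:
  assumes "0 \<le> t"
  shows "integrable M (\<lambda>\<omega>. (Y \<phi> \<phi>2 t \<omega>)\<^sup>2)"
proof -
  have "integrable M (\<lambda>\<omega>. (Y \<phi> \<phi>2 t \<omega>)\<^sup>2 - I (\<lambda>x. (\<phi> x)\<^sup>2) 0 t \<omega>)"
    using mart2' assms unfolding cont_martingale_def by blast
  from Bochner_Integration.integrable_add[OF this I_sq_integrable1[of 0 t]] show ?thesis using assms by simp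
qed

lemma Y_prod_integrable:
  assumes "0 \<le> s" "0 \<le> t"
  shows "integrable M (\<lambda>\<omega>. Y \<phi> \<phi>2 s \<omega> * Y \<phi> \<phi>2 t \<omega>)"
proof (rule Bochner_Integration.integrable_bound)
  show "integrable M (\<lambda>\<omega>. (Y \<phi> \<phi>2 s \<omega>)\<^sup>2 + (Y \<phi> \<phi>2 t \<omega>)\<^sup>2)"
    using Y_sq_integrable assms by simp
  show "AE \<omega> in M. norm (Y \<phi> \<phi>2 s \<omega> * Y \<phi> \<phi>2 t \<omega>) \<le> norm ((Y \<phi> \<phi>2 s \<omega>)\<^sup>2 + (Y \<phi> \<phi>2 t \<omega>)\<^sup>2)"
  proof (intro AE_I2)
    fix \<omega>
    have "2 * (\<bar>Y \<phi> \<phi>2 s \<omega>\<bar> * \<bar>Y \<phi> \<phi>2 t \<omega>\<bar>) \<le> (Y \<phi> \<phi>2 s \<omega>)\<^sup>2 + (Y \<phi> \<phi>2 t \<omega>)\<^sup>2"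
      using sum_squares_bound[of "\<bar>Y \<phi> \<phi>2 s \<omega>\<bar>" "\<bar>Y \<phi> \<phi>2 t \<omega>\<bar>"] by simp
    moreover have "0 \<le> \<bar>Y \<phi> \<phi>2 s \<omega>\<bar> * \<bar>Y \<phi> \<phi>2 t \<omega>\<bar>" by simp
    ultimately show "norm (Y \<phi> \<phi>2 s \<omega> * Y \<phi> \<phi>2 t \<omega>) \<le> norm ((Y \<phi> \<phi>2 s \<omega>)\<^sup>2 + (Y \<phi> \<phi>2 t \<omega>)\<^sup>2)"
      unfolding real_norm_def abs_mult by linarith
  qed
qed (use assms Y_measurable in measurable)

context
  fixes s t :: real and V :: "'a \<Rightarrow> real" and C :: real
  assumes st: "0 \<le> s" "s \<le> t" and V: "V \<in> borel_measurable (F s)" and VC: "\<And>\<omega>. \<omega> \<in> space M \<Longrightarrow> \<bar>V \<omega>\<bar> \<le> C"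
begin

lemma Y_increment: "(\<integral>\<omega>. V \<omega> * (Y \<phi> \<phi>2 t \<omega> - Y \<phi> \<phi>2 s \<omega>) \<partial>M) = 0"
proof -
  have t: "0 \<le> t" using st by simp
  note i = integrable_bdd_mult[OF Y_integrable F_M[OF V] VC]
  show ?thesis
    using cont_martingale_expectation(2)[OF mart1[OF tf] st V i] st t i[OF t] i[OF st(1)]
    by (simp add: right_diff_distrib)
qed

lemma Y_sq_increment:
  "(\<integral>\<omega>. V \<omega> * (Y \<phi> \<phi>2 t \<omega>)\<^sup>2 \<partial>M) - (\<integral>\<omega>. V \<omega> * (Y \<phi> \<phi>2 s \<omega>)\<^sup>2 \<partial>M) = (\<integral>\<omega>. V \<omega> * I (\<lambda>x. (\<phi> x)\<^sup>2) s t \<omega> \<partial>M)"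
proof -
  have t: "0 \<le> t" using st by simp
  note VM = F_M[OF V]
  note i2 = integrable_bdd_mult[OF Y_sq_integrable VM VC]
  note iI = I_sq_integrable[OF order_refl _ VM VC]
  have i: "integrable M (\<lambda>\<omega>. V \<omega> * ((Y \<phi> \<phi>2 u \<omega>)\<^sup>2 - I (\<lambda>x. (\<phi> x)\<^sup>2) 0 u \<omega>))" if "0 \<le> u" for u
    using i2[OF that] iI[OF that] by (simp add: right_diff_distrib)
  have "(\<integral>\<omega>. V \<omega> * ((Y \<phi> \<phi>2 t \<omega>)\<^sup>2 - I (\<lambda>x. (\<phi> x)\<^sup>2) 0 t \<omega>) \<partial>M) = (\<integral>\<omega>. V \<omega> * ((Y \<phi> \<phi>2 s \<omega>)\<^sup>2 - I (\<lambda>x. (\<phi> x)\<^sup>2) 0 s \<omega>) \<partial>M)"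
    by (rule cont_martingale_expectation(2)[OF mart2' st V i[OF t]])
  then have "(\<integral>\<omega>. V \<omega> * (Y \<phi> \<phi>2 t \<omega>)\<^sup>2 \<partial>M) - (\<integral>\<omega>. V \<omega> * (Y \<phi> \<phi>2 s \<omega>)\<^sup>2 \<partial>M)
     = (\<integral>\<omega>. V \<omega> * I (\<lambda>x. (\<phi> x)\<^sup>2) 0 t \<omega> \<partial>M) - (\<integral>\<omega>. V \<omega> * I (\<lambda>x. (\<phi> x)\<^sup>2) 0 s \<omega> \<partial>M)"
    using i2 iI st t by (simp add: right_diff_distrib)
  also have "\<dots> = (\<integral>\<omega>. V \<omega> * I (\<lambda>x. (\<phi> x)\<^sup>2) 0 t \<omega> - V \<omega> * I (\<lambda>x. (\<phi> x)\<^sup>2) 0 s \<omega> \<partial>M)"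
    using iI st t by simp
  also have "\<dots> = (\<integral>\<omega>. V \<omega> * I (\<lambda>x. (\<phi> x)\<^sup>2) s t \<omega> \<partial>M)"
    using st by (intro Bochner_Integration.integral_cong) (auto simp: I_sq_split[of _ 0 s t] algebra_simps)
  finally show ?thesis .
qed

lemma Y_increment_sq:
  shows "integrable M (\<lambda>\<omega>. V \<omega> * (Y \<phi> \<phi>2 t \<omega> - Y \<phi> \<phi>2 s \<omega>)\<^sup>2)"
    and "(\<integral>\<omega>. V \<omega> * (Y \<phi> \<phi>2 t \<omega> - Y \<phi> \<phi>2 s \<omega>)\<^sup>2 \<partial>M) = (\<integral>\<omega>. V \<omega> * I (\<lambda>x. (\<phi> x)\<^sup>2) s t \<omega> \<partial>M)"
proof -
  have t: "0 \<le> t" using st by simp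
  note VM = F_M[OF V]
  note i2 = integrable_bdd_mult[OF Y_sq_integrable VM VC]
  have i3: "integrable M (\<lambda>\<omega>. V \<omega> * (Y \<phi> \<phi>2 s \<omega> * Y \<phi> \<phi>2 u \<omega>))" if "0 \<le> u" for u
    by (rule integrable_bdd_mult[OF Y_prod_integrable VM VC]) (use st that in auto)
  have i3': "integrable M (\<lambda>\<omega>. (V \<omega> * Y \<phi> \<phi>2 s \<omega>) * Y \<phi> \<phi>2 t \<omega>)"
    using i3[OF t] by (simp add: mult.assoc)
  \<comment> \<open>The weight \<open>V * Y s\<close> is unbounded but measurable at time
    \<open>s\<close>. By this identity the square of the increment and the increment of the square
    have the same weighted mean.\<close>
  have cross: "(\<integral>\<omega>. (V \<omega> * Y \<phi> \<phi>2 s \<omega>) * Y \<phi> \<phi>2 t \<omega> \<partial>M) = (\<integral>\<omega>. (V \<omega> * Y \<phi> \<phi>2 s \<omega>) * Y \<phi> \<phi>2 s \<omega> \<partial>M)"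
    by (rule cont_martingale_expectation(2)[OF mart1[OF tf] st _ i3'])
       (intro borel_measurable_times V Y_measurable_F st)
  have eq: "(\<lambda>\<omega>. V \<omega> * (Y \<phi> \<phi>2 t \<omega> - Y \<phi> \<phi>2 s \<omega>)\<^sup>2) =
     (\<lambda>\<omega>. V \<omega> * (Y \<phi> \<phi>2 t \<omega>)\<^sup>2 - 2 * ((V \<omega> * Y \<phi> \<phi>2 s \<omega>) * Y \<phi> \<phi>2 t \<omega>) + V \<omega> * (Y \<phi> \<phi>2 s \<omega>)\<^sup>2)"
    by (auto simp: power2_eq_square algebra_simps)
  show "integrable M (\<lambda>\<omega>. V \<omega> * (Y \<phi> \<phi>2 t \<omega> - Y \<phi> \<phi>2 s \<omega>)\<^sup>2)"
    unfolding eq using i2[OF t] i2[OF st(1)] i3' by simp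
  have "(\<integral>\<omega>. V \<omega> * (Y \<phi> \<phi>2 t \<omega> - Y \<phi> \<phi>2 s \<omega>)\<^sup>2 \<partial>M) = (\<integral>\<omega>. V \<omega> * (Y \<phi> \<phi>2 t \<omega>)\<^sup>2 \<partial>M) - (\<integral>\<omega>. V \<omega> * (Y \<phi> \<phi>2 s \<omega>)\<^sup>2 \<partial>M)"
    unfolding eq using i2[OF t] i2[OF st(1)] i3' cross by (simp add: power2_eq_square mult.assoc)
  then show "(\<integral>\<omega>. V \<omega> * (Y \<phi> \<phi>2 t \<omega> - Y \<phi> \<phi>2 s \<omega>)\<^sup>2 \<partial>M) = (\<integral>\<omega>. V \<omega> * I (\<lambda>x. (\<phi> x)\<^sup>2) s t \<omega> \<partial>M)"
    using Y_sq_increment by simp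
qed

end

end

text \<open>For the constant test function the bracket integrates the mass itself, so the variance
  of the mass is the time integral of the constant \<open>m0\<close>.\<close>

lemma mass_sq:
  assumes "0 < t"
  shows "integrable M (\<lambda>\<omega>. (mass t \<omega>)\<^sup>2)" "(\<integral>\<omega>. (mass t \<omega>)\<^sup>2 \<partial>M) = m0\<^sup>2 + t * m0"
proof -
  let ?Y = "Y (\<lambda>_. 1) (\<lambda>_. 0)"
  have Y: "?Y t = (\<lambda>\<omega>. mass t \<omega> - m0)" "?Y 0 = (\<lambda>\<omega>. 0)" using assms by (simp_all add: sbm_mart_1[abs_def])
  have i: "integrable M (\<lambda>\<omega>. (mass t \<omega> - m0)\<^sup>2)" using Y_sq_integrable[OF test_fun_1, of t] assms Y(1) by simp
  have eq: "(\<lambda>\<omega>. (mass t \<omega>)\<^sup>2) = (\<lambda>\<omega>. (mass t \<omega> - m0)\<^sup>2 + 2 * m0 * mass t \<omega> - m0\<^sup>2)"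
    by (auto simp: power2_eq_square algebra_simps)
  show "integrable M (\<lambda>\<omega>. (mass t \<omega>)\<^sup>2)" unfolding eq using i mass_integrable[OF assms] by simp
  have "(\<integral>\<omega>. 1 * (?Y t \<omega> - ?Y 0 \<omega>)\<^sup>2 \<partial>M) = (\<integral>\<omega>. 1 * I (\<lambda>x. 1\<^sup>2) 0 t \<omega> \<partial>M)"
    by (rule Y_increment_sq(2)[OF test_fun_1, where C=1]) (use assms in auto)
  then have "(\<integral>\<omega>. (mass t \<omega> - m0)\<^sup>2 \<partial>M) = (\<integral>\<omega>. 1 * I (\<lambda>x. 1) 0 t \<omega> \<partial>M)" using Y by simp
  also have "\<dots> = (LINT s:{0<..t}|lborel. \<integral>\<omega>. 1 * mass s \<omega> \<partial>M)"
    by (rule I_integrable(3)[where L=1 and C=1]) (use assms in auto)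
  also have "\<dots> = (LINT s:{0<..t}|lborel. m0)"
    by (rule set_lebesgue_integral_cong) (auto simp: mass_expectation)
  also have "\<dots> = t * m0" using assms by (simp add: set_lebesgue_integral_def)
  finally have "(\<integral>\<omega>. (mass t \<omega> - m0)\<^sup>2 \<partial>M) = t * m0" .
  then show "(\<integral>\<omega>. (mass t \<omega>)\<^sup>2 \<partial>M) = m0\<^sup>2 + t * m0"
    unfolding eq using i mass_integrable[OF assms] mass_expectation[OF assms]
    by (simp add: prob_space power2_eq_square)
qed

end

section \<open>Equidistant partitions and their large increments\<close>

definition grid :: "real \<Rightarrow> real \<Rightarrow> nat \<Rightarrow> nat \<Rightarrow> real" where
  "grid a b m i = a + real i * ((b - a) / real m)"

lemma grid_0 [simp]: "grid a b m 0 = a" and grid_m: "0 < m \<Longrightarrow> grid a b m m = b"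
  by (simp_all add: grid_def)

lemma grid_mono: "a \<le> b \<Longrightarrow> i \<le> j \<Longrightarrow> grid a b m i \<le> grid a b m j"
  unfolding grid_def by (intro add_left_mono mult_right_mono) auto

lemma grid_le: "a \<le> b \<Longrightarrow> i \<le> m \<Longrightarrow> grid a b m i \<le> b"
  by (cases "m = 0") (use grid_mono[of a b i m m] grid_m[of m a b] in \<open>auto simp: grid_def\<close>)

lemma grid_ge: "a \<le> b \<Longrightarrow> a \<le> grid a b m i"
  using grid_mono[of a b 0 i m] by simp

lemma grid_Suc_diff: "grid a b m (Suc i) - grid a b m i = (b - a) / real m"
  unfolding grid_def by (simp add: distrib_right add_divide_distrib)

text \<open>Removing the earlier sets leaves disjoint sets, each marking a first occurrence, so a
  sum over a whole partition costs a single indicator.\<close>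

lemma sum_indicator_first:
  fixes n :: nat
  shows "(\<Sum>i<n. indicat_real (A i - (\<Union>k<i. A k)) \<omega>) = indicat_real (\<Union>k<n. A k) \<omega>"
  by (induction n) (auto simp: indicator_def lessThan_Suc split: if_splits)

context sbm_process
begin

lemma dct_events:
  assumes U: "integrable M U" and S: "\<And>m. S m \<in> sets M"
    and ae: "AE \<omega> in M. \<exists>m0. \<forall>m\<ge>m0. \<omega> \<notin> S (m::nat)"
  shows "(\<lambda>m. \<integral>\<omega>. indicat_real (S m) \<omega> * U \<omega> \<partial>M) \<longlonglongrightarrow> 0"
proof -
  have [measurable]: "U \<in> borel_measurable M" "\<And>m. S m \<in> sets M" using U S by auto
  have "(\<lambda>m. \<integral>\<omega>. indicat_real (S m) \<omega> * U \<omega> \<partial>M) \<longlonglongrightarrow> (\<integral>\<omega>. 0 \<partial>M)"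
  proof (rule integral_dominated_convergence[where w = "\<lambda>\<omega>. \<bar>U \<omega>\<bar>"])
    show "AE \<omega> in M. (\<lambda>m. indicat_real (S m) \<omega> * U \<omega>) \<longlonglongrightarrow> 0"
      using ae
    proof eventually_elim
      fix \<omega> assume "\<exists>m0. \<forall>m\<ge>m0. \<omega> \<notin> S m"
      then have "eventually (\<lambda>m. indicat_real (S m) \<omega> * U \<omega> = 0) sequentially"
        unfolding eventually_sequentially by (auto simp: indicator_def)
      then show "(\<lambda>m. indicat_real (S m) \<omega> * U \<omega>) \<longlonglongrightarrow> 0" by (rule tendsto_eventually)
    qed
  qed (use U in \<open>auto simp: indicator_def\<close>)
  then show ?thesis by simp
qed

lemma indicator_integrable_mult: "integrable M U \<Longrightarrow> A \<in> sets M \<Longrightarrow> integrable M (\<lambda>\<omega>. indicat_real A \<omega> * U \<omega>)"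
  using integrable_real_mult_indicator[of A M U] by (simp add: mult.commute)

context
  fixes \<phi> \<phi>1 \<phi>2 :: "real \<Rightarrow> real" and a b :: real
  assumes tf: "test_fun \<phi> \<phi>1 \<phi>2" and ab: "0 \<le> a" "a < b"
begin

abbreviation (input) Yg :: "nat \<Rightarrow> nat \<Rightarrow> 'a \<Rightarrow> real" where
  "Yg m i \<equiv> Y \<phi> \<phi>2 (grid a b m i)"

abbreviation (input) dY :: "nat \<Rightarrow> nat \<Rightarrow> 'a \<Rightarrow> real" where
  "dY m i \<omega> \<equiv> Yg m (Suc i) \<omega> - Yg m i \<omega>"

abbreviation (input) Ig :: "nat \<Rightarrow> nat \<Rightarrow> 'a \<Rightarrow> real" where
  "Ig m i \<equiv> I (\<lambda>x. (\<phi> x)\<^sup>2) (grid a b m i) (grid a b m (Suc i))"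

lemma grid_nonneg: "0 \<le> grid a b m i"
  using grid_ge[of a b m i] ab by simp

lemma dY_small: "AE \<omega> in M. \<forall>\<eta>>0. \<exists>m0. \<forall>m\<ge>m0. \<forall>i<m. \<bar>dY m i \<omega>\<bar> \<le> \<eta>"
proof -
  have "AE \<omega> in M. continuous_on {0..} (\<lambda>t. Y \<phi> \<phi>2 t \<omega>)"
    using mart1[OF tf] unfolding cont_martingale_def by blast
  then show ?thesis
  proof eventually_elim
    fix \<omega> assume "continuous_on {0..} (\<lambda>t. Y \<phi> \<phi>2 t \<omega>)"
    then have "continuous_on {a..b} (\<lambda>t. Y \<phi> \<phi>2 t \<omega>)" by (rule continuous_on_subset) (use ab in auto)
    then have "uniformly_continuous_on {a..b} (\<lambda>t. Y \<phi> \<phi>2 t \<omega>)" by (intro compact_uniformly_continuous) auto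
    then have uc: "\<exists>d>0. \<forall>s\<in>{a..b}. \<forall>t\<in>{a..b}. dist t s < d \<longrightarrow> dist (Y \<phi> \<phi>2 t \<omega>) (Y \<phi> \<phi>2 s \<omega>) < \<eta>" if "0 < \<eta>" for \<eta>
      using that unfolding uniformly_continuous_on_def by blast
    show "\<forall>\<eta>>0. \<exists>m0. \<forall>m\<ge>m0. \<forall>i<m. \<bar>dY m i \<omega>\<bar> \<le> \<eta>"
    proof (intro allI impI)
      fix \<eta> :: real assume "0 < \<eta>"
      then obtain d where d: "0 < d" "\<And>s t. s \<in> {a..b} \<Longrightarrow> t \<in> {a..b} \<Longrightarrow> dist t s < d \<Longrightarrow> dist (Y \<phi> \<phi>2 t \<omega>) (Y \<phi> \<phi>2 s \<omega>) < \<eta>"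
        using uc by meson
      obtain m0 :: nat where m0: "(b - a) / d < real m0" using reals_Archimedean2 by blast
      have "0 < (b - a) / d" using d ab by simp
      then have m0p: "0 < real m0" using m0 by linarith
      show "\<exists>m0. \<forall>m\<ge>m0. \<forall>i<m. \<bar>dY m i \<omega>\<bar> \<le> \<eta>"
      proof (intro exI[of _ m0] allI impI)
        fix m i :: nat assume m: "m0 \<le> m" "i < m"
        have mp: "0 < real m" "real m0 \<le> real m" using m m0p by auto
        then have "(b - a) / d < real m" using m0 by linarith
        then have "(b - a) / real m < d" using mp d(1) by (simp add: field_simps)
        then have "dist (grid a b m (Suc i)) (grid a b m i) < d"
          using grid_Suc_diff[of a b m i] ab mp by (simp add: dist_real_def)
        then show "\<bar>dY m i \<omega>\<bar> \<le> \<eta>"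
          using d(2)[of "grid a b m i" "grid a b m (Suc i)"] m ab grid_le[of a b "Suc i" m] grid_le[of a b i m] grid_ge[of a b m]
          by (auto simp: dist_real_def)
      qed
    qed
  qed
qed

lemma Y_bounded_path: "AE \<omega> in M. \<exists>L0::nat. \<forall>L\<ge>L0. \<forall>m. \<forall>i\<le>m. \<not> \<bar>Yg m i \<omega>\<bar> > real L"
proof -
  have "AE \<omega> in M. continuous_on {0..} (\<lambda>t. Y \<phi> \<phi>2 t \<omega>)"
    using mart1[OF tf] unfolding cont_martingale_def by blast
  then show ?thesis
  proof eventually_elim
    fix \<omega> assume "continuous_on {0..} (\<lambda>t. Y \<phi> \<phi>2 t \<omega>)"
    then have "continuous_on {a..b} (\<lambda>t. Y \<phi> \<phi>2 t \<omega>)" by (rule continuous_on_subset) (use ab in auto)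
    then have "bounded ((\<lambda>t. Y \<phi> \<phi>2 t \<omega>) ` {a..b})" by (intro compact_imp_bounded compact_continuous_image) auto
    then have "\<exists>B. \<forall>t\<in>{a..b}. \<bar>Y \<phi> \<phi>2 t \<omega>\<bar> \<le> B" unfolding bounded_iff by simp
    then obtain B where B: "\<And>t. t \<in> {a..b} \<Longrightarrow> \<bar>Y \<phi> \<phi>2 t \<omega>\<bar> \<le> B" by blast
    obtain L0 :: nat where L0: "B \<le> real L0" using real_arch_simple by blast
    show "\<exists>L0::nat. \<forall>L\<ge>L0. \<forall>m. \<forall>i\<le>m. \<not> \<bar>Yg m i \<omega>\<bar> > real L"
    proof (intro exI[of _ L0] allI impI)
      fix L m i :: nat assume "L0 \<le> L" "i \<le> m"
      then have "\<bar>Yg m i \<omega>\<bar> \<le> B" "real L0 \<le> real L" using B[of "grid a b m i"] grid_le[of a b i m] grid_ge[of a b m i] ab by auto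
      then show "\<not> \<bar>Yg m i \<omega>\<bar> > real L" using L0 by linarith
    qed
  qed
qed

lemma sum_Ig: "\<omega> \<in> space M \<Longrightarrow> i \<le> m \<Longrightarrow> (\<Sum>k<i. Ig m k \<omega>) = I (\<lambda>x. (\<phi> x)\<^sup>2) a (grid a b m i) \<omega>"
proof (induction i)
  case 0
  then show ?case by (simp add: I_def set_lebesgue_integral_def)
next
  case (Suc i)
  then show ?case using I_sq_split[OF tf Suc.prems(1), of a "grid a b m i" "grid a b m (Suc i)"] grid_ge[of a b m i] grid_mono[of a b i "Suc i" m] ab
    by simp
qed

lemma Ig_integrable: "integrable M (Ig m i)"
  using I_sq_integrable1[OF tf grid_nonneg grid_mono[of a b i "Suc i" m]] ab by simp

text \<open>The pieces of the time integral are nonnegative, so all events can be enlarged to a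
  common \<open>T\<close> before the pieces are summed to the full integral.\<close>

lemma sum_Ig_event:
  assumes "0 < m" and S: "\<And>i. i < m \<Longrightarrow> S i \<in> sets M" "T \<in> sets M" "\<And>i. i < m \<Longrightarrow> S i \<subseteq> T"
  shows "(\<Sum>i<m. \<integral>\<omega>. indicat_real (S i) \<omega> * Ig m i \<omega> \<partial>M) \<le> (\<integral>\<omega>. indicat_real T \<omega> * I (\<lambda>x. (\<phi> x)\<^sup>2) a b \<omega> \<partial>M)"
proof -
  have i: "integrable M (\<lambda>\<omega>. indicat_real (S i) \<omega> * Ig m i \<omega>)" if "i < m" for i
    by (rule indicator_integrable_mult[OF Ig_integrable S(1)[OF that]])
  have "(\<Sum>i<m. \<integral>\<omega>. indicat_real (S i) \<omega> * Ig m i \<omega> \<partial>M) = (\<integral>\<omega>. (\<Sum>i<m. indicat_real (S i) \<omega> * Ig m i \<omega>) \<partial>M)"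
    using i by (intro Bochner_Integration.integral_sum[symmetric]) auto
  also have "\<dots> \<le> (\<integral>\<omega>. indicat_real T \<omega> * I (\<lambda>x. (\<phi> x)\<^sup>2) a b \<omega> \<partial>M)"
  proof (rule integral_mono)
    show "integrable M (\<lambda>\<omega>. \<Sum>i<m. indicat_real (S i) \<omega> * Ig m i \<omega>)" by (intro Bochner_Integration.integrable_sum) (use i in auto)
    show "integrable M (\<lambda>\<omega>. indicat_real T \<omega> * I (\<lambda>x. (\<phi> x)\<^sup>2) a b \<omega>)"
      by (rule indicator_integrable_mult[OF I_sq_integrable1[OF tf] S(2)]) (use ab in auto)
    fix \<omega> assume \<omega>: "\<omega> \<in> space M"
    have "(\<Sum>i<m. indicat_real (S i) \<omega> * Ig m i \<omega>) \<le> (\<Sum>i<m. indicat_real T \<omega> * Ig m i \<omega>)"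
    proof (rule sum_mono)
      fix i assume "i \<in> {..<m}"
      then have "indicat_real (S i) \<omega> \<le> indicat_real T \<omega>" using S(3)[of i] by (auto simp: indicator_def)
      then show "indicat_real (S i) \<omega> * Ig m i \<omega> \<le> indicat_real T \<omega> * Ig m i \<omega>"
        by (rule mult_right_mono) (rule I_sq_nonneg[OF tf \<omega> grid_nonneg])
    qed
    also have "\<dots> = indicat_real T \<omega> * I (\<lambda>x. (\<phi> x)\<^sup>2) a b \<omega>"
      using sum_Ig[OF \<omega>, of m m] grid_m[OF assms(1)] by (simp add: sum_distrib_left[symmetric])
    finally show "(\<Sum>i<m. indicat_real (S i) \<omega> * Ig m i \<omega>) \<le> indicat_real T \<omega> * I (\<lambda>x. (\<phi> x)\<^sup>2) a b \<omega>" .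
  qed
  finally show ?thesis .
qed

lemma dY_measurable_F:
  assumes "Suc k \<le> i" shows "(\<lambda>\<omega>. dY m k \<omega>) \<in> borel_measurable (F (grid a b m i))"
  by (intro borel_measurable_diff F_mono[OF grid_mono Y_measurable_F[OF tf grid_nonneg]]) (use assms ab in auto)

lemma F_sets: "A \<in> sets (F t) \<Longrightarrow> A \<in> sets M"
  using subalg[of t] unfolding subalgebra_def by auto

lemma dY_sq_integrable: "integrable M (\<lambda>\<omega>. (dY m i \<omega>)\<^sup>2)"
  using Y_increment_sq(1)[OF tf grid_nonneg grid_mono[of a b i "Suc i" m], of "\<lambda>_. 1" 1] ab by simp

lemma dY_sq_event:
  assumes "A \<in> sets (F (grid a b m i))"
  shows "(\<integral>\<omega>. indicat_real A \<omega> * (dY m i \<omega>)\<^sup>2 \<partial>M) = (\<integral>\<omega>. indicat_real A \<omega> * Ig m i \<omega> \<partial>M)"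
  using Y_increment_sq(2)[OF tf grid_nonneg grid_mono[of a b i "Suc i" m], of "indicat_real A" 1] assms ab by simp

text \<open>The increments exceeding \<open>\<eta>\<close> are split according to the size of the martingale at the left end
  point (\<open>N\<close>), whether a large increment occurred before (\<open>K\<close>), and the first large increment,
  which the submartingale property of \<open>Y\<^sup>2\<close> controls by the terminal value.\<close>
proposition dY_lindeberg:
  assumes \<eta>: "0 < \<eta>"
  shows "(\<lambda>m. \<Sum>i<m. \<integral>\<omega>. indicat_real {\<omega> \<in> space M. \<eta> < \<bar>dY m i \<omega>\<bar>} \<omega> * (dY m i \<omega>)\<^sup>2 \<partial>M) \<longlonglongrightarrow> 0"
proof -
  define B where "B m i = {\<omega> \<in> space M. \<eta> < \<bar>dY m i \<omega>\<bar>}" for m i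
  define K where "K m i = (\<Union>k<i. B m k)" for m i
  define N where "N L m i = {\<omega> \<in> space M. real L < \<bar>Yg m i \<omega>\<bar>}" for L m i :: nat
  define NN where "NN L = (\<Union>m. \<Union>i\<in>{..m}. N L m i)" for L
  define Q where "Q = I (\<lambda>x. (\<phi> x)\<^sup>2) a b"
  define Z where "Z \<omega> = (Y \<phi> \<phi>2 b \<omega>)\<^sup>2" for \<omega>
  have Q: "integrable M Q" unfolding Q_def by (rule I_sq_integrable1[OF tf]) (use ab in auto)
  have Z: "integrable M Z" unfolding Z_def by (rule Y_sq_integrable[OF tf]) (use ab in auto)
  have BF: "B m k \<in> sets (F (grid a b m i))" if "Suc k \<le> i" for m k i
  proof -
    have [measurable]: "(\<lambda>\<omega>. dY m k \<omega>) \<in> borel_measurable (F (grid a b m i))" by (rule dY_measurable_F[OF that])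
    have "{\<omega> \<in> space (F (grid a b m i)). \<eta> < \<bar>dY m k \<omega>\<bar>} \<in> sets (F (grid a b m i))" by measurable
    then show ?thesis by (simp add: B_def)
  qed
  have KF: "K m j \<in> sets (F (grid a b m i))" if "j \<le> i" for m i j
    unfolding K_def using BF that by (intro sets.finite_UN) auto
  have Ksub: "K m i \<subseteq> K m m" if "i < m" for i m
    unfolding K_def by (rule UN_mono) (use that in auto)
  have NF: "N L m i \<in> sets (F (grid a b m i))" for L m i
  proof -
    have [measurable]: "Yg m i \<in> borel_measurable (F (grid a b m i))" by (rule Y_measurable_F[OF tf grid_nonneg])
    have "{\<omega> \<in> space (F (grid a b m i)). real L < \<bar>Yg m i \<omega>\<bar>} \<in> sets (F (grid a b m i))" by measurable
    then show ?thesis by (simp add: N_def)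
  qed
  note [measurable] = F_sets[OF BF[OF order_refl]] F_sets[OF KF[OF order_refl]] F_sets[OF NF]
  have [measurable]: "NN L \<in> sets M" for L unfolding NN_def by measurable
  have main: "(\<Sum>i<m. \<integral>\<omega>. indicat_real (B m i) \<omega> * (dY m i \<omega>)\<^sup>2 \<partial>M) \<le>
      (\<integral>\<omega>. indicat_real (NN L) \<omega> * Q \<omega> \<partial>M) + (\<integral>\<omega>. indicat_real (K m m) \<omega> * Q \<omega> \<partial>M)
      + (\<integral>\<omega>. indicat_real (K m m) \<omega> * (2 * Z \<omega> + 2 * (real L)\<^sup>2) \<partial>M)" if m: "0 < m" for m L
  proof -
    let ?J = "\<lambda>i. B m i - K m i"
    have JF: "?J i \<in> sets (F (grid a b m (Suc i)))" for i
      using BF[of i "Suc i" m] KF[of i "Suc i" m] by auto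
    note [measurable] = F_sets[OF JF]
    have J_int: "integrable M (\<lambda>\<omega>. indicat_real (?J i) \<omega> * (Y \<phi> \<phi>2 t \<omega>)\<^sup>2)" if "0 \<le> t" for i t
      by (rule indicator_integrable_mult[OF Y_sq_integrable[OF tf that]]) measurable
    have "(\<Sum>i<m. \<integral>\<omega>. indicat_real (B m i) \<omega> * (dY m i \<omega>)\<^sup>2 \<partial>M) \<le> (\<Sum>i<m.
        (\<integral>\<omega>. indicat_real (N L m i) \<omega> * Ig m i \<omega> \<partial>M) + (\<integral>\<omega>. indicat_real (K m i) \<omega> * Ig m i \<omega> \<partial>M)
        + (\<integral>\<omega>. indicat_real (?J i) \<omega> * (2 * Z \<omega> + 2 * (real L)\<^sup>2) \<partial>M))"
    proof (rule sum_mono)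
      fix i assume i: "i \<in> {..<m}"
      let ?t = "grid a b m (Suc i)"
      have t: "0 \<le> ?t" "?t \<le> b" using grid_nonneg grid_le[of a b "Suc i" m] i ab by auto
      have "(\<integral>\<omega>. indicat_real (B m i) \<omega> * (dY m i \<omega>)\<^sup>2 \<partial>M) \<le>
         (\<integral>\<omega>. indicat_real (N L m i) \<omega> * (dY m i \<omega>)\<^sup>2 + indicat_real (K m i) \<omega> * (dY m i \<omega>)\<^sup>2
        + (indicat_real (?J i) \<omega> * (Y \<phi> \<phi>2 ?t \<omega>)\<^sup>2 * 2 + indicat_real (?J i) \<omega> * (2 * (real L)\<^sup>2)) \<partial>M)"
      proof (rule integral_mono)
        show "integrable M (\<lambda>\<omega>. indicat_real (B m i) \<omega> * (dY m i \<omega>)\<^sup>2)"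
          by (rule indicator_integrable_mult[OF dY_sq_integrable]) measurable
        show "integrable M (\<lambda>\<omega>. indicat_real (N L m i) \<omega> * (dY m i \<omega>)\<^sup>2 + indicat_real (K m i) \<omega> * (dY m i \<omega>)\<^sup>2
            + (indicat_real (?J i) \<omega> * (Y \<phi> \<phi>2 ?t \<omega>)\<^sup>2 * 2 + indicat_real (?J i) \<omega> * (2 * (real L)\<^sup>2)))"
          by (intro Bochner_Integration.integrable_add indicator_integrable_mult[OF dY_sq_integrable] integrable_mult_left J_int t)
            (simp_all add: emeasure_eq_measure)
        fix \<omega>
        have "(dY m i \<omega>)\<^sup>2 \<le> (Y \<phi> \<phi>2 ?t \<omega>)\<^sup>2 * 2 + 2 * (real L)\<^sup>2" if "\<bar>Yg m i \<omega>\<bar> \<le> real L"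
        proof -
          have "(Yg m i \<omega>)\<^sup>2 \<le> (real L)\<^sup>2" using that by (simp add: abs_le_square_iff[symmetric])
          moreover have "0 \<le> (Y \<phi> \<phi>2 ?t \<omega> + Yg m i \<omega>)\<^sup>2" by simp
          ultimately show ?thesis by (simp add: power2_eq_square algebra_simps)
        qed
        then show "indicat_real (B m i) \<omega> * (dY m i \<omega>)\<^sup>2 \<le> indicat_real (N L m i) \<omega> * (dY m i \<omega>)\<^sup>2 + indicat_real (K m i) \<omega> * (dY m i \<omega>)\<^sup>2
          + (indicat_real (?J i) \<omega> * (Y \<phi> \<phi>2 ?t \<omega>)\<^sup>2 * 2 + indicat_real (?J i) \<omega> * (2 * (real L)\<^sup>2))"
          by (auto simp: indicator_def B_def N_def not_less)
      qed
      also have "\<dots> = (\<integral>\<omega>. indicat_real (N L m i) \<omega> * (dY m i \<omega>)\<^sup>2 \<partial>M) + (\<integral>\<omega>. indicat_real (K m i) \<omega> * (dY m i \<omega>)\<^sup>2 \<partial>M)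
        + ((\<integral>\<omega>. indicat_real (?J i) \<omega> * (Y \<phi> \<phi>2 ?t \<omega>)\<^sup>2 \<partial>M) * 2 + (\<integral>\<omega>. indicat_real (?J i) \<omega> * (2 * (real L)\<^sup>2) \<partial>M))"
        using indicator_integrable_mult[OF dY_sq_integrable, of "N L m i"] indicator_integrable_mult[OF dY_sq_integrable, of "K m i"]
          J_int[OF t(1)] by (simp add: emeasure_eq_measure)
      also have "(\<integral>\<omega>. indicat_real (?J i) \<omega> * (Y \<phi> \<phi>2 ?t \<omega>)\<^sup>2 \<partial>M) \<le> (\<integral>\<omega>. indicat_real (?J i) \<omega> * Z \<omega> \<partial>M)"
      proof -
        have "(\<integral>\<omega>. indicat_real (?J i) \<omega> * (Y \<phi> \<phi>2 b \<omega>)\<^sup>2 \<partial>M) - (\<integral>\<omega>. indicat_real (?J i) \<omega> * (Y \<phi> \<phi>2 ?t \<omega>)\<^sup>2 \<partial>M)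
          = (\<integral>\<omega>. indicat_real (?J i) \<omega> * I (\<lambda>x. (\<phi> x)\<^sup>2) ?t b \<omega> \<partial>M)"
          by (rule Y_sq_increment[OF tf t, where C=1]) (use JF in auto)
        also have "\<dots> \<ge> 0" using I_sq_nonneg[OF tf _ t(1)] by (intro integral_nonneg_AE AE_I2) auto
        finally show ?thesis unfolding Z_def by simp
      qed
      also have "(\<integral>\<omega>. indicat_real (?J i) \<omega> * Z \<omega> \<partial>M) * 2 + (\<integral>\<omega>. indicat_real (?J i) \<omega> * (2 * (real L)\<^sup>2) \<partial>M)
         = (\<integral>\<omega>. indicat_real (?J i) \<omega> * (2 * Z \<omega> + 2 * (real L)\<^sup>2) \<partial>M)"
      proof -
        have "(\<integral>\<omega>. indicat_real (?J i) \<omega> * (2 * Z \<omega> + 2 * (real L)\<^sup>2) \<partial>M) = (\<integral>\<omega>. (indicat_real (?J i) \<omega> * Z \<omega>) * 2 + indicat_real (?J i) \<omega> * (2 * (real L)\<^sup>2) \<partial>M)"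
          by (intro Bochner_Integration.integral_cong) (auto simp: algebra_simps)
        also have "\<dots> = (\<integral>\<omega>. indicat_real (?J i) \<omega> * Z \<omega> \<partial>M) * 2 + (\<integral>\<omega>. indicat_real (?J i) \<omega> * (2 * (real L)\<^sup>2) \<partial>M)"
          using indicator_integrable_mult[OF Z, of "?J i"] by (simp add: emeasure_eq_measure)
        finally show ?thesis by simp
      qed
      finally show "(\<integral>\<omega>. indicat_real (B m i) \<omega> * (dY m i \<omega>)\<^sup>2 \<partial>M) \<le>
        (\<integral>\<omega>. indicat_real (N L m i) \<omega> * Ig m i \<omega> \<partial>M) + (\<integral>\<omega>. indicat_real (K m i) \<omega> * Ig m i \<omega> \<partial>M)
        + (\<integral>\<omega>. indicat_real (?J i) \<omega> * (2 * Z \<omega> + 2 * (real L)\<^sup>2) \<partial>M)"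
        using dY_sq_event[OF NF, of L m i] dY_sq_event[OF KF[OF order_refl], of m i] by simp
    qed
    also have "\<dots> = (\<Sum>i<m. \<integral>\<omega>. indicat_real (N L m i) \<omega> * Ig m i \<omega> \<partial>M) + (\<Sum>i<m. \<integral>\<omega>. indicat_real (K m i) \<omega> * Ig m i \<omega> \<partial>M)
       + (\<Sum>i<m. \<integral>\<omega>. indicat_real (?J i) \<omega> * (2 * Z \<omega> + 2 * (real L)\<^sup>2) \<partial>M)"
      by (simp add: sum.distrib)
    also have "(\<Sum>i<m. \<integral>\<omega>. indicat_real (N L m i) \<omega> * Ig m i \<omega> \<partial>M) \<le> (\<integral>\<omega>. indicat_real (NN L) \<omega> * Q \<omega> \<partial>M)"
      unfolding Q_def by (rule sum_Ig_event[OF m]) (use less_imp_le in \<open>auto simp: NN_def\<close>)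
    also have "(\<Sum>i<m. \<integral>\<omega>. indicat_real (K m i) \<omega> * Ig m i \<omega> \<partial>M) \<le> (\<integral>\<omega>. indicat_real (K m m) \<omega> * Q \<omega> \<partial>M)"
      unfolding Q_def by (rule sum_Ig_event[OF m]) (use Ksub in auto)
    also have "(\<Sum>i<m. \<integral>\<omega>. indicat_real (?J i) \<omega> * (2 * Z \<omega> + 2 * (real L)\<^sup>2) \<partial>M) = (\<integral>\<omega>. indicat_real (K m m) \<omega> * (2 * Z \<omega> + 2 * (real L)\<^sup>2) \<partial>M)"
    proof -
      have "(\<Sum>i<m. \<integral>\<omega>. indicat_real (?J i) \<omega> * (2 * Z \<omega> + 2 * (real L)\<^sup>2) \<partial>M) = (\<integral>\<omega>. (\<Sum>i<m. indicat_real (?J i) \<omega> * (2 * Z \<omega> + 2 * (real L)\<^sup>2)) \<partial>M)"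
        by (intro Bochner_Integration.integral_sum[symmetric] indicator_integrable_mult) (use Z in auto)
      then show ?thesis unfolding sum_distrib_right[symmetric] K_def sum_indicator_first .
    qed
    finally show ?thesis by simp
  qed
  have aeK: "AE \<omega> in M. \<exists>m0. \<forall>m\<ge>m0. \<omega> \<notin> K m m"
    using dY_small
  proof eventually_elim
    fix \<omega> assume "\<forall>\<eta>>0. \<exists>m0. \<forall>m\<ge>m0. \<forall>i<m. \<bar>dY m i \<omega>\<bar> \<le> \<eta>"
    then obtain m0 where "\<forall>m\<ge>m0. \<forall>i<m. \<bar>dY m i \<omega>\<bar> \<le> \<eta>" using \<eta> by blast
    then show "\<exists>m0. \<forall>m\<ge>m0. \<omega> \<notin> K m m" unfolding K_def B_def by (intro exI[of _ m0]) (auto simp: not_less)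
  qed
  have aeN: "AE \<omega> in M. \<exists>L0. \<forall>L\<ge>L0. \<omega> \<notin> NN L"
    using Y_bounded_path
  proof eventually_elim
    fix \<omega> assume "\<exists>L0::nat. \<forall>L\<ge>L0. \<forall>m. \<forall>i\<le>m. \<not> \<bar>Yg m i \<omega>\<bar> > real L"
    then obtain L0 :: nat where L0: "\<And>L m i. L0 \<le> L \<Longrightarrow> i \<le> m \<Longrightarrow> \<not> \<bar>Yg m i \<omega>\<bar> > real L" by blast
    show "\<exists>L0. \<forall>L\<ge>L0. \<omega> \<notin> NN L"
      unfolding NN_def N_def by (intro exI[of _ L0]) (simp add: L0)
  qed
  have Nlim: "(\<lambda>L. \<integral>\<omega>. indicat_real (NN L) \<omega> * Q \<omega> \<partial>M) \<longlonglongrightarrow> 0"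
    by (rule dct_events[OF Q _ aeN]) measurable
  show ?thesis unfolding B_def[symmetric]
  proof (rule LIMSEQ_I)
    fix e :: real assume e: "0 < e"
    \<comment> \<open>\<open>NN L\<close> collects the points of all partitions, so \<open>L\<close>
      can be fixed before \<open>m\<close> tends to infinity.\<close>
    obtain L where L: "\<bar>\<integral>\<omega>. indicat_real (NN L) \<omega> * Q \<omega> \<partial>M\<bar> < e / 2"
      using LIMSEQ_D[OF Nlim, of "e/2"] e by auto
    have "(\<lambda>m. (\<integral>\<omega>. indicat_real (K m m) \<omega> * Q \<omega> \<partial>M)
      + (\<integral>\<omega>. indicat_real (K m m) \<omega> * (2 * Z \<omega> + 2 * (real L)\<^sup>2) \<partial>M)) \<longlonglongrightarrow> 0 + 0"
      by (intro tendsto_add dct_events Q aeK) (use Z in auto)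
    then have "(\<lambda>m. (\<integral>\<omega>. indicat_real (K m m) \<omega> * Q \<omega> \<partial>M)
      + (\<integral>\<omega>. indicat_real (K m m) \<omega> * (2 * Z \<omega> + 2 * (real L)\<^sup>2) \<partial>M)) \<longlonglongrightarrow> 0" by simp
    from LIMSEQ_D[OF this, of "e/2"] e obtain m0 where m0: "\<And>m. m0 \<le> m \<Longrightarrow> \<bar>(\<integral>\<omega>. indicat_real (K m m) \<omega> * Q \<omega> \<partial>M)
      + (\<integral>\<omega>. indicat_real (K m m) \<omega> * (2 * Z \<omega> + 2 * (real L)\<^sup>2) \<partial>M)\<bar> < e/2" by auto
    show "\<exists>no. \<forall>m\<ge>no. norm ((\<Sum>i<m. \<integral>\<omega>. indicat_real (B m i) \<omega> * (dY m i \<omega>)\<^sup>2 \<partial>M) - 0) < e"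
    proof (intro exI[of _ "max 1 m0"] allI impI)
      fix m assume m: "max 1 m0 \<le> m"
      have "0 \<le> (\<Sum>i<m. \<integral>\<omega>. indicat_real (B m i) \<omega> * (dY m i \<omega>)\<^sup>2 \<partial>M)"
        by (intro sum_nonneg integral_nonneg_AE AE_I2) auto
      then show "norm ((\<Sum>i<m. \<integral>\<omega>. indicat_real (B m i) \<omega> * (dY m i \<omega>)\<^sup>2 \<partial>M) - 0) < e"
        using main[of m L] m0[of m] L m by (auto simp: abs_if split: if_splits)
    qed
  qed
qed

end

end

section \<open>The expectation form of the Ito formula\<close>

text \<open>The remainder carries two bounds because only second moments of the increments are at
  hand: the cubic bound is small for small increments, and the quadratic one is integrable for large
  increments.\<close>

definition taylor_bdd :: "(real \<Rightarrow> real) \<Rightarrow> (real \<Rightarrow> real) \<Rightarrow> (real \<Rightarrow> real) \<Rightarrow> real \<Rightarrow> bool" where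
  "taylor_bdd G G1 G2 C \<longleftrightarrow> 0 \<le> C \<and> (\<forall>z. \<bar>G z\<bar> \<le> C \<and> \<bar>G1 z\<bar> \<le> C \<and> \<bar>G2 z\<bar> \<le> C) \<and>
     (\<forall>z w. \<bar>G z - G w\<bar> \<le> C * \<bar>z - w\<bar> \<and> \<bar>G1 z - G1 w\<bar> \<le> C * \<bar>z - w\<bar> \<and> \<bar>G2 z - G2 w\<bar> \<le> C * \<bar>z - w\<bar>) \<and>
     (\<forall>z h. \<bar>G (z + h) - G z - G1 z * h - G2 z / 2 * h\<^sup>2\<bar> \<le> C * h\<^sup>2 \<and>
            \<bar>G (z + h) - G z - G1 z * h - G2 z / 2 * h\<^sup>2\<bar> \<le> C * (\<bar>h\<bar> * h\<^sup>2))"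

lemma lipschitz_borel_measurable:
  fixes g :: "real \<Rightarrow> real"
  assumes "\<And>z w. \<bar>g z - g w\<bar> \<le> C * \<bar>z - w\<bar>"
  shows "g \<in> borel_measurable borel"
proof (rule borel_measurable_continuous_onI)
  have "0 \<le> C" using assms[of 1 0] by simp
  then have "C-lipschitz_on UNIV g" using assms by (auto simp: lipschitz_on_def dist_real_def)
  then show "continuous_on UNIV g" by (rule lipschitz_on_continuous_on)
qed

lemma taylor_bdd_measurable:
  assumes "taylor_bdd G G1 G2 C"
  shows "G \<in> borel_measurable borel" "G1 \<in> borel_measurable borel" "G2 \<in> borel_measurable borel"
  using assms unfolding taylor_bdd_def by (auto intro!: lipschitz_borel_measurable[of _ C])

text \<open>\<open>x\<close> stands for the martingale part of an increment and \<open>y\<close> for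
  its drift part, which is smaller by an order, so only the square of \<open>x\<close> is kept at
  second order. Summed over a partition, the three errors are governed by \<open>\<eta>\<close>
  times the quadratic variation, by the mesh, and by \<open>dY_lindeberg\<close>.\<close>

lemma taylor_step_bound:
  fixes x y :: real
  assumes T: "taylor_bdd G G1 G2 C" and \<eta>: "0 < \<eta>" "\<eta> \<le> 1"
  shows "\<bar>G (z + (x + y)) - G z - G1 z * x - G1 z * y - G2 z / 2 * x\<^sup>2\<bar>
    \<le> 4 * C * (\<eta> * x\<^sup>2 + y\<^sup>2 / \<eta> + (if \<eta> < \<bar>x\<bar> then x\<^sup>2 else 0))"
proof -
  define R where "R = G (z + (x + y)) - G z - G1 z * (x + y) - G2 z / 2 * (x + y)\<^sup>2"
  have C: "0 \<le> C" and G2: "\<bar>G2 z\<bar> \<le> C" and R2: "\<bar>R\<bar> \<le> C * (x + y)\<^sup>2" and R3: "\<bar>R\<bar> \<le> C * (\<bar>x + y\<bar> * (x + y)\<^sup>2)"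
    using T unfolding taylor_bdd_def R_def by auto
  \<comment> \<open>Young's inequality weighted by \<open>\<eta>\<close>: a small multiple of the
    larger square and a large multiple of the smaller one.\<close>
  have xy: "\<bar>x\<bar> * \<bar>y\<bar> \<le> (\<eta> * x\<^sup>2 + y\<^sup>2 / \<eta>) / 2"
  proof -
    have "0 \<le> (\<eta> * \<bar>x\<bar> - \<bar>y\<bar>)\<^sup>2 / \<eta>" using \<eta> by simp
    also have "\<dots> = \<eta> * x\<^sup>2 - 2 * (\<bar>x\<bar> * \<bar>y\<bar>) + y\<^sup>2 / \<eta>" using \<eta> by (simp add: power2_eq_square field_simps)
    finally show ?thesis by simp
  qed
  have y2: "y\<^sup>2 \<le> y\<^sup>2 / \<eta>" using \<eta> mult_right_mono[of \<eta> 1 "y\<^sup>2"] by (simp add: pos_le_divide_eq mult.commute)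
  have sq: "(x + y)\<^sup>2 \<le> 2 * x\<^sup>2 + 2 * y\<^sup>2" using sum_squares_ge_zero[of "x - y" 0] by (simp add: power2_eq_square algebra_simps)
  have Rb: "\<bar>R\<bar> \<le> C * (2 * y\<^sup>2 + 2 * \<eta> * x\<^sup>2 + 2 * \<eta> * (\<bar>x\<bar> * \<bar>y\<bar>) + 2 * (if \<eta> < \<bar>x\<bar> then x\<^sup>2 else 0))"
  proof (cases "\<eta> < \<bar>x\<bar>")
    case True
    have "\<bar>R\<bar> \<le> C * (2 * x\<^sup>2 + 2 * y\<^sup>2)" using R2 mult_left_mono[OF sq C] by linarith
    also have "\<dots> \<le> C * (2 * y\<^sup>2 + 2 * \<eta> * x\<^sup>2 + 2 * \<eta> * (\<bar>x\<bar> * \<bar>y\<bar>) + 2 * x\<^sup>2)"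
      using C \<eta> by (intro mult_left_mono) auto
    finally show ?thesis using True by simp
  next
    case False
    \<comment> \<open>Both remainder bounds at once: below, the square of \<open>x\<close> takes the
      factor \<open>\<bar>x + y\<bar>\<close> and the square of \<open>y\<close> the factor
      1.\<close>
    have "\<bar>R\<bar> \<le> C * (min 1 \<bar>x + y\<bar> * (x + y)\<^sup>2)" using R2 R3 by (simp add: min_def)
    also have "\<dots> \<le> C * (min 1 \<bar>x + y\<bar> * (2 * x\<^sup>2 + 2 * y\<^sup>2))"
      by (intro mult_left_mono sq C) auto
    also have "min 1 \<bar>x + y\<bar> * (2 * x\<^sup>2 + 2 * y\<^sup>2) \<le> \<bar>x + y\<bar> * (2 * x\<^sup>2) + 1 * (2 * y\<^sup>2)"
      unfolding distrib_left by (intro add_mono mult_right_mono) auto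
    also have "\<bar>x + y\<bar> * (2 * x\<^sup>2) \<le> (\<eta> + \<bar>y\<bar>) * (2 * x\<^sup>2)" using False by (intro mult_right_mono) auto
    also have "\<dots> = 2 * \<eta> * x\<^sup>2 + 2 * ((\<bar>x\<bar> * \<bar>y\<bar>) * \<bar>x\<bar>)"
    proof -
      have "x\<^sup>2 = \<bar>x\<bar> * \<bar>x\<bar>" by (simp add: power2_eq_square)
      then show ?thesis by (simp only: distrib_right) (simp only: mult.commute mult.left_commute mult.assoc)
    qed
    also have "(\<bar>x\<bar> * \<bar>y\<bar>) * \<bar>x\<bar> \<le> (\<bar>x\<bar> * \<bar>y\<bar>) * \<eta>" using False by (intro mult_left_mono) auto
    finally have "\<bar>R\<bar> \<le> C * (2 * \<eta> * x\<^sup>2 + 2 * ((\<bar>x\<bar> * \<bar>y\<bar>) * \<eta>) + 1 * (2 * y\<^sup>2))" using C by (simp add: mult_left_mono)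
    then show ?thesis using False by (simp add: algebra_simps)
  qed
  have eq: "G (z + (x + y)) - G z - G1 z * x - G1 z * y - G2 z / 2 * x\<^sup>2 = R + G2 z * (x * y + y\<^sup>2 / 2)"
    unfolding R_def by (simp add: power2_eq_square field_simps)
  have "\<bar>G2 z * (x * y + y\<^sup>2 / 2)\<bar> \<le> C * (\<bar>x\<bar> * \<bar>y\<bar> + y\<^sup>2 / 2)"
    unfolding abs_mult[of "G2 z"]
    by (intro mult_mono G2 C order_trans[OF abs_triangle_ineq]) (auto simp: abs_mult)
  then have "\<bar>R + G2 z * (x * y + y\<^sup>2 / 2)\<bar> \<le> C * (2 * y\<^sup>2 + 2 * \<eta> * x\<^sup>2 + 2 * \<eta> * (\<bar>x\<bar> * \<bar>y\<bar>) + 2 * (if \<eta> < \<bar>x\<bar> then x\<^sup>2 else 0)) + C * (\<bar>x\<bar> * \<bar>y\<bar> + y\<^sup>2 / 2)"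
    using Rb by linarith
  also have "\<dots> = C * (2 * y\<^sup>2 + 2 * \<eta> * x\<^sup>2 + 2 * \<eta> * (\<bar>x\<bar> * \<bar>y\<bar>) + 2 * (if \<eta> < \<bar>x\<bar> then x\<^sup>2 else 0) + \<bar>x\<bar> * \<bar>y\<bar> + y\<^sup>2 / 2)"
    by (simp add: algebra_simps)
  also have "\<dots> \<le> C * (4 * (\<eta> * x\<^sup>2 + y\<^sup>2 / \<eta> + (if \<eta> < \<bar>x\<bar> then x\<^sup>2 else 0)))"
  proof (intro mult_left_mono C)
    have "2 * \<eta> * (\<bar>x\<bar> * \<bar>y\<bar>) \<le> 2 * 1 * (\<bar>x\<bar> * \<bar>y\<bar>)" using \<eta> by (intro mult_right_mono mult_left_mono) auto
    then have "2 * y\<^sup>2 + 2 * E + 2 * \<eta> * (\<bar>x\<bar> * \<bar>y\<bar>) + 2 * J + \<bar>x\<bar> * \<bar>y\<bar> + y\<^sup>2 / 2 \<le> 4 * (E + D + J)"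
      if "E = \<eta> * x\<^sup>2" "D = y\<^sup>2 / \<eta>" "0 \<le> J" for E D J
    proof -
      have "0 \<le> E" "\<bar>x\<bar> * \<bar>y\<bar> \<le> (E + D) / 2" "y\<^sup>2 \<le> D" "2 * \<eta> * (\<bar>x\<bar> * \<bar>y\<bar>) \<le> 2 * (\<bar>x\<bar> * \<bar>y\<bar>)"
        using xy y2 that \<eta> \<open>2 * \<eta> * (\<bar>x\<bar> * \<bar>y\<bar>) \<le> 2 * 1 * (\<bar>x\<bar> * \<bar>y\<bar>)\<close> by auto
      then show ?thesis using that(3) by argo
    qed
    from this[of "\<eta> * x\<^sup>2" "y\<^sup>2 / \<eta>" "if \<eta> < \<bar>x\<bar> then x\<^sup>2 else 0"]
    show "2 * y\<^sup>2 + 2 * \<eta> * x\<^sup>2 + 2 * \<eta> * (\<bar>x\<bar> * \<bar>y\<bar>) + 2 * (if \<eta> < \<bar>x\<bar> then x\<^sup>2 else 0) + \<bar>x\<bar> * \<bar>y\<bar> + y\<^sup>2 / 2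
      \<le> 4 * (\<eta> * x\<^sup>2 + y\<^sup>2 / \<eta> + (if \<eta> < \<bar>x\<bar> then x\<^sup>2 else 0))"
      by (simp add: mult.assoc)
  qed
  finally show ?thesis unfolding eq by (simp add: mult.assoc mult.left_commute)
qed

context sbm_process
begin

text \<open>Cauchy-Schwarz in time gives the square of the length. Since finiteness of the second
  moment is part of the claim, the variable is cut at \<open>n\<close> first, the second moment of
  the truncation is absorbed into the left-hand side, and Fatou's lemma removes the cut.\<close>

lemma I1_sq:
  assumes st: "0 \<le> s" "s < t" "t \<le> T"
  shows "integrable M (\<lambda>\<omega>. (I (\<lambda>_. 1) s t \<omega>)\<^sup>2)" (is ?i)
    and "(\<integral>\<omega>. (I (\<lambda>_. 1) s t \<omega>)\<^sup>2 \<partial>M) \<le> (t - s)\<^sup>2 * (m0\<^sup>2 + T * m0)"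
proof -
  define V where "V = I (\<lambda>_. 1) s t"
  define h where "h = t - s"
  define B where "B = m0\<^sup>2 + T * m0"
  define Vn where "Vn n \<omega> = min (V \<omega>) (real n)" for n \<omega>
  have h: "0 < h" using st by (simp add: h_def)
  have T: "0 \<le> T" using st by simp
  have "integrable M (\<lambda>\<omega>. 1 * V \<omega>)" unfolding V_def by (rule I_integrable(1)[where L=1 and C=1]) (use st in auto)
  then have Vi: "integrable M V" by simp
  then have [measurable]: "V \<in> borel_measurable M" by simp
  have V0: "0 \<le> V \<omega>" if "\<omega> \<in> space M" for \<omega>
    unfolding V_def by (rule I_mono[where L=1, OF that]) (simp_all add: st)
  have Vnb: "\<bar>Vn n \<omega>\<bar> \<le> real n" "0 \<le> Vn n \<omega>" "Vn n \<omega> \<le> V \<omega>" if "\<omega> \<in> space M" for n \<omega>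
    using V0[OF that] unfolding Vn_def by auto
  have [measurable]: "Vn n \<in> borel_measurable M" for n unfolding Vn_def by measurable
  have VnV: "integrable M (\<lambda>\<omega>. Vn n \<omega> * V \<omega>)" for n
    by (rule integrable_bdd_mult[OF Vi _ Vnb(1)]) auto
  have Vn2: "integrable M (\<lambda>\<omega>. (Vn n \<omega>)\<^sup>2)" for n
  proof (rule Bochner_Integration.integrable_bound[OF VnV[of n]])
    show "AE \<omega> in M. norm ((Vn n \<omega>)\<^sup>2) \<le> norm (Vn n \<omega> * V \<omega>)"
      using Vnb V0 by (intro AE_I2) (auto simp: power2_eq_square intro!: mult_left_mono)
  qed auto
  have bound: "(\<integral>\<omega>. Vn n \<omega> * V \<omega> \<partial>M) \<le> h\<^sup>2 * B" for n
  proof -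
    have iu: "set_integrable lborel {s<..t} (\<lambda>u. \<integral>\<omega>. Vn n \<omega> * mass u \<omega> \<partial>M)"
      and eq: "(\<integral>\<omega>. Vn n \<omega> * V \<omega> \<partial>M) = (LINT u:{s<..t}|lborel. \<integral>\<omega>. Vn n \<omega> * mass u \<omega> \<partial>M)"
      unfolding V_def using I_integrable(2,3)[of s t "\<lambda>_. 1" "Vn n" 1 "real n"] st Vnb by auto
    note eq
    also have "(LINT u:{s<..t}|lborel. \<integral>\<omega>. Vn n \<omega> * mass u \<omega> \<partial>M) \<le> (LINT u:{s<..t}|lborel. (\<integral>\<omega>. (Vn n \<omega>)\<^sup>2 \<partial>M) / (2 * h) + h * B / 2)"
    proof (rule set_integral_mono[OF iu])
      show "set_integrable lborel {s<..t} (\<lambda>u. (\<integral>\<omega>. (Vn n \<omega>)\<^sup>2 \<partial>M) / (2 * h) + h * B / 2)"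
        unfolding set_integrable_def using st by simp
      fix u assume u: "u \<in> {s<..t}"
      then have up: "0 < u" using st by simp
      have "(\<integral>\<omega>. Vn n \<omega> * mass u \<omega> \<partial>M) \<le> (\<integral>\<omega>. (Vn n \<omega>)\<^sup>2 / (2 * h) + h / 2 * (mass u \<omega>)\<^sup>2 \<partial>M)"
      proof (rule integral_mono)
        show "integrable M (\<lambda>\<omega>. Vn n \<omega> * mass u \<omega>)"
          by (rule integrable_bdd_mult[OF mass_integrable[OF up] _ Vnb(1)]) auto
        show "integrable M (\<lambda>\<omega>. (Vn n \<omega>)\<^sup>2 / (2 * h) + h / 2 * (mass u \<omega>)\<^sup>2)"
          using Vn2[of n] mass_sq(1)[OF up] by auto
        fix \<omega>
        \<comment> \<open>Young's inequality with the weight \<open>h = t - s\<close>: integration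
          over an interval of length \<open>h\<close> leaves exactly half of the second moment of
          \<open>Vn n\<close>, which can be absorbed.\<close>
        have "0 \<le> (Vn n \<omega> - h * mass u \<omega>)\<^sup>2 / (2 * h)" using h by simp
        then show "Vn n \<omega> * mass u \<omega> \<le> (Vn n \<omega>)\<^sup>2 / (2 * h) + h / 2 * (mass u \<omega>)\<^sup>2"
          using h by (simp add: power2_eq_square field_simps)
      qed
      also have "\<dots> = (\<integral>\<omega>. (Vn n \<omega>)\<^sup>2 \<partial>M) / (2 * h) + h / 2 * (m0\<^sup>2 + u * m0)"
        using Vn2[of n] mass_sq[OF up] by simp
      also have "\<dots> \<le> (\<integral>\<omega>. (Vn n \<omega>)\<^sup>2 \<partial>M) / (2 * h) + h * B / 2"
        using h u st mult_right_mono[of u T m0] mult_left_mono[of "m0\<^sup>2 + u * m0" B "h/2"] unfolding B_def by auto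
      finally show "(\<integral>\<omega>. Vn n \<omega> * mass u \<omega> \<partial>M) \<le> (\<integral>\<omega>. (Vn n \<omega>)\<^sup>2 \<partial>M) / (2 * h) + h * B / 2" .
    qed
    also have "\<dots> = ((\<integral>\<omega>. (Vn n \<omega>)\<^sup>2 \<partial>M) / (2 * h) + h * B / 2) * h"
      unfolding set_lebesgue_integral_def using st by (simp add: h_def)
    also have "\<dots> = (\<integral>\<omega>. (Vn n \<omega>)\<^sup>2 \<partial>M) / 2 + h\<^sup>2 * B / 2" using h by (simp add: power2_eq_square field_simps)
    finally have "(\<integral>\<omega>. Vn n \<omega> * V \<omega> \<partial>M) \<le> (\<integral>\<omega>. (Vn n \<omega>)\<^sup>2 \<partial>M) / 2 + h\<^sup>2 * B / 2" .
    moreover have "(\<integral>\<omega>. (Vn n \<omega>)\<^sup>2 \<partial>M) \<le> (\<integral>\<omega>. Vn n \<omega> * V \<omega> \<partial>M)"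
      using Vnb by (intro integral_mono Vn2 VnV) (auto simp: power2_eq_square intro!: mult_left_mono)
    ultimately show ?thesis by simp
  qed
  have lim: "(\<lambda>n. Vn n \<omega> * V \<omega>) \<longlonglongrightarrow> (V \<omega>)\<^sup>2" for \<omega>
  proof (rule tendsto_eventually)
    obtain n0 :: nat where "V \<omega> \<le> real n0" using real_arch_simple by blast
    then have "Vn n \<omega> * V \<omega> = (V \<omega>)\<^sup>2" if "n0 \<le> n" for n
      using that unfolding Vn_def by (simp add: min_def power2_eq_square)
    then show "\<forall>\<^sub>F n in sequentially. Vn n \<omega> * V \<omega> = (V \<omega>)\<^sup>2" unfolding eventually_sequentially by blast
  qed
  have nn: "(\<integral>\<^sup>+\<omega>. ennreal ((V \<omega>)\<^sup>2) \<partial>M) \<le> ennreal (h\<^sup>2 * B)"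
  proof -
    have "(\<integral>\<^sup>+\<omega>. ennreal ((V \<omega>)\<^sup>2) \<partial>M) = (\<integral>\<^sup>+\<omega>. liminf (\<lambda>n. ennreal (Vn n \<omega> * V \<omega>)) \<partial>M)"
      using lim by (intro nn_integral_cong lim_imp_Liminf[symmetric] tendsto_ennrealI) auto
    also have "\<dots> \<le> liminf (\<lambda>n. \<integral>\<^sup>+\<omega>. ennreal (Vn n \<omega> * V \<omega>) \<partial>M)" by (rule nn_integral_liminf) measurable
    also have "\<dots> \<le> ennreal (h\<^sup>2 * B)"
    proof (rule Liminf_le)
      show "\<forall>\<^sub>F n in sequentially. (\<integral>\<^sup>+\<omega>. ennreal (Vn n \<omega> * V \<omega>) \<partial>M) \<le> ennreal (h\<^sup>2 * B)"
        using bound Vnb V0 by (intro always_eventually allI) (subst nn_integral_eq_integral[OF VnV], auto intro!: ennreal_leI)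
    qed simp
    finally show ?thesis .
  qed
  show i: ?i unfolding V_def[symmetric]
    by (rule integrableI_bounded) (use nn in \<open>auto intro: le_less_trans\<close>)
  have "0 \<le> B" unfolding B_def using T by simp
  then show "(\<integral>\<omega>. (I (\<lambda>_. 1) s t \<omega>)\<^sup>2 \<partial>M) \<le> (t - s)\<^sup>2 * (m0\<^sup>2 + T * m0)"
    using nn nn_integral_eq_integral[OF i] unfolding V_def[symmetric] B_def[symmetric] h_def[symmetric]
    by (simp add: ennreal_le_iff)
qed

lemma J_increment:
  assumes tf: "test_fun \<phi> \<phi>1 \<phi>2" and \<omega>: "\<omega> \<in> space M" and st: "0 < s" "s \<le> t"
  shows "J t \<phi> \<omega> = J s \<phi> \<omega> + ((Y \<phi> \<phi>2 t \<omega> - Y \<phi> \<phi>2 s \<omega>) + I (\<lambda>x. \<phi>2 x / 2) s t \<omega>)"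
proof -
  obtain L where L: "\<And>x. \<bar>\<phi>2 x\<bar> \<le> L" using test_fun_bdd(3)[OF tf] by blast
  note [measurable] = test_fun_bdd(2)[OF tf]
  have "I (\<lambda>x. \<phi>2 x / 2) 0 t \<omega> = I (\<lambda>x. \<phi>2 x / 2) 0 s \<omega> + I (\<lambda>x. \<phi>2 x / 2) s t \<omega>"
    by (rule I_split[OF \<omega>, where L="L/2"]) (use st L in \<open>auto simp: divide_right_mono\<close>)
  then show ?thesis using st unfolding sbm_mart_def I_def by simp
qed

text \<open>The weighted Ito drift with two clocks: within one partition step the derivatives of
  \<open>G\<close> are frozen at the left end \<open>s\<close>, while Fubini's theorem integrates
  the pairings over the later times \<open>u\<close>.\<close>

definition gen :: "('a \<Rightarrow> real) \<Rightarrow> (real \<Rightarrow> real) \<Rightarrow> (real \<Rightarrow> real) \<Rightarrow> real \<Rightarrow> (real \<Rightarrow> real) \<Rightarrow> real \<Rightarrow> (real \<Rightarrow> real) \<Rightarrow> (real \<Rightarrow> real) \<Rightarrow> real" where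
  "gen W G1 G2 s \<phi> u \<psi> \<theta> = (\<integral>\<omega>. W \<omega> * (G1 (J s \<phi> \<omega>) * J u \<psi> \<omega> + G2 (J s \<phi> \<omega>) / 2 * J u \<theta> \<omega>) \<partial>M)"

context
  fixes \<phi> \<phi>1 \<phi>2 G G1 G2 :: "real \<Rightarrow> real" and C Cw :: real and W :: "'a \<Rightarrow> real" and a b c \<epsilon> :: real
  assumes tf: "test_fun \<phi> \<phi>1 \<phi>2" and T: "taylor_bdd G G1 G2 C" and ab: "0 < a" "a < b"
    and W: "W \<in> borel_measurable (F a)" and WC: "\<And>\<omega>. \<omega> \<in> space M \<Longrightarrow> \<bar>W \<omega>\<bar> \<le> Cw"
    and close: "\<And>s u. a \<le> s \<Longrightarrow> s \<le> u \<Longrightarrow> u \<le> b \<Longrightarrow> \<bar>gen W G1 G2 s \<phi> u (\<lambda>x. \<phi>2 x / 2) (\<lambda>x. (\<phi> x)\<^sup>2) - c\<bar> \<le> \<epsilon>"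
begin

lemma Cw_nonneg: "0 \<le> Cw"
proof -
  obtain \<omega> where "\<omega> \<in> space M" using not_empty by blast
  then show ?thesis using WC[of \<omega>] by linarith
qed

lemma C_nonneg: "0 \<le> C" and G_bdd: "\<bar>G z\<bar> \<le> C" "\<bar>G1 z\<bar> \<le> C" "\<bar>G2 z\<bar> \<le> C"
  using T unfolding taylor_bdd_def by auto

text \<open>The martingale increment has weighted mean zero, its square may be exchanged for its
  bracket, and Fubini's theorem turns what remains into a time integral of \<open>gen\<close>, which
  \<open>close\<close> pins to \<open>c\<close>. The rest is the error of
  \<open>taylor_step_bound\<close>.\<close>

lemma ito_step:
  assumes st: "a \<le> s" "s < t" "t \<le> b" and \<eta>: "0 < \<eta>" "\<eta> \<le> 1" and L: "0 \<le> L" "\<And>x. \<bar>\<phi>2 x / 2\<bar> \<le> L" "\<And>x. \<bar>(\<phi> x)\<^sup>2\<bar> \<le> L"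
  shows "\<bar>(\<integral>\<omega>. W \<omega> * G (J t \<phi> \<omega>) \<partial>M) - (\<integral>\<omega>. W \<omega> * G (J s \<phi> \<omega>) \<partial>M) - (t - s) * c\<bar> \<le> \<epsilon> * (t - s)
    + Cw * (4 * C) * (\<eta> * (\<integral>\<omega>. I (\<lambda>x. (\<phi> x)\<^sup>2) s t \<omega> \<partial>M) + L\<^sup>2 * ((t - s)\<^sup>2 * (m0\<^sup>2 + b * m0)) / \<eta>
       + (\<integral>\<omega>. indicat_real {\<omega> \<in> space M. \<eta> < \<bar>Y \<phi> \<phi>2 t \<omega> - Y \<phi> \<phi>2 s \<omega>\<bar>} \<omega> * (Y \<phi> \<phi>2 t \<omega> - Y \<phi> \<phi>2 s \<omega>)\<^sup>2 \<partial>M))"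
proof -
  have s: "0 < s" "0 \<le> s" and t: "0 < t" "0 \<le> t" using st ab by auto
  note \<phi>m[measurable] = test_fun_bdd(1,2)[OF tf]
  define \<psi> where "\<psi> x = \<phi>2 x / 2" for x
  define \<theta> where "\<theta> x = (\<phi> x)\<^sup>2" for x
  have \<psi>m[measurable]: "\<psi> \<in> borel_measurable borel" unfolding \<psi>_def by measurable
  have \<theta>m[measurable]: "\<theta> \<in> borel_measurable borel" unfolding \<theta>_def by measurable
  have \<psi>b: "\<bar>\<psi> x\<bar> \<le> L" and \<theta>b: "\<bar>\<theta> x\<bar> \<le> L" for x using L by (auto simp: \<psi>_def \<theta>_def)
  define D where "D \<omega> = Y \<phi> \<phi>2 t \<omega> - Y \<phi> \<phi>2 s \<omega>" for \<omega>
  define E where "E = I \<psi> s t"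
  define V1 where "V1 \<omega> = W \<omega> * G1 (J s \<phi> \<omega>)" for \<omega>
  define V2 where "V2 \<omega> = W \<omega> * (G2 (J s \<phi> \<omega>) / 2)" for \<omega>
  note G1m[measurable] = taylor_bdd_measurable[OF T]
  have JF[measurable]: "J s \<phi> \<in> borel_measurable (F s)" by (rule J_measurable_F[OF s(1) \<phi>m(1)])
  have WF[measurable]: "W \<in> borel_measurable (F s)" by (rule F_mono[OF st(1) W])
  have V1F: "V1 \<in> borel_measurable (F s)" and V2F: "V2 \<in> borel_measurable (F s)"
    unfolding V1_def V2_def by measurable
  note [measurable] = F_M[OF V1F] F_M[OF V2F] F_M[OF WF]
  have V1b: "\<bar>V1 \<omega>\<bar> \<le> Cw * C" if "\<omega> \<in> space M" for \<omega>
    unfolding V1_def abs_mult by (intro mult_mono WC that G_bdd Cw_nonneg) auto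
  have V2b: "\<bar>V2 \<omega>\<bar> \<le> Cw * C" if "\<omega> \<in> space M" for \<omega>
  proof -
    have "\<bar>G2 (J s \<phi> \<omega>) / 2\<bar> \<le> C" using G_bdd(3)[of "J s \<phi> \<omega>"] by simp
    then show ?thesis unfolding V2_def abs_mult by (intro mult_mono WC that Cw_nonneg) auto
  qed
  have Di: "integrable M D" unfolding D_def using Y_integrable[OF tf] s t by simp
  have D2i: "integrable M (\<lambda>\<omega>. (D \<omega>)\<^sup>2)"
    using Y_increment_sq(1)[OF tf s(2), of t "\<lambda>_. 1" 1] st unfolding D_def by simp
  have E1: "\<bar>E \<omega>\<bar> \<le> L * I (\<lambda>_. 1) s t \<omega>" if "\<omega> \<in> space M" for \<omega>
  proof -
    have "\<bar>E \<omega>\<bar> \<le> (LINT u:{s<..t}|lborel. \<bar>J u \<psi> \<omega>\<bar>)"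
      unfolding E_def I_def set_lebesgue_integral_def
      by (rule order_trans[OF integral_abs_bound]) (simp add: abs_mult)
    also have "\<dots> \<le> (LINT u:{s<..t}|lborel. L * mass u \<omega>)"
      by (rule set_integral_mono[OF set_integrable_abs[OF J_set_integrable[OF that s(2) \<psi>m \<psi>b]]
        set_integrable_mult_right[OF J_set_integrable[OF that s(2), of "\<lambda>_. 1" 1]]])
       (use s in \<open>auto intro!: J_bound[OF that _ \<psi>m \<psi>b]\<close>)
    finally show ?thesis by (simp add: I_def)
  qed
  have Em[measurable]: "E \<in> borel_measurable M" unfolding E_def using I_integrable(1)[OF s(2) less_imp_le[OF st(2)] \<psi>m _ \<psi>b, of "\<lambda>_. 1" 1] by auto
  have I1: "integrable M (\<lambda>\<omega>. (I (\<lambda>_. 1) s t \<omega>)\<^sup>2)" "(\<integral>\<omega>. (I (\<lambda>_. 1) s t \<omega>)\<^sup>2 \<partial>M) \<le> (t - s)\<^sup>2 * (m0\<^sup>2 + b * m0)"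
    using I1_sq[OF s(2) st(2,3)] by auto
  have E2: "(E \<omega>)\<^sup>2 \<le> L\<^sup>2 * (I (\<lambda>_. 1) s t \<omega>)\<^sup>2" if "\<omega> \<in> space M" for \<omega>
    using E1[OF that] by (metis abs_ge_zero power2_abs power_mono power_mult_distrib)
  have E2i: "integrable M (\<lambda>\<omega>. (E \<omega>)\<^sup>2)"
    by (rule Bochner_Integration.integrable_bound[OF integrable_mult_right[OF I1(1), of "L\<^sup>2"]]) (use E2 in \<open>auto intro!: AE_I2\<close>)
  have E2e: "(\<integral>\<omega>. (E \<omega>)\<^sup>2 \<partial>M) \<le> L\<^sup>2 * ((t - s)\<^sup>2 * (m0\<^sup>2 + b * m0))"
  proof -
    have "(\<integral>\<omega>. (E \<omega>)\<^sup>2 \<partial>M) \<le> (\<integral>\<omega>. L\<^sup>2 * (I (\<lambda>_. 1) s t \<omega>)\<^sup>2 \<partial>M)"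
      by (intro integral_mono E2i integrable_mult_right I1(1) E2)
    also have "\<dots> = L\<^sup>2 * (\<integral>\<omega>. (I (\<lambda>_. 1) s t \<omega>)\<^sup>2 \<partial>M)" by simp
    also have "\<dots> \<le> L\<^sup>2 * ((t - s)\<^sup>2 * (m0\<^sup>2 + b * m0))" by (intro mult_left_mono I1(2)) simp
    finally show ?thesis .
  qed
  note iE = I_integrable[OF s(2) less_imp_le[OF st(2)] \<psi>m F_M[OF V1F] \<psi>b V1b, folded E_def]
  note iX = I_integrable[OF s(2) less_imp_le[OF st(2)] \<theta>m F_M[OF V2F] \<theta>b V2b]
  have D1: "(\<integral>\<omega>. V1 \<omega> * D \<omega> \<partial>M) = 0" unfolding D_def by (rule Y_increment[OF tf s(2) less_imp_le[OF st(2)] V1F V1b])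
  have D2: "(\<integral>\<omega>. V2 \<omega> * (D \<omega>)\<^sup>2 \<partial>M) = (\<integral>\<omega>. V2 \<omega> * I \<theta> s t \<omega> \<partial>M)"
    unfolding D_def \<theta>_def by (rule Y_increment_sq(2)[OF tf s(2) less_imp_le[OF st(2)] V2F V2b])
  have th: "(\<integral>\<omega>. V1 \<omega> * J u \<psi> \<omega> \<partial>M) + (\<integral>\<omega>. V2 \<omega> * J u \<theta> \<omega> \<partial>M) = gen W G1 G2 s \<phi> u \<psi> \<theta>" if "0 < u" for u
  proof -
    have "integrable M (\<lambda>\<omega>. V1 \<omega> * J u \<psi> \<omega>)"
      by (rule integrable_bdd_mult[OF J_integrable[OF that \<psi>m \<psi>b] F_M[OF V1F] V1b])
    moreover have "integrable M (\<lambda>\<omega>. V2 \<omega> * J u \<theta> \<omega>)"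
      by (rule integrable_bdd_mult[OF J_integrable[OF that \<theta>m \<theta>b] F_M[OF V2F] V2b])
    ultimately have "integrable M (\<lambda>\<omega>. V1 \<omega> * J u \<psi> \<omega>)" "integrable M (\<lambda>\<omega>. V2 \<omega> * J u \<theta> \<omega>)" by blast+
    then show ?thesis unfolding gen_def V1_def V2_def
      by (subst Bochner_Integration.integral_add[symmetric]) (auto simp: algebra_simps)
  qed
  have sgen: "set_integrable lborel {s<..t} (\<lambda>u. gen W G1 G2 s \<phi> u \<psi> \<theta>)"
    and sgen_eq: "(\<integral>\<omega>. V1 \<omega> * E \<omega> \<partial>M) + (\<integral>\<omega>. V2 \<omega> * (D \<omega>)\<^sup>2 \<partial>M) = (LINT u:{s<..t}|lborel. gen W G1 G2 s \<phi> u \<psi> \<theta>)"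
  proof -
    have "set_integrable lborel {s<..t} (\<lambda>u. (\<integral>\<omega>. V1 \<omega> * J u \<psi> \<omega> \<partial>M) + (\<integral>\<omega>. V2 \<omega> * J u \<theta> \<omega> \<partial>M))"
      by (rule set_integral_add(1)[OF iE(2) iX(2)])
    then show "set_integrable lborel {s<..t} (\<lambda>u. gen W G1 G2 s \<phi> u \<psi> \<theta>)"
      by (rule set_integrable_cong[THEN iffD1, rotated 3]) (use th s in auto)
    have "(\<integral>\<omega>. V1 \<omega> * E \<omega> \<partial>M) + (\<integral>\<omega>. V2 \<omega> * (D \<omega>)\<^sup>2 \<partial>M) = (LINT u:{s<..t}|lborel. (\<integral>\<omega>. V1 \<omega> * J u \<psi> \<omega> \<partial>M) + (\<integral>\<omega>. V2 \<omega> * J u \<theta> \<omega> \<partial>M))"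
      using set_integral_add(2)[OF iE(2) iX(2)] iE(3) iX(3) D2 by simp
    also have "\<dots> = (LINT u:{s<..t}|lborel. gen W G1 G2 s \<phi> u \<psi> \<theta>)"
      by (rule set_lebesgue_integral_cong) (use th s in auto)
    finally show "(\<integral>\<omega>. V1 \<omega> * E \<omega> \<partial>M) + (\<integral>\<omega>. V2 \<omega> * (D \<omega>)\<^sup>2 \<partial>M) = (LINT u:{s<..t}|lborel. gen W G1 G2 s \<phi> u \<psi> \<theta>)" .
  qed
  have int_const: "set_integrable lborel {s<..t} (\<lambda>u. k)" "(LINT u:{s<..t}|lborel. k) = k * (t - s)" for k :: real
    unfolding set_integrable_def set_lebesgue_integral_def using st by auto
  have cl: "\<bar>gen W G1 G2 s \<phi> u \<psi> \<theta> - c\<bar> \<le> \<epsilon>" if "u \<in> {s<..t}" for u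
    using close[of s u] st that unfolding \<psi>_def[symmetric] \<theta>_def[symmetric] by auto
  have "(LINT u:{s<..t}|lborel. gen W G1 G2 s \<phi> u \<psi> \<theta>) \<le> (LINT u:{s<..t}|lborel. c + \<epsilon>)"
    by (rule set_integral_mono[OF sgen int_const(1)]) (use cl in \<open>fastforce simp: abs_le_iff\<close>)
  moreover have "(LINT u:{s<..t}|lborel. c - \<epsilon>) \<le> (LINT u:{s<..t}|lborel. gen W G1 G2 s \<phi> u \<psi> \<theta>)"
    by (rule set_integral_mono[OF int_const(1) sgen]) (use cl in \<open>fastforce simp: abs_le_iff\<close>)
  ultimately have A: "\<bar>(\<integral>\<omega>. V1 \<omega> * E \<omega> \<partial>M) + (\<integral>\<omega>. V2 \<omega> * (D \<omega>)\<^sup>2 \<partial>M) - (t - s) * c\<bar> \<le> \<epsilon> * (t - s)"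
    unfolding sgen_eq int_const by (simp add: abs_le_iff algebra_simps)
  have WGi: "integrable M (\<lambda>\<omega>. W \<omega> * G (J u \<phi> \<omega>))" if "0 < u" for u
  proof (rule integrable_bdd_mult[OF _ F_M[OF WF] WC])
    show "integrable M (\<lambda>\<omega>. G (J u \<phi> \<omega>))"
    proof (rule Bochner_Integration.integrable_bound[of M "\<lambda>_. C"])
      have [measurable]: "J u \<phi> \<in> borel_measurable M" by (rule J_measurable[OF that \<phi>m(1)])
      show "(\<lambda>\<omega>. G (J u \<phi> \<omega>)) \<in> borel_measurable M" by measurable
    qed (use G_bdd(1) C_nonneg in auto)
  qed
  note iD = integrable_bdd_mult[OF Di F_M[OF V1F] V1b]
  note iD2 = integrable_bdd_mult[OF D2i F_M[OF V2F] V2b]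
  have [measurable]: "D \<in> borel_measurable M" using Di by simp
  have ind_i: "integrable M (\<lambda>\<omega>. indicat_real {\<omega> \<in> space M. \<eta> < \<bar>D \<omega>\<bar>} \<omega> * (D \<omega>)\<^sup>2)"
    by (rule indicator_integrable_mult[OF D2i]) measurable
  have eqD: "(\<integral>\<omega>. (D \<omega>)\<^sup>2 \<partial>M) = (\<integral>\<omega>. I (\<lambda>x. (\<phi> x)\<^sup>2) s t \<omega> \<partial>M)"
    using Y_increment_sq(2)[OF tf s(2), of t "\<lambda>_. 1" 1] st unfolding D_def by simp
  let ?err = "\<lambda>\<omega>. W \<omega> * G (J t \<phi> \<omega>) - W \<omega> * G (J s \<phi> \<omega>) - V1 \<omega> * D \<omega> - V1 \<omega> * E \<omega> - V2 \<omega> * (D \<omega>)\<^sup>2"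
  have erri: "integrable M ?err" using WGi s t iD iD2 iE(1) by simp
  have err: "\<bar>?err \<omega>\<bar> \<le> Cw * (4 * C * (\<eta> * (D \<omega>)\<^sup>2 + (E \<omega>)\<^sup>2 / \<eta> + indicat_real {\<omega> \<in> space M. \<eta> < \<bar>D \<omega>\<bar>} \<omega> * (D \<omega>)\<^sup>2))"
    if \<omega>: "\<omega> \<in> space M" for \<omega>
  proof -
    have eq: "J t \<phi> \<omega> = J s \<phi> \<omega> + (D \<omega> + E \<omega>)"
      unfolding D_def E_def \<psi>_def by (rule J_increment[OF tf \<omega> s(1)]) (use st in simp)
    have "?err \<omega> = W \<omega> * (G (J s \<phi> \<omega> + (D \<omega> + E \<omega>)) - G (J s \<phi> \<omega>) - G1 (J s \<phi> \<omega>) * D \<omega> - G1 (J s \<phi> \<omega>) * E \<omega> - G2 (J s \<phi> \<omega>) / 2 * (D \<omega>)\<^sup>2)"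
      unfolding eq V1_def V2_def by (simp add: algebra_simps)
    then have "\<bar>?err \<omega>\<bar> = \<bar>W \<omega>\<bar> * \<bar>G (J s \<phi> \<omega> + (D \<omega> + E \<omega>)) - G (J s \<phi> \<omega>) - G1 (J s \<phi> \<omega>) * D \<omega> - G1 (J s \<phi> \<omega>) * E \<omega> - G2 (J s \<phi> \<omega>) / 2 * (D \<omega>)\<^sup>2\<bar>"
      by (simp add: abs_mult)
    also have "\<dots> \<le> Cw * (4 * C * (\<eta> * (D \<omega>)\<^sup>2 + (E \<omega>)\<^sup>2 / \<eta> + (if \<eta> < \<bar>D \<omega>\<bar> then (D \<omega>)\<^sup>2 else 0)))"
      by (intro mult_mono WC \<omega> taylor_step_bound[OF T \<eta>] Cw_nonneg) auto
    finally show ?thesis using \<omega> by (auto simp: indicator_def)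
  qed
  have "\<bar>\<integral>\<omega>. ?err \<omega> \<partial>M\<bar> \<le> (\<integral>\<omega>. Cw * (4 * C * (\<eta> * (D \<omega>)\<^sup>2 + (E \<omega>)\<^sup>2 / \<eta> + indicat_real {\<omega> \<in> space M. \<eta> < \<bar>D \<omega>\<bar>} \<omega> * (D \<omega>)\<^sup>2)) \<partial>M)"
    by (intro order_trans[OF integral_abs_bound] integral_mono integrable_abs erri err integrable_mult_right
      Bochner_Integration.integrable_add ind_i D2i integrable_divide_zero E2i)
  also have "\<dots> = Cw * (4 * C * (\<eta> * (\<integral>\<omega>. (D \<omega>)\<^sup>2 \<partial>M) + (\<integral>\<omega>. (E \<omega>)\<^sup>2 \<partial>M) / \<eta> + (\<integral>\<omega>. indicat_real {\<omega> \<in> space M. \<eta> < \<bar>D \<omega>\<bar>} \<omega> * (D \<omega>)\<^sup>2 \<partial>M)))"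
    using D2i E2i ind_i by simp
  also have "\<dots> \<le> Cw * (4 * C * (\<eta> * (\<integral>\<omega>. (D \<omega>)\<^sup>2 \<partial>M) + L\<^sup>2 * ((t - s)\<^sup>2 * (m0\<^sup>2 + b * m0)) / \<eta> + (\<integral>\<omega>. indicat_real {\<omega> \<in> space M. \<eta> < \<bar>D \<omega>\<bar>} \<omega> * (D \<omega>)\<^sup>2 \<partial>M)))"
    using \<eta> Cw_nonneg C_nonneg by (intro mult_left_mono add_mono divide_right_mono E2e order_refl) auto
  finally have B: "\<bar>\<integral>\<omega>. ?err \<omega> \<partial>M\<bar> \<le> Cw * (4 * C) * (\<eta> * (\<integral>\<omega>. I (\<lambda>x. (\<phi> x)\<^sup>2) s t \<omega> \<partial>M) + L\<^sup>2 * ((t - s)\<^sup>2 * (m0\<^sup>2 + b * m0)) / \<eta> + (\<integral>\<omega>. indicat_real {\<omega> \<in> space M. \<eta> < \<bar>D \<omega>\<bar>} \<omega> * (D \<omega>)\<^sup>2 \<partial>M))"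
    by (simp add: eqD mult.assoc)
  have "(\<integral>\<omega>. ?err \<omega> \<partial>M) = (\<integral>\<omega>. W \<omega> * G (J t \<phi> \<omega>) \<partial>M) - (\<integral>\<omega>. W \<omega> * G (J s \<phi> \<omega>) \<partial>M) - (\<integral>\<omega>. V1 \<omega> * D \<omega> \<partial>M) - (\<integral>\<omega>. V1 \<omega> * E \<omega> \<partial>M) - (\<integral>\<omega>. V2 \<omega> * (D \<omega>)\<^sup>2 \<partial>M)"
    using WGi s t iD iD2 iE(1) by simp
  then show ?thesis using A B unfolding D1 D_def[symmetric] by (simp add: abs_le_iff)
qed

lemma local_ito: "\<bar>(\<integral>\<omega>. W \<omega> * G (J b \<phi> \<omega>) \<partial>M) - (\<integral>\<omega>. W \<omega> * G (J a \<phi> \<omega>) \<partial>M) - (b - a) * c\<bar> \<le> \<epsilon> * (b - a)"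
proof -
  obtain L' where L': "0 \<le> L'" "\<And>x. \<bar>\<phi> x\<bar> \<le> L'" "\<And>x. \<bar>\<phi>2 x\<bar> \<le> L'" using test_fun_bdd(3)[OF tf] by blast
  define L where "L = max L' (L'\<^sup>2)"
  have L: "0 \<le> L" "\<bar>\<phi>2 x / 2\<bar> \<le> L" "\<bar>(\<phi> x)\<^sup>2\<bar> \<le> L" for x
  proof -
    show "0 \<le> L" using L' by (simp add: L_def max_def)
    show "\<bar>\<phi>2 x / 2\<bar> \<le> L" using L'(3)[of x] by (simp add: L_def)
    have "(\<phi> x)\<^sup>2 \<le> L'\<^sup>2" using L'(2)[of x] by (metis abs_ge_zero power2_abs power_mono)
    then show "\<bar>(\<phi> x)\<^sup>2\<bar> \<le> L" by (simp add: L_def)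
  qed
  let ?g = "grid a b"
  let ?U = "\<lambda>\<eta> m i. \<integral>\<omega>. indicat_real {\<omega> \<in> space M. \<eta> < \<bar>Y \<phi> \<phi>2 (?g m (Suc i)) \<omega> - Y \<phi> \<phi>2 (?g m i) \<omega>\<bar>} \<omega> * (Y \<phi> \<phi>2 (?g m (Suc i)) \<omega> - Y \<phi> \<phi>2 (?g m i) \<omega>)\<^sup>2 \<partial>M"
  define D where "D = \<bar>(\<integral>\<omega>. W \<omega> * G (J b \<phi> \<omega>) \<partial>M) - (\<integral>\<omega>. W \<omega> * G (J a \<phi> \<omega>) \<partial>M) - (b - a) * c\<bar>"
  define Q where "Q = (\<integral>\<omega>. I (\<lambda>x. (\<phi> x)\<^sup>2) a b \<omega> \<partial>M)"
  define B where "B = L\<^sup>2 * (m0\<^sup>2 + b * m0) * (b - a)\<^sup>2"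
  have bound: "D \<le> \<epsilon> * (b - a) + Cw * (4 * C) * (\<eta> * Q + B / \<eta> * (1 / real m) + (\<Sum>i<m. ?U \<eta> m i))"
    if \<eta>: "0 < \<eta>" "\<eta> \<le> 1" and m: "0 < m" for \<eta> m
  proof -
    let ?h = "(b - a) / real m"
    have h: "?g m (Suc i) - ?g m i = ?h" for i by (rule grid_Suc_diff)
    have hpos: "0 < ?h" using ab m by simp
    let ?E = "\<lambda>i. \<integral>\<omega>. W \<omega> * G (J (?g m i) \<phi> \<omega>) \<partial>M"
    have step: "\<bar>?E (Suc i) - ?E i - ?h * c\<bar> \<le> \<epsilon> * ?h + Cw * (4 * C) * (\<eta> * (\<integral>\<omega>. I (\<lambda>x. (\<phi> x)\<^sup>2) (?g m i) (?g m (Suc i)) \<omega> \<partial>M) + L\<^sup>2 * (?h\<^sup>2 * (m0\<^sup>2 + b * m0)) / \<eta>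
       + ?U \<eta> m i)" if i: "i < m" for i
      using ito_step[of "?g m i" "?g m (Suc i)", OF _ _ _ \<eta> L] grid_ge[of a b m i] grid_le[of a b "Suc i" m] ab i h[of i] hpos
      by simp
    have "(\<integral>\<omega>. W \<omega> * G (J b \<phi> \<omega>) \<partial>M) - (\<integral>\<omega>. W \<omega> * G (J a \<phi> \<omega>) \<partial>M) = ?E m - ?E 0"
      using grid_m[OF m] by simp
    also have "\<dots> = (\<Sum>i<m. ?E (Suc i) - ?E i)" by (rule sum_lessThan_telescope[symmetric])
    finally have "D = \<bar>\<Sum>i<m. (?E (Suc i) - ?E i - ?h * c)\<bar>"
      unfolding D_def using m by (simp add: sum_subtractf)
    also have "\<dots> \<le> (\<Sum>i<m. \<bar>?E (Suc i) - ?E i - ?h * c\<bar>)" by (rule sum_abs)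
    also have "\<dots> \<le> (\<Sum>i<m. \<epsilon> * ?h + Cw * (4 * C) * (\<eta> * (\<integral>\<omega>. I (\<lambda>x. (\<phi> x)\<^sup>2) (?g m i) (?g m (Suc i)) \<omega> \<partial>M) + L\<^sup>2 * (?h\<^sup>2 * (m0\<^sup>2 + b * m0)) / \<eta> + ?U \<eta> m i))"
      by (rule sum_mono) (use step in auto)
    also have "\<dots> = \<epsilon> * (real m * ?h) + Cw * (4 * C) * (\<eta> * (\<Sum>i<m. \<integral>\<omega>. I (\<lambda>x. (\<phi> x)\<^sup>2) (?g m i) (?g m (Suc i)) \<omega> \<partial>M) + real m * (L\<^sup>2 * (?h\<^sup>2 * (m0\<^sup>2 + b * m0)) / \<eta>) + (\<Sum>i<m. ?U \<eta> m i))"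
      by (simp add: sum.distrib sum_distrib_left[symmetric])
    also have "(\<Sum>i<m. \<integral>\<omega>. I (\<lambda>x. (\<phi> x)\<^sup>2) (?g m i) (?g m (Suc i)) \<omega> \<partial>M) = Q"
    proof -
      have "(\<Sum>i<m. \<integral>\<omega>. I (\<lambda>x. (\<phi> x)\<^sup>2) (?g m i) (?g m (Suc i)) \<omega> \<partial>M) = (\<integral>\<omega>. (\<Sum>i<m. I (\<lambda>x. (\<phi> x)\<^sup>2) (?g m i) (?g m (Suc i)) \<omega>) \<partial>M)"
        using Ig_integrable[OF tf less_imp_le[OF ab(1)] ab(2)] by (intro Bochner_Integration.integral_sum[symmetric]) auto
      also have "\<dots> = Q" unfolding Q_def
        using sum_Ig[OF tf less_imp_le[OF ab(1)] ab(2) _ order_refl] grid_m[OF m, of a b] by (intro Bochner_Integration.integral_cong) auto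
      finally show ?thesis .
    qed
    also have "real m * ?h = b - a" using m by simp
    also have "real m * (L\<^sup>2 * (?h\<^sup>2 * (m0\<^sup>2 + b * m0)) / \<eta>) = B / \<eta> * (1 / real m)"
    proof -
      have "real m * (L\<^sup>2 * (?h\<^sup>2 * (m0\<^sup>2 + b * m0)) / \<eta>) = L\<^sup>2 * ((real m * ?h\<^sup>2) * (m0\<^sup>2 + b * m0)) / \<eta>"
        by (simp only: mult.left_commute mult.assoc times_divide_eq_right)
      also have "real m * ?h\<^sup>2 = (b - a)\<^sup>2 * (1 / real m)" using m by (simp add: power_divide power2_eq_square)
      finally show ?thesis unfolding B_def by (simp add: mult.commute mult.left_commute)
    qed
    finally show ?thesis .
  qed
  \<comment> \<open>The mesh tends to zero with the threshold \<open>\<eta>\<close> fixed, which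
    removes the drift squares and the large increments; only afterwards does \<open>\<eta>\<close>
    tend to zero.\<close>
  have bound2: "D \<le> \<epsilon> * (b - a) + Cw * (4 * C) * (\<eta> * Q)" if \<eta>: "0 < \<eta>" "\<eta> \<le> 1" for \<eta>
  proof (rule LIMSEQ_le_const)
    have "(\<lambda>m. \<Sum>i<m. ?U \<eta> m i) \<longlonglongrightarrow> 0" by (rule dY_lindeberg[OF tf less_imp_le[OF ab(1)] ab(2) \<eta>(1)])
    then have "(\<lambda>m. \<epsilon> * (b - a) + Cw * (4 * C) * (\<eta> * Q + B / \<eta> * (1 / real m) + (\<Sum>i<m. ?U \<eta> m i))) \<longlonglongrightarrow> \<epsilon> * (b - a) + Cw * (4 * C) * (\<eta> * Q + B / \<eta> * 0 + 0)"
      by (intro tendsto_intros lim_1_over_n)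
    then show "(\<lambda>m. \<epsilon> * (b - a) + Cw * (4 * C) * (\<eta> * Q + B / \<eta> * (1 / real m) + (\<Sum>i<m. ?U \<eta> m i))) \<longlonglongrightarrow> \<epsilon> * (b - a) + Cw * (4 * C) * (\<eta> * Q)" by simp
    show "\<exists>N. \<forall>n\<ge>N. D \<le> \<epsilon> * (b - a) + Cw * (4 * C) * (\<eta> * Q + B / \<eta> * (1 / real n) + (\<Sum>i<n. ?U \<eta> n i))"
      using bound[OF \<eta>] by (intro exI[of _ 1]) auto
  qed
  have "D \<le> \<epsilon> * (b - a)"
  proof (rule LIMSEQ_le_const)
    have "(\<lambda>n. \<epsilon> * (b - a) + Cw * (4 * C) * (inverse (real (Suc n)) * Q)) \<longlonglongrightarrow> \<epsilon> * (b - a) + Cw * (4 * C) * (0 * Q)"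
      by (intro tendsto_intros LIMSEQ_inverse_real_of_nat)
    then show "(\<lambda>n. \<epsilon> * (b - a) + Cw * (4 * C) * (inverse (real (Suc n)) * Q)) \<longlonglongrightarrow> \<epsilon> * (b - a)" by simp
    have "0 < inverse (real (Suc n))" "inverse (real (Suc n)) \<le> 1" for n by (simp_all add: field_simps)
    then show "\<exists>N. \<forall>n\<ge>N. D \<le> \<epsilon> * (b - a) + Cw * (4 * C) * (inverse (real (Suc n)) * Q)"
      using bound2 by blast
  qed
  then show ?thesis unfolding D_def .
qed

end

end

section \<open>Convergence of expectations of products\<close>

lemma (in prob_space) tail_expectation_small:
  assumes A: "integrable M A" and e: "0 < (e::real)"
  shows "\<exists>R>0. (\<integral>\<omega>. indicat_real {\<omega> \<in> space M. R < \<bar>A \<omega>\<bar>} \<omega> * \<bar>A \<omega>\<bar> \<partial>M) < e"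
proof -
  have [measurable]: "A \<in> borel_measurable M" using A by simp
  have "(\<lambda>n. \<integral>\<omega>. indicat_real {\<omega> \<in> space M. real (Suc n) < \<bar>A \<omega>\<bar>} \<omega> * \<bar>A \<omega>\<bar> \<partial>M) \<longlonglongrightarrow> (\<integral>\<omega>. 0 \<partial>M)"
  proof (rule integral_dominated_convergence[where w = "\<lambda>\<omega>. \<bar>A \<omega>\<bar>"])
    show "AE \<omega> in M. (\<lambda>n. indicat_real {\<omega> \<in> space M. real (Suc n) < \<bar>A \<omega>\<bar>} \<omega> * \<bar>A \<omega>\<bar>) \<longlonglongrightarrow> 0"
    proof (intro AE_I2 tendsto_eventually)
      fix \<omega>
      obtain n0 :: nat where n0: "\<bar>A \<omega>\<bar> \<le> real n0" using real_arch_simple by blast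
      have "indicat_real {\<omega> \<in> space M. real (Suc n) < \<bar>A \<omega>\<bar>} \<omega> * \<bar>A \<omega>\<bar> = 0" if "n0 \<le> n" for n
        using n0 that by (auto simp: indicator_def)
      then show "\<forall>\<^sub>F n in sequentially. indicat_real {\<omega> \<in> space M. real (Suc n) < \<bar>A \<omega>\<bar>} \<omega> * \<bar>A \<omega>\<bar> = 0"
        unfolding eventually_sequentially by blast
    qed
  qed (use A in \<open>auto simp: indicator_def\<close>)
  then have "(\<lambda>n. \<integral>\<omega>. indicat_real {\<omega> \<in> space M. real (Suc n) < \<bar>A \<omega>\<bar>} \<omega> * \<bar>A \<omega>\<bar> \<partial>M) \<longlonglongrightarrow> 0" by simp
  from LIMSEQ_D[OF this e] obtain n where "\<bar>\<integral>\<omega>. indicat_real {\<omega> \<in> space M. real (Suc n) < \<bar>A \<omega>\<bar>} \<omega> * \<bar>A \<omega>\<bar> \<partial>M\<bar> < e" by auto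
  then show ?thesis by (intro exI[of _ "real (Suc n)"]) auto
qed

text \<open>In the difference of the values of \<open>g\<close> the other factor \<open>A\<close> is
  merely integrable. It is split at a level \<open>R\<close>: below it the Lipschitz bound is used,
  above it the boundedness of \<open>g\<close> together with a small tail of
  \<open>A\<close>.\<close>

lemma (in prob_space) expectation_product_tendsto:
  fixes Z A W :: "'a \<Rightarrow> real" and g :: "real \<Rightarrow> real"
  assumes Zn: "\<And>n. integrable M (Zn n)" and Z: "integrable M Z" and An: "\<And>n. integrable M (An n)" and A: "integrable M A"
    and W: "W \<in> borel_measurable M" "\<And>\<omega>. \<omega> \<in> space M \<Longrightarrow> \<bar>W \<omega>\<bar> \<le> Cw"
    and g: "\<And>z. \<bar>g z\<bar> \<le> C" "\<And>z w. \<bar>g z - g w\<bar> \<le> C * \<bar>z - w\<bar>"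
    and Zl: "(\<lambda>n. \<integral>\<omega>. \<bar>Zn n \<omega> - Z \<omega>\<bar> \<partial>M) \<longlonglongrightarrow> 0" and Al: "(\<lambda>n. \<integral>\<omega>. \<bar>An n \<omega> - A \<omega>\<bar> \<partial>M) \<longlonglongrightarrow> 0"
  shows "(\<lambda>n. \<integral>\<omega>. W \<omega> * (g (Zn n \<omega>) * An n \<omega>) \<partial>M) \<longlonglongrightarrow> (\<integral>\<omega>. W \<omega> * (g (Z \<omega>) * A \<omega>) \<partial>M)"
proof (rule LIMSEQ_I)
  fix e :: real assume e: "0 < e"
  obtain \<omega>0 where "\<omega>0 \<in> space M" using not_empty by blast
  then have Cw: "0 \<le> Cw" using W(2)[of \<omega>0] by linarith
  have C: "0 \<le> C" using g(1)[of 0] by linarith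
  have [measurable]: "g \<in> borel_measurable borel" by (rule lipschitz_borel_measurable[OF g(2)])
  have [measurable]: "\<And>n. Zn n \<in> borel_measurable M" "Z \<in> borel_measurable M" "\<And>n. An n \<in> borel_measurable M" "A \<in> borel_measurable M" "W \<in> borel_measurable M"
    using Zn Z An A W by auto
  \<comment> \<open>The summand 1 keeps the divisor positive when \<open>Cw * C\<close> is
    zero.\<close>
  define K where "K = Cw * C + 1"
  have K: "0 < K" "Cw * C \<le> K" using Cw C by (auto simp: K_def intro: add_nonneg_pos)
  obtain R where R: "0 < R" "(\<integral>\<omega>. indicat_real {\<omega> \<in> space M. R < \<bar>A \<omega>\<bar>} \<omega> * \<bar>A \<omega>\<bar> \<partial>M) < e / (6 * K)"
    using tail_expectation_small[OF A, of "e / (6 * K)"] e K by auto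
  let ?T = "\<integral>\<omega>. indicat_real {\<omega> \<in> space M. R < \<bar>A \<omega>\<bar>} \<omega> * \<bar>A \<omega>\<bar> \<partial>M"
  have int: "integrable M (\<lambda>\<omega>. W \<omega> * (g (B \<omega>) * D \<omega>))" if "integrable M D" and [measurable]: "B \<in> borel_measurable M" for B D
  proof (rule Bochner_Integration.integrable_bound[of M "\<lambda>\<omega>. Cw * (C * D \<omega>)"])
    have [measurable]: "D \<in> borel_measurable M" using that by simp
    show "integrable M (\<lambda>\<omega>. Cw * (C * D \<omega>))" using that by simp
    show "(\<lambda>\<omega>. W \<omega> * (g (B \<omega>) * D \<omega>)) \<in> borel_measurable M" by measurable
    show "AE \<omega> in M. norm (W \<omega> * (g (B \<omega>) * D \<omega>)) \<le> norm (Cw * (C * D \<omega>))"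
      using W(2) g(1) C Cw by (intro AE_I2) (auto simp: abs_mult intro!: mult_mono)
  qed
  have Ti: "integrable M (\<lambda>\<omega>. indicat_real {\<omega> \<in> space M. R < \<bar>A \<omega>\<bar>} \<omega> * \<bar>A \<omega>\<bar>)"
    using integrable_real_mult_indicator[of "{\<omega> \<in> space M. R < \<bar>A \<omega>\<bar>}" M "\<lambda>\<omega>. \<bar>A \<omega>\<bar>"] A by (simp add: mult.commute)
  have est: "\<bar>(\<integral>\<omega>. W \<omega> * (g (Zn n \<omega>) * An n \<omega>) \<partial>M) - (\<integral>\<omega>. W \<omega> * (g (Z \<omega>) * A \<omega>) \<partial>M)\<bar>
     \<le> Cw * C * ((\<integral>\<omega>. \<bar>An n \<omega> - A \<omega>\<bar> \<partial>M) + R * (\<integral>\<omega>. \<bar>Zn n \<omega> - Z \<omega>\<bar> \<partial>M) + 2 * ?T)" for n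
  proof -
    have "\<bar>(\<integral>\<omega>. W \<omega> * (g (Zn n \<omega>) * An n \<omega>) \<partial>M) - (\<integral>\<omega>. W \<omega> * (g (Z \<omega>) * A \<omega>) \<partial>M)\<bar>
      = \<bar>\<integral>\<omega>. W \<omega> * (g (Zn n \<omega>) * An n \<omega>) - W \<omega> * (g (Z \<omega>) * A \<omega>) \<partial>M\<bar>"
      using int[OF An] int[OF A] by simp
    also have "\<dots> \<le> (\<integral>\<omega>. Cw * C * (\<bar>An n \<omega> - A \<omega>\<bar> + R * \<bar>Zn n \<omega> - Z \<omega>\<bar> + 2 * (indicat_real {\<omega> \<in> space M. R < \<bar>A \<omega>\<bar>} \<omega> * \<bar>A \<omega>\<bar>)) \<partial>M)"
    proof (rule order_trans[OF integral_abs_bound integral_mono])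
      show "integrable M (\<lambda>\<omega>. \<bar>W \<omega> * (g (Zn n \<omega>) * An n \<omega>) - W \<omega> * (g (Z \<omega>) * A \<omega>)\<bar>)" using int[OF An] int[OF A] by simp
      show "integrable M (\<lambda>\<omega>. Cw * C * (\<bar>An n \<omega> - A \<omega>\<bar> + R * \<bar>Zn n \<omega> - Z \<omega>\<bar> + 2 * (indicat_real {\<omega> \<in> space M. R < \<bar>A \<omega>\<bar>} \<omega> * \<bar>A \<omega>\<bar>)))"
        by (intro integrable_mult_right Bochner_Integration.integrable_add Ti integrable_abs Bochner_Integration.integrable_diff An A Zn Z)
      fix \<omega> assume \<omega>: "\<omega> \<in> space M"
      let ?i = "indicat_real {\<omega> \<in> space M. R < \<bar>A \<omega>\<bar>} \<omega>"
      have "\<bar>g (Zn n \<omega>) - g (Z \<omega>)\<bar> * \<bar>A \<omega>\<bar> \<le> C * (R * \<bar>Zn n \<omega> - Z \<omega>\<bar> + 2 * (?i * \<bar>A \<omega>\<bar>))"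
      proof (cases "R < \<bar>A \<omega>\<bar>")
        case True
        have "\<bar>g (Zn n \<omega>) - g (Z \<omega>)\<bar> \<le> 2 * C" using g(1)[of "Zn n \<omega>"] g(1)[of "Z \<omega>"] by linarith
        then have "\<bar>g (Zn n \<omega>) - g (Z \<omega>)\<bar> * \<bar>A \<omega>\<bar> \<le> (2 * C) * \<bar>A \<omega>\<bar>" by (rule mult_right_mono) simp
        also have "\<dots> \<le> C * (R * \<bar>Zn n \<omega> - Z \<omega>\<bar> + 2 * \<bar>A \<omega>\<bar>)" using C R(1) by (simp add: distrib_left)
        finally show ?thesis using True \<omega> by simp
      next
        case False
        have "\<bar>g (Zn n \<omega>) - g (Z \<omega>)\<bar> * \<bar>A \<omega>\<bar> \<le> (C * \<bar>Zn n \<omega> - Z \<omega>\<bar>) * R"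
          using False C by (intro mult_mono g) auto
        then show ?thesis using False by (simp add: mult.commute mult.left_commute)
      qed
      moreover have "\<bar>g (Zn n \<omega>)\<bar> * \<bar>An n \<omega> - A \<omega>\<bar> \<le> C * \<bar>An n \<omega> - A \<omega>\<bar>" by (intro mult_right_mono g) auto
      moreover have "g (Zn n \<omega>) * An n \<omega> - g (Z \<omega>) * A \<omega> = g (Zn n \<omega>) * (An n \<omega> - A \<omega>) + (g (Zn n \<omega>) - g (Z \<omega>)) * A \<omega>"
        by (simp add: algebra_simps)
      ultimately have "\<bar>g (Zn n \<omega>) * An n \<omega> - g (Z \<omega>) * A \<omega>\<bar> \<le> C * (\<bar>An n \<omega> - A \<omega>\<bar> + R * \<bar>Zn n \<omega> - Z \<omega>\<bar> + 2 * (?i * \<bar>A \<omega>\<bar>))"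
        using abs_triangle_ineq[of "g (Zn n \<omega>) * (An n \<omega> - A \<omega>)" "(g (Zn n \<omega>) - g (Z \<omega>)) * A \<omega>"]
        unfolding abs_mult distrib_left by linarith
      then have "\<bar>W \<omega>\<bar> * \<bar>g (Zn n \<omega>) * An n \<omega> - g (Z \<omega>) * A \<omega>\<bar> \<le> Cw * (C * (\<bar>An n \<omega> - A \<omega>\<bar> + R * \<bar>Zn n \<omega> - Z \<omega>\<bar> + 2 * (?i * \<bar>A \<omega>\<bar>)))"
        using Cw by (intro mult_mono W \<omega>) auto
      then show "\<bar>W \<omega> * (g (Zn n \<omega>) * An n \<omega>) - W \<omega> * (g (Z \<omega>) * A \<omega>)\<bar> \<le> Cw * C * (\<bar>An n \<omega> - A \<omega>\<bar> + R * \<bar>Zn n \<omega> - Z \<omega>\<bar> + 2 * (?i * \<bar>A \<omega>\<bar>))"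
        by (simp add: abs_mult[symmetric] right_diff_distrib mult.assoc)
    qed
    also have "\<dots> = Cw * C * ((\<integral>\<omega>. \<bar>An n \<omega> - A \<omega>\<bar> \<partial>M) + R * (\<integral>\<omega>. \<bar>Zn n \<omega> - Z \<omega>\<bar> \<partial>M) + 2 * ?T)"
      using An A Zn Z Ti by simp
    finally show ?thesis .
  qed
  have "(\<lambda>n. (\<integral>\<omega>. \<bar>An n \<omega> - A \<omega>\<bar> \<partial>M) + R * (\<integral>\<omega>. \<bar>Zn n \<omega> - Z \<omega>\<bar> \<partial>M)) \<longlonglongrightarrow> 0 + R * 0"
    by (intro tendsto_intros Al Zl)
  then have "(\<lambda>n. (\<integral>\<omega>. \<bar>An n \<omega> - A \<omega>\<bar> \<partial>M) + R * (\<integral>\<omega>. \<bar>Zn n \<omega> - Z \<omega>\<bar> \<partial>M)) \<longlonglongrightarrow> 0" by simp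
  from LIMSEQ_D[OF this, of "e / (2 * K)"] e K obtain N where
    N: "\<And>n. N \<le> n \<Longrightarrow> \<bar>(\<integral>\<omega>. \<bar>An n \<omega> - A \<omega>\<bar> \<partial>M) + R * (\<integral>\<omega>. \<bar>Zn n \<omega> - Z \<omega>\<bar> \<partial>M)\<bar> < e / (2 * K)" by auto
  show "\<exists>N. \<forall>n\<ge>N. norm ((\<integral>\<omega>. W \<omega> * (g (Zn n \<omega>) * An n \<omega>) \<partial>M) - (\<integral>\<omega>. W \<omega> * (g (Z \<omega>) * A \<omega>) \<partial>M)) < e"
  proof (intro exI[of _ N] allI impI)
    fix n assume "N \<le> n"
    let ?S = "(\<integral>\<omega>. \<bar>An n \<omega> - A \<omega>\<bar> \<partial>M) + R * (\<integral>\<omega>. \<bar>Zn n \<omega> - Z \<omega>\<bar> \<partial>M) + 2 * ?T"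
    have T0: "0 \<le> ?T" by (intro integral_nonneg_AE AE_I2) auto
    have S0: "0 \<le> ?S" using R(1) T0 by (intro add_nonneg_nonneg mult_nonneg_nonneg integral_nonneg_AE AE_I2) auto
    have "?S < e / (2 * K) + 2 * (e / (6 * K))" using N[OF \<open>N \<le> n\<close>] R(2) by linarith
    also have "\<dots> \<le> e / K" using e K by (simp add: field_simps)
    finally have "K * ?S < e" using K(1) by (simp add: pos_less_divide_eq mult.commute)
    moreover have "Cw * C * ?S \<le> K * ?S" by (rule mult_right_mono[OF K(2) S0])
    ultimately show "norm ((\<integral>\<omega>. W \<omega> * (g (Zn n \<omega>) * An n \<omega>) \<partial>M) - (\<integral>\<omega>. W \<omega> * (g (Z \<omega>) * A \<omega>) \<partial>M)) < e"
      using est[of n] by simp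
  qed
qed

context sbm_process
begin

section \<open>Time-dependent test functions\<close>

definition time_test :: "real \<Rightarrow> real \<Rightarrow> (real \<Rightarrow> real \<Rightarrow> real) \<Rightarrow> (real \<Rightarrow> real \<Rightarrow> real) \<Rightarrow> (real \<Rightarrow> real \<Rightarrow> real) \<Rightarrow> (real \<Rightarrow> real \<Rightarrow> real) \<Rightarrow> real \<Rightarrow> bool" where
  "time_test a b v v1 v2 vd L \<longleftrightarrow> (\<forall>s\<in>{a..b}. test_fun (v s) (v1 s) (v2 s) \<and> vd s \<in> borel_measurable borel \<and>
     (\<forall>x. ((\<lambda>s. v s x) has_real_derivative vd s x) (at s within {a..b}) \<and> \<bar>v s x\<bar> \<le> L \<and> \<bar>v2 s x\<bar> \<le> L \<and> \<bar>vd s x\<bar> \<le> L)) \<and>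
     (\<forall>x. continuous_on {a..b} (\<lambda>s. v2 s x))"

text \<open>The first summand lets the process move under a fixed test function, the second lets the
  test function move under a fixed process.\<close>

definition drift :: "('a \<Rightarrow> real) \<Rightarrow> (real \<Rightarrow> real) \<Rightarrow> (real \<Rightarrow> real) \<Rightarrow> (real \<Rightarrow> real \<Rightarrow> real) \<Rightarrow> (real \<Rightarrow> real \<Rightarrow> real) \<Rightarrow> (real \<Rightarrow> real \<Rightarrow> real) \<Rightarrow> real \<Rightarrow> real" where
  "drift W G1 G2 v v2 vd s = gen W G1 G2 s (v s) s (\<lambda>x. v2 s x / 2) (\<lambda>x. (v s x)\<^sup>2) + (\<integral>\<omega>. W \<omega> * (G1 (J s (v s) \<omega>) * J s (vd s) \<omega>) \<partial>M)"

context
  fixes v v1 v2 vd :: "real \<Rightarrow> real \<Rightarrow> real" and a b L :: real and G G1 G2 :: "real \<Rightarrow> real" and C Cw :: real and W :: "'a \<Rightarrow> real"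
  assumes ab: "0 < a" "a < b" and tt: "time_test a b v v1 v2 vd L" and T: "taylor_bdd G G1 G2 C"
    and W: "W \<in> borel_measurable (F a)" and WC: "\<And>\<omega>. \<omega> \<in> space M \<Longrightarrow> \<bar>W \<omega>\<bar> \<le> Cw"
begin

lemma tv: "s \<in> {a..b} \<Longrightarrow> test_fun (v s) (v1 s) (v2 s)"
  and dv: "s \<in> {a..b} \<Longrightarrow> ((\<lambda>s. v s x) has_real_derivative vd s x) (at s within {a..b})"
  and bv: "s \<in> {a..b} \<Longrightarrow> \<bar>v s x\<bar> \<le> L" "s \<in> {a..b} \<Longrightarrow> \<bar>v2 s x\<bar> \<le> L" "s \<in> {a..b} \<Longrightarrow> \<bar>vd s x\<bar> \<le> L"
  and cv2: "continuous_on {a..b} (\<lambda>s. v2 s x)"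
  and mvd: "s \<in> {a..b} \<Longrightarrow> vd s \<in> borel_measurable borel"
  using tt unfolding time_test_def by blast+

lemma mv: "s \<in> {a..b} \<Longrightarrow> v s \<in> borel_measurable borel" "s \<in> {a..b} \<Longrightarrow> v2 s \<in> borel_measurable borel"
  using test_fun_bdd(1,2)[OF tv] by auto

lemma L_nonneg: "0 \<le> L" using bv(1)[of a 0] ab by auto

lemma v_lipschitz: "s \<in> {a..b} \<Longrightarrow> t \<in> {a..b} \<Longrightarrow> \<bar>v s x - v t x\<bar> \<le> L * \<bar>s - t\<bar>"
  using field_differentiable_bound[of "{a..b}" "\<lambda>s. v s x" "\<lambda>s. vd s x" L s t] dv bv(3) by auto

lemma v_tendsto: "(\<And>n. q n \<in> {a..b}) \<Longrightarrow> s \<in> {a..b} \<Longrightarrow> q \<longlonglongrightarrow> s \<Longrightarrow> (\<lambda>n. v (q n) x) \<longlonglongrightarrow> v s x"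
  "(\<And>n. q n \<in> {a..b}) \<Longrightarrow> s \<in> {a..b} \<Longrightarrow> q \<longlonglongrightarrow> s \<Longrightarrow> (\<lambda>n. v2 (q n) x) \<longlonglongrightarrow> v2 s x"
proof -
  have "continuous_on {a..b} (\<lambda>s. v s x)" using dv by (intro DERIV_continuous_on)
  then show "(\<And>n. q n \<in> {a..b}) \<Longrightarrow> s \<in> {a..b} \<Longrightarrow> q \<longlonglongrightarrow> s \<Longrightarrow> (\<lambda>n. v (q n) x) \<longlonglongrightarrow> v s x"
    by (rule continuous_on_tendsto_compose) auto
  show "(\<And>n. q n \<in> {a..b}) \<Longrightarrow> s \<in> {a..b} \<Longrightarrow> q \<longlonglongrightarrow> s \<Longrightarrow> (\<lambda>n. v2 (q n) x) \<longlonglongrightarrow> v2 s x"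
    by (rule continuous_on_tendsto_compose[OF cv2]) auto
qed

lemma WM: "W \<in> borel_measurable M" by (rule F_M[OF W])

lemma Tprops: "0 \<le> C" "\<bar>G z\<bar> \<le> C" "\<bar>G1 z\<bar> \<le> C" "\<bar>G2 z / 2\<bar> \<le> C"
   "\<bar>G z - G w\<bar> \<le> C * \<bar>z - w\<bar>" "\<bar>G1 z - G1 w\<bar> \<le> C * \<bar>z - w\<bar>" "\<bar>G2 z / 2 - G2 w / 2\<bar> \<le> C * \<bar>z - w\<bar>"
  "\<bar>G (z + h) - G z - G1 z * h\<bar> \<le> 2 * C * h\<^sup>2"
proof -
  show "0 \<le> C" and 2: "\<bar>G z\<bar> \<le> C" "\<bar>G1 z\<bar> \<le> C" for z using T unfolding taylor_bdd_def by auto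
  have G2: "\<bar>G2 z\<bar> \<le> C" for z using T unfolding taylor_bdd_def by auto
  then show G2': "\<bar>G2 z / 2\<bar> \<le> C" for z using order_trans[OF _ G2[of z], of "\<bar>G2 z / 2\<bar>"] by simp
  show "\<bar>G z - G w\<bar> \<le> C * \<bar>z - w\<bar>" "\<bar>G1 z - G1 w\<bar> \<le> C * \<bar>z - w\<bar>" using T unfolding taylor_bdd_def by auto
  have "\<bar>G2 z - G2 w\<bar> \<le> C * \<bar>z - w\<bar>" using T unfolding taylor_bdd_def by auto
  then show "\<bar>G2 z / 2 - G2 w / 2\<bar> \<le> C * \<bar>z - w\<bar>" by (simp add: diff_divide_distrib[symmetric])
  have "\<bar>G (z + h) - G z - G1 z * h - G2 z / 2 * h\<^sup>2\<bar> \<le> C * h\<^sup>2" using T unfolding taylor_bdd_def by blast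
  moreover have "\<bar>G2 z / 2 * h\<^sup>2\<bar> \<le> C * h\<^sup>2" using mult_right_mono[OF G2'[of z], of "h\<^sup>2"] by (simp add: abs_mult)
  ultimately show "\<bar>G (z + h) - G z - G1 z * h\<bar> \<le> 2 * C * h\<^sup>2" by linarith
qed

lemma product_integrable:
  assumes "integrable M A" "Z \<in> borel_measurable M" "g \<in> borel_measurable borel" "\<And>z. \<bar>g z\<bar> \<le> C"
  shows "integrable M (\<lambda>\<omega>. W \<omega> * (g (Z \<omega>) * A \<omega>))"
  by (rule integrable_bdd_mult[OF integrable_bdd_mult[OF assms(1), of "\<lambda>\<omega>. g (Z \<omega>)" C] WM WC])
    (use assms in measurable)

lemma gen_split:
  assumes "0 < s" "0 < u" "\<phi> \<in> borel_measurable borel" "\<psi> \<in> borel_measurable borel" "\<And>x. \<bar>\<psi> x\<bar> \<le> B" "\<theta> \<in> borel_measurable borel" "\<And>x. \<bar>\<theta> x\<bar> \<le> B'"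
  shows "gen W G1 G2 s \<phi> u \<psi> \<theta> = (\<integral>\<omega>. W \<omega> * (G1 (J s \<phi> \<omega>) * J u \<psi> \<omega>) \<partial>M) + (\<integral>\<omega>. W \<omega> * (G2 (J s \<phi> \<omega>) / 2 * J u \<theta> \<omega>) \<partial>M)"
proof -
  note [measurable] = taylor_bdd_measurable[OF T]
  show ?thesis unfolding gen_def distrib_left
    by (intro Bochner_Integration.integral_add product_integrable[OF J_integrable[OF assms(2,4,5)] J_measurable[OF assms(1,3)]]
       product_integrable[OF J_integrable[OF assms(2,6,7)] J_measurable[OF assms(1,3)], of "\<lambda>z. G2 z / 2"] Tprops) measurable
qed

lemma v_sq: "s \<in> {a..b} \<Longrightarrow> (\<lambda>x. (v s x)\<^sup>2) \<in> borel_measurable borel" "s \<in> {a..b} \<Longrightarrow> \<bar>(v s x)\<^sup>2\<bar> \<le> L\<^sup>2"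
  "s \<in> {a..b} \<Longrightarrow> (\<lambda>x. v2 s x / 2) \<in> borel_measurable borel" "s \<in> {a..b} \<Longrightarrow> \<bar>v2 s x / 2\<bar> \<le> L"
proof -
  assume s: "s \<in> {a..b}"
  note [measurable] = mv[OF s]
  show "(\<lambda>x. (v s x)\<^sup>2) \<in> borel_measurable borel" "(\<lambda>x. v2 s x / 2) \<in> borel_measurable borel" by measurable
  show "\<bar>(v s x)\<^sup>2\<bar> \<le> L\<^sup>2" using bv(1)[OF s, of x] by (simp add: L_nonneg abs_le_square_iff[symmetric])
  show "\<bar>v2 s x / 2\<bar> \<le> L" using bv(2)[OF s, of x] L_nonneg by simp
qed

lemma gen_tendsto:
  assumes p: "\<And>n. p n \<in> {a..b}" "p \<longlonglongrightarrow> s" and u: "\<And>n. u n \<in> {a..b}" "u \<longlonglongrightarrow> s" and q: "\<And>n. q n \<in> {a..b}" "q \<longlonglongrightarrow> s" and s: "s \<in> {a..b}"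
  shows "(\<lambda>n. gen W G1 G2 (p n) (v (q n)) (u n) (\<lambda>x. v2 (q n) x / 2) (\<lambda>x. (v (q n) x)\<^sup>2)) \<longlonglongrightarrow> gen W G1 G2 s (v s) s (\<lambda>x. v2 s x / 2) (\<lambda>x. (v s x)\<^sup>2)"
proof -
  have pos: "\<And>n. 0 < p n" "\<And>n. 0 < u n" "0 < s" using p(1) u(1) s ab by (metis atLeastAtMost_iff less_le_trans)+
  note [measurable] = taylor_bdd_measurable[OF T]
  have Z: "(\<lambda>n. \<integral>\<omega>. \<bar>J (p n) (v (q n)) \<omega> - J s (v s) \<omega>\<bar> \<partial>M) \<longlonglongrightarrow> 0"
    by (rule J_tendsto_L1[OF pos(1) pos(3) p(2) mv(1)[OF q(1)] mv(1)[OF s] bv(1)[OF q(1)] bv(1)[OF s] v_tendsto(1)[OF q(1) s q(2)]])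
  have A: "(\<lambda>n. \<integral>\<omega>. \<bar>J (u n) (\<lambda>x. v2 (q n) x / 2) \<omega> - J s (\<lambda>x. v2 s x / 2) \<omega>\<bar> \<partial>M) \<longlonglongrightarrow> 0"
    by (rule J_tendsto_L1[OF pos(2) pos(3) u(2) v_sq(3)[OF q(1)] v_sq(3)[OF s] v_sq(4)[OF q(1)] v_sq(4)[OF s]])
      (intro tendsto_intros v_tendsto(2)[OF q(1) s q(2)], simp)
  have B: "(\<lambda>n. \<integral>\<omega>. \<bar>J (u n) (\<lambda>x. (v (q n) x)\<^sup>2) \<omega> - J s (\<lambda>x. (v s x)\<^sup>2) \<omega>\<bar> \<partial>M) \<longlonglongrightarrow> 0"
    by (rule J_tendsto_L1[OF pos(2) pos(3) u(2) v_sq(1)[OF q(1)] v_sq(1)[OF s] v_sq(2)[OF q(1)] v_sq(2)[OF s]])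
      (intro tendsto_intros v_tendsto(1)[OF q(1) s q(2)])
  have i: "integrable M (J (p n) (v (q n)))" "integrable M (J s (v s))" "integrable M (J (u n) (\<lambda>x. v2 (q n) x / 2))"
      "integrable M (J s (\<lambda>x. v2 s x / 2))" "integrable M (J (u n) (\<lambda>x. (v (q n) x)\<^sup>2))" "integrable M (J s (\<lambda>x. (v s x)\<^sup>2))" for n
    by (rule J_integrable[OF _ mv(1) bv(1)] J_integrable[OF _ v_sq(3,4)] J_integrable[OF _ v_sq(1,2)], (fact pos q(1) s)+)+
  have "(\<lambda>n. (\<integral>\<omega>. W \<omega> * (G1 (J (p n) (v (q n)) \<omega>) * J (u n) (\<lambda>x. v2 (q n) x / 2) \<omega>) \<partial>M)
      + (\<integral>\<omega>. W \<omega> * (G2 (J (p n) (v (q n)) \<omega>) / 2 * J (u n) (\<lambda>x. (v (q n) x)\<^sup>2) \<omega>) \<partial>M))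
    \<longlonglongrightarrow> (\<integral>\<omega>. W \<omega> * (G1 (J s (v s) \<omega>) * J s (\<lambda>x. v2 s x / 2) \<omega>) \<partial>M)
      + (\<integral>\<omega>. W \<omega> * (G2 (J s (v s) \<omega>) / 2 * J s (\<lambda>x. (v s x)\<^sup>2) \<omega>) \<partial>M)"
    by (intro tendsto_add expectation_product_tendsto[OF i(1,2,3,4) WM WC Tprops(3) Tprops(6) Z A]
       expectation_product_tendsto[OF i(1,2,5,6) WM WC Tprops(4) Tprops(7) Z B])
  then show ?thesis
    using gen_split[OF pos(1) pos(2) mv(1)[OF q(1)] v_sq(3)[OF q(1)] v_sq(4)[OF q(1)] v_sq(1)[OF q(1)] v_sq(2)[OF q(1)]]
     gen_split[OF pos(3) pos(3) mv(1)[OF s] v_sq(3)[OF s] v_sq(4)[OF s] v_sq(1)[OF s] v_sq(2)[OF s]]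
    by simp
qed

text \<open>\<open>local_ito\<close> holds the test function at a single time while the coefficients
  and the pairings range independently over the interval, so closeness is needed in three separate
  times.\<close>

lemma gen_near:
  assumes s: "s \<in> {a..b}" and e: "0 < \<epsilon>"
  shows "\<exists>\<delta>>0. \<forall>p\<in>{a..b}. \<forall>u\<in>{a..b}. \<forall>q\<in>{a..b}. \<bar>p - s\<bar> < \<delta> \<longrightarrow> \<bar>u - s\<bar> < \<delta> \<longrightarrow> \<bar>q - s\<bar> < \<delta> \<longrightarrow>
    \<bar>gen W G1 G2 p (v q) u (\<lambda>x. v2 q x / 2) (\<lambda>x. (v q x)\<^sup>2) - gen W G1 G2 s (v s) s (\<lambda>x. v2 s x / 2) (\<lambda>x. (v s x)\<^sup>2)\<bar> < \<epsilon>"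
proof (rule ccontr)
  let ?g = "\<lambda>p u q. gen W G1 G2 p (v q) u (\<lambda>x. v2 q x / 2) (\<lambda>x. (v q x)\<^sup>2)"
  assume c: "\<not> ?thesis"
  have "\<exists>p u q. p \<in> {a..b} \<and> u \<in> {a..b} \<and> q \<in> {a..b} \<and> \<bar>p - s\<bar> < inverse (real (Suc n)) \<and> \<bar>u - s\<bar> < inverse (real (Suc n)) \<and> \<bar>q - s\<bar> < inverse (real (Suc n)) \<and> \<not> \<bar>?g p u q - ?g s s s\<bar> < \<epsilon>" for n
  proof -
    have "0 < inverse (real (Suc n))" by simp
    with c show ?thesis by blast
  qed
  then obtain p u q where h: "\<And>n. p n \<in> {a..b}" "\<And>n. u n \<in> {a..b}" "\<And>n. q n \<in> {a..b}"
     "\<And>n. \<bar>p n - s\<bar> < inverse (real (Suc n))" "\<And>n. \<bar>u n - s\<bar> < inverse (real (Suc n))" "\<And>n. \<bar>q n - s\<bar> < inverse (real (Suc n))"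
     "\<And>n. \<not> \<bar>?g (p n) (u n) (q n) - ?g s s s\<bar> < \<epsilon>"
    by metis
  have lim: "f \<longlonglongrightarrow> s" if "\<And>n. \<bar>f n - s\<bar> < inverse (real (Suc n))" for f
  proof -
    have "(\<lambda>n. \<bar>f n - s\<bar>) \<longlonglongrightarrow> 0"
      by (rule tendsto_sandwich[OF always_eventually always_eventually tendsto_const LIMSEQ_inverse_real_of_nat])
        (use that in \<open>auto intro: less_imp_le\<close>)
    then show ?thesis by (simp add: tendsto_rabs_zero_iff LIM_zero_iff)
  qed
  have "(\<lambda>n. ?g (p n) (u n) (q n)) \<longlonglongrightarrow> ?g s s s"
    by (rule gen_tendsto[OF h(1) lim[OF h(4)] h(2) lim[OF h(5)] h(3) lim[OF h(6)] s])
  from LIMSEQ_D[OF this e] h(7) show False by (auto simp: real_norm_def)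
qed

text \<open>The process stays at time \<open>s\<close>. The difference quotients of \<open>v\<close>
  converge boundedly, and the second-order remainder is at most a multiple of
  \<open>(q n - s) ^ 2\<close> times the squared mass, whose mean is finite by
  \<open>mass_sq\<close>.\<close>

lemma time_derivative:
  assumes s: "s \<in> {a..b}" and q: "\<And>n. q n \<in> {a..b}" "\<And>n. q n \<noteq> s" "q \<longlonglongrightarrow> s"
  shows "(\<lambda>n. ((\<integral>\<omega>. W \<omega> * G (J s (v (q n)) \<omega>) \<partial>M) - (\<integral>\<omega>. W \<omega> * G (J s (v s) \<omega>) \<partial>M)) / (q n - s))
     \<longlonglongrightarrow> (\<integral>\<omega>. W \<omega> * (G1 (J s (v s) \<omega>) * J s (vd s) \<omega>) \<partial>M)"
proof -
  have s0: "0 < s" using s ab by auto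
  note [measurable] = taylor_bdd_measurable[OF T] mv[OF s] mvd[OF s] mv[OF q(1)] WM
  define dq where "dq n x = (v (q n) x - v s x) / (q n - s)" for n x
  have dqm[measurable]: "dq n \<in> borel_measurable borel" for n unfolding dq_def by measurable
  have dqb: "\<bar>dq n x\<bar> \<le> L" for n x
    using v_lipschitz[OF q(1) s, of n x] q(2)[of n] unfolding dq_def by (simp add: abs_divide pos_divide_le_eq)
  have dql: "(\<lambda>n. dq n x) \<longlonglongrightarrow> vd s x" for x
  proof -
    have "((\<lambda>y. (v y x - v s x) / (y - s)) \<longlongrightarrow> vd s x) (at s within {a..b})"
      using dv[OF s, of x] by (simp add: has_field_derivative_iff)
    then show ?thesis using q unfolding dq_def by (simp add: tendsto_at_iff_sequentially comp_def)
  qed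
  have A: "(\<lambda>n. \<integral>\<omega>. \<bar>J s (dq n) \<omega> - J s (vd s) \<omega>\<bar> \<partial>M) \<longlonglongrightarrow> 0"
    by (rule J_tendsto_L1[OF s0 s0 tendsto_const dqm mvd[OF s] dqb bv(3)[OF s] dql])
  have idq: "integrable M (J s (dq n))" for n by (rule J_integrable[OF s0 dqm dqb])
  have ivs: "integrable M (J s (v s))" by (rule J_integrable[OF s0 mv(1)[OF s] bv(1)[OF s]])
  have Z0: "(\<lambda>n::nat. \<integral>\<omega>. \<bar>J s (v s) \<omega> - J s (v s) \<omega>\<bar> \<partial>M) \<longlonglongrightarrow> 0" by simp
  have main: "(\<lambda>n. \<integral>\<omega>. W \<omega> * (G1 (J s (v s) \<omega>) * J s (dq n) \<omega>) \<partial>M) \<longlonglongrightarrow> (\<integral>\<omega>. W \<omega> * (G1 (J s (v s) \<omega>) * J s (vd s) \<omega>) \<partial>M)"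
    by (rule expectation_product_tendsto[OF ivs ivs idq J_integrable[OF s0 mvd[OF s] bv(3)[OF s]] WM WC Tprops(3) Tprops(6) Z0 A])
  obtain \<omega>0 where "\<omega>0 \<in> space M" using not_empty by blast
  then have Cw: "0 \<le> Cw" using WC[of \<omega>0] by linarith
  have WGi: "integrable M (\<lambda>\<omega>. W \<omega> * G (J s \<phi> \<omega>))" if [measurable]: "\<phi> \<in> borel_measurable borel" for \<phi>
  proof (rule integrable_bdd_mult[OF _ WM WC])
    have [measurable]: "J s \<phi> \<in> borel_measurable M" by (rule J_measurable[OF s0 that])
    show "integrable M (\<lambda>\<omega>. G (J s \<phi> \<omega>))"
      by (rule Bochner_Integration.integrable_bound[of M "\<lambda>_. C"]) (use Tprops(1,2) in auto)
  qed
  have W1i: "integrable M (\<lambda>\<omega>. W \<omega> * (G1 (J s (v s) \<omega>) * J s (dq n) \<omega>))" for n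
    by (rule product_integrable[OF idq J_measurable[OF s0 mv(1)[OF s]] _ Tprops(3)]) measurable
  define B where "B = Cw * (2 * C * (L\<^sup>2 * (m0\<^sup>2 + s * m0)))"
  have diff: "\<bar>((\<integral>\<omega>. W \<omega> * G (J s (v (q n)) \<omega>) \<partial>M) - (\<integral>\<omega>. W \<omega> * G (J s (v s) \<omega>) \<partial>M)) / (q n - s)
     - (\<integral>\<omega>. W \<omega> * (G1 (J s (v s) \<omega>) * J s (dq n) \<omega>) \<partial>M)\<bar> \<le> B * \<bar>q n - s\<bar>" for n
  proof -
    let ?h = "q n - s"
    have h: "?h \<noteq> 0" using q(2) by simp
    have Jq: "J s (v (q n)) \<omega> = J s (v s) \<omega> + ?h * J s (dq n) \<omega>" if \<omega>: "\<omega> \<in> space M" for \<omega>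
    proof -
      have "J s (v (q n)) \<omega> - J s (v s) \<omega> = J s (\<lambda>x. v (q n) x - v s x) \<omega>"
        by (rule J_diff[OF \<omega> s0 mv(1)[OF q(1)] bv(1)[OF q(1)] mv(1)[OF s] bv(1)[OF s], symmetric])
      also have "(\<lambda>x. v (q n) x - v s x) = (\<lambda>x. ?h * dq n x)" using h by (auto simp: dq_def)
      finally show ?thesis by (simp add: J_cmult)
    qed
    have "\<bar>(\<integral>\<omega>. W \<omega> * G (J s (v (q n)) \<omega>) \<partial>M) - (\<integral>\<omega>. W \<omega> * G (J s (v s) \<omega>) \<partial>M) - ?h * (\<integral>\<omega>. W \<omega> * (G1 (J s (v s) \<omega>) * J s (dq n) \<omega>) \<partial>M)\<bar>
      = \<bar>\<integral>\<omega>. W \<omega> * G (J s (v (q n)) \<omega>) - W \<omega> * G (J s (v s) \<omega>) - ?h * (W \<omega> * (G1 (J s (v s) \<omega>) * J s (dq n) \<omega>)) \<partial>M\<bar>"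
      using WGi[OF mv(1)[OF s]] WGi[OF mv(1)[OF q(1)]] W1i by simp
    also have "\<dots> \<le> (\<integral>\<omega>. Cw * (2 * C * (?h\<^sup>2 * (L\<^sup>2 * (mass s \<omega>)\<^sup>2))) \<partial>M)"
    proof (rule order_trans[OF integral_abs_bound integral_mono])
      show "integrable M (\<lambda>\<omega>. \<bar>W \<omega> * G (J s (v (q n)) \<omega>) - W \<omega> * G (J s (v s) \<omega>) - ?h * (W \<omega> * (G1 (J s (v s) \<omega>) * J s (dq n) \<omega>))\<bar>)"
        by (intro integrable_abs Bochner_Integration.integrable_diff integrable_mult_right WGi W1i mv(1) q(1) s)
      show "integrable M (\<lambda>\<omega>. Cw * (2 * C * (?h\<^sup>2 * (L\<^sup>2 * (mass s \<omega>)\<^sup>2))))"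
        by (intro integrable_mult_right mass_sq s0)
      fix \<omega> assume \<omega>: "\<omega> \<in> space M"
      have "W \<omega> * G (J s (v (q n)) \<omega>) - W \<omega> * G (J s (v s) \<omega>) - ?h * (W \<omega> * (G1 (J s (v s) \<omega>) * J s (dq n) \<omega>))
        = W \<omega> * (G (J s (v s) \<omega> + ?h * J s (dq n) \<omega>) - G (J s (v s) \<omega>) - G1 (J s (v s) \<omega>) * (?h * J s (dq n) \<omega>))"
        unfolding Jq[OF \<omega>] by (simp add: algebra_simps)
      then have "\<bar>W \<omega> * G (J s (v (q n)) \<omega>) - W \<omega> * G (J s (v s) \<omega>) - ?h * (W \<omega> * (G1 (J s (v s) \<omega>) * J s (dq n) \<omega>))\<bar>
        = \<bar>W \<omega>\<bar> * \<bar>G (J s (v s) \<omega> + ?h * J s (dq n) \<omega>) - G (J s (v s) \<omega>) - G1 (J s (v s) \<omega>) * (?h * J s (dq n) \<omega>)\<bar>"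
        by (simp only: abs_mult)
      moreover have "\<dots> \<le> Cw * (2 * C * (?h * J s (dq n) \<omega>)\<^sup>2)"
        by (intro mult_mono WC \<omega> Tprops(8) Cw) auto
      moreover have "Cw * (2 * C * (?h * J s (dq n) \<omega>)\<^sup>2) \<le> Cw * (2 * C * (?h\<^sup>2 * (L\<^sup>2 * (mass s \<omega>)\<^sup>2)))"
        using Tprops(1) Cw
      proof (intro mult_left_mono)
        show "(?h * J s (dq n) \<omega>)\<^sup>2 \<le> ?h\<^sup>2 * (L\<^sup>2 * (mass s \<omega>)\<^sup>2)"
      proof -
        have "(J s (dq n) \<omega>)\<^sup>2 \<le> (L * mass s \<omega>)\<^sup>2"
          using J_bound[OF \<omega> s0 dqm dqb] by (metis abs_ge_zero power2_abs power_mono)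
        then show ?thesis unfolding power_mult_distrib by (intro mult_left_mono) auto
      qed
      qed auto
      ultimately show "\<bar>W \<omega> * G (J s (v (q n)) \<omega>) - W \<omega> * G (J s (v s) \<omega>) - ?h * (W \<omega> * (G1 (J s (v s) \<omega>) * J s (dq n) \<omega>))\<bar> \<le> Cw * (2 * C * (?h\<^sup>2 * (L\<^sup>2 * (mass s \<omega>)\<^sup>2)))"
        by linarith
    qed
    also have "\<dots> = B * ?h\<^sup>2" using mass_sq[OF s0] unfolding B_def by simp
    finally have "\<bar>(\<integral>\<omega>. W \<omega> * G (J s (v (q n)) \<omega>) \<partial>M) - (\<integral>\<omega>. W \<omega> * G (J s (v s) \<omega>) \<partial>M) - ?h * (\<integral>\<omega>. W \<omega> * (G1 (J s (v s) \<omega>) * J s (dq n) \<omega>) \<partial>M)\<bar> / \<bar>?h\<bar> \<le> B * ?h\<^sup>2 / \<bar>?h\<bar>"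
      by (rule divide_right_mono) simp
    also have "B * ?h\<^sup>2 / \<bar>?h\<bar> = B * \<bar>?h\<bar>"
    proof -
      have "?h\<^sup>2 = \<bar>?h\<bar> * \<bar>?h\<bar>" by (simp only: abs_mult_self_eq power2_eq_square)
      moreover have "\<bar>?h\<bar> \<noteq> 0" using h by simp
      ultimately show ?thesis by (simp only: nonzero_mult_div_cancel_right mult.assoc[symmetric] not_False_eq_True)
    qed
    finally show ?thesis using h by (simp add: abs_divide[symmetric] diff_divide_distrib)
  qed
  have "(\<lambda>n. B * \<bar>q n - s\<bar>) \<longlonglongrightarrow> B * \<bar>s - s\<bar>" by (intro tendsto_intros q)
  then have "(\<lambda>n. B * \<bar>q n - s\<bar>) \<longlonglongrightarrow> 0" by simp
  then have "(\<lambda>n. ((\<integral>\<omega>. W \<omega> * G (J s (v (q n)) \<omega>) \<partial>M) - (\<integral>\<omega>. W \<omega> * G (J s (v s) \<omega>) \<partial>M)) / (q n - s)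
     - (\<integral>\<omega>. W \<omega> * (G1 (J s (v s) \<omega>) * J s (dq n) \<omega>) \<partial>M)) \<longlonglongrightarrow> 0"
    by (rule Lim_null_comparison[rotated]) (use diff in auto)
  from tendsto_add[OF this main] show ?thesis by simp
qed

text \<open>The increment is split at the mixed value with the process at time \<open>s\<close> and
  the test function at time \<open>q n\<close>: \<open>local_ito\<close> accounts for the motion of
  the process and \<open>time_derivative\<close> for that of the test function.\<close>

proposition expectation_has_derivative:
  assumes s: "s \<in> {a..b}"
  shows "((\<lambda>t. \<integral>\<omega>. W \<omega> * G (J t (v t) \<omega>) \<partial>M) has_real_derivative drift W G1 G2 v v2 vd s) (at s within {a..b})"
  unfolding has_field_derivative_iff tendsto_at_iff_sequentially comp_def
proof (intro allI impI)
  fix q :: "nat \<Rightarrow> real" assume "\<forall>i. q i \<in> {a..b} - {s}" and ql: "q \<longlonglongrightarrow> s"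
  then have q: "\<And>n. q n \<in> {a..b}" "\<And>n. q n \<noteq> s" by auto
  let ?m = "\<lambda>t r. \<integral>\<omega>. W \<omega> * G (J t (v r) \<omega>) \<partial>M"
  let ?g = "\<lambda>p u q. gen W G1 G2 p (v q) u (\<lambda>x. v2 q x / 2) (\<lambda>x. (v q x)\<^sup>2)"
  have "(\<lambda>n. (?m (q n) (q n) - ?m s (q n)) / (q n - s)) \<longlonglongrightarrow> ?g s s s"
  proof (rule LIMSEQ_I)
    fix e :: real assume e: "0 < e"
    obtain d where d: "0 < d" "\<And>p u r. p \<in> {a..b} \<Longrightarrow> u \<in> {a..b} \<Longrightarrow> r \<in> {a..b} \<Longrightarrow> \<bar>p - s\<bar> < d \<Longrightarrow> \<bar>u - s\<bar> < d \<Longrightarrow> \<bar>r - s\<bar> < d \<Longrightarrow> \<bar>?g p u r - ?g s s s\<bar> < e / 2"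
      using gen_near[OF s, of "e/2"] e by auto
    from LIMSEQ_D[OF ql d(1)] obtain N where N: "\<And>n. N \<le> n \<Longrightarrow> \<bar>q n - s\<bar> < d" by auto
    show "\<exists>no. \<forall>n\<ge>no. norm ((?m (q n) (q n) - ?m s (q n)) / (q n - s) - ?g s s s) < e"
    proof (intro exI[of _ N] allI impI)
      fix n assume n: "N \<le> n"
      \<comment> \<open>\<open>q n\<close> may lie on either side of \<open>s\<close>, but
        \<open>local_ito\<close> needs an ordered interval; the quotient is symmetric in the two end
        points.\<close>
      define lo hi where "lo = min s (q n)" and "hi = max s (q n)"
      have lh: "0 < lo" "lo < hi" "a \<le> lo" "hi \<le> b" using s q(1)[of n] q(2)[of n] ab unfolding lo_def hi_def by auto
      have "\<bar>?m hi (q n) - ?m lo (q n) - (hi - lo) * ?g s s s\<bar> \<le> e / 2 * (hi - lo)"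
      proof (rule local_ito[OF tv[OF q(1)] T lh(1,2) F_mono[OF lh(3) W] WC])
        fix p u assume pu: "lo \<le> p" "p \<le> u" "u \<le> hi"
        have "\<bar>p - s\<bar> < d" "\<bar>u - s\<bar> < d" using pu N[OF n] unfolding lo_def hi_def by (auto simp: min_def max_def abs_if split: if_splits)
        then show "\<bar>?g p u (q n) - ?g s s s\<bar> \<le> e / 2"
          using pu lh q(1)[of n] N[OF n] by (intro less_imp_le d(2)) auto
      qed
      moreover have "(?m (q n) (q n) - ?m s (q n)) / (q n - s) = (?m hi (q n) - ?m lo (q n)) / (hi - lo)"
        using q(2)[of n] unfolding lo_def hi_def by (auto simp: min_def max_def field_simps)
      moreover have "\<bar>(?m hi (q n) - ?m lo (q n)) / (hi - lo) - ?g s s s\<bar> = \<bar>?m hi (q n) - ?m lo (q n) - (hi - lo) * ?g s s s\<bar> / (hi - lo)"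
      proof -
        have "(?m hi (q n) - ?m lo (q n)) / (hi - lo) - ?g s s s = (?m hi (q n) - ?m lo (q n) - (hi - lo) * ?g s s s) / (hi - lo)"
          using lh(2) by (simp add: diff_divide_distrib)
        then show ?thesis using lh(2) by (simp only: abs_divide)
      qed
      ultimately have "\<bar>(?m (q n) (q n) - ?m s (q n)) / (q n - s) - ?g s s s\<bar> \<le> e / 2"
        using lh(2) by (simp add: pos_divide_le_eq)
      then show "norm ((?m (q n) (q n) - ?m s (q n)) / (q n - s) - ?g s s s) < e" using e by simp
    qed
  qed
  from tendsto_add[OF this time_derivative[OF s q ql]]
  show "(\<lambda>n. (?m (q n) (q n) - ?m s s) / (q n - s)) \<longlonglongrightarrow> drift W G1 G2 v v2 vd s"
    unfolding drift_def by (simp add: add_divide_distrib[symmetric])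
qed

end

end

section \<open>Exponential supermartingales\<close>

text \<open>The Lagrange remainder of order three gives the cubic bound, the one of order two the
  quadratic bound.\<close>

lemma taylor_bddI:
  assumes d: "\<And>z. (G has_real_derivative G1 z) (at z)" "\<And>z. (G1 has_real_derivative G2 z) (at z)" "\<And>z. (G2 has_real_derivative G3 z) (at z)"
    and b: "\<And>z. \<bar>G z\<bar> \<le> C" "\<And>z. \<bar>G1 z\<bar> \<le> C" "\<And>z. \<bar>G2 z\<bar> \<le> C" "\<And>z. \<bar>G3 z\<bar> \<le> C"
  shows "taylor_bdd G G1 G2 C"
proof -
  have C: "0 \<le> C" using b(1)[of 0] by linarith
  have lip: "\<bar>g z - g w\<bar> \<le> C * \<bar>z - w\<bar>" if "\<And>z. (g has_real_derivative g' z) (at z)" "\<And>z. \<bar>g' z\<bar> \<le> C" for g g' z w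
    using field_differentiable_bound[of UNIV g g' C z w] that by auto
  have t3: "\<bar>G (z + h) - G z - G1 z * h - G2 z / 2 * h\<^sup>2\<bar> \<le> C * (\<bar>h\<bar> * h\<^sup>2)"
    and t2: "\<bar>G (z + h) - G z - G1 z * h - G2 z / 2 * h\<^sup>2\<bar> \<le> C * h\<^sup>2" for z h
  proof -
    define D where "D = (\<lambda>n::nat. if n = 0 then G else if n = 1 then G1 else if n = 2 then G2 else G3)"
    have D: "DERIV (D m) t :> D (Suc m) t" if "m < 3" for m t
      using that d by (auto simp: D_def less_Suc_eq numeral_3_eq_3)
    have "\<bar>G (z + h) - G z - G1 z * h - G2 z / 2 * h\<^sup>2\<bar> \<le> C * (\<bar>h\<bar> * h\<^sup>2) \<and> \<bar>G (z + h) - G z - G1 z * h - G2 z / 2 * h\<^sup>2\<bar> \<le> C * h\<^sup>2"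
    proof (cases "h = 0")
      case False
      have "\<exists>t. (if z + h < z then z + h < t \<and> t < z else z < t \<and> t < z + h) \<and> G (z + h) = (\<Sum>m<3. (D m z / fact m) * (z + h - z) ^ m) + (D 3 t / fact 3) * (z + h - z) ^ 3"
        by (rule Taylor[where a = "min z (z + h)" and b = "max z (z + h)"]) (use D False in \<open>auto simp: D_def\<close>)
      then obtain t where "G (z + h) = (\<Sum>m<3. (D m z / fact m) * h ^ m) + (D 3 t / fact 3) * h ^ 3" by auto
      then have "G (z + h) - G z - G1 z * h - G2 z / 2 * h\<^sup>2 = G3 t / 6 * h ^ 3"
        by (simp add: D_def numeral_3_eq_3 fact_numeral) (simp add: fact_Suc power2_eq_square eval_nat_numeral)
      then have "\<bar>G (z + h) - G z - G1 z * h - G2 z / 2 * h\<^sup>2\<bar> = \<bar>G3 t / 6 * h ^ 3\<bar>" by (simp only:)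
      then have "\<bar>G (z + h) - G z - G1 z * h - G2 z / 2 * h\<^sup>2\<bar> = (\<bar>G3 t\<bar> / 6) * \<bar>h ^ 3\<bar>" by (simp only: abs_mult abs_divide abs_numeral)
      also have "\<dots> \<le> C * \<bar>h ^ 3\<bar>" using b(4)[of t] by (intro mult_right_mono) auto
      also have "\<bar>h ^ 3\<bar> = \<bar>h\<bar> * h\<^sup>2" by (simp add: power3_eq_cube power2_eq_square abs_mult)
      finally have 1: "\<bar>G (z + h) - G z - G1 z * h - G2 z / 2 * h\<^sup>2\<bar> \<le> C * (\<bar>h\<bar> * h\<^sup>2)" .
      have "\<exists>t. (if z + h < z then z + h < t \<and> t < z else z < t \<and> t < z + h) \<and> G (z + h) = (\<Sum>m<2. (D m z / fact m) * (z + h - z) ^ m) + (D 2 t / fact 2) * (z + h - z) ^ 2"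
        by (rule Taylor[where a = "min z (z + h)" and b = "max z (z + h)"]) (use D False in \<open>auto simp: D_def\<close>)
      then obtain t where "G (z + h) = (\<Sum>m<2. (D m z / fact m) * h ^ m) + (D 2 t / fact 2) * h ^ 2" by auto
      then have "G (z + h) - G z - G1 z * h - G2 z / 2 * h\<^sup>2 = (G2 t - G2 z) / 2 * h\<^sup>2"
        by (simp add: D_def numeral_2_eq_2) (simp add: power2_eq_square eval_nat_numeral field_simps)
      then have "\<bar>G (z + h) - G z - G1 z * h - G2 z / 2 * h\<^sup>2\<bar> = \<bar>(G2 t - G2 z) / 2 * h\<^sup>2\<bar>" by (simp only:)
      then have "\<bar>G (z + h) - G z - G1 z * h - G2 z / 2 * h\<^sup>2\<bar> = \<bar>(G2 t - G2 z) / 2\<bar> * h\<^sup>2" by (simp only: abs_mult abs_power2)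
      also have "\<dots> \<le> C * h\<^sup>2" using b(3)[of t] b(3)[of z] by (intro mult_right_mono) auto
      finally show ?thesis using 1 by blast
    qed simp
    then show "\<bar>G (z + h) - G z - G1 z * h - G2 z / 2 * h\<^sup>2\<bar> \<le> C * (\<bar>h\<bar> * h\<^sup>2)" "\<bar>G (z + h) - G z - G1 z * h - G2 z / 2 * h\<^sup>2\<bar> \<le> C * h\<^sup>2" by auto
  qed
  show ?thesis unfolding taylor_bdd_def using C b lip[OF d(1) b(2)] lip[OF d(2) b(3)] lip[OF d(3) b(4)] t2 t3 by blast
qed

text \<open>A bounded concave function of \<open>e\<^sup>z\<close>; concavity gives \<open>G'' \<le> G'\<close>, so that truncation preserves supermartingales.\<close>
definition Gu :: "real \<Rightarrow> real \<Rightarrow> real" where "Gu \<epsilon> z = 1 / (1 + \<epsilon> * exp z)"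
definition Gt :: "real \<Rightarrow> real \<Rightarrow> real" where "Gt \<epsilon> z = (1 - Gu \<epsilon> z) / \<epsilon>"
definition Gt1 :: "real \<Rightarrow> real \<Rightarrow> real" where "Gt1 \<epsilon> z = Gu \<epsilon> z * (1 - Gu \<epsilon> z) / \<epsilon>"
definition Gt2 :: "real \<Rightarrow> real \<Rightarrow> real" where "Gt2 \<epsilon> z = (2 * Gu \<epsilon> z - 1) * (Gu \<epsilon> z * (1 - Gu \<epsilon> z)) / \<epsilon>"

lemma Gu_props:
  assumes "0 < \<epsilon>"
  shows "0 < Gu \<epsilon> z" "Gu \<epsilon> z < 1" "1 - Gu \<epsilon> z = \<epsilon> * exp z * Gu \<epsilon> z"
    "(Gu \<epsilon> has_real_derivative - (Gu \<epsilon> z * (1 - Gu \<epsilon> z))) (at z)"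
proof -
  have pos: "0 < 1 + \<epsilon> * exp z" "0 < \<epsilon> * exp z" using assms by (simp_all add: add_pos_pos)
  then show "0 < Gu \<epsilon> z" "Gu \<epsilon> z < 1" unfolding Gu_def by simp_all
  show eq: "1 - Gu \<epsilon> z = \<epsilon> * exp z * Gu \<epsilon> z"
  proof -
    have "1 + \<epsilon> * exp z \<noteq> 0" using pos(1) by linarith
    then show ?thesis unfolding Gu_def using assms by (simp add: divide_simps)
  qed
  have "(Gu \<epsilon> has_real_derivative - (\<epsilon> * exp z) / (1 + \<epsilon> * exp z)\<^sup>2) (at z)"
    unfolding Gu_def[abs_def] using pos(1) by (auto intro!: derivative_eq_intros simp: power2_eq_square)
  moreover have "- (\<epsilon> * exp z) / (1 + \<epsilon> * exp z)\<^sup>2 = - (Gu \<epsilon> z * (1 - Gu \<epsilon> z))"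
    unfolding eq unfolding Gu_def by (simp add: power2_eq_square)
  ultimately show "(Gu \<epsilon> has_real_derivative - (Gu \<epsilon> z * (1 - Gu \<epsilon> z))) (at z)" by simp
qed

text \<open>\<open>u = Gu \<epsilon> z\<close> solves the logistic equation
  \<open>u' = - u * (1 - u)\<close>, so every derivative of \<open>Gt\<close> is a polynomial in
  \<open>u\<close> with the factor \<open>u * (1 - u)\<close>, which lies between 0 and 1/4.\<close>

lemma Gt_taylor:
  assumes e: "0 < \<epsilon>"
  shows "taylor_bdd (Gt \<epsilon>) (Gt1 \<epsilon>) (Gt2 \<epsilon>) (1 / \<epsilon>)"
proof (rule taylor_bddI)
  fix z
  note d = Gu_props(4)[OF e]
  define u where "u = Gu \<epsilon> z"
  have u: "0 < u" "u < 1" using Gu_props[OF e, of z] by (auto simp: u_def)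
  show "(Gt \<epsilon> has_real_derivative Gt1 \<epsilon> z) (at z)"
    unfolding Gt_def[abs_def] Gt1_def by (rule DERIV_cdivide) (auto intro!: derivative_eq_intros d)
  show "(Gt1 \<epsilon> has_real_derivative Gt2 \<epsilon> z) (at z)"
    unfolding Gt1_def[abs_def] Gt2_def by (rule DERIV_cdivide) (auto intro!: derivative_eq_intros d simp: algebra_simps)
  show "(Gt2 \<epsilon> has_real_derivative (1 - 6 * Gu \<epsilon> z + 6 * (Gu \<epsilon> z)\<^sup>2) * (Gu \<epsilon> z * (1 - Gu \<epsilon> z)) / \<epsilon>) (at z)"
    unfolding Gt2_def[abs_def] by (rule DERIV_cdivide) (auto intro!: derivative_eq_intros d simp: algebra_simps power2_eq_square)
  have q: "0 \<le> u * (1 - u)" "u * (1 - u) \<le> 1 / 4"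
  proof -
    show "0 \<le> u * (1 - u)" using u by simp
    have "0 \<le> (u - 1 / 2)\<^sup>2" by simp
    then show "u * (1 - u) \<le> 1 / 4" by (simp add: power2_eq_square algebra_simps)
  qed
  have a: "\<bar>k * (u * (1 - u)) / \<epsilon>\<bar> \<le> 1 / \<epsilon>" if "\<bar>k\<bar> \<le> 1" for k
  proof -
    have "\<bar>k * (u * (1 - u))\<bar> \<le> 1 * 1" unfolding abs_mult[of k] using that q by (intro mult_mono) auto
    then show ?thesis using e by (simp add: abs_divide divide_right_mono)
  qed
  show "\<bar>Gt \<epsilon> z\<bar> \<le> 1 / \<epsilon>" using u e unfolding Gt_def u_def[symmetric] by (simp add: divide_right_mono)
  show "\<bar>Gt1 \<epsilon> z\<bar> \<le> 1 / \<epsilon>" using a[of 1] unfolding Gt1_def u_def[symmetric] by simp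
  show "\<bar>Gt2 \<epsilon> z\<bar> \<le> 1 / \<epsilon>" using a[of "2 * u - 1"] u unfolding Gt2_def u_def[symmetric] by (simp add: abs_le_iff)
  have "1 - 6 * u + 6 * u\<^sup>2 = 1 - 6 * (u * (1 - u))" by (simp add: power2_eq_square algebra_simps)
  then have "\<bar>1 - 6 * u + 6 * u\<^sup>2\<bar> \<le> 1" using q by linarith
  from a[OF this] show "\<bar>(1 - 6 * Gu \<epsilon> z + 6 * (Gu \<epsilon> z)\<^sup>2) * (Gu \<epsilon> z * (1 - Gu \<epsilon> z)) / \<epsilon>\<bar> \<le> 1 / \<epsilon>"
    unfolding u_def .
qed

text \<open>\<open>Gt1 - Gt2 = 2 * u * (1 - u) ^ 2 / \<epsilon>\<close> measures what truncation
  costs. Its sign is the right one for supermartingales; for submartingales it must be small, and it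
  is at most \<open>2 * \<epsilon>\<close> on the half-line \<open>z \<le> 0\<close>, where
  \<open>1 - u \<le> \<epsilon>\<close>.\<close>

lemma Gt_props:
  assumes e: "0 < \<epsilon>"
  shows "0 \<le> Gt \<epsilon> z" "Gt \<epsilon> z \<le> exp z" "0 \<le> Gt1 \<epsilon> z" "Gt2 \<epsilon> z \<le> Gt1 \<epsilon> z"
    "z \<le> 0 \<Longrightarrow> (Gt1 \<epsilon> z - Gt2 \<epsilon> z) / 2 \<le> \<epsilon>" "Gt \<epsilon> z = exp z / (1 + \<epsilon> * exp z)"
proof -
  define u where "u = Gu \<epsilon> z"
  have u: "0 < u" "u < 1" "1 - u = \<epsilon> * exp z * u" using Gu_props[OF e, of z] by (auto simp: u_def)
  have G: "Gt \<epsilon> z = exp z * u" unfolding Gt_def u_def[symmetric] u(3) using e by simp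
  show "0 \<le> Gt \<epsilon> z" "Gt \<epsilon> z \<le> exp z" unfolding G using u by auto
  show "Gt \<epsilon> z = exp z / (1 + \<epsilon> * exp z)" unfolding G u_def Gu_def by simp
  show "0 \<le> Gt1 \<epsilon> z" using u e unfolding Gt1_def u_def[symmetric] by simp
  have eq: "Gt1 \<epsilon> z - Gt2 \<epsilon> z = 2 * (u * (1 - u)\<^sup>2 / \<epsilon>)"
    unfolding Gt1_def Gt2_def u_def[symmetric] by (simp add: diff_divide_distrib[symmetric]) (simp add: power2_eq_square algebra_simps)
  have "0 \<le> u * (1 - u)\<^sup>2 / \<epsilon>" using u e by simp
  then show "Gt2 \<epsilon> z \<le> Gt1 \<epsilon> z" using eq by linarith
  show "(Gt1 \<epsilon> z - Gt2 \<epsilon> z) / 2 \<le> \<epsilon>" if z: "z \<le> 0"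
  proof -
    have "exp z * u \<le> 1 * 1" using z u by (intro mult_mono) auto
    then have "1 - u \<le> \<epsilon>" unfolding u(3) using e by (simp add: mult.assoc mult_left_le)
    then have "u * (1 - u)\<^sup>2 \<le> 1 * \<epsilon>\<^sup>2" using u by (intro mult_mono power_mono) auto
    then show ?thesis unfolding eq using e by (simp add: pos_divide_le_eq power2_eq_square)
  qed
qed

context sbm_process
begin

text \<open>For the exponential itself \<open>G1 = G2\<close> and the second term would vanish. The
  rearrangement separates the differential inequality for \<open>v\<close> from the loss caused by
  truncating the exponential.\<close>

lemma drift_eq:
  assumes ab: "0 < a" "a < b" and tt: "time_test a b v v1 v2 vd L" and T: "taylor_bdd G G1 G2 C"
    and W: "W \<in> borel_measurable (F a)" and WC: "\<And>\<omega>. \<omega> \<in> space M \<Longrightarrow> \<bar>W \<omega>\<bar> \<le> Cw" and s: "s \<in> {a..b}"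
  shows "drift W G1 G2 v v2 vd s = (\<integral>\<omega>. W \<omega> * (G1 (J s (v s) \<omega>) * J s (\<lambda>x. vd s x + v2 s x / 2 + (v s x)\<^sup>2 / 2) \<omega>
      - (G1 (J s (v s) \<omega>) - G2 (J s (v s) \<omega>)) / 2 * J s (\<lambda>x. (v s x)\<^sup>2) \<omega>) \<partial>M)"
proof -
  note cx = ab tt T W WC
  have s0: "0 < s" using s ab by auto
  note m[measurable] = mv[OF cx s] mvd[OF cx s] v_sq(1,3)[OF cx s] taylor_bdd_measurable[OF T]
  note b = bv[OF cx s] v_sq(2,4)[OF cx s]
  have b2: "\<bar>(v s x)\<^sup>2 / 2\<bar> \<le> L\<^sup>2" for x
  proof -
    have "0 \<le> (v s x)\<^sup>2" by simp
    then show ?thesis using b(4)[of x] unfolding abs_le_iff by linarith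
  qed
  have b3: "\<bar>vd s x + v2 s x / 2\<bar> \<le> L + L" for x by (rule order_trans[OF abs_triangle_ineq add_mono[OF b(3) b(5)]])
  have mm: "(\<lambda>x. vd s x + v2 s x / 2) \<in> borel_measurable borel" "(\<lambda>x. (v s x)\<^sup>2 / 2) \<in> borel_measurable borel"
    using m(3,4,5) by measurable
  have i1: "integrable M (\<lambda>\<omega>. W \<omega> * (G1 (J s (v s) \<omega>) * J s (\<lambda>x. v2 s x / 2) \<omega> + G2 (J s (v s) \<omega>) / 2 * J s (\<lambda>x. (v s x)\<^sup>2) \<omega>))"
    unfolding distrib_left
    by (intro Bochner_Integration.integrable_add product_integrable[OF cx J_integrable[OF s0 m(5) b(5)] J_measurable[OF s0 m(1)]]
       product_integrable[OF cx J_integrable[OF s0 m(4) b(4)] J_measurable[OF s0 m(1)], of "\<lambda>z. G2 z / 2"] Tprops[OF cx]) measurable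
  have i2: "integrable M (\<lambda>\<omega>. W \<omega> * (G1 (J s (v s) \<omega>) * J s (vd s) \<omega>))"
    by (intro product_integrable[OF cx J_integrable[OF s0 m(3) b(3)] J_measurable[OF s0 m(1)]] Tprops[OF cx]) measurable
  show ?thesis unfolding drift_def gen_def Bochner_Integration.integral_add[OF i1 i2, symmetric]
  proof (rule Bochner_Integration.integral_cong[OF refl])
    fix \<omega> assume \<omega>: "\<omega> \<in> space M"
    have "J s (\<lambda>x. (v s x)\<^sup>2 / 2) \<omega> = J s (\<lambda>x. (v s x)\<^sup>2) \<omega> / 2" using J_cmult[of \<omega> s "1/2" "\<lambda>x. (v s x)\<^sup>2"] by simp
    moreover have "J s (\<lambda>x. vd s x + v2 s x / 2) \<omega> = J s (vd s) \<omega> + J s (\<lambda>x. v2 s x / 2) \<omega>"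
      by (rule J_add[OF \<omega> s0 m(3) b(3) m(5) b(5)])
    moreover have "J s (\<lambda>x. (vd s x + v2 s x / 2) + (v s x)\<^sup>2 / 2) \<omega> = J s (\<lambda>x. vd s x + v2 s x / 2) \<omega> + J s (\<lambda>x. (v s x)\<^sup>2 / 2) \<omega>"
      by (rule J_add[OF \<omega> s0 mm(1) b3 mm(2) b2])
    ultimately have tot: "J s (\<lambda>x. vd s x + v2 s x / 2 + (v s x)\<^sup>2 / 2) \<omega> = J s (vd s) \<omega> + J s (\<lambda>x. v2 s x / 2) \<omega> + J s (\<lambda>x. (v s x)\<^sup>2) \<omega> / 2"
      by simp
    have "w * (g * A + h / 2 * B) + w * (g * D) = w * (g * (D + A + B / 2) - (g - h) / 2 * B)" for w g h A B D :: real
      by (simp add: field_simps)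
    then show "W \<omega> * (G1 (J s (v s) \<omega>) * J s (\<lambda>x. v2 s x / 2) \<omega> + G2 (J s (v s) \<omega>) / 2 * J s (\<lambda>x. (v s x)\<^sup>2) \<omega>) + W \<omega> * (G1 (J s (v s) \<omega>) * J s (vd s) \<omega>)
      = W \<omega> * (G1 (J s (v s) \<omega>) * J s (\<lambda>x. vd s x + v2 s x / 2 + (v s x)\<^sup>2 / 2) \<omega> - (G1 (J s (v s) \<omega>) - G2 (J s (v s) \<omega>)) / 2 * J s (\<lambda>x. (v s x)\<^sup>2) \<omega>)"
      unfolding tot .
  qed
qed

lemma G_expectation_mono:
  assumes ab: "0 < a" "a < b" and tt: "time_test a b v v1 v2 vd L" and T: "taylor_bdd G G1 G2 C"
    and W: "W \<in> borel_measurable (F a)" and WC: "\<And>\<omega>. \<omega> \<in> space M \<Longrightarrow> \<bar>W \<omega>\<bar> \<le> Cw"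
    and d: "\<And>s. s \<in> {a..b} \<Longrightarrow> drift W G1 G2 v v2 vd s \<le> K"
  shows "(\<integral>\<omega>. W \<omega> * G (J b (v b) \<omega>) \<partial>M) \<le> (\<integral>\<omega>. W \<omega> * G (J a (v a) \<omega>) \<partial>M) + K * (b - a)"
proof -
  let ?m = "\<lambda>t. (\<integral>\<omega>. W \<omega> * G (J t (v t) \<omega>) \<partial>M) - K * t"
  have D: "(?m has_real_derivative drift W G1 G2 v v2 vd s - K) (at s within {a..b})" if "s \<in> {a..b}" for s
    by (auto intro!: derivative_eq_intros expectation_has_derivative[OF ab tt T W WC that])
  have "?m b \<le> ?m a"
  proof (rule DERIV_nonpos_imp_decreasing_open[of a b ?m])
    show "a \<le> b" using ab by simp
    show "\<exists>y. (?m has_real_derivative y) (at x) \<and> y \<le> 0" if "a < x" "x < b" for x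
      using D[of x] d[of x] that by (intro exI[of _ "drift W G1 G2 v v2 vd x - K"]) (auto simp: at_within_Icc_at)
    show "continuous_on {a..b} ?m" by (rule DERIV_continuous_on) (rule D)
  qed
  then show ?thesis by (simp add: algebra_simps)
qed

text \<open>Exponential moments may be infinite, hence the nonnegative integrals. The weight is cut
  at \<open>n\<close> and \<open>exp\<close> replaced by the bounded \<open>Gt\<close>, for which
  both terms of \<open>drift_eq\<close> have a favourable sign. Fatou's lemma restores the left-hand
  side, and \<open>Gt \<le> exp\<close> suffices on the right.\<close>

proposition exp_supermartingale:
  assumes ab: "0 < a" "a < b" and tt: "time_test a b v v1 v2 vd L"
    and H: "\<And>s x. s \<in> {a..b} \<Longrightarrow> vd s x + v2 s x / 2 + (v s x)\<^sup>2 / 2 \<le> 0"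
    and W: "W \<in> borel_measurable (F a)" and W0: "\<And>\<omega>. \<omega> \<in> space M \<Longrightarrow> 0 \<le> W \<omega>"
  shows "(\<integral>\<^sup>+\<omega>. ennreal (W \<omega> * exp (J b (v b) \<omega>)) \<partial>M) \<le> (\<integral>\<^sup>+\<omega>. ennreal (W \<omega> * exp (J a (v a) \<omega>)) \<partial>M)"
proof -
  define Wn where "Wn n \<omega> = min (W \<omega>) (real n)" for n \<omega>
  define e where "e n = inverse (real (Suc n))" for n
  have e: "0 < e n" for n by (simp add: e_def)
  have WnF: "Wn n \<in> borel_measurable (F a)" for n unfolding Wn_def using W by measurable
  have Wnb: "\<bar>Wn n \<omega>\<bar> \<le> real n" "0 \<le> Wn n \<omega>" "Wn n \<omega> \<le> W \<omega>" if "\<omega> \<in> space M" for n \<omega>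
    using W0[OF that] unfolding Wn_def by auto
  have b0: "0 < b" using ab by simp
  note cx = ab tt Gt_taylor[OF e] WnF Wnb(1)
  have mab: "a \<in> {a..b}" "b \<in> {a..b}" using ab by auto
  have [measurable]: "J t (v t) \<in> borel_measurable M" if "t \<in> {a..b}" for t
    by (rule J_measurable[OF _ mv(1)[OF cx that]]) (use that ab in auto)
  note [measurable] = this[OF mab(1)] this[OF mab(2)] F_M[OF WnF] F_M[OF W] taylor_bdd_measurable[OF Gt_taylor[OF e]]
  have Gb: "\<bar>Gt (e n) z\<bar> \<le> \<bar>1 / e n\<bar>" for n z
    using Gt_taylor[OF e[of n]] unfolding taylor_bdd_def by (meson abs_ge_self order_trans)
  have step: "(\<integral>\<^sup>+\<omega>. ennreal (Wn n \<omega> * Gt (e n) (J b (v b) \<omega>)) \<partial>M) \<le> (\<integral>\<^sup>+\<omega>. ennreal (W \<omega> * exp (J a (v a) \<omega>)) \<partial>M)" for n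
  proof -
    have dr: "drift (Wn n) (Gt1 (e n)) (Gt2 (e n)) v v2 vd s \<le> 0" if s: "s \<in> {a..b}" for s
    proof -
      have s0: "0 < s" using s ab by auto
      have "0 \<le> (\<integral>\<omega>. - (Wn n \<omega> * (Gt1 (e n) (J s (v s) \<omega>) * J s (\<lambda>x. vd s x + v2 s x / 2 + (v s x)\<^sup>2 / 2) \<omega>
        - (Gt1 (e n) (J s (v s) \<omega>) - Gt2 (e n) (J s (v s) \<omega>)) / 2 * J s (\<lambda>x. (v s x)\<^sup>2) \<omega>)) \<partial>M)"
      proof (intro integral_nonneg_AE AE_I2)
        fix \<omega> assume \<omega>: "\<omega> \<in> space M"
        let ?z = "J s (v s) \<omega>"
        have "0 \<le> J s (\<lambda>x. - 1 * (vd s x + v2 s x / 2 + (v s x)\<^sup>2 / 2)) \<omega>"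
        proof (rule J_nonneg[OF \<omega> s0])
          fix x show "0 \<le> - 1 * (vd s x + v2 s x / 2 + (v s x)\<^sup>2 / 2)" using H[OF s, of x] by (simp only: mult_minus1 neg_0_le_iff_le)
        qed
        then have "J s (\<lambda>x. vd s x + v2 s x / 2 + (v s x)\<^sup>2 / 2) \<omega> \<le> 0" unfolding J_cmult by simp
        then have "Gt1 (e n) ?z * J s (\<lambda>x. vd s x + v2 s x / 2 + (v s x)\<^sup>2 / 2) \<omega> \<le> 0"
          using Gt_props(3)[OF e] by (simp add: mult_nonneg_nonpos)
        moreover have "0 \<le> (Gt1 (e n) ?z - Gt2 (e n) ?z) / 2 * J s (\<lambda>x. (v s x)\<^sup>2) \<omega>"
          using Gt_props(4)[OF e, of n ?z] J_nonneg[OF \<omega> s0, of "\<lambda>x. (v s x)\<^sup>2"] by (intro mult_nonneg_nonneg) auto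
        ultimately show "0 \<le> - (Wn n \<omega> * (Gt1 (e n) ?z * J s (\<lambda>x. vd s x + v2 s x / 2 + (v s x)\<^sup>2 / 2) \<omega>
           - (Gt1 (e n) ?z - Gt2 (e n) ?z) / 2 * J s (\<lambda>x. (v s x)\<^sup>2) \<omega>))"
          using Wnb(2)[OF \<omega>, of n] by (simp add: mult_nonneg_nonpos)
      qed
      moreover have "drift (Wn n) (Gt1 (e n)) (Gt2 (e n)) v v2 vd s = (\<integral>\<omega>. Wn n \<omega> * (Gt1 (e n) (J s (v s) \<omega>) * J s (\<lambda>x. vd s x + v2 s x / 2 + (v s x)\<^sup>2 / 2) \<omega>
        - (Gt1 (e n) (J s (v s) \<omega>) - Gt2 (e n) (J s (v s) \<omega>)) / 2 * J s (\<lambda>x. (v s x)\<^sup>2) \<omega>) \<partial>M)"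
        by (rule drift_eq[OF cx s])
      ultimately show ?thesis by simp
    qed
    have "(\<integral>\<omega>. Wn n \<omega> * Gt (e n) (J b (v b) \<omega>) \<partial>M) \<le> (\<integral>\<omega>. Wn n \<omega> * Gt (e n) (J a (v a) \<omega>) \<partial>M)"
      using G_expectation_mono[OF cx dr] by simp
    moreover have i: "integrable M (\<lambda>\<omega>. Wn n \<omega> * Gt (e n) (J t (v t) \<omega>))" if "t \<in> {a, b}" for t
    proof (rule integrable_bdd_mult[OF _ F_M[OF WnF] Wnb(1)])
      show "integrable M (\<lambda>\<omega>. Gt (e n) (J t (v t) \<omega>))"
        by (rule Bochner_Integration.integrable_bound[of M "\<lambda>_. 1 / e n"]) (use that Gb in auto)
    qed
    ultimately have "(\<integral>\<^sup>+\<omega>. ennreal (Wn n \<omega> * Gt (e n) (J b (v b) \<omega>)) \<partial>M) \<le> (\<integral>\<^sup>+\<omega>. ennreal (Wn n \<omega> * Gt (e n) (J a (v a) \<omega>)) \<partial>M)"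
      using Wnb(2) Gt_props(1)[OF e] by (subst (1 2) nn_integral_eq_integral) (auto intro!: AE_I2 ennreal_leI)
    also have "\<dots> \<le> (\<integral>\<^sup>+\<omega>. ennreal (W \<omega> * exp (J a (v a) \<omega>)) \<partial>M)"
      using Wnb W0 Gt_props(1,2)[OF e] by (intro nn_integral_mono ennreal_leI mult_mono) auto
    finally show ?thesis .
  qed
  have lim: "(\<lambda>n. ennreal (Wn n \<omega> * Gt (e n) (J b (v b) \<omega>))) \<longlonglongrightarrow> ennreal (W \<omega> * exp (J b (v b) \<omega>))" for \<omega>
  proof (rule tendsto_ennrealI, rule tendsto_mult)
    obtain n0 :: nat where "W \<omega> \<le> real n0" using real_arch_simple by blast
    then have "\<And>n. n0 \<le> n \<Longrightarrow> Wn n \<omega> = W \<omega>" unfolding Wn_def by simp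
    then show "(\<lambda>n. Wn n \<omega>) \<longlonglongrightarrow> W \<omega>" by (intro tendsto_eventually) (auto simp: eventually_sequentially)
    have "(\<lambda>n. exp (J b (v b) \<omega>) / (1 + e n * exp (J b (v b) \<omega>))) \<longlonglongrightarrow> exp (J b (v b) \<omega>) / (1 + 0 * exp (J b (v b) \<omega>))"
      unfolding e_def by (intro tendsto_intros LIMSEQ_inverse_real_of_nat) simp
    then show "(\<lambda>n. Gt (e n) (J b (v b) \<omega>)) \<longlonglongrightarrow> exp (J b (v b) \<omega>)" by (simp add: Gt_props(6)[OF e])
  qed
  have "(\<integral>\<^sup>+\<omega>. ennreal (W \<omega> * exp (J b (v b) \<omega>)) \<partial>M) = (\<integral>\<^sup>+\<omega>. liminf (\<lambda>n. ennreal (Wn n \<omega> * Gt (e n) (J b (v b) \<omega>))) \<partial>M)"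
    by (intro nn_integral_cong lim_imp_Liminf[symmetric] lim) auto
  also have "\<dots> \<le> liminf (\<lambda>n. \<integral>\<^sup>+\<omega>. ennreal (Wn n \<omega> * Gt (e n) (J b (v b) \<omega>)) \<partial>M)" by (rule nn_integral_liminf) measurable
  also have "\<dots> \<le> (\<integral>\<^sup>+\<omega>. ennreal (W \<omega> * exp (J a (v a) \<omega>)) \<partial>M)"
    by (rule Liminf_le) (use step in \<open>auto intro: always_eventually\<close>)
  finally show ?thesis .
qed

text \<open>Here the truncation loss has the wrong sign. Since \<open>v \<le> 0\<close> keeps the
  exponent nonpositive, the loss is at most \<open>\<epsilon>\<close> times a multiple of the mass
  and disappears in the limit.\<close>

proposition exp_submartingale:
  assumes ab: "0 < a" "a < b" and tt: "time_test a b v v1 v2 vd L"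
    and H: "\<And>s x. s \<in> {a..b} \<Longrightarrow> 0 \<le> vd s x + v2 s x / 2 + (v s x)\<^sup>2 / 2"
    and v0: "\<And>s x. s \<in> {a..b} \<Longrightarrow> v s x \<le> 0"
  shows "(\<integral>\<omega>. exp (J a (v a) \<omega>) \<partial>M) \<le> (\<integral>\<omega>. exp (J b (v b) \<omega>) \<partial>M)"
proof (rule LIMSEQ_le_const)
  define e where "e n = inverse (real (Suc n))" for n
  have e: "0 < e n" for n by (simp add: e_def)
  have "(\<lambda>n. (\<integral>\<omega>. exp (J b (v b) \<omega>) \<partial>M) + e n * (L\<^sup>2 * m0) * (b - a) + e n) \<longlonglongrightarrow> (\<integral>\<omega>. exp (J b (v b) \<omega>) \<partial>M) + 0 * (L\<^sup>2 * m0) * (b - a) + 0"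
    unfolding e_def by (intro tendsto_intros LIMSEQ_inverse_real_of_nat)
  then show "(\<lambda>n. (\<integral>\<omega>. exp (J b (v b) \<omega>) \<partial>M) + e n * (L\<^sup>2 * m0) * (b - a) + e n) \<longlonglongrightarrow> (\<integral>\<omega>. exp (J b (v b) \<omega>) \<partial>M)" by simp
  have "(\<integral>\<omega>. exp (J a (v a) \<omega>) \<partial>M) \<le> (\<integral>\<omega>. exp (J b (v b) \<omega>) \<partial>M) + e n * (L\<^sup>2 * m0) * (b - a) + e n" for n
  proof -
    define \<epsilon> where "\<epsilon> = e n"
    have \<epsilon>: "0 < \<epsilon>" using e by (simp add: \<epsilon>_def)
    \<comment> \<open>The weight -1 reverses the inequality, so that the upper bound
      \<open>G_expectation_mono\<close> yields a lower bound.\<close>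
    define W :: "'a \<Rightarrow> real" where "W = (\<lambda>_. - 1)"
    have W: "W \<in> borel_measurable (F a)" "\<And>\<omega>. \<omega> \<in> space M \<Longrightarrow> \<bar>W \<omega>\<bar> \<le> 1" by (auto simp: W_def)
    note cx = ab tt Gt_taylor[OF \<epsilon>] W
    have Jn: "J s (v s) \<omega> \<le> 0" if s: "s \<in> {a..b}" and \<omega>: "\<omega> \<in> space M" for s \<omega>
    proof -
      have s0: "0 < s" using s ab by auto
      have "0 \<le> J s (\<lambda>x. - 1 * v s x) \<omega>" by (rule J_nonneg[OF \<omega> s0]) (use v0[OF s] in auto)
      then show ?thesis unfolding J_cmult by simp
    qed
    have mab: "a \<in> {a..b}" "b \<in> {a..b}" using ab by auto
    have [measurable]: "J t (v t) \<in> borel_measurable M" if "t \<in> {a..b}" for t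
      by (rule J_measurable[OF _ mv(1)[OF cx that]]) (use that ab in auto)
    note [measurable] = this[OF mab(1)] this[OF mab(2)] taylor_bdd_measurable[OF Gt_taylor[OF \<epsilon>]]
    have dr: "drift W (Gt1 \<epsilon>) (Gt2 \<epsilon>) v v2 vd s \<le> \<epsilon> * (L\<^sup>2 * m0)" if s: "s \<in> {a..b}" for s
    proof -
      have s0: "0 < s" using s ab by auto
      have "0 \<le> (\<integral>\<omega>. \<epsilon> * (L\<^sup>2 * mass s \<omega>) - W \<omega> * (Gt1 \<epsilon> (J s (v s) \<omega>) * J s (\<lambda>x. vd s x + v2 s x / 2 + (v s x)\<^sup>2 / 2) \<omega>
        - (Gt1 \<epsilon> (J s (v s) \<omega>) - Gt2 \<epsilon> (J s (v s) \<omega>)) / 2 * J s (\<lambda>x. (v s x)\<^sup>2) \<omega>) \<partial>M)"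
      proof (intro integral_nonneg_AE AE_I2)
        fix \<omega> assume \<omega>: "\<omega> \<in> space M"
        let ?z = "J s (v s) \<omega>"
        have "0 \<le> J s (\<lambda>x. vd s x + v2 s x / 2 + (v s x)\<^sup>2 / 2) \<omega>"
          by (rule J_nonneg[OF \<omega> s0]) (use H[OF s] in auto)
        then have "0 \<le> Gt1 \<epsilon> ?z * J s (\<lambda>x. vd s x + v2 s x / 2 + (v s x)\<^sup>2 / 2) \<omega>"
          using Gt_props(3)[OF \<epsilon>] by simp
        moreover have "(Gt1 \<epsilon> ?z - Gt2 \<epsilon> ?z) / 2 * J s (\<lambda>x. (v s x)\<^sup>2) \<omega> \<le> \<epsilon> * (L\<^sup>2 * mass s \<omega>)"
        proof (rule mult_mono)
          show "(Gt1 \<epsilon> ?z - Gt2 \<epsilon> ?z) / 2 \<le> \<epsilon>" by (rule Gt_props(5)[OF \<epsilon> Jn[OF s \<omega>]])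
          show "J s (\<lambda>x. (v s x)\<^sup>2) \<omega> \<le> L\<^sup>2 * mass s \<omega>"
            using J_bound[OF \<omega> s0 v_sq(1)[OF cx s] v_sq(2)[OF cx s]] by simp
          show "0 \<le> J s (\<lambda>x. (v s x)\<^sup>2) \<omega>" by (rule J_nonneg[OF \<omega> s0]) simp
        qed (use \<epsilon> in simp)
        ultimately show "0 \<le> \<epsilon> * (L\<^sup>2 * mass s \<omega>) - W \<omega> * (Gt1 \<epsilon> ?z * J s (\<lambda>x. vd s x + v2 s x / 2 + (v s x)\<^sup>2 / 2) \<omega>
           - (Gt1 \<epsilon> ?z - Gt2 \<epsilon> ?z) / 2 * J s (\<lambda>x. (v s x)\<^sup>2) \<omega>)" by (simp add: W_def)
      qed
      also have "\<dots> = \<epsilon> * (L\<^sup>2 * m0) - drift W (Gt1 \<epsilon>) (Gt2 \<epsilon>) v v2 vd s"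
      proof -
        note m[measurable] = mv[OF cx s] mvd[OF cx s] v_sq(1,3)[OF cx s]
        note b = bv[OF cx s] v_sq(2,4)[OF cx s]
        have bb: "\<bar>vd s x + v2 s x / 2 + (v s x)\<^sup>2 / 2\<bar> \<le> L + L + L\<^sup>2" for x
        proof -
          have "0 \<le> (v s x)\<^sup>2" by simp
          then show ?thesis using b(3)[of x] b(5)[of x] b(4)[of x] unfolding abs_le_iff by linarith
        qed
        have "integrable M (\<lambda>\<omega>. W \<omega> * (Gt1 \<epsilon> (J s (v s) \<omega>) * J s (\<lambda>x. vd s x + v2 s x / 2 + (v s x)\<^sup>2 / 2) \<omega>))"
          by (rule product_integrable[OF cx J_integrable[OF s0 _ bb] J_measurable[OF s0 m(1)] _ Tprops(3)[OF cx]]) measurable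
        moreover have "integrable M (\<lambda>\<omega>. W \<omega> * ((\<lambda>z. (Gt1 \<epsilon> z - Gt2 \<epsilon> z) / 2) (J s (v s) \<omega>) * J s (\<lambda>x. (v s x)\<^sup>2) \<omega>))"
        proof (rule product_integrable[OF cx J_integrable[OF s0 m(4) b(4)] J_measurable[OF s0 m(1)]])
          show "(\<lambda>z. (Gt1 \<epsilon> z - Gt2 \<epsilon> z) / 2) \<in> borel_measurable borel" by measurable
          show "\<bar>(Gt1 \<epsilon> z - Gt2 \<epsilon> z) / 2\<bar> \<le> 1 / \<epsilon>" for z
          proof -
            have "\<bar>Gt1 \<epsilon> z\<bar> \<le> 1 / \<epsilon>" "\<bar>Gt2 \<epsilon> z\<bar> \<le> 1 / \<epsilon>" using Gt_taylor[OF \<epsilon>] unfolding taylor_bdd_def by auto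
            then have "\<bar>Gt1 \<epsilon> z - Gt2 \<epsilon> z\<bar> \<le> 2 * (1 / \<epsilon>)" by linarith
            then show ?thesis by simp
          qed
        qed
        ultimately have "integrable M (\<lambda>\<omega>. W \<omega> * (Gt1 \<epsilon> (J s (v s) \<omega>) * J s (\<lambda>x. vd s x + v2 s x / 2 + (v s x)\<^sup>2 / 2) \<omega>
        - (Gt1 \<epsilon> (J s (v s) \<omega>) - Gt2 \<epsilon> (J s (v s) \<omega>)) / 2 * J s (\<lambda>x. (v s x)\<^sup>2) \<omega>))"
          unfolding right_diff_distrib by (rule Bochner_Integration.integrable_diff)
        moreover have "drift W (Gt1 \<epsilon>) (Gt2 \<epsilon>) v v2 vd s = (\<integral>\<omega>. W \<omega> * (Gt1 \<epsilon> (J s (v s) \<omega>) * J s (\<lambda>x. vd s x + v2 s x / 2 + (v s x)\<^sup>2 / 2) \<omega>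
        - (Gt1 \<epsilon> (J s (v s) \<omega>) - Gt2 \<epsilon> (J s (v s) \<omega>)) / 2 * J s (\<lambda>x. (v s x)\<^sup>2) \<omega>) \<partial>M)"
          by (rule drift_eq[OF cx s])
        ultimately show ?thesis using mass_integrable[OF s0] mass_expectation[OF s0] by simp
      qed
      finally show ?thesis by simp
    qed
    have "(\<integral>\<omega>. Gt \<epsilon> (J a (v a) \<omega>) \<partial>M) \<le> (\<integral>\<omega>. Gt \<epsilon> (J b (v b) \<omega>) \<partial>M) + \<epsilon> * (L\<^sup>2 * m0) * (b - a)"
      using G_expectation_mono[OF cx dr] by (simp add: W_def)
    moreover have i: "integrable M (\<lambda>\<omega>. Gt \<epsilon> (J t (v t) \<omega>))" if "t \<in> {a, b}" for t
      by (rule Bochner_Integration.integrable_bound[of M "\<lambda>_. 1 / \<epsilon>"]) (use that Tprops(1,2)[OF cx] in auto)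
    moreover have ie: "integrable M (\<lambda>\<omega>. exp (J t (v t) \<omega>))" if "t \<in> {a, b}" for t
      by (rule Bochner_Integration.integrable_bound[of M "\<lambda>_. 1 :: real"]) (use that Jn mab in \<open>auto intro!: AE_I2\<close>)
    moreover have "(\<integral>\<omega>. Gt \<epsilon> (J b (v b) \<omega>) \<partial>M) \<le> (\<integral>\<omega>. exp (J b (v b) \<omega>) \<partial>M)"
      by (intro integral_mono i ie Gt_props \<epsilon>) auto
    moreover have "(\<integral>\<omega>. exp (J a (v a) \<omega>) \<partial>M) \<le> (\<integral>\<omega>. Gt \<epsilon> (J a (v a) \<omega>) + \<epsilon> \<partial>M)"
    proof (intro integral_mono ie Bochner_Integration.integrable_add i)
      fix \<omega> assume "\<omega> \<in> space M"
      then have z: "exp (J a (v a) \<omega>) \<le> 1" using Jn[OF mab(1)] by simp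
      let ?y = "exp (J a (v a) \<omega>)"
      have "?y - Gt \<epsilon> (J a (v a) \<omega>) = \<epsilon> * (?y * (?y / (1 + \<epsilon> * ?y)))"
        unfolding Gt_props(6)[OF \<epsilon>] using \<epsilon> by (simp add: field_simps add_pos_pos[THEN less_imp_neq, symmetric])
      also have "\<dots> \<le> \<epsilon> * (1 * 1)"
        using \<epsilon> z by (intro mult_left_mono mult_mono) (auto simp: pos_divide_le_eq add_pos_pos intro: add_increasing2)
      finally show "?y \<le> Gt \<epsilon> (J a (v a) \<omega>) + \<epsilon>" by simp
    qed auto
    ultimately show ?thesis unfolding \<epsilon>_def[symmetric] by (simp add: prob_space)
  qed
  then show "\<exists>N. \<forall>n\<ge>N. (\<integral>\<omega>. exp (J a (v a) \<omega>) \<partial>M) \<le> (\<integral>\<omega>. exp (J b (v b) \<omega>) \<partial>M) + e n * (L\<^sup>2 * m0) * (b - a) + e n" by blast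
qed

end

section \<open>Heat kernel duals and deviation bounds\<close>

definition hk :: "real \<Rightarrow> real \<Rightarrow> real" where "hk \<tau> z = exp (- z\<^sup>2 / (2 * \<tau>)) / sqrt (2 * pi * \<tau>)"

text \<open>The second space derivative of \<open>hk\<close>, hence by the heat equation twice its
  derivative in \<open>\<tau>\<close>.\<close>

definition hkq :: "real \<Rightarrow> real \<Rightarrow> real" where "hkq \<tau> z = (z\<^sup>2 / \<tau>\<^sup>2 - 1 / \<tau>) * hk \<tau> z"

lemma hk_pos: "0 < \<tau> \<Longrightarrow> 0 < hk \<tau> z"
  unfolding hk_def by simp

lemma hk_le: "0 < \<tau> \<Longrightarrow> hk \<tau> z \<le> 1 / sqrt (2 * pi * \<tau>)"
  unfolding hk_def by (intro divide_right_mono) auto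

lemma hk_le_mono: "0 < e \<Longrightarrow> e \<le> \<tau> \<Longrightarrow> hk \<tau> z \<le> 1 / sqrt (2 * pi * e)"
  by (rule order_trans[OF hk_le]) (auto intro!: divide_left_mono)

lemma hk_abs_le: "0 < e \<Longrightarrow> e \<le> \<tau> \<Longrightarrow> \<bar>hk \<tau> z\<bar> \<le> 1 / sqrt (2 * pi * e)"
  using hk_le_mono[of e \<tau> z] hk_pos[of \<tau> z] by simp

lemma hk_measurable [measurable]: "(\<lambda>y. hk \<tau> (x - y)) \<in> borel_measurable borel"
  unfolding hk_def by measurable

lemma hk_dx: "0 < \<tau> \<Longrightarrow> ((\<lambda>y. hk \<tau> (x - y)) has_real_derivative (x - y) / \<tau> * hk \<tau> (x - y)) (at y)"
proof -
  assume t: "0 < \<tau>"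
  have "((\<lambda>y. exp (- (x - y)\<^sup>2 / (2 * \<tau>)) / sqrt (2 * pi * \<tau>)) has_real_derivative (exp (- (x - y)\<^sup>2 / (2 * \<tau>)) * ((x - y) / \<tau>)) / sqrt (2 * pi * \<tau>)) (at y)"
  proof (rule DERIV_cdivide)
    have "((\<lambda>y. - (x - y)\<^sup>2) has_real_derivative 2 * (x - y)) (at y)" by (auto intro!: derivative_eq_intros)
    from DERIV_chain2[OF DERIV_exp DERIV_cdivide[OF this, of "2 * \<tau>"]]
    show "((\<lambda>y. exp (- (x - y)\<^sup>2 / (2 * \<tau>))) has_real_derivative exp (- (x - y)\<^sup>2 / (2 * \<tau>)) * ((x - y) / \<tau>)) (at y)"
      unfolding mult_divide_mult_cancel_left[OF zero_neq_numeral[symmetric]] .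
  qed
  then show ?thesis by (simp add: hk_def mult.commute)
qed

lemma hk_dxx: "0 < \<tau> \<Longrightarrow> ((\<lambda>y. (x - y) / \<tau> * hk \<tau> (x - y)) has_real_derivative hkq \<tau> (x - y)) (at y)"
proof -
  assume t: "0 < \<tau>"
  have "((\<lambda>y. (x - y) / \<tau>) has_real_derivative - 1 / \<tau>) (at y)"
    by (rule DERIV_cdivide) (auto intro!: derivative_eq_intros)
  from DERIV_mult[OF this hk_dx[OF t]]
  have "((\<lambda>y. (x - y) / \<tau> * hk \<tau> (x - y)) has_real_derivative - 1 / \<tau> * hk \<tau> (x - y) + (x - y) / \<tau> * hk \<tau> (x - y) * ((x - y) / \<tau>)) (at y)" .
  moreover have "- 1 / \<tau> * h + z / \<tau> * h * (z / \<tau>) = (z\<^sup>2 / \<tau>\<^sup>2 - 1 / \<tau>) * h" for z h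
    by (simp add: power2_eq_square left_diff_distrib)
  ultimately show ?thesis unfolding hkq_def by simp
qed

lemma hk_dt:
  assumes "0 < \<tau>"
  shows "((\<lambda>\<tau>. hk \<tau> z) has_real_derivative hkq \<tau> z / 2) (at \<tau>)"
proof -
  have s: "0 < sqrt (2 * pi * \<tau>)" and sq: "sqrt (2 * pi * \<tau>) * sqrt (2 * pi * \<tau>) = 2 * pi * \<tau>" using assms by auto
  have 1: "((\<lambda>\<tau>. exp (- z\<^sup>2 / (2 * \<tau>))) has_real_derivative exp (- z\<^sup>2 / (2 * \<tau>)) * (z\<^sup>2 / (2 * \<tau>\<^sup>2))) (at \<tau>)"
    using assms by (auto intro!: derivative_eq_intros simp: power2_eq_square)
  have 2: "((\<lambda>\<tau>. sqrt (2 * pi * \<tau>)) has_real_derivative sqrt (2 * pi * \<tau>) / (2 * \<tau>)) (at \<tau>)"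
  proof -
    have "((\<lambda>\<tau>. sqrt (2 * pi * \<tau>)) has_real_derivative inverse (sqrt (2 * pi * \<tau>)) / 2 * (2 * pi)) (at \<tau>)"
      using assms pi_gt_zero by (auto intro!: derivative_eq_intros simp: mult_less_0_iff)
    also have "inverse (sqrt (2 * pi * \<tau>)) / 2 * (2 * pi) = sqrt (2 * pi * \<tau>) / (2 * \<tau>)"
    proof -
      have "inverse S / 2 * (2 * pi) = S / (2 * \<tau>)" if "S * S = 2 * pi * \<tau>" "S \<noteq> 0" for S
        using that assms by (simp add: field_simps)
      moreover have "sqrt (2 * pi * \<tau>) \<noteq> 0" using s by linarith
      ultimately show ?thesis using sq by blast
    qed
    finally show ?thesis .
  qed
  have "((\<lambda>\<tau>. hk \<tau> z) has_real_derivative (exp (- z\<^sup>2 / (2 * \<tau>)) * (z\<^sup>2 / (2 * \<tau>\<^sup>2)) * sqrt (2 * pi * \<tau>) - exp (- z\<^sup>2 / (2 * \<tau>)) * (sqrt (2 * pi * \<tau>) / (2 * \<tau>))) / (sqrt (2 * pi * \<tau>) * sqrt (2 * pi * \<tau>))) (at \<tau>)"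
    unfolding hk_def[abs_def] by (rule DERIV_divide[OF 1 2]) (use s in linarith)
  also have "(exp (- z\<^sup>2 / (2 * \<tau>)) * (z\<^sup>2 / (2 * \<tau>\<^sup>2)) * sqrt (2 * pi * \<tau>) - exp (- z\<^sup>2 / (2 * \<tau>)) * (sqrt (2 * pi * \<tau>) / (2 * \<tau>))) / (sqrt (2 * pi * \<tau>) * sqrt (2 * pi * \<tau>)) = hkq \<tau> z / 2"
  proof -
    have "(E * A * S - E * (S / B)) / (S * S) = (A * 2 - 2 / B) * (E / S) / 2" if "S \<noteq> 0" for E A B S :: real
      using that by (simp add: field_simps)
    from this[of "sqrt (2 * pi * \<tau>)" "exp (- z\<^sup>2 / (2 * \<tau>))" "z\<^sup>2 / (2 * \<tau>\<^sup>2)" "2 * \<tau>"] s assms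
    show ?thesis unfolding hkq_def hk_def by simp
  qed
  finally show ?thesis .
qed

text \<open>It follows from \<open>u * exp (- u) \<le> 1\<close>; of the constant 3, the quadratic
  term contributes 2 and the other term 1.\<close>

lemma hkq_bound:
  assumes "0 < e" "e \<le> \<tau>"
  shows "\<bar>hkq \<tau> z\<bar> \<le> 3 / e * (1 / sqrt (2 * pi * e))"
proof -
  have t: "0 < \<tau>" using assms by simp
  let ?u = "z\<^sup>2 / (2 * \<tau>)"
  have "?u * exp (- ?u) \<le> 1"
  proof -
    have "?u \<le> exp ?u" using exp_ge_add_one_self[of ?u] by linarith
    then have "?u * exp (- ?u) \<le> exp ?u * exp (- ?u)" by (intro mult_right_mono) auto
    then show ?thesis by (simp add: exp_minus)
  qed
  then have "2 / \<tau> * ((?u * exp (- ?u)) / sqrt (2 * pi * \<tau>)) \<le> 2 / \<tau> * (1 / sqrt (2 * pi * \<tau>))"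
    using t by (intro mult_left_mono divide_right_mono) auto
  moreover have "z\<^sup>2 / \<tau>\<^sup>2 * hk \<tau> z = 2 / \<tau> * ((?u * exp (- ?u)) / sqrt (2 * pi * \<tau>))"
    unfolding hk_def using t by (simp add: power2_eq_square)
  moreover have "1 / \<tau> * hk \<tau> z \<le> 1 / \<tau> * (1 / sqrt (2 * pi * \<tau>))" using t by (intro mult_left_mono hk_le) auto
  moreover have "\<bar>hkq \<tau> z\<bar> \<le> z\<^sup>2 / \<tau>\<^sup>2 * hk \<tau> z + 1 / \<tau> * hk \<tau> z"
    unfolding hkq_def left_diff_distrib using hk_pos[OF t, of z] t by (intro order_trans[OF abs_triangle_ineq4]) (simp add: abs_mult)
  ultimately have "\<bar>hkq \<tau> z\<bar> \<le> 3 / \<tau> * (1 / sqrt (2 * pi * \<tau>))" by (simp add: field_simps)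
  also have "\<dots> \<le> 3 / e * (1 / sqrt (2 * pi * e))"
    using assms t by (intro mult_mono divide_left_mono) auto
  finally show ?thesis .
qed

lemma hk_continuous_y: "0 < \<tau> \<Longrightarrow> continuous_on UNIV (\<lambda>y. hkq \<tau> (x - y))"
  unfolding hkq_def hk_def by (intro continuous_intros) auto

text \<open>\<open>k\<close> is the value at the terminal time. The subtracted term is the integral,
  over kernel times from \<open>e\<close> to \<open>\<tau> + e\<close>, of half the sup norm
  \<open>1 / sqrt (2 * pi * r)\<close> of the heat kernel. Positive \<open>k\<close> leads to upper
  bounds for the density, negative \<open>k\<close> to lower ones.\<close>

definition coefD :: "real \<Rightarrow> real \<Rightarrow> real \<Rightarrow> real" where
  "coefD k e \<tau> = k - (sqrt (\<tau> + e) - sqrt e) / sqrt (2 * pi)"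

context sbm_process
begin

text \<open>\<open>v = hk / coefD\<close> solves \<open>\<partial>\<^sub>s v + v'' / 2 + v\<^sup>2 / 2 \<le> 0\<close>: the denominator is chosen so that its
  derivative absorbs the sup norm of the heat kernel in the quadratic term, whatever the sign of \<open>k\<close>.\<close>
lemma kernel_time_test:
  assumes aT: "0 < a" "a < T" and e: "0 < e" and d0: "0 < d0" "\<And>s. s \<in> {a..T} \<Longrightarrow> d0 \<le> \<bar>coefD k e (T - s)\<bar>"
  defines "P0 \<equiv> 1 / sqrt (2 * pi * e)"
  defines "D \<equiv> (\<lambda>s. coefD k e (T - s))"
  defines "D' \<equiv> (\<lambda>s. 1 / (2 * sqrt (2 * pi * (T - s + e))))"
  shows "time_test a T (\<lambda>s y. hk (T - s + e) (x - y) / D s) (\<lambda>s y. (x - y) / (T - s + e) * hk (T - s + e) (x - y) / D s)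
     (\<lambda>s y. hkq (T - s + e) (x - y) / D s) (\<lambda>s y. - (hkq (T - s + e) (x - y) / 2) / D s - hk (T - s + e) (x - y) * D' s / (D s)\<^sup>2)
     (P0 / d0 + 3 / e * P0 / d0 + P0 * P0 / d0\<^sup>2)"
    and "s \<in> {a..T} \<Longrightarrow> (- (hkq (T - s + e) (x - y) / 2) / D s - hk (T - s + e) (x - y) * D' s / (D s)\<^sup>2)
      + (hkq (T - s + e) (x - y) / D s) / 2 + (hk (T - s + e) (x - y) / D s)\<^sup>2 / 2 \<le> 0"
proof -
  have P0: "0 < P0" using e by (simp add: P0_def)
  have Dd: "(D has_real_derivative D' s) (at s within {a..T})" if "s \<in> {a..T}" for s
  proof -
    have pos: "0 < T - s + e" using that e by auto
    have "(D has_real_derivative - ((inverse (sqrt (T - s + e)) / 2 * (-1)) / sqrt (2 * pi))) (at s within {a..T})"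
    proof -
      have "((\<lambda>s. sqrt (T - s + e) - sqrt e) has_real_derivative inverse (sqrt (T - s + e)) / 2 * (-1)) (at s within {a..T})"
        using pos by (auto intro!: derivative_eq_intros)
      from DERIV_diff[OF DERIV_const DERIV_cdivide[OF this]] show ?thesis
        unfolding D_def coefD_def by (simp only: diff_0)
    qed
    also have "- ((inverse (sqrt (T - s + e)) / 2 * (-1)) / sqrt (2 * pi)) = D' s"
    proof -
      have "- ((inverse p / 2 * (-1)) / q) = 1 / (2 * (q * p))" for p q :: real by (cases "p = 0"; cases "q = 0") (simp_all add: field_simps)
      then show ?thesis unfolding D'_def real_sqrt_mult[of "2 * pi"] .
    qed
    finally show ?thesis .
  qed
  show "time_test a T (\<lambda>s y. hk (T - s + e) (x - y) / D s) (\<lambda>s y. (x - y) / (T - s + e) * hk (T - s + e) (x - y) / D s)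
     (\<lambda>s y. hkq (T - s + e) (x - y) / D s) (\<lambda>s y. - (hkq (T - s + e) (x - y) / 2) / D s - hk (T - s + e) (x - y) * D' s / (D s)\<^sup>2)
     (P0 / d0 + 3 / e * P0 / d0 + P0 * P0 / d0\<^sup>2)" (is "time_test a T ?v ?v1 ?v2 ?vd ?L")
    unfolding time_test_def
  proof (intro conjI ballI allI)
    fix s assume s: "s \<in> {a..T}"
    let ?t = "T - s + e"
    have t: "0 < ?t" "e \<le> ?t" using s e by auto
    have Ds: "d0 \<le> \<bar>D s\<bar>" using d0(2)[OF s] by (simp add: D_def)
    then have D0: "D s \<noteq> 0" "0 < \<bar>D s\<bar>" using d0(1) by auto
    have b1: "\<bar>?v s y\<bar> \<le> P0 / d0" for y
      unfolding abs_divide by (rule frac_le[OF less_imp_le[OF P0] hk_abs_le[OF e t(2), folded P0_def] d0(1) Ds])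
    have b2: "\<bar>?v2 s y\<bar> \<le> 3 / e * P0 / d0" for y
      unfolding abs_divide by (rule frac_le[OF _ hkq_bound[OF e t(2), folded P0_def] d0(1) Ds]) (use P0 e in simp)
    have D'b: "\<bar>D' s\<bar> \<le> P0"
    proof -
      have "1 / (2 * sqrt (2 * pi * ?t)) \<le> 1 / (1 * sqrt (2 * pi * e))"
        using t e by (intro divide_left_mono mult_mono) auto
      then show ?thesis unfolding D'_def P0_def using t by simp
    qed
    have b3: "\<bar>?vd s y\<bar> \<le> 3 / e * P0 / d0 + P0 * P0 / d0\<^sup>2" for y
    proof -
      have "\<bar>- (hkq ?t (x - y) / 2) / D s\<bar> = \<bar>?v2 s y\<bar> / 2" by (simp add: abs_mult)
      also have "\<dots> \<le> 3 / e * P0 / d0"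
      proof (rule order_trans[OF _ b2[of y]])
        have "r / 2 \<le> r" if "0 \<le> r" for r :: real using that by simp
        from this[OF abs_ge_zero] show "\<bar>?v2 s y\<bar> / 2 \<le> \<bar>?v2 s y\<bar>" .
      qed
      finally have 1: "\<bar>- (hkq ?t (x - y) / 2) / D s\<bar> \<le> 3 / e * P0 / d0" .
      have "\<bar>hk ?t (x - y) * D' s / (D s)\<^sup>2\<bar> = \<bar>hk ?t (x - y)\<bar> * \<bar>D' s\<bar> / \<bar>D s\<bar>\<^sup>2" by (simp add: abs_mult)
      also have "\<dots> \<le> P0 * P0 / d0\<^sup>2"
        by (rule frac_le[OF _ mult_mono[OF hk_abs_le[OF e t(2), folded P0_def] D'b] _ power_mono[OF Ds]]) (use P0 d0(1) in auto)
      finally show ?thesis using 1 by linarith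
    qed
    show "test_fun (?v s) (?v1 s) (?v2 s)"
      unfolding test_fun_def
    proof (intro conjI allI)
      fix y
      show "(?v s has_real_derivative ?v1 s y) (at y)" by (rule DERIV_cdivide[OF hk_dx[OF t(1)]])
      show "(?v1 s has_real_derivative ?v2 s y) (at y)" by (rule DERIV_cdivide[OF hk_dxx[OF t(1)]])
    next
      show "continuous_on UNIV (?v2 s)" by (intro continuous_intros hk_continuous_y t) (use D0 in auto)
      show "bounded (range (?v s))" "bounded (range (?v2 s))"
        using b1 b2 unfolding bounded_iff by (auto simp del: abs_divide)
    qed
    show "?vd s \<in> borel_measurable borel"
    proof -
      have [measurable]: "(\<lambda>y. hkq ?t (x - y)) \<in> borel_measurable borel"
        by (rule borel_measurable_continuous_onI[OF hk_continuous_y[OF t(1)]])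
      show ?thesis by measurable
    qed
    have nn: "0 \<le> P0 / d0" "0 \<le> 3 / e * P0 / d0" "0 \<le> P0 * P0 / d0\<^sup>2" using P0 d0 e by auto
    fix y
    show "\<bar>?v s y\<bar> \<le> ?L" "\<bar>?v2 s y\<bar> \<le> ?L" "\<bar>?vd s y\<bar> \<le> ?L"
      using b1[of y] b2[of y] b3[of y] nn by linarith+
    have hkd: "((\<lambda>s. hk (T - s + e) (x - y)) has_real_derivative hkq ?t (x - y) / 2 * (-1)) (at s within {a..T})"
      by (rule DERIV_chain2[where f = "\<lambda>\<tau>. hk \<tau> (x - y)" and g = "\<lambda>s. T - s + e", OF hk_dt[OF t(1)]]) (auto intro!: derivative_eq_intros)
    have "((\<lambda>s. ?v s y) has_real_derivative (hkq ?t (x - y) / 2 * (-1) * D s - hk ?t (x - y) * D' s) / (D s * D s)) (at s within {a..T})"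
      by (rule DERIV_divide[OF hkd Dd[OF s] D0(1)])
    also have "(hkq ?t (x - y) / 2 * (-1) * D s - hk ?t (x - y) * D' s) / (D s * D s) = ?vd s y"
      using D0 by (simp add: diff_divide_distrib power2_eq_square)
    finally show "((\<lambda>s. ?v s y) has_real_derivative ?vd s y) (at s within {a..T})" .
  next
    fix y
    have "continuous_on {a..T} D" using Dd by (intro DERIV_continuous_on)
    moreover have "D s \<noteq> 0" if "s \<in> {a..T}" for s using d0(2)[OF that] d0(1) by (auto simp: D_def)
    moreover have "continuous_on {a..T} (\<lambda>s. hkq (T - s + e) (x - y))"
      unfolding hkq_def hk_def using e by (intro continuous_intros) auto
    ultimately show "continuous_on {a..T} (\<lambda>s. ?v2 s y)" by (intro continuous_intros) auto
  qed
  show "(- (hkq (T - s + e) (x - y) / 2) / D s - hk (T - s + e) (x - y) * D' s / (D s)\<^sup>2)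
      + (hkq (T - s + e) (x - y) / D s) / 2 + (hk (T - s + e) (x - y) / D s)\<^sup>2 / 2 \<le> 0" if s: "s \<in> {a..T}"
  proof -
    let ?t = "T - s + e"
    have t: "0 < ?t" using s e by auto
    have "hk ?t (x - y) * hk ?t (x - y) \<le> hk ?t (x - y) * (2 * D' s)"
      using hk_le[OF t, of "x - y"] hk_pos[OF t, of "x - y"] by (intro mult_left_mono) (auto simp: D'_def)
    then have "(hk ?t (x - y))\<^sup>2 / 2 / (D s)\<^sup>2 \<le> hk ?t (x - y) * D' s / (D s)\<^sup>2"
      by (intro divide_right_mono) (auto simp: power2_eq_square)
    then show ?thesis by (simp add: power_divide)
  qed
qed

text \<open>At the terminal time the denominator equals \<open>k\<close> and the kernel is
  \<open>hk e\<close>, a smoothed point mass at \<open>x\<close>. The constant \<open>d0\<close>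
  keeps the denominator away from zero on the whole interval, so that the dual does not blow
  up.\<close>

lemma kernel_supermartingale:
  assumes aT: "0 < a" "a < T" and e: "0 < e" and d0: "0 < d0" "\<And>s. s \<in> {a..T} \<Longrightarrow> d0 \<le> \<bar>coefD k e (T - s)\<bar>"
    and W: "W \<in> borel_measurable (F a)" and W0: "\<And>\<omega>. \<omega> \<in> space M \<Longrightarrow> 0 \<le> W \<omega>"
  shows "(\<integral>\<^sup>+\<omega>. ennreal (W \<omega> * exp (J T (\<lambda>y. hk e (x - y)) \<omega> / k)) \<partial>M)
     \<le> (\<integral>\<^sup>+\<omega>. ennreal (W \<omega> * exp (J a (\<lambda>y. hk (T - a + e) (x - y)) \<omega> / coefD k e (T - a))) \<partial>M)"
proof -
  have c: "J t (\<lambda>y. f y / d) \<omega> = J t f \<omega> / d" for t f d \<omega>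
    using J_cmult[of \<omega> t "1 / d" f] by simp
  have "coefD k e 0 = k" by (simp add: coefD_def)
  then show ?thesis
    using exp_supermartingale[OF aT kernel_time_test(1)[OF aT e d0, of x] kernel_time_test(2)[OF aT e d0, of _ x] W W0]
    by (simp add: c)
qed

end

section \<open>Recovering the density from heat kernel averages\<close>

lemma hk_normal: "0 < \<tau> \<Longrightarrow> hk \<tau> (x - y) = normal_density x (sqrt \<tau>) y"
  unfolding hk_def normal_density_def by (simp add: power2_commute)

lemma hk_integral: "0 < \<tau> \<Longrightarrow> integrable lborel (\<lambda>y. hk \<tau> (x - y))" "0 < \<tau> \<Longrightarrow> (\<integral>y. hk \<tau> (x - y) \<partial>lborel) = 1"
  by (simp_all add: hk_normal)

text \<open>Away from its centre the narrow kernel is dominated by the fixed kernel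
  \<open>hk 1\<close> times a factor that vanishes with \<open>e\<close>. The tail of an average of
  the density is thereby controlled through its total mass, although the density may be unbounded in
  space.\<close>

lemma hk_tail:
  assumes e: "0 < e" "e \<le> 1" and z: "\<delta> \<le> \<bar>z\<bar>" "0 < \<delta>"
  shows "hk e z \<le> exp (- \<delta>\<^sup>2 / 2 * (1 / e - 1)) / sqrt e * hk 1 z"
proof -
  have "\<delta>\<^sup>2 \<le> z\<^sup>2" using z by (metis abs_le_square_iff abs_of_pos)
  then have "\<delta>\<^sup>2 / 2 * (1 / e - 1) \<le> z\<^sup>2 / 2 * (1 / e - 1)" using e by (intro mult_right_mono) auto
  then have "exp (- z\<^sup>2 / (2 * e)) \<le> exp (- \<delta>\<^sup>2 / 2 * (1 / e - 1)) * exp (- z\<^sup>2 / 2)"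
  proof -
    have "z\<^sup>2 / 2 * (1 / e - 1) = z\<^sup>2 / (2 * e) - z\<^sup>2 / 2" by (simp add: right_diff_distrib)
    then have "- z\<^sup>2 / (2 * e) \<le> - \<delta>\<^sup>2 / 2 * (1 / e - 1) + - z\<^sup>2 / 2"
      using \<open>\<delta>\<^sup>2 / 2 * (1 / e - 1) \<le> z\<^sup>2 / 2 * (1 / e - 1)\<close> unfolding minus_divide_left[symmetric] mult_minus_left by linarith
    then show ?thesis unfolding exp_add[symmetric] exp_le_cancel_iff .
  qed
  then have "exp (- z\<^sup>2 / (2 * e)) / (sqrt (2 * pi) * sqrt e) \<le> exp (- \<delta>\<^sup>2 / 2 * (1 / e - 1)) * exp (- z\<^sup>2 / 2) / (sqrt (2 * pi) * sqrt e)"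
    using e by (intro divide_right_mono) auto
  then show ?thesis unfolding hk_def by (simp add: real_sqrt_mult mult.commute)
qed

definition ee :: "nat \<Rightarrow> real" where "ee n = inverse (real (Suc n))"

lemma ee: "0 < ee n" "0 \<le> ee n" "ee n \<le> 1" "ee \<longlonglongrightarrow> 0"
  using LIMSEQ_inverse_real_of_nat unfolding ee_def[abs_def] by (simp_all add: field_simps)

context sbm_process
begin

lemma hk_approx_identity:
  assumes \<omega>: "\<omega> \<in> space M" and t: "0 < t"
  shows "(\<lambda>n. J t (\<lambda>y. hk (ee n) (x - y)) \<omega>) \<longlonglongrightarrow> X \<omega> t x"
proof (rule LIMSEQ_I)
  fix r :: real assume r: "0 < r"
  define f where "f y = X \<omega> t y" for y
  have fi: "integrable lborel f" unfolding f_def by (rule integ[OF \<omega> t])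
  have f0: "0 \<le> f y" for y unfolding f_def by (rule nonneg[OF \<omega> t])
  have cf: "continuous_on UNIV f"
  proof -
    have "continuous_on UNIV (\<lambda>y. (\<lambda>(t, x). X \<omega> t x) (t, y))"
      by (rule continuous_on_compose2[OF cont[OF \<omega>]]) (use t in \<open>auto intro!: continuous_intros\<close>)
    then show ?thesis by (simp add: f_def)
  qed
  then have "isCont f x" by (simp add: continuous_on_eq_continuous_at)
  then obtain \<delta> where \<delta>: "0 < \<delta>" "\<And>y. \<bar>y - x\<bar> < \<delta> \<Longrightarrow> \<bar>f y - f x\<bar> < r / 2"
    using r unfolding continuous_at_eps_delta dist_real_def by (metis half_gt_zero)
  define e where "e = ee"
  have e: "0 < e n" "e n \<le> 1" for n using ee by (simp_all add: e_def)
  define \<kappa> where "\<kappa> n = exp (- \<delta>\<^sup>2 / 2 * (1 / e n - 1)) / sqrt (e n)" for n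
  have \<kappa>0: "0 \<le> \<kappa> n" for n using e[of n] by (simp add: \<kappa>_def)
  have \<kappa>lim: "\<kappa> \<longlonglongrightarrow> 0" unfolding \<kappa>_def e_def ee_def using \<delta>(1) by real_asymp
  define S where "S = \<bar>mass t \<omega>\<bar> + f x"
  have S: "0 \<le> S" using f0 by (simp add: S_def)
  have bound: "\<bar>J t (\<lambda>y. hk (e n) (x - y)) \<omega> - f x\<bar> \<le> r / 2 + \<kappa> n * S" for n
  proof -
    let ?h = "\<lambda>y. hk (e n) (x - y)"
    have hi: "integrable lborel ?h" and h1: "(\<integral>y. ?h y \<partial>lborel) = 1" using hk_integral[OF e(1)] by auto
    have hb: "\<bar>?h y\<bar> \<le> 1 / sqrt (2 * pi * e n)" for y by (rule hk_abs_le[OF e(1) order_refl])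
    have fh: "integrable lborel (\<lambda>y. f y * ?h y)" unfolding f_def by (rule integ_mult[OF \<omega> t _ hb]) measurable
    have k1: "integrable lborel (\<lambda>y. f y * hk 1 (x - y))" unfolding f_def by (rule integ_mult[OF \<omega> t _ hk_abs_le[of 1 1]]) auto
    have eq1: "J t ?h \<omega> - f x = (\<integral>y. f y * ?h y \<partial>lborel) - f x * (\<integral>y. ?h y \<partial>lborel)" unfolding h1 pair_dens_def f_def by simp
    have eq2: "(\<integral>y. f y * ?h y \<partial>lborel) - f x * (\<integral>y. ?h y \<partial>lborel) = (\<integral>y. (f y - f x) * ?h y \<partial>lborel)"
      using fh hi by (simp add: left_diff_distrib)
    have "\<bar>J t ?h \<omega> - f x\<bar> = \<bar>\<integral>y. (f y - f x) * ?h y \<partial>lborel\<bar>" unfolding eq1 eq2 ..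
    also have "\<dots> \<le> (\<integral>y. r / 2 * ?h y + \<kappa> n * (f y * hk 1 (x - y) + f x * hk 1 (x - y)) \<partial>lborel)"
    proof (rule order_trans[OF integral_abs_bound integral_mono])
      show "integrable lborel (\<lambda>y. \<bar>(f y - f x) * ?h y\<bar>)" using fh hi by (intro integrable_abs) (simp add: left_diff_distrib)
      show "integrable lborel (\<lambda>y. r / 2 * ?h y + \<kappa> n * (f y * hk 1 (x - y) + f x * hk 1 (x - y)))"
        using hi k1 hk_integral(1)[of 1 x] by simp
      fix y
      have hp: "0 < ?h y" "0 < hk 1 (x - y)" using hk_pos[OF e(1)] hk_pos[of 1] by auto
      have nn: "0 \<le> \<kappa> n * (f y * hk 1 (x - y) + f x * hk 1 (x - y))"
        using \<kappa>0[of n] f0[of y] f0[of x] hp by simp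
      show "\<bar>(f y - f x) * ?h y\<bar> \<le> r / 2 * ?h y + \<kappa> n * (f y * hk 1 (x - y) + f x * hk 1 (x - y))"
      proof (cases "\<bar>y - x\<bar> < \<delta>")
        case True
        then have "\<bar>(f y - f x) * ?h y\<bar> \<le> r / 2 * ?h y"
          unfolding abs_mult using \<delta>(2)[OF True] hp r by (intro mult_mono) auto
        then show ?thesis using nn by linarith
      next
        case False
        then have t: "?h y \<le> \<kappa> n * hk 1 (x - y)"
          unfolding \<kappa>_def by (intro hk_tail[OF e _ \<delta>(1)]) (simp add: abs_minus_commute)
        have "\<bar>(f y - f x) * ?h y\<bar> \<le> (f y + f x) * (\<kappa> n * hk 1 (x - y))"
          unfolding abs_mult using f0[of y] f0[of x] hp t by (intro mult_mono) auto
        moreover have "0 \<le> r / 2 * ?h y" using r hp by simp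
        ultimately show ?thesis by (simp add: algebra_simps)
      qed
    qed
    also have "\<dots> = r / 2 + \<kappa> n * ((\<integral>y. f y * hk 1 (x - y) \<partial>lborel) + f x)"
      using hi h1 k1 hk_integral[of 1 x] by simp
    also have "\<dots> \<le> r / 2 + \<kappa> n * S"
    proof (intro add_left_mono mult_left_mono \<kappa>0)
      have "(\<integral>y. f y * hk 1 (x - y) \<partial>lborel) \<le> (\<integral>y. f y * 1 \<partial>lborel)"
      proof (intro integral_mono k1 mult_left_mono f0)
        show "integrable lborel (\<lambda>y. f y * 1)" using fi by simp
        have "1 \<le> sqrt (2 * pi)" using pi_gt3 by (simp add: real_le_rsqrt)
        then have "1 / sqrt (2 * pi * 1) \<le> 1" by simp
        then show "hk 1 (x - y) \<le> 1" for y using hk_le[of 1 "x - y"] by linarith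
      qed
      then show "(\<integral>y. f y * hk 1 (x - y) \<partial>lborel) + f x \<le> S" unfolding S_def pair_dens_def f_def by simp
    qed
    finally show ?thesis .
  qed
  have "(\<lambda>n. \<kappa> n * S) \<longlonglongrightarrow> 0 * S" by (intro tendsto_intros \<kappa>lim)
  then have "(\<lambda>n. \<kappa> n * S) \<longlonglongrightarrow> 0" by simp
  from LIMSEQ_D[OF this, of "r / 2"] r obtain N where N: "\<And>n. N \<le> n \<Longrightarrow> \<bar>\<kappa> n * S\<bar> < r / 2" by auto
  show "\<exists>no. \<forall>n\<ge>no. norm (J t (\<lambda>y. hk (ee n) (x - y)) \<omega> - X \<omega> t x) < r"
  proof (intro exI[of _ N] allI impI)
    fix n assume "N \<le> n"
    then show "norm (J t (\<lambda>y. hk (ee n) (x - y)) \<omega> - X \<omega> t x) < r"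
      using bound[of n] N[of n] abs_ge_self[of "\<kappa> n * S"] unfolding e_def f_def real_norm_def by argo
  qed
qed

lemma J_tendsto_path:
  assumes \<omega>: "\<omega> \<in> space M" and s: "0 < s" and m: "\<And>n. \<psi>s n \<in> borel_measurable borel" "\<psi> \<in> borel_measurable borel"
    and b: "\<And>n x. \<bar>\<psi>s n x\<bar> \<le> L" and l: "\<And>x. (\<lambda>n. \<psi>s n x) \<longlonglongrightarrow> \<psi> x"
  shows "(\<lambda>n. J s (\<psi>s n) \<omega>) \<longlonglongrightarrow> J s \<psi> \<omega>"
  unfolding pair_dens_def
proof (rule integral_dominated_convergence[where w = "\<lambda>x. L * X \<omega> s x"])
  have [measurable]: "X \<omega> s \<in> borel_measurable borel" using integ[OF \<omega> s] by simp
  show "(\<lambda>x. X \<omega> s x * \<psi>s n x) \<in> borel_measurable lborel" "(\<lambda>x. X \<omega> s x * \<psi> x) \<in> borel_measurable lborel" for n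
    using m by measurable
  show "integrable lborel (\<lambda>x. L * X \<omega> s x)" using integ[OF \<omega> s] by simp
  show "AE x in lborel. (\<lambda>n. X \<omega> s x * \<psi>s n x) \<longlonglongrightarrow> X \<omega> s x * \<psi> x" by (intro AE_I2 tendsto_intros l)
  show "AE x in lborel. norm (X \<omega> s x * \<psi>s n x) \<le> L * X \<omega> s x" for n
    using b[of n] nonneg[OF \<omega> s] by (intro AE_I2) (auto simp: abs_mult mult.commute intro!: mult_right_mono)
qed

section \<open>Exponential moments of the density against its heat flow\<close>

definition U :: "real \<Rightarrow> real \<Rightarrow> real \<Rightarrow> 'a \<Rightarrow> real" where
  "U s t x \<omega> = J s (\<lambda>y. hk (t - s) (x - y)) \<omega>"

context
  fixes s t x l l' :: real
  assumes st: "0 < s" "s < t" and l: "0 < l" "l < l'" and cond: "sqrt (t - s) \<le> 1 / l - 1 / l'"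
begin

abbreviation (input) Ua :: "nat \<Rightarrow> 'a \<Rightarrow> real" where "Ua n \<equiv> J s (\<lambda>y. hk (t - s + ee n) (x - y))"
abbreviation (input) Xa :: "nat \<Rightarrow> 'a \<Rightarrow> real" where "Xa n \<equiv> J t (\<lambda>y. hk (ee n) (x - y))"

lemma t_pos: "0 < t" using st by simp

lemma hk_s_bound: "0 \<le> r \<Longrightarrow> \<bar>hk (t - s + r) z\<bar> \<le> 1 / sqrt (2 * pi * (t - s))"
  by (rule hk_abs_le) (use st in auto)

lemma U_nonneg: "\<omega> \<in> space M \<Longrightarrow> 0 \<le> U s t x \<omega>" "\<omega> \<in> space M \<Longrightarrow> 0 \<le> Ua n \<omega>"
  unfolding U_def using st ee(1) by (auto intro!: J_nonneg less_imp_le[OF hk_pos] add_pos_pos)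

lemma U_integrable: "integrable M (U s t x)" "integrable M (Ua n)"
  unfolding U_def using hk_s_bound[of 0] hk_s_bound[OF ee(2)] by (auto intro!: J_integrable st)

lemma U_measurable [measurable]: "U s t x \<in> borel_measurable M" "Ua n \<in> borel_measurable M" "Ua n \<in> borel_measurable (F s)"
    "Xa n \<in> borel_measurable M" "(\<lambda>\<omega>. X \<omega> t x) \<in> borel_measurable M"
  using U_integrable F_M[OF adapted[OF t_pos]] st by (auto intro!: J_measurable_F J_measurable)

lemma hk_s_tendsto: "(\<lambda>n. hk (t - s + ee n) z) \<longlonglongrightarrow> hk (t - s) z"
proof -
  have "isCont (\<lambda>\<tau>. hk \<tau> z) (t - s)" by (rule DERIV_isCont[OF hk_dt]) (use st in simp)
  moreover have "(\<lambda>n. t - s + ee n) \<longlonglongrightarrow> t - s + 0" by (intro tendsto_intros ee(4))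
  ultimately show ?thesis using isCont_tendsto_compose[of "t - s" "\<lambda>\<tau>. hk \<tau> z" "\<lambda>n. t - s + ee n" sequentially] by simp
qed

lemma Un_tendsto: "\<omega> \<in> space M \<Longrightarrow> (\<lambda>n. Ua n \<omega>) \<longlonglongrightarrow> U s t x \<omega>"
  unfolding U_def by (rule J_tendsto_path[OF _ st(1) _ _ hk_s_bound[OF ee(2)] hk_s_tendsto]) auto

lemma Un_expectation: "(\<lambda>n. \<integral>\<omega>. Ua n \<omega> \<partial>M) \<longlonglongrightarrow> (\<integral>\<omega>. U s t x \<omega> \<partial>M)"
proof -
  have "(\<lambda>n. \<integral>\<omega>. \<bar>Ua n \<omega> - U s t x \<omega>\<bar> \<partial>M) \<longlonglongrightarrow> 0"
    unfolding U_def by (rule J_tendsto_L1[OF st(1) st(1) tendsto_const _ _ hk_s_bound[OF ee(2)] hk_s_bound[of 0, simplified] hk_s_tendsto]) auto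
  then have "(\<lambda>n. (\<integral>\<omega>. Ua n \<omega> \<partial>M) - (\<integral>\<omega>. U s t x \<omega> \<partial>M)) \<longlonglongrightarrow> 0"
  proof (rule Lim_null_comparison[rotated], intro always_eventually allI)
    fix n
    have "(\<integral>\<omega>. Ua n \<omega> \<partial>M) - (\<integral>\<omega>. U s t x \<omega> \<partial>M) = (\<integral>\<omega>. Ua n \<omega> - U s t x \<omega> \<partial>M)" using U_integrable(1) U_integrable(2)[of n] by simp
    then show "norm ((\<integral>\<omega>. Ua n \<omega> \<partial>M) - (\<integral>\<omega>. U s t x \<omega> \<partial>M)) \<le> (\<integral>\<omega>. \<bar>Ua n \<omega> - U s t x \<omega>\<bar> \<partial>M)" by (simp only: real_norm_def integral_abs_bound)
  qed
  then show ?thesis by (simp add: LIM_zero_iff)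
qed

text \<open>This is where \<open>cond\<close> comes from: over the lag \<open>t - s\<close> the
  denominator moves by at most \<open>sqrt (t - s)\<close>, so starting from \<open>1 / l\<close> it
  stays above \<open>1 / l'\<close>, and starting from \<open>- 1 / l'\<close> it stays above
  \<open>- 1 / l\<close>. The factor \<open>1 / sqrt (2 * pi)\<close> is given away.\<close>

lemma coefD_range:
  assumes "r \<in> {s..t}"
  shows "1 / l' \<le> coefD (1 / l) (ee n) (t - r)" "coefD (- 1 / l') (ee n) (t - r) \<le> - 1 / l'" "- 1 / l \<le> coefD (- 1 / l') (ee n) (t - r)"
proof -
  have q: "sqrt (t - r + ee n) - sqrt (ee n) \<le> sqrt (t - s)" "0 \<le> sqrt (t - r + ee n) - sqrt (ee n)"
  proof -
    have "sqrt (t - r + ee n) \<le> sqrt (t - r) + sqrt (ee n)" using assms ee(2) by (intro sqrt_add_le_add_sqrt) auto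
    moreover have "sqrt (t - r) \<le> sqrt (t - s)" using assms by simp
    ultimately show "sqrt (t - r + ee n) - sqrt (ee n) \<le> sqrt (t - s)" by linarith
    show "0 \<le> sqrt (t - r + ee n) - sqrt (ee n)" using assms by simp
  qed
  have "1 \<le> sqrt (2 * pi)" using pi_gt3 by (simp add: real_le_rsqrt)
  then have "(sqrt (t - r + ee n) - sqrt (ee n)) / sqrt (2 * pi) \<le> (sqrt (t - r + ee n) - sqrt (ee n)) / 1"
    using q(2) by (intro divide_left_mono) auto
  then have "(sqrt (t - r + ee n) - sqrt (ee n)) / sqrt (2 * pi) \<le> 1 / l - 1 / l'" "0 \<le> (sqrt (t - r + ee n) - sqrt (ee n)) / sqrt (2 * pi)"
    using q cond by auto
  then show "1 / l' \<le> coefD (1 / l) (ee n) (t - r)" "coefD (- 1 / l') (ee n) (t - r) \<le> - 1 / l'" "- 1 / l \<le> coefD (- 1 / l') (ee n) (t - r)"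
    unfolding coefD_def by (simp_all add: algebra_simps)
qed

text \<open>With the weight \<open>exp (- l' * U)\<close> the supermartingale has mean at most 1.
  Subtracting the mean of the weight leaves \<open>1 - exp (- l' * U) \<le> l' * U\<close>, so the
  bound is proportional to the mean of \<open>U\<close>; this makes it summable over an infinite
  spatial grid.\<close>

lemma upper_exp_moment: "(\<integral>\<^sup>+\<omega>. ennreal ((exp (l * X \<omega> t x) - 1) * exp (- l' * U s t x \<omega>)) \<partial>M) \<le> ennreal (l' * (\<integral>\<omega>. U s t x \<omega> \<partial>M))"
proof -
  have l'0: "0 < l'" using l by simp
  have step: "(\<integral>\<^sup>+\<omega>. ennreal ((exp (l * Xa n \<omega>) - 1) * exp (- l' * Ua n \<omega>)) \<partial>M) \<le> ennreal (l' * (\<integral>\<omega>. Ua n \<omega> \<partial>M))" for n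
  proof -
    let ?W = "\<lambda>\<omega>. exp (- l' * Ua n \<omega>)"
    have d0: "1 / l' \<le> \<bar>coefD (1 / l) (ee n) (t - r)\<bar>" if "r \<in> {s..t}" for r using coefD_range(1)[OF that, of n] by linarith
    have X0: "0 \<le> Xa n \<omega>" if "\<omega> \<in> space M" for \<omega> by (rule J_nonneg[OF that t_pos less_imp_le[OF hk_pos[OF ee(1)]]])
    have Wi: "integrable M ?W"
      by (rule Bochner_Integration.integrable_bound[of M "\<lambda>_. 1 :: real"]) (use U_nonneg(2) l'0 in \<open>auto intro!: AE_I2\<close>)
    have "(\<integral>\<^sup>+\<omega>. ennreal (?W \<omega> * exp (Xa n \<omega> / (1 / l))) \<partial>M) \<le> (\<integral>\<^sup>+\<omega>. ennreal (?W \<omega> * exp (Ua n \<omega> / coefD (1 / l) (ee n) (t - s))) \<partial>M)"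
      by (rule kernel_supermartingale[OF st ee(1) _ d0]) (use l'0 in auto)
    also have "\<dots> \<le> (\<integral>\<^sup>+\<omega>. 1 \<partial>M)"
    proof (intro nn_integral_mono)
      fix \<omega> assume \<omega>: "\<omega> \<in> space M"
      have c: "1 / l' \<le> coefD (1 / l) (ee n) (t - s)" using coefD_range(1)[of s n] st by simp
      have "Ua n \<omega> / coefD (1 / l) (ee n) (t - s) \<le> Ua n \<omega> / (1 / l')"
      proof (rule divide_left_mono[OF c U_nonneg(2)[OF \<omega>]])
        have "0 < coefD (1 / l) (ee n) (t - s)" by (rule less_le_trans[OF _ c]) (use l'0 in simp)
        then show "0 < coefD (1 / l) (ee n) (t - s) * (1 / l')" using l'0 by simp
      qed
      then have "?W \<omega> * exp (Ua n \<omega> / coefD (1 / l) (ee n) (t - s)) \<le> 1" unfolding exp_add[symmetric] by (simp add: mult.commute)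
      then show "ennreal (?W \<omega> * exp (Ua n \<omega> / coefD (1 / l) (ee n) (t - s))) \<le> 1" using ennreal_leI by fastforce
    qed
    also have "\<dots> = 1" by (simp add: emeasure_space_1)
    finally have one: "(\<integral>\<^sup>+\<omega>. ennreal (?W \<omega> * exp (l * Xa n \<omega>)) \<partial>M) \<le> 1" by (simp add: mult.commute)
    have Ei: "integrable M (\<lambda>\<omega>. ?W \<omega> * exp (l * Xa n \<omega>))"
      by (rule integrableI_bounded) (use one in \<open>auto intro: le_less_trans\<close>)
    have E1: "(\<integral>\<omega>. ?W \<omega> * exp (l * Xa n \<omega>) \<partial>M) \<le> 1"
      using one nn_integral_eq_integral[OF Ei] by simp
    have di: "integrable M (\<lambda>\<omega>. (exp (l * Xa n \<omega>) - 1) * ?W \<omega>)" using Ei Wi by (simp add: left_diff_distrib mult.commute)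
    have "(\<integral>\<omega>. (exp (l * Xa n \<omega>) - 1) * ?W \<omega> \<partial>M) = (\<integral>\<omega>. ?W \<omega> * exp (l * Xa n \<omega>) \<partial>M) - (\<integral>\<omega>. ?W \<omega> \<partial>M)"
      using Ei Wi by (simp add: left_diff_distrib mult.commute)
    also have "\<dots> \<le> (\<integral>\<omega>. 1 \<partial>M) - (\<integral>\<omega>. ?W \<omega> \<partial>M)" using E1 by (simp add: prob_space)
    also have "\<dots> = (\<integral>\<omega>. 1 - ?W \<omega> \<partial>M)" using Wi by simp
    also have "\<dots> \<le> (\<integral>\<omega>. l' * Ua n \<omega> \<partial>M)"
    proof (intro integral_mono Bochner_Integration.integrable_diff Wi integrable_mult_right U_integrable(2))
      show "1 - ?W \<omega> \<le> l' * Ua n \<omega>" for \<omega>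
        using exp_ge_add_one_self[of "- l' * Ua n \<omega>"] by linarith
    qed simp
    finally have "(\<integral>\<omega>. (exp (l * Xa n \<omega>) - 1) * ?W \<omega> \<partial>M) \<le> l' * (\<integral>\<omega>. Ua n \<omega> \<partial>M)" by simp
    then show ?thesis using X0 l by (subst nn_integral_eq_integral[OF di]) (auto intro!: AE_I2 ennreal_leI)
  qed
  have "(\<integral>\<^sup>+\<omega>. ennreal ((exp (l * X \<omega> t x) - 1) * exp (- l' * U s t x \<omega>)) \<partial>M)
     = (\<integral>\<^sup>+\<omega>. liminf (\<lambda>n. ennreal ((exp (l * Xa n \<omega>) - 1) * exp (- l' * Ua n \<omega>))) \<partial>M)"
    by (intro nn_integral_cong lim_imp_Liminf[symmetric] tendsto_ennrealI tendsto_intros hk_approx_identity t_pos Un_tendsto) auto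
  also have "\<dots> \<le> liminf (\<lambda>n. \<integral>\<^sup>+\<omega>. ennreal ((exp (l * Xa n \<omega>) - 1) * exp (- l' * Ua n \<omega>)) \<partial>M)" by (rule nn_integral_liminf) measurable
  also have "\<dots> \<le> liminf (\<lambda>n. ennreal (l' * (\<integral>\<omega>. Ua n \<omega> \<partial>M)))" by (intro Liminf_mono always_eventually allI step)
  also have "\<dots> = ennreal (l' * (\<integral>\<omega>. U s t x \<omega> \<partial>M))"
    by (intro lim_imp_Liminf tendsto_ennrealI tendsto_intros Un_expectation) simp
  finally show ?thesis .
qed

text \<open>The mirror image, with the negative denominator starting from \<open>- 1 / l'\<close>.
  The weight \<open>exp (l * U) - 1\<close> is nonnegative and already contains the subtraction, and
  \<open>1 - exp (- l * U) \<le> l * U\<close> again brings in the mean of \<open>U\<close>.\<close>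

lemma lower_exp_moment: "(\<integral>\<^sup>+\<omega>. ennreal ((exp (l * U s t x \<omega>) - 1) * exp (- l' * X \<omega> t x)) \<partial>M) \<le> ennreal (l * (\<integral>\<omega>. U s t x \<omega> \<partial>M))"
proof -
  have l'0: "0 < l'" using l by simp
  have step: "(\<integral>\<^sup>+\<omega>. ennreal ((exp (l * Ua n \<omega>) - 1) * exp (- l' * Xa n \<omega>)) \<partial>M) \<le> ennreal (l * (\<integral>\<omega>. Ua n \<omega> \<partial>M))" for n
  proof -
    let ?W = "\<lambda>\<omega>. exp (l * Ua n \<omega>) - 1"
    have d0: "1 / l' \<le> \<bar>coefD (- 1 / l') (ee n) (t - r)\<bar>" if "r \<in> {s..t}" for r using coefD_range(2)[OF that, of n] by linarith
    have "(\<integral>\<^sup>+\<omega>. ennreal (?W \<omega> * exp (Xa n \<omega> / (- 1 / l'))) \<partial>M) \<le> (\<integral>\<^sup>+\<omega>. ennreal (?W \<omega> * exp (Ua n \<omega> / coefD (- 1 / l') (ee n) (t - s))) \<partial>M)"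
      by (rule kernel_supermartingale[OF st ee(1) _ d0]) (use l'0 l U_nonneg(2) in auto)
    also have "\<dots> \<le> (\<integral>\<^sup>+\<omega>. ennreal (l * Ua n \<omega>) \<partial>M)"
    proof (intro nn_integral_mono ennreal_leI)
      fix \<omega> assume \<omega>: "\<omega> \<in> space M"
      have c: "- 1 / l \<le> coefD (- 1 / l') (ee n) (t - s)" "coefD (- 1 / l') (ee n) (t - s) \<le> - 1 / l'" using coefD_range(2,3)[of s n] st by auto
      have u: "0 \<le> Ua n \<omega>" by (rule U_nonneg(2)[OF \<omega>])
      have neg: "coefD (- 1 / l') (ee n) (t - s) < 0" using c(2) l'0 by (simp add: le_less_trans)
      \<comment> \<open>The denominator is negative, so the comparison is made through its absolute
        value, which is at most \<open>1 / l\<close>.\<close>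
      have "Ua n \<omega> / (- coefD (- 1 / l') (ee n) (t - s)) \<ge> Ua n \<omega> / (1 / l)"
        using u c(1) neg l(1) by (intro divide_left_mono) (auto intro!: mult_pos_pos simp: minus_le_iff divide_neg_pos)
      then have "Ua n \<omega> / coefD (- 1 / l') (ee n) (t - s) \<le> - (l * Ua n \<omega>)" by (simp add: mult.commute)
      then have "?W \<omega> * exp (Ua n \<omega> / coefD (- 1 / l') (ee n) (t - s)) \<le> ?W \<omega> * exp (- (l * Ua n \<omega>))"
        using u l by (intro mult_left_mono) auto
      also have "\<dots> = 1 - exp (- (l * Ua n \<omega>))" by (simp add: left_diff_distrib exp_add[symmetric])
      also have "\<dots> \<le> l * Ua n \<omega>" using exp_ge_add_one_self[of "- (l * Ua n \<omega>)"] by linarith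
      finally show "?W \<omega> * exp (Ua n \<omega> / coefD (- 1 / l') (ee n) (t - s)) \<le> l * Ua n \<omega>" .
    qed
    also have "\<dots> = ennreal (l * (\<integral>\<omega>. Ua n \<omega> \<partial>M))"
      using nn_integral_eq_integral[OF integrable_mult_right[OF U_integrable(2)[of n], of l]] U_nonneg(2) l by (auto simp: AE_I2)
    finally show ?thesis by (simp add: mult.commute)
  qed
  have "(\<integral>\<^sup>+\<omega>. ennreal ((exp (l * U s t x \<omega>) - 1) * exp (- l' * X \<omega> t x)) \<partial>M)
     = (\<integral>\<^sup>+\<omega>. liminf (\<lambda>n. ennreal ((exp (l * Ua n \<omega>) - 1) * exp (- l' * Xa n \<omega>))) \<partial>M)"
    by (intro nn_integral_cong lim_imp_Liminf[symmetric] tendsto_ennrealI tendsto_intros hk_approx_identity t_pos Un_tendsto) auto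
  also have "\<dots> \<le> liminf (\<lambda>n. \<integral>\<^sup>+\<omega>. ennreal ((exp (l * Ua n \<omega>) - 1) * exp (- l' * Xa n \<omega>)) \<partial>M)" by (rule nn_integral_liminf) measurable
  also have "\<dots> \<le> liminf (\<lambda>n. ennreal (l * (\<integral>\<omega>. Ua n \<omega> \<partial>M)))" by (intro Liminf_mono always_eventually allI step)
  also have "\<dots> = ennreal (l * (\<integral>\<omega>. U s t x \<omega> \<partial>M))"
    by (intro lim_imp_Liminf tendsto_ennrealI tendsto_intros Un_expectation) simp
  finally show ?thesis .
qed

text \<open>Markov's inequality: on the event, the slope \<open>l' / l\<close> gives
  \<open>l * B - l' * A \<ge> l * a\<close>, so the integrand of the exponential moment is at least
  \<open>exp (l * a) - 1\<close>. The two directions differ only in the roles of \<open>X\<close>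
  and \<open>U\<close>.\<close>

proposition deviation_bounds:
  assumes a: "0 < a"
  shows "emeasure M {\<omega> \<in> space M. l' / l * U s t x \<omega> + a < X \<omega> t x} \<le> (\<integral>\<^sup>+\<omega>. ennreal (l' / (exp (l * a) - 1) * U s t x \<omega>) \<partial>M)"
    and "emeasure M {\<omega> \<in> space M. l' / l * X \<omega> t x + a < U s t x \<omega>} \<le> (\<integral>\<^sup>+\<omega>. ennreal (l' / (exp (l * a) - 1) * U s t x \<omega>) \<partial>M)"
proof -
  define c where "c = exp (l * a) - 1"
  have c: "0 < c" using a l by (simp add: c_def)
  have l'0: "0 < l'" using l by simp
  have markov: "emeasure M {\<omega> \<in> space M. l' / l * A \<omega> + a < B \<omega>} \<le> (\<integral>\<^sup>+\<omega>. ennreal (l' / c * U s t x \<omega>) \<partial>M)"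
    if [measurable]: "A \<in> borel_measurable M" "B \<in> borel_measurable M" and A0: "\<And>\<omega>. \<omega> \<in> space M \<Longrightarrow> 0 \<le> A \<omega>" and B0: "\<And>\<omega>. \<omega> \<in> space M \<Longrightarrow> 0 \<le> B \<omega>"
      and h: "(\<integral>\<^sup>+\<omega>. ennreal ((exp (l * B \<omega>) - 1) * exp (- l' * A \<omega>)) \<partial>M) \<le> ennreal (k * (\<integral>\<omega>. U s t x \<omega> \<partial>M))" and k: "k \<le> l'" for A B k
  proof -
    let ?E = "{\<omega> \<in> space M. l' / l * A \<omega> + a < B \<omega>}"
    have [measurable]: "?E \<in> sets M" by measurable
    have "ennreal c * emeasure M ?E = (\<integral>\<^sup>+\<omega>. ennreal c * indicator ?E \<omega> \<partial>M)" by (simp add: nn_integral_cmult_indicator)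
    also have "\<dots> \<le> (\<integral>\<^sup>+\<omega>. ennreal ((exp (l * B \<omega>) - 1) * exp (- l' * A \<omega>)) \<partial>M)"
    proof (intro nn_integral_mono)
      fix \<omega> assume \<omega>: "\<omega> \<in> space M"
      show "ennreal c * indicator ?E \<omega> \<le> ennreal ((exp (l * B \<omega>) - 1) * exp (- l' * A \<omega>))"
      proof (cases "\<omega> \<in> ?E")
        case True
        then have "l * (l' / l * A \<omega> + a) \<le> l * B \<omega>" using l by (intro mult_left_mono) auto
        then have "l * a \<le> l * B \<omega> - l' * A \<omega>" using l by (simp add: distrib_left)
        then have "exp (l * a) \<le> exp (l * B \<omega>) * exp (- l' * A \<omega>)" by (simp add: exp_add[symmetric])
        moreover have "exp (- l' * A \<omega>) \<le> 1" using A0[OF \<omega>] l'0 by simp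
        ultimately have "c \<le> (exp (l * B \<omega>) - 1) * exp (- l' * A \<omega>)" unfolding c_def left_diff_distrib mult_1_left by linarith
        then show ?thesis using True by (simp add: ennreal_leI)
      qed simp
    qed
    also have "\<dots> \<le> ennreal (k * (\<integral>\<omega>. U s t x \<omega> \<partial>M))" by (rule h)
    also have "\<dots> \<le> ennreal (c * (l' / c * (\<integral>\<omega>. U s t x \<omega> \<partial>M)))"
    proof (rule ennreal_leI)
      have "0 \<le> (\<integral>\<omega>. U s t x \<omega> \<partial>M)" using U_nonneg(1) by (intro integral_nonneg_AE AE_I2) auto
      then show "k * (\<integral>\<omega>. U s t x \<omega> \<partial>M) \<le> c * (l' / c * (\<integral>\<omega>. U s t x \<omega> \<partial>M))" using k c by (simp add: mult_right_mono)
    qed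
    also have "\<dots> = ennreal c * ennreal (l' / c * (\<integral>\<omega>. U s t x \<omega> \<partial>M))" using c by (simp only: ennreal_mult'[OF less_imp_le])
    also have "ennreal (l' / c * (\<integral>\<omega>. U s t x \<omega> \<partial>M)) = (\<integral>\<^sup>+\<omega>. ennreal (l' / c * U s t x \<omega>) \<partial>M)"
      using nn_integral_eq_integral[OF integrable_mult_right[OF U_integrable(1), of "l' / c"]] U_nonneg(1) l'0 c by (auto simp: AE_I2)
    finally show ?thesis using c by (subst (asm) ennreal_mult_le_mult_iff) auto
  qed
  show "emeasure M {\<omega> \<in> space M. l' / l * U s t x \<omega> + a < X \<omega> t x} \<le> (\<integral>\<^sup>+\<omega>. ennreal (l' / (exp (l * a) - 1) * U s t x \<omega>) \<partial>M)"
    unfolding c_def[symmetric] by (rule markov[OF _ _ U_nonneg(1) nonneg[OF _ t_pos] upper_exp_moment]) auto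
  show "emeasure M {\<omega> \<in> space M. l' / l * X \<omega> t x + a < U s t x \<omega>} \<le> (\<integral>\<^sup>+\<omega>. ennreal (l' / (exp (l * a) - 1) * U s t x \<omega>) \<partial>M)"
    unfolding c_def[symmetric] by (rule markov[OF _ _ nonneg[OF _ t_pos] U_nonneg(1) lower_exp_moment]) (use l in auto)
qed

end

section \<open>Extinction\<close>

text \<open>The test function is constant in space, and
  \<open>v = - 1 / ((T - s) / 2 + \<delta>)\<close> solves \<open>v' + v ^ 2 / 2 = 0\<close>
  exactly: it is the Laplace dual of the total mass, a Feller diffusion. Its terminal value is
  \<open>- 1 / \<delta>\<close>, so small \<open>\<delta>\<close> detects whether the mass is
  positive.\<close>

lemma mass_positive_bound:
  assumes T: "0 < T"
  shows "measure M {\<omega> \<in> space M. 0 < mass T \<omega>} \<le> 4 * m0 / T"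
proof -
  \<comment> \<open>Densities are available only at positive times, so the comparison starts at
    \<open>T / 2\<close>; at this time \<open>- v\<close> is below \<open>4 / T\<close>.\<close>
  define a where "a = T / 2"
  have a: "0 < a" "a < T" "0 < T - a" using T by (simp_all add: a_def)
  have [measurable]: "mass T \<in> borel_measurable M" using mass_integrable[OF T] by simp
  let ?D = "\<lambda>n s. (T - s) / 2 + ee n"
  have bound: "(\<integral>\<omega>. 1 - exp (- (mass T \<omega> / ee n)) \<partial>M) \<le> 4 * m0 / T" for n
  proof -
    define \<delta> where "\<delta> = ee n"
    have \<delta>: "0 < \<delta>" using ee by (simp add: \<delta>_def)
    define v where "v s = - 1 / ((T - s) / 2 + \<delta>)" for s
    define vd where "vd s = - (1 / 2) / ((T - s) / 2 + \<delta>)\<^sup>2" for s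
    have D: "\<delta> \<le> (T - s) / 2 + \<delta>" "0 < (T - s) / 2 + \<delta>" if "s \<in> {a..T}" for s
    proof -
      have "0 \<le> (T - s) / 2" using that by simp
      then show "\<delta> \<le> (T - s) / 2 + \<delta>" "0 < (T - s) / 2 + \<delta>" using \<delta> by linarith+
    qed
    have b1: "\<bar>v s\<bar> \<le> 1 / \<delta>" if "s \<in> {a..T}" for s
    proof -
      have "\<bar>v s\<bar> = 1 / ((T - s) / 2 + \<delta>)" unfolding v_def using D[OF that] by (simp add: abs_divide)
      also have "\<dots> \<le> 1 / \<delta>" by (rule divide_left_mono) (use D[OF that] \<delta> in auto)
      finally show ?thesis .
    qed
    have b2: "\<bar>vd s\<bar> \<le> (1 / \<delta>)\<^sup>2" if "s \<in> {a..T}" for s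
    proof -
      have "\<bar>vd s\<bar> = (v s)\<^sup>2 / 2" unfolding v_def vd_def by (simp add: power_divide)
      also have "\<dots> \<le> \<bar>v s\<bar>\<^sup>2" by simp
      also have "\<dots> \<le> (1 / \<delta>)\<^sup>2" by (intro power_mono b1 that) simp
      finally show ?thesis .
    qed
    have tt: "time_test a T (\<lambda>s x. v s) (\<lambda>s x. 0) (\<lambda>s x. 0) (\<lambda>s x. vd s) (1 / \<delta> + (1 / \<delta>)\<^sup>2)"
      unfolding time_test_def
    proof (intro conjI ballI allI)
      fix s assume s: "s \<in> {a..T}"
      show "test_fun (\<lambda>x. v s) (\<lambda>x. 0) (\<lambda>x. 0)" unfolding test_fun_def by auto
      show "(\<lambda>x. vd s) \<in> borel_measurable borel" by simp
      fix x :: real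
      have "0 \<le> 1 / \<delta>" "0 \<le> (1 / \<delta>)\<^sup>2" using \<delta> by auto
      then show "\<bar>v s\<bar> \<le> 1 / \<delta> + (1 / \<delta>)\<^sup>2" "\<bar>0::real\<bar> \<le> 1 / \<delta> + (1 / \<delta>)\<^sup>2" "\<bar>vd s\<bar> \<le> 1 / \<delta> + (1 / \<delta>)\<^sup>2"
        using b1[OF s] b2[OF s] by linarith+
      have n0: "(T - s) / 2 + \<delta> \<noteq> 0" using D(2)[OF s] by linarith
      have "((\<lambda>s. (T - s) / 2 + \<delta>) has_real_derivative - 1 / 2) (at s within {a..T})" by (auto intro!: derivative_eq_intros)
      from DERIV_divide[OF DERIV_const[of "- 1"] this n0]
      show "(v has_real_derivative vd s) (at s within {a..T})" unfolding v_def[abs_def] vd_def by (simp add: power2_eq_square)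
    qed auto
    have "(\<integral>\<omega>. exp (J a (\<lambda>x. v a) \<omega>) \<partial>M) \<le> (\<integral>\<omega>. exp (J T (\<lambda>x. v T) \<omega>) \<partial>M)"
    proof (rule exp_submartingale[OF a(1,2) tt])
      show "0 \<le> vd s + 0 / 2 + (v s)\<^sup>2 / 2" for s unfolding v_def vd_def by (simp add: power_divide)
      show "v s \<le> 0" if "s \<in> {a..T}" for s unfolding v_def using D(2)[OF that] by (simp add: divide_nonpos_pos)
    qed
    moreover have "J t (\<lambda>x. v t) \<omega> = v t * mass t \<omega>" for t \<omega> using J_cmult[of \<omega> t "v t" "\<lambda>_. 1"] by simp
    ultimately have "(\<integral>\<omega>. exp (v a * mass a \<omega>) \<partial>M) \<le> (\<integral>\<omega>. exp (v T * mass T \<omega>) \<partial>M)" by (simp only:)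
    moreover have "v T * r = - (r / \<delta>)" for r by (simp add: v_def)
    ultimately have E: "(\<integral>\<omega>. exp (v a * mass a \<omega>) \<partial>M) \<le> (\<integral>\<omega>. exp (- (mass T \<omega> / \<delta>)) \<partial>M)" by (simp only:)
    have [measurable]: "mass a \<in> borel_measurable M" using mass_integrable[OF a(1)] by simp
    have va: "v a \<le> 0" unfolding v_def using a \<delta> by (simp add: divide_nonpos_pos)
    have i1: "integrable M (\<lambda>\<omega>. exp (v a * mass a \<omega>))"
      by (rule Bochner_Integration.integrable_bound[of M "\<lambda>_. 1 :: real"]) (use mass_nonneg[OF _ a(1)] va in \<open>auto intro!: AE_I2 simp: mult_nonpos_nonneg\<close>)
    have i2: "integrable M (\<lambda>\<omega>. exp (- (mass T \<omega> / \<delta>)))"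
      by (rule Bochner_Integration.integrable_bound[of M "\<lambda>_. 1 :: real"]) (use mass_nonneg[OF _ T] \<delta> in \<open>auto intro!: AE_I2\<close>)
    have "(\<integral>\<omega>. 1 - exp (- (mass T \<omega> / \<delta>)) \<partial>M) = 1 - (\<integral>\<omega>. exp (- (mass T \<omega> / \<delta>)) \<partial>M)" using i2 by (simp add: prob_space)
    also have "\<dots> \<le> 1 - (\<integral>\<omega>. exp (v a * mass a \<omega>) \<partial>M)" using E by simp
    also have "\<dots> = (\<integral>\<omega>. 1 - exp (v a * mass a \<omega>) \<partial>M)" using i1 by (simp add: prob_space)
    also have "\<dots> \<le> (\<integral>\<omega>. - v a * mass a \<omega> \<partial>M)"
    proof (intro integral_mono Bochner_Integration.integrable_diff i1 integrable_mult_right mass_integrable a)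
      show "1 - exp (v a * mass a \<omega>) \<le> - v a * mass a \<omega>" for \<omega>
        using exp_ge_add_one_self[of "v a * mass a \<omega>"] by linarith
    qed auto
    also have "\<dots> = - v a * m0" using mass_expectation[OF a(1)] by simp
    also have "- v a \<le> 4 / T"
    proof -
      have "- v a = 1 / (T / 4 + \<delta>)"
      proof -
        have "(T - T / 2) / 2 = T / 4" by simp
        then show ?thesis unfolding v_def a_def by simp
      qed
      also have "\<dots> \<le> 1 / (T / 4)" using T \<delta> by (intro divide_left_mono) auto
      finally show ?thesis by simp
    qed
    then have "- v a * m0 \<le> 4 / T * m0" by (rule mult_right_mono) simp
    finally show ?thesis unfolding \<delta>_def by simp
  qed
  have "(\<lambda>n. \<integral>\<omega>. 1 - exp (- (mass T \<omega> / ee n)) \<partial>M) \<longlonglongrightarrow> (\<integral>\<omega>. indicat_real {\<omega> \<in> space M. 0 < mass T \<omega>} \<omega> \<partial>M)"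
  proof (rule integral_dominated_convergence[where w = "\<lambda>_. 1"])
    show "AE \<omega> in M. (\<lambda>n. 1 - exp (- (mass T \<omega> / ee n))) \<longlonglongrightarrow> indicat_real {\<omega> \<in> space M. 0 < mass T \<omega>} \<omega>"
    proof (intro AE_I2)
      fix \<omega> assume \<omega>: "\<omega> \<in> space M"
      show "(\<lambda>n. 1 - exp (- (mass T \<omega> / ee n))) \<longlonglongrightarrow> indicat_real {\<omega> \<in> space M. 0 < mass T \<omega>} \<omega>"
      proof (cases "mass T \<omega> = 0")
        case False
        then have p: "0 < mass T \<omega>" using mass_nonneg[OF \<omega> T] by linarith
        have "(\<lambda>n. 1 - exp (- (mass T \<omega> / ee n))) \<longlonglongrightarrow> 1"
        proof -
          have "(\<lambda>n. 1 - exp (- (c * real (Suc n)))) \<longlonglongrightarrow> 1" if "0 < c" for c :: real using that by real_asymp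
          from this[OF p] show ?thesis by (simp add: ee_def divide_inverse)
        qed
        then show ?thesis using p \<omega> by simp
      qed simp
    qed
    show "AE \<omega> in M. norm (1 - exp (- (mass T \<omega> / ee n))) \<le> 1" for n
      using mass_nonneg[OF _ T] ee(1)[of n] by (intro AE_I2) simp
  qed auto
  then have "(\<integral>\<omega>. indicat_real {\<omega> \<in> space M. 0 < mass T \<omega>} \<omega> \<partial>M) \<le> 4 * m0 / T"
    by (rule LIMSEQ_le_const2) (use bound in blast)
  then show ?thesis by simp
qed

lemma mass_zero_imp_zero:
  assumes \<omega>: "\<omega> \<in> space M" and t: "0 < t" and z: "mass t \<omega> = 0"
  shows "X \<omega> t x = 0"
proof -
  have "J t (\<lambda>y. hk (ee n) (x - y)) \<omega> = 0" for n
    using J_bound[OF \<omega> t hk_measurable hk_abs_le[OF ee(1)[of n] order_refl], of x] z by simp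
  then show ?thesis using LIMSEQ_unique[OF hk_approx_identity[OF \<omega> t, of x]] by auto
qed

text \<open>A nonnegative martingale at zero stays there: weighted by the indicator of extinction at
  \<open>T\<close>, the mass at any later time has mean zero. Countably many rational times are
  treated together, and continuity of the density covers the others.\<close>

lemma extinct_absorbing:
  assumes T: "0 < T"
  shows "AE \<omega> in M. mass T \<omega> = 0 \<longrightarrow> (\<forall>t\<ge>T. \<forall>x. X \<omega> t x = 0)"
proof -
  have [measurable]: "mass T \<in> borel_measurable (F T)" by (rule J_measurable_F[OF T]) simp
  define V where "V = indicat_real {\<omega> \<in> space (F T). mass T \<omega> = 0}"
  have VF: "V \<in> borel_measurable (F T)" unfolding V_def by measurable
  have Vb: "\<bar>V \<omega>\<bar> \<le> 1" for \<omega> by (simp add: V_def indicator_def)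
  have q: "AE \<omega> in M. mass T \<omega> = 0 \<longrightarrow> mass t \<omega> = 0" if t: "T \<le> t" for t
  proof -
    have t0: "0 < t" using t T by simp
    have i: "integrable M (\<lambda>\<omega>. V \<omega> * mass u \<omega>)" if "0 < u" for u
      by (rule integrable_bdd_mult[OF mass_integrable[OF that] F_M[OF VF] Vb])
    have iV: "integrable M V" using integrable_bdd_mult[OF _ F_M[OF VF] Vb, of "\<lambda>_. 1"] by simp
    have "(\<integral>\<omega>. V \<omega> * Y (\<lambda>_. 1) (\<lambda>_. 0) t \<omega> \<partial>M) = (\<integral>\<omega>. V \<omega> * Y (\<lambda>_. 1) (\<lambda>_. 0) T \<omega> \<partial>M)"
      by (rule cont_martingale_expectation(2)[OF mart1[OF test_fun_1] _ t VF]) (use T t i[OF t0] iV in \<open>auto simp: sbm_mart_1 right_diff_distrib\<close>)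
    then have "(\<integral>\<omega>. V \<omega> * mass t \<omega> \<partial>M) = (\<integral>\<omega>. V \<omega> * mass T \<omega> \<partial>M)"
      using T t0 i[OF t0] i[OF T] iV by (simp add: sbm_mart_1 right_diff_distrib)
    also have "(\<lambda>\<omega>. V \<omega> * mass T \<omega>) = (\<lambda>_. 0)" by (auto simp: V_def indicator_def)
    finally have "(\<integral>\<omega>. V \<omega> * mass t \<omega> \<partial>M) = 0" by simp
    moreover have "AE \<omega> in M. 0 \<le> V \<omega> * mass t \<omega>" using mass_nonneg[OF _ t0] by (intro AE_I2) (simp add: V_def)
    ultimately have "AE \<omega> in M. V \<omega> * mass t \<omega> = 0" using integral_nonneg_eq_0_iff_AE[OF i[OF t0]] by blast
    then show ?thesis using AE_space by eventually_elim (auto simp: V_def)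
  qed
  have "AE \<omega> in M. \<forall>q\<in>{q\<in>\<rat>. T \<le> q}. mass T \<omega> = 0 \<longrightarrow> mass q \<omega> = 0"
    by (subst AE_ball_countable) (use q countable_rat in \<open>auto intro: countable_subset\<close>)
  then show ?thesis using AE_space
  proof eventually_elim
    fix \<omega> assume h: "\<forall>q\<in>{q\<in>\<rat>. T \<le> q}. mass T \<omega> = 0 \<longrightarrow> mass q \<omega> = 0" and \<omega>: "\<omega> \<in> space M"
    show "mass T \<omega> = 0 \<longrightarrow> (\<forall>t\<ge>T. \<forall>x. X \<omega> t x = 0)"
    proof (intro impI allI)
      fix t x assume z: "mass T \<omega> = 0" and t: "T \<le> t"
      \<comment> \<open>Rounding up gives rational times not before \<open>t\<close>, where the mass
        is already known to vanish.\<close>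
      let ?q = "\<lambda>n. of_int \<lceil>real (Suc n) * t\<rceil> / real (Suc n)"
      have qt: "t \<le> ?q n" for n
        using le_of_int_ceiling[of "real (Suc n) * t"] by (simp add: pos_le_divide_eq mult.commute del: of_nat_Suc)
      have X0: "X \<omega> (?q n) x = 0" for n
      proof (rule mass_zero_imp_zero[OF \<omega>])
        show "0 < ?q n" using qt[of n] t T by linarith
        have "?q n \<in> {q\<in>\<rat>. T \<le> q}" using order_trans[OF t qt[of n]] by (simp del: of_nat_Suc)
        then show "mass (?q n) \<omega> = 0" using h z by blast
      qed
      have "(\<lambda>n. (\<lambda>(t, x). X \<omega> t x) (?q n, x)) \<longlonglongrightarrow> (\<lambda>(t, x). X \<omega> t x) (t, x)"
      proof (rule continuous_on_tendsto_compose[OF cont[OF \<omega>]])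
        show "(\<lambda>n. (?q n, x)) \<longlonglongrightarrow> (t, x)" by (intro tendsto_Pair LIMSEQ_ceiling_grid tendsto_const)
        show "(t, x) \<in> {0<..} \<times> UNIV" using t T by auto
        have "0 < ?q n" for n using qt[of n] t T by linarith
        then show "\<forall>\<^sub>F n in sequentially. (?q n, x) \<in> {0<..} \<times> UNIV" by auto
      qed
      then have "(\<lambda>n. 0) \<longlonglongrightarrow> X \<omega> t x" using X0 by (simp del: of_nat_Suc)
      then show "X \<omega> t x = 0" using LIMSEQ_unique tendsto_const by blast
    qed
  qed
qed

proposition extinction: "AE \<omega> in M. \<exists>N::nat. 0 < N \<and> mass (real N) \<omega> = 0"
proof -
  have [measurable]: "mass (real (Suc n)) \<in> borel_measurable M" for n by (rule J_measurable) auto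
  let ?A = "\<Inter>n. {\<omega> \<in> space M. 0 < mass (real (Suc n)) \<omega>}"
  have A: "?A \<in> sets M" by measurable
  have "measure M ?A \<le> 4 * m0 / real (Suc n)" for n
    by (rule order_trans[OF finite_measure_mono mass_positive_bound]) auto
  moreover have "(\<lambda>n. 4 * m0 / real (Suc n)) \<longlonglongrightarrow> 0" by real_asymp
  ultimately have "measure M ?A \<le> 0" by (intro LIMSEQ_le_const) auto
  then have "emeasure M ?A = 0" by (simp add: emeasure_eq_measure measure_le_0_iff)
  then have "AE \<omega> in M. \<omega> \<notin> ?A" using A by (intro AE_not_in) (auto simp: null_sets_def)
  then show ?thesis using AE_space
  proof eventually_elim
    fix \<omega> assume "\<omega> \<notin> ?A" "\<omega> \<in> space M"
    then obtain n where "\<not> 0 < mass (real (Suc n)) \<omega>" by auto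
    moreover have "0 \<le> mass (real (Suc n)) \<omega>" by (rule mass_nonneg) (use \<open>\<omega> \<in> space M\<close> in auto)
    ultimately show "\<exists>N::nat. 0 < N \<and> mass (real N) \<omega> = 0" by (intro exI[of _ "Suc n"]) auto
  qed
qed

end

section \<open>Deviations on dyadic grids\<close>

lemma hk_scale: "0 < r \<Longrightarrow> hk (\<tau> * r\<^sup>2) (r * z) = hk \<tau> z / r"
proof -
  assume r: "0 < r"
  have "sqrt (2 * pi * (\<tau> * r\<^sup>2)) = sqrt (2 * pi * \<tau>) * r"
    using r real_sqrt_mult[of "2 * pi * \<tau>" "r\<^sup>2"] by (simp add: mult.assoc)
  moreover have "(r * z)\<^sup>2 / (2 * (\<tau> * r\<^sup>2)) = z\<^sup>2 / (2 * \<tau>)" using r by (simp add: power_mult_distrib)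
  ultimately show ?thesis unfolding hk_def by (simp add: minus_divide_left[symmetric])
qed

lemma hk_even: "hk \<tau> (- z) = hk \<tau> z"
  unfolding hk_def by simp

lemma hk_le_rational:
  assumes "1 \<le> \<tau>"
  shows "hk \<tau> z \<le> 2 * \<tau> / (1 + z\<^sup>2)"
proof -
  have "1 \<le> sqrt (2 * pi * \<tau>)"
  proof (rule real_le_rsqrt)
    have "1 * 1 \<le> (2 * pi) * \<tau>" using assms pi_gt3 by (intro mult_mono) auto
    then show "1\<^sup>2 \<le> 2 * pi * \<tau>" by simp
  qed
  then have "hk \<tau> z \<le> exp (- z\<^sup>2 / (2 * \<tau>)) / 1" unfolding hk_def by (intro divide_left_mono) auto
  also have "\<dots> = 1 / exp (z\<^sup>2 / (2 * \<tau>))" by (simp add: exp_minus inverse_eq_divide)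
  also have "\<dots> \<le> 1 / ((1 + z\<^sup>2) / (2 * \<tau>))"
  proof (intro divide_left_mono)
    have "(1 + z\<^sup>2) / (2 * \<tau>) \<le> 1 + z\<^sup>2 / (2 * \<tau>)" using assms by (simp add: add_divide_distrib)
    also have "\<dots> \<le> exp (z\<^sup>2 / (2 * \<tau>))" by (rule exp_ge_add_one_self)
    finally show "(1 + z\<^sup>2) / (2 * \<tau>) \<le> exp (z\<^sup>2 / (2 * \<tau>))" .
    have "0 < 1 + z\<^sup>2" by (rule add_pos_nonneg) auto
    then show "0 < exp (z\<^sup>2 / (2 * \<tau>)) * ((1 + z\<^sup>2) / (2 * \<tau>))" using assms by simp
  qed simp
  finally show ?thesis by simp
qed

text \<open>Comparison with the increments of \<open>3 arctan\<close> makes the sum telescope, uniformly in the shift.\<close>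
lemma rational_le_arctan: "1 / (1 + z\<^sup>2) \<le> 3 * (arctan (z + 1) - arctan z)"
proof -
  obtain w where w: "z < w" "w < z + 1" and eq: "arctan (z + 1) - arctan z = (z + 1 - z) * inverse (1 + w\<^sup>2)"
    using MVT2[of z "z + 1" arctan "\<lambda>w. inverse (1 + w\<^sup>2)"] by (auto intro: DERIV_arctan)
  have "\<bar>w\<bar> \<le> \<bar>z\<bar> + 1" using w by auto
  then have "w\<^sup>2 \<le> (\<bar>z\<bar> + 1)\<^sup>2" by (metis abs_ge_zero power2_abs power_mono)
  also have "\<dots> \<le> 2 * z\<^sup>2 + 2"
    using sum_squares_ge_zero[of "\<bar>z\<bar> - 1" 0] by (simp add: power2_eq_square algebra_simps)
  finally have le: "1 + w\<^sup>2 \<le> 3 * (1 + z\<^sup>2)" using zero_le_power2[of z] by argo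
  have pos: "0 < 1 + w\<^sup>2" "0 < 1 + z\<^sup>2" by (auto intro: add_pos_nonneg)
  have "1 / (1 + z\<^sup>2) = 3 * (1 / (3 * (1 + z\<^sup>2)))"
  proof -
    have "1 / q = 3 * (1 / (3 * q))" for q :: real by simp
    then show ?thesis .
  qed
  also have "\<dots> \<le> 3 * (1 / (1 + w\<^sup>2))" using le pos by (intro mult_left_mono divide_left_mono) auto
  finally show ?thesis unfolding eq by (simp add: inverse_eq_divide)
qed

lemma hk_sum_bound:
  assumes "1 \<le> \<tau>"
  shows "(\<Sum>l<L. hk \<tau> (real l - \<theta>)) \<le> 24 * \<tau>"
proof -
  have "(\<Sum>l<L. hk \<tau> (real l - \<theta>)) \<le> (\<Sum>l<L. 2 * \<tau> * (3 * (arctan (real (Suc l) - \<theta>) - arctan (real l - \<theta>))))"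
  proof (rule sum_mono)
    fix l
    have "hk \<tau> (real l - \<theta>) \<le> 2 * \<tau> * (1 / (1 + (real l - \<theta>)\<^sup>2))" using hk_le_rational[OF assms] by simp
    also have "\<dots> \<le> 2 * \<tau> * (3 * (arctan (real l - \<theta> + 1) - arctan (real l - \<theta>)))"
      using assms by (intro mult_left_mono rational_le_arctan) auto
    finally show "hk \<tau> (real l - \<theta>) \<le> 2 * \<tau> * (3 * (arctan (real (Suc l) - \<theta>) - arctan (real l - \<theta>)))"
      by (simp add: add.commute add_diff_eq)
  qed
  also have "\<dots> = 6 * \<tau> * (arctan (real L - \<theta>) - arctan (- \<theta>))"
    unfolding sum_distrib_left[symmetric] by (subst sum_lessThan_telescope) simp
  \<comment> \<open>\<open>arctan\<close> varies by less than pi, hence by less than 4, over the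
    whole line; this is the source of the constant 24 below.\<close>
  also have "\<dots> \<le> 6 * \<tau> * 4"
    using assms arctan_ubound[of "real L - \<theta>"] arctan_lbound[of "- \<theta>"] pi_less_4 by (intro mult_left_mono) auto
  finally show ?thesis by simp
qed

text \<open>Lengths are measured in units of \<open>r\<close>. With a variance of about
  \<open>b ^ 4\<close>, a unit shift changes the exponent by about
  \<open>\<bar>z\<bar> / b ^ 4\<close>, which is at most \<open>1 / b\<close> up to
  \<open>\<bar>z\<bar> = b ^ 3\<close>; there the exponent costs \<open>3 / b\<close> altogether and
  the normalising factor another \<open>1 / b\<close>. Farther out the kernel itself is at most
  \<open>exp (- b ^ 2 / 4)\<close>.\<close>

lemma hk_unit_compare:
  fixes b \<tau> \<tau>' z e :: real
  assumes b: "2 \<le> b" and \<tau>: "b ^ 4 \<le> \<tau>" "\<tau> \<le> b ^ 4 + 3" and \<tau>': "b ^ 4 \<le> \<tau>'" "\<tau>' \<le> b ^ 4 + 3" and e: "\<bar>e\<bar> \<le> 1"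
  shows "hk \<tau>' (z + e) \<le> exp (4 / b) * hk \<tau> z + exp (- b\<^sup>2 / 4)"
proof -
  have b0: "0 < b" using b by simp
  have b4: "0 < b ^ 4" using b0 by simp
  have t: "0 < \<tau>" "0 < \<tau>'" using \<tau> \<tau>' b4 by linarith+
  have b2: "4 \<le> b\<^sup>2" using mult_mono[of 2 b 2 b] b by (simp add: power2_eq_square)
  have b3: "8 \<le> b ^ 3" using mult_mono[of 4 "b\<^sup>2" 2 b] b2 b by (simp add: power3_eq_cube power2_eq_square)
  show ?thesis
  proof (cases "\<bar>z\<bar> \<le> b ^ 3")
    case True
    have "z\<^sup>2 / (2 * \<tau>) - (z + e)\<^sup>2 / (2 * \<tau>') \<le> 3 / b"
    proof -
      have z2: "z\<^sup>2 \<le> (b ^ 3)\<^sup>2" using True b0 by (metis abs_ge_zero power2_abs power_mono)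
      have eq: "z\<^sup>2 / (2 * \<tau>) - (z + e)\<^sup>2 / (2 * \<tau>') = z\<^sup>2 * ((\<tau>' - \<tau>) / (2 * \<tau> * \<tau>')) - (2 * z * e + e\<^sup>2) / (2 * \<tau>')"
        using t by (simp add: power2_eq_square field_simps)
      have "z\<^sup>2 * ((\<tau>' - \<tau>) / (2 * \<tau> * \<tau>')) \<le> (b ^ 3)\<^sup>2 * (3 / (2 * b ^ 4 * b ^ 4))"
      proof (rule order_trans[OF mult_left_mono mult_right_mono[OF z2]])
        have "(\<tau>' - \<tau>) / (2 * \<tau> * \<tau>') \<le> 3 / (2 * \<tau> * \<tau>')" using t \<tau> \<tau>' by (intro divide_right_mono) auto
        also have "\<dots> \<le> 3 / (2 * b ^ 4 * b ^ 4)" using \<tau> \<tau>' b4 t by (intro divide_left_mono mult_mono mult_pos_pos) auto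
        finally show "(\<tau>' - \<tau>) / (2 * \<tau> * \<tau>') \<le> 3 / (2 * b ^ 4 * b ^ 4)" .
      qed (use b0 in auto)
      also have "(b ^ 3)\<^sup>2 * (3 / (2 * b ^ 4 * b ^ 4)) = 3 / 2 / b\<^sup>2"
        using b0 by (simp add: field_simps eval_nat_numeral)
      also have "3 / 2 / b\<^sup>2 \<le> 2 / b"
        using b b0 by (simp add: power2_eq_square field_simps)
      finally have h1: "z\<^sup>2 * ((\<tau>' - \<tau>) / (2 * \<tau> * \<tau>')) \<le> 2 / b" .
      have h2: "- ((2 * z * e + e\<^sup>2) / (2 * \<tau>')) \<le> 1 / b"
      proof -
        have "- (2 * z * e + e\<^sup>2) \<le> 2 * \<bar>z\<bar> * \<bar>e\<bar>"
        proof -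
          have "- (z * e) \<le> \<bar>z\<bar> * \<bar>e\<bar>" using abs_ge_minus_self[of "z * e"] by (simp add: abs_mult)
          then have "- (2 * z * e + q) \<le> 2 * \<bar>z\<bar> * \<bar>e\<bar>" if "0 \<le> q" for q using that by simp
          from this[OF zero_le_power2] show ?thesis .
        qed
        also have "\<dots> \<le> 2 * b ^ 3 * 1" using True e b0 by (intro mult_mono) auto
        finally have "- (2 * z * e + e\<^sup>2) / (2 * \<tau>') \<le> (2 * b ^ 3) / (2 * \<tau>')" using t by (intro divide_right_mono) auto
        also have "\<dots> \<le> (2 * b ^ 3) / (2 * b ^ 4)" using \<tau>' b4 b0 t by (intro divide_left_mono) auto
        also have "\<dots> = 1 / b" using b0 by (simp add: eval_nat_numeral)
        finally show ?thesis unfolding minus_divide_left .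
      qed
      have "p - q \<le> 3 / b" if "p \<le> 2 / b" "- q \<le> 1 / b" for p q using that by (simp add: field_simps)
      from this[OF h1 h2] show ?thesis unfolding eq .
    qed
    moreover have "- (z + e)\<^sup>2 / (2 * \<tau>') = (z\<^sup>2 / (2 * \<tau>) - (z + e)\<^sup>2 / (2 * \<tau>')) + - z\<^sup>2 / (2 * \<tau>)" by (simp add: minus_divide_left[symmetric])
    ultimately have E: "exp (- (z + e)\<^sup>2 / (2 * \<tau>')) \<le> exp (3 / b) * exp (- z\<^sup>2 / (2 * \<tau>))"
      unfolding exp_add[symmetric] by simp
    have S: "sqrt (2 * pi * \<tau>) \<le> exp (1 / b) * sqrt (2 * pi * \<tau>')"
    proof -
      have "2 * pi * \<tau> \<le> (exp (1 / b))\<^sup>2 * (2 * pi * \<tau>')"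
      proof -
        have "\<tau> \<le> b ^ 4 + 3" by (rule \<tau>)
        also have "\<dots> \<le> (1 + 2 / b) * b ^ 4"
        proof -
          have "3 \<le> 2 * b ^ 3" using b3 by linarith
          then show ?thesis using b0 by (simp add: distrib_right eval_nat_numeral)
        qed
        also have "\<dots> \<le> exp (2 / b) * \<tau>'" using \<tau>' b4 b0 exp_ge_add_one_self[of "2 / b"] by (intro mult_mono) auto
        also have "exp (2 / b) = (exp (1 / b))\<^sup>2" by (simp add: power2_eq_square exp_add[symmetric])
        finally show ?thesis by (simp add: mult.left_commute)
      qed
      then have "sqrt (2 * pi * \<tau>) \<le> sqrt ((exp (1 / b))\<^sup>2 * (2 * pi * \<tau>'))" by (rule real_sqrt_le_mono)
      then show ?thesis by (simp add: real_sqrt_mult)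
    qed
    have pos: "0 < sqrt (2 * pi * \<tau>)" "0 < sqrt (2 * pi * \<tau>')" using t by auto
    have "1 / sqrt (2 * pi * \<tau>') \<le> exp (1 / b) / sqrt (2 * pi * \<tau>)"
      using S pos by (simp add: pos_divide_le_eq pos_le_divide_eq)
    then have "exp (- (z + e)\<^sup>2 / (2 * \<tau>')) * (1 / sqrt (2 * pi * \<tau>')) \<le> (exp (3 / b) * exp (- z\<^sup>2 / (2 * \<tau>))) * (exp (1 / b) / sqrt (2 * pi * \<tau>))"
      using E pos by (intro mult_mono) auto
    also have "\<dots> = exp (3 / b + 1 / b) * hk \<tau> z" unfolding hk_def exp_add by simp
    also have "3 / b + 1 / b = 4 / b" by (simp add: add_divide_distrib[symmetric])
    finally show ?thesis unfolding hk_def by (simp add: add_increasing2)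
  next
    case False
    \<comment> \<open>After the shift the square is still at least \<open>b ^ 2 / 2\<close> times
      the largest admissible variance \<open>b ^ 4 + 3\<close>.\<close>
    have "b ^ 3 - 1 \<le> \<bar>z + e\<bar>" using False e by linarith
    then have "(b ^ 3 - 1)\<^sup>2 \<le> (z + e)\<^sup>2" using b3 by (metis abs_le_square_iff abs_of_nonneg diff_ge_0_iff_ge order_trans one_le_numeral)
    moreover have "b\<^sup>2 / 4 * (2 * (b ^ 4 + 3)) \<le> (b ^ 3 - 1)\<^sup>2"
    proof -
      have "8 * b ^ 3 \<le> b ^ 3 * b ^ 3" using b3 b0 by (intro mult_right_mono) auto
      moreover have "2 * b\<^sup>2 \<le> b ^ 3" using mult_right_mono[OF b, of "b\<^sup>2"] by (simp add: power3_eq_cube power2_eq_square)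
      moreover have "(b ^ 3 - 1)\<^sup>2 = b ^ 3 * b ^ 3 - 2 * b ^ 3 + 1" by (simp add: power2_eq_square algebra_simps)
      moreover have "b\<^sup>2 / 4 * (2 * (b ^ 4 + 3)) = (b ^ 3 * b ^ 3) / 2 + 3 / 2 * b\<^sup>2" by (simp add: algebra_simps eval_nat_numeral)
      ultimately show ?thesis using b2 b3 by linarith
    qed
    ultimately have A: "b\<^sup>2 / 4 * (2 * (b ^ 4 + 3)) \<le> (z + e)\<^sup>2" by linarith
    have "b\<^sup>2 / 4 * (2 * \<tau>') \<le> b\<^sup>2 / 4 * (2 * (b ^ 4 + 3))" using \<tau>' by (intro mult_left_mono) auto
    then have "b\<^sup>2 / 4 * (2 * \<tau>') \<le> (z + e)\<^sup>2" using A by (rule order_trans)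
    then have "b\<^sup>2 / 4 \<le> (z + e)\<^sup>2 / (2 * \<tau>')" using t by (subst pos_le_divide_eq) auto
    then have "exp (- (z + e)\<^sup>2 / (2 * \<tau>')) \<le> exp (- b\<^sup>2 / 4)" by (simp add: minus_divide_left[symmetric])
    moreover have "hk \<tau>' (z + e) \<le> exp (- (z + e)\<^sup>2 / (2 * \<tau>')) / 1"
    proof -
      have "1 * 1 \<le> (2 * pi) * \<tau>'" using \<tau>' b3 b pi_gt3 self_le_power[of b 4] by (intro mult_mono) auto
      then have "1 \<le> sqrt (2 * pi * \<tau>')" by (intro real_le_rsqrt) simp
      then show ?thesis unfolding hk_def by (intro divide_left_mono) auto
    qed
    ultimately have "hk \<tau>' (z + e) \<le> exp (- b\<^sup>2 / 4)" by linarith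
    moreover have "0 \<le> exp (4 / b) * hk \<tau> z" using hk_pos[OF t(1), of z] by simp
    ultimately show ?thesis by linarith
  qed
qed

section \<open>Spatial sums and exceptional grid points\<close>

context sbm_process
begin

lemma hk_scaled_sum:
  assumes r: "0 < r" and \<tau>: "1 \<le> \<tau>" and \<sigma>: "\<sigma> \<in> {1, - 1}"
  shows "(\<Sum>l<L. hk (\<tau> * r\<^sup>2) (\<sigma> * real l * r - y)) \<le> 24 * \<tau> / r"
proof -
  have "hk (\<tau> * r\<^sup>2) (\<sigma> * real l * r - y) = hk \<tau> (real l - \<sigma> * (y / r)) / r" for l
  proof -
    have "hk (\<tau> * r\<^sup>2) (\<sigma> * real l * r - y) = hk \<tau> (\<sigma> * real l - y / r) / r"
      using hk_scale[OF r, of \<tau> "\<sigma> * real l - y / r"] r by (simp add: right_diff_distrib mult.commute)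
    moreover have "hk \<tau> (\<sigma> * real l - y / r) = hk \<tau> (real l - \<sigma> * (y / r))"
      using \<sigma> hk_even[of \<tau> "real l + y / r"] by (auto simp: add.commute)
    ultimately show ?thesis by simp
  qed
  then have "(\<Sum>l<L. hk (\<tau> * r\<^sup>2) (\<sigma> * real l * r - y)) = (\<Sum>l<L. hk \<tau> (real l - \<sigma> * (y / r))) / r"
    by (simp add: sum_divide_distrib)
  also have "\<dots> \<le> 24 * \<tau> / r" using r by (intro divide_right_mono hk_sum_bound \<tau>) simp
  finally show ?thesis .
qed

text \<open>Summing the kernels before pairing gives one bounded test function, with a bound
  independent of the number of points, so the spatial sum costs no more than the total mass.\<close>

lemma U_sum_bound:
  assumes \<omega>: "\<omega> \<in> space M" and s: "0 < s" "t = s + \<tau> * r\<^sup>2" and r: "0 < r" and \<tau>: "1 \<le> \<tau>" and \<sigma>: "\<sigma> \<in> {1, - 1}"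
  shows "(\<Sum>l<L. U s t (\<sigma> * real l * r) \<omega>) \<le> 24 * \<tau> / r * mass s \<omega>"
proof -
  have ts: "t - s = \<tau> * r\<^sup>2" "0 < \<tau> * r\<^sup>2" using s r \<tau> by auto
  note hb = hk_abs_le[OF ts(2) order_refl]
  have "(\<Sum>l<L. U s t (\<sigma> * real l * r) \<omega>) = J s (\<lambda>y. \<Sum>l<L. hk (\<tau> * r\<^sup>2) (\<sigma> * real l * r - y)) \<omega>"
    unfolding U_def pair_dens_def ts sum_distrib_left
    by (rule Bochner_Integration.integral_sum[symmetric]) (intro integ_mult[OF \<omega> s(1) hk_measurable hb])
  also have "\<dots> \<le> 24 * \<tau> / r * mass s \<omega>"
  proof (rule order_trans[OF abs_ge_self J_bound[OF \<omega> s(1)]])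
    fix y
    have "0 \<le> (\<Sum>l<L. hk (\<tau> * r\<^sup>2) (\<sigma> * real l * r - y))" by (intro sum_nonneg less_imp_le[OF hk_pos] ts)
    then show "\<bar>\<Sum>l<L. hk (\<tau> * r\<^sup>2) (\<sigma> * real l * r - y)\<bar> \<le> 24 * \<tau> / r"
      using hk_scaled_sum[OF r \<tau> \<sigma>, where L=L and y=y] by simp
  qed measurable
  finally show ?thesis .
qed

text \<open>The grid points are \<open>(j r\<^sup>2, \<plusminus>l r)\<close>; they are compared with the time \<open>i r\<^sup>2\<close> for
  \<open>j = i + b ^ 4 + d\<close>. The slack \<open>d \<le> 3\<close> lets two neighbouring points share the same \<open>i\<close>.\<close>

definition bad_point :: "real \<Rightarrow> nat \<Rightarrow> nat \<Rightarrow> nat \<Rightarrow> real \<Rightarrow> 'a set" where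
  "bad_point r b i j x = {\<omega> \<in> space M. (1 + 1 / b) * U (i * r\<^sup>2) (j * r\<^sup>2) x \<omega> + real b ^ 4 * r < X \<omega> (j * r\<^sup>2) x}
     \<union> {\<omega> \<in> space M. (1 + 1 / b) * X \<omega> (j * r\<^sup>2) x + real b ^ 4 * r < U (i * r\<^sup>2) (j * r\<^sup>2) x \<omega>}"

text \<open>Outside this event the Gaussian tail error of \<open>U_compare\<close>, which involves
  the total mass, is absorbed by the additive error \<open>b ^ 4 * r\<close>.\<close>

definition bad_mass :: "real \<Rightarrow> nat \<Rightarrow> nat \<Rightarrow> 'a set" where
  "bad_mass r b i = {\<omega> \<in> space M. real b ^ 4 * r < exp (- (real b)\<^sup>2 / 4) / r * mass (i * r\<^sup>2) \<omega>}"

definition bad :: "real \<Rightarrow> nat \<Rightarrow> nat \<Rightarrow> 'a set" where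
  "bad r b N = (\<Union>i\<in>{1..N}. bad_mass r b i \<union> (\<Union>d\<in>{..3}. \<Union>\<sigma>\<in>{1, - 1}. \<Union>l::nat. bad_point r b i (i + b ^ 4 + d) (\<sigma> * real l * r)))"

lemma U_measurable': "0 < s \<Longrightarrow> s < t \<Longrightarrow> U s t x \<in> borel_measurable M"
  unfolding U_def by (rule J_measurable) auto

context
  fixes r :: real and b :: nat
  assumes r: "0 < r" and b: "1 \<le> b"
begin

lemma bad_point_sets:
  assumes "1 \<le> i" "i < j"
  shows "{\<omega> \<in> space M. (1 + 1 / b) * U (i * r\<^sup>2) (j * r\<^sup>2) x \<omega> + real b ^ 4 * r < X \<omega> (j * r\<^sup>2) x} \<in> sets M"
   "{\<omega> \<in> space M. (1 + 1 / b) * X \<omega> (j * r\<^sup>2) x + real b ^ 4 * r < U (i * r\<^sup>2) (j * r\<^sup>2) x \<omega>} \<in> sets M"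
   "bad_point r b i j x \<in> sets M"
proof -
  have p: "0 < real i * r\<^sup>2" "real i * r\<^sup>2 < real j * r\<^sup>2" "0 < real j * r\<^sup>2" using assms r by auto
  have [measurable]: "U (i * r\<^sup>2) (j * r\<^sup>2) x \<in> borel_measurable M" "(\<lambda>\<omega>. X \<omega> (j * r\<^sup>2) x) \<in> borel_measurable M"
    using U_measurable'[OF p(1,2)] F_M[OF adapted[OF p(3)]] by auto
  show 1: "{\<omega> \<in> space M. (1 + 1 / b) * U (i * r\<^sup>2) (j * r\<^sup>2) x \<omega> + real b ^ 4 * r < X \<omega> (j * r\<^sup>2) x} \<in> sets M"
   and 2: "{\<omega> \<in> space M. (1 + 1 / b) * X \<omega> (j * r\<^sup>2) x + real b ^ 4 * r < U (i * r\<^sup>2) (j * r\<^sup>2) x \<omega>} \<in> sets M" by measurable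
  show "bad_point r b i j x \<in> sets M" unfolding bad_point_def using 1 2 by (rule sets.Un)
qed

lemma bad_mass_sets: "1 \<le> i \<Longrightarrow> bad_mass r b i \<in> sets M"
proof -
  assume "1 \<le> i"
  then have [measurable]: "mass (i * r\<^sup>2) \<in> borel_measurable M" using r by (intro J_measurable) auto
  show ?thesis unfolding bad_mass_def by measurable
qed

lemma bad_sets: "bad r b N \<in> sets M"
  unfolding bad_def using b by (intro sets.finite_UN sets.Un sets.countable_UN bad_mass_sets) (auto intro!: bad_point_sets(3))

lemma bad_point_union_bound:
  assumes i: "1 \<le> i" and d: "d \<le> 3" and \<sigma>: "\<sigma> \<in> {1, - 1}"
  shows "emeasure M (\<Union>l::nat. bad_point r b i (i + b ^ 4 + d) (\<sigma> * real l * r))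
    \<le> ennreal (2 * (1 / (r * (exp (b / 4) - 1)) * (24 * (b ^ 4 + 3) / r) * m0))"
proof -
  define s t where "s = real i * r\<^sup>2" and "t = real (i + b ^ 4 + d) * r\<^sup>2"
  define \<tau> where "\<tau> = real (b ^ 4 + d)"
  define l where "l = 1 / (4 * real b ^ 3 * r)"
  define l' where "l' = l * (1 + 1 / b)"
  have b1: "1 \<le> real b" using b by simp
  have b4: "1 \<le> real b ^ 4" "1 \<le> real b ^ 3" using b1 by (simp_all add: one_le_power)
  have s: "0 < s" "t = s + \<tau> * r\<^sup>2" "s < t" proof -
    show "0 < s" using i r by (simp add: s_def)
    show *: "t = s + \<tau> * r\<^sup>2" unfolding s_def t_def \<tau>_def by (simp add: algebra_simps)
    have "0 < \<tau> * r\<^sup>2" using r b4 unfolding \<tau>_def by (intro mult_pos_pos) auto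
    then show "s < t" using * by simp
  qed
  have \<tau>: "1 \<le> \<tau>" "\<tau> \<le> b ^ 4 + 3" using b4 d unfolding \<tau>_def by auto
  have l0: "0 < l" using r b1 unfolding l_def by simp
  have "l * 1 < l * (1 + 1 / b)" using l0 b1 by (intro mult_strict_left_mono) auto
  then have l: "0 < l" "l < l'" using l0 by (simp_all add: l'_def)
  have ll: "l' / l = 1 + 1 / b" using l(1) by (simp add: l'_def)
  have cond: "sqrt (t - s) \<le> 1 / l - 1 / l'"
  proof -
    have "t - s = \<tau> * r\<^sup>2" using s by simp
    also have "\<dots> \<le> (4 * real b ^ 4) * r\<^sup>2" using \<tau>(2) b4 by (intro mult_right_mono) auto
    also have "\<dots> = (2 * (real b)\<^sup>2 * r)\<^sup>2" by (simp add: power_mult_distrib)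
    finally have "sqrt (t - s) \<le> sqrt ((2 * (real b)\<^sup>2 * r)\<^sup>2)" by (rule real_sqrt_le_mono)
    then have "sqrt (t - s) \<le> 2 * (real b)\<^sup>2 * r" using r by simp
    also have "\<dots> \<le> 1 / l - 1 / l'"
    proof -
      have "1 / l - 1 / l' = 4 * real b ^ 3 * r * (1 - 1 / (1 + 1 / b))"
        using l(1) by (simp add: l'_def l_def right_diff_distrib)
      also have "1 - 1 / (1 + 1 / b) = 1 / (real b + 1)" using b1 by (simp add: field_simps)
      also have "4 * real b ^ 3 * r * (1 / (real b + 1)) \<ge> 4 * real b ^ 3 * r * (1 / (2 * real b))"
        using b1 r by (intro mult_left_mono divide_left_mono) auto
      also have "4 * real b ^ 3 * r * (1 / (2 * real b)) = 2 * (real b)\<^sup>2 * r" using b1 by (simp add: power3_eq_cube power2_eq_square)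
      finally show ?thesis .
    qed
    finally show ?thesis .
  qed
  define a where "a = real b ^ 4 * r"
  have a: "0 < a" using r b unfolding a_def by (intro mult_pos_pos) auto
  have la: "l * a = b / 4" using r b1 by (simp add: l_def a_def eval_nat_numeral)
  define c where "c = l' / (exp (b / 4) - 1)"
  have e0: "0 < exp (real b / 4) - 1" using b1 by simp
  have c0: "0 \<le> c" using l e0 by (simp add: c_def)
  have cb: "c \<le> 1 / (r * (exp (b / 4) - 1))"
  proof -
    have "l' \<le> (1 / (4 * 1 * r)) * (1 + 1)"
      unfolding l'_def l_def using b1 b4 r by (intro mult_mono divide_left_mono) auto
    also have "\<dots> \<le> 1 / r" using r by (simp add: field_simps)
    finally show ?thesis unfolding c_def using e0 by (simp add: divide_right_mono flip: divide_divide_eq_left)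
  qed
  let ?x = "\<lambda>l. \<sigma> * real l * r"
  have ij: "1 \<le> i" "i < i + b ^ 4 + d" using i b by auto
  have pt: "emeasure M (bad_point r b i (i + b ^ 4 + d) x) \<le> 2 * (\<integral>\<^sup>+\<omega>. ennreal (c * U s t x \<omega>) \<partial>M)" for x
  proof -
    note D = deviation_bounds[OF s(1,3) l cond a, of x, unfolded la ll, folded c_def]
    have "emeasure M (bad_point r b i (i + b ^ 4 + d) x) \<le> (\<integral>\<^sup>+\<omega>. ennreal (c * U s t x \<omega>) \<partial>M) + (\<integral>\<^sup>+\<omega>. ennreal (c * U s t x \<omega>) \<partial>M)"
      unfolding bad_point_def
      by (rule order_trans[OF emeasure_subadditive[OF bad_point_sets(1)[OF ij] bad_point_sets(2)[OF ij]] add_mono])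
        (use D in \<open>simp_all add: s_def t_def a_def\<close>)
    then show ?thesis by (simp add: mult_2)
  qed
  have part: "(\<Sum>l<L. emeasure M (bad_point r b i (i + b ^ 4 + d) (?x l))) \<le> ennreal (2 * (1 / (r * (exp (b / 4) - 1)) * (24 * (b ^ 4 + 3) / r) * m0))" for L
  proof -
    have [measurable]: "U s t x \<in> borel_measurable M" for x by (rule U_measurable'[OF s(1,3)])
    have "(\<Sum>l<L. emeasure M (bad_point r b i (i + b ^ 4 + d) (?x l))) \<le> (\<Sum>l<L. 2 * (\<integral>\<^sup>+\<omega>. ennreal (c * U s t (?x l) \<omega>) \<partial>M))"
      by (intro sum_mono pt)
    also have "\<dots> = 2 * (\<integral>\<^sup>+\<omega>. (\<Sum>l<L. ennreal (c * U s t (?x l) \<omega>)) \<partial>M)"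
      by (simp add: sum_distrib_left[symmetric] nn_integral_sum)
    also have "(\<integral>\<^sup>+\<omega>. (\<Sum>l<L. ennreal (c * U s t (?x l) \<omega>)) \<partial>M) \<le> (\<integral>\<^sup>+\<omega>. ennreal (1 / (r * (exp (b / 4) - 1)) * (24 * (b ^ 4 + 3) / r)) * ennreal (mass s \<omega>) \<partial>M)"
    proof (intro nn_integral_mono)
      fix \<omega> assume \<omega>: "\<omega> \<in> space M"
      have U0: "0 \<le> U s t x \<omega>" for x unfolding U_def by (rule J_nonneg[OF \<omega> s(1) less_imp_le[OF hk_pos]]) (use s in simp)
      have "(\<Sum>l<L. ennreal (c * U s t (?x l) \<omega>)) = ennreal (c * (\<Sum>l<L. U s t (?x l) \<omega>))"
        using c0 U0 by (subst sum_ennreal) (auto simp: sum_distrib_left)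
      also have "\<dots> \<le> ennreal (1 / (r * (exp (b / 4) - 1)) * (24 * (b ^ 4 + 3) / r * mass s \<omega>))"
      proof (intro ennreal_leI mult_mono cb)
        have "24 * \<tau> / r * mass s \<omega> \<le> 24 * (b ^ 4 + 3) / r * mass s \<omega>"
          using \<tau> r mass_nonneg[OF \<omega> s(1)] by (intro mult_right_mono divide_right_mono) auto
        then show "(\<Sum>l<L. U s t (?x l) \<omega>) \<le> 24 * (b ^ 4 + 3) / r * mass s \<omega>"
          using U_sum_bound[OF \<omega> s(1,2) r \<tau>(1) \<sigma>, of L] by linarith
      qed (use U0 r e0 in \<open>auto intro!: sum_nonneg\<close>)
      also have "\<dots> = ennreal (1 / (r * (exp (b / 4) - 1)) * (24 * (b ^ 4 + 3) / r)) * ennreal (mass s \<omega>)"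
        using r e0 mass_nonneg[OF \<omega> s(1)] by (subst ennreal_mult[symmetric]) (auto simp: mult.assoc)
      finally show "(\<Sum>l<L. ennreal (c * U s t (?x l) \<omega>)) \<le> ennreal (1 / (r * (exp (b / 4) - 1)) * (24 * (b ^ 4 + 3) / r)) * ennreal (mass s \<omega>)" .
    qed
    also have "\<dots> = ennreal (1 / (r * (exp (b / 4) - 1)) * (24 * (b ^ 4 + 3) / r)) * ennreal m0"
      using s mass_integrable[OF s(1)] by (subst nn_integral_cmult) (auto simp: mass_nn_expectation)
    also have "2 * (ennreal (1 / (r * (exp (b / 4) - 1)) * (24 * (b ^ 4 + 3) / r)) * ennreal m0) = ennreal (2 * (1 / (r * (exp (b / 4) - 1)) * (24 * (b ^ 4 + 3) / r) * m0))"
      using r e0 by (simp add: ennreal_mult[symmetric] flip: ennreal_numeral)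
    finally show ?thesis by (simp add: mult_left_mono)
  qed
  have "emeasure M (\<Union>l. bad_point r b i (i + b ^ 4 + d) (?x l)) \<le> (\<Sum>l. emeasure M (bad_point r b i (i + b ^ 4 + d) (?x l)))"
    by (rule emeasure_subadditive_countably) (use bad_point_sets(3)[OF ij] in auto)
  also have "\<dots> \<le> ennreal (2 * (1 / (r * (exp (b / 4) - 1)) * (24 * (b ^ 4 + 3) / r) * m0))"
    by (rule suminf_le_const[OF summableI part])
  finally show ?thesis .
qed

lemma bad_mass_bound:
  assumes i: "1 \<le> i"
  shows "emeasure M (bad_mass r b i) \<le> ennreal (exp (- (real b)\<^sup>2 / 4) / r\<^sup>2 * m0)"
proof -
  have s: "0 < real i * r\<^sup>2" using i r by simp
  have b4: "1 \<le> real b ^ 4" using b by (simp add: one_le_power)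
  note [measurable] = bad_mass_sets[OF i]
  have "emeasure M (bad_mass r b i) = (\<integral>\<^sup>+\<omega>. indicator (bad_mass r b i) \<omega> \<partial>M)" by simp
  also have "\<dots> \<le> (\<integral>\<^sup>+\<omega>. ennreal (exp (- (real b)\<^sup>2 / 4) / r\<^sup>2) * ennreal (mass (i * r\<^sup>2) \<omega>) \<partial>M)"
  proof (intro nn_integral_mono)
    fix \<omega> assume \<omega>: "\<omega> \<in> space M"
    show "indicator (bad_mass r b i) \<omega> \<le> ennreal (exp (- (real b)\<^sup>2 / 4) / r\<^sup>2) * ennreal (mass (i * r\<^sup>2) \<omega>)"
    proof (cases "\<omega> \<in> bad_mass r b i")
      case True
      then have "real b ^ 4 * r < exp (- (real b)\<^sup>2 / 4) / r * mass (i * r\<^sup>2) \<omega>" by (simp add: bad_mass_def)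
      moreover have "1 * r \<le> real b ^ 4 * r" using b4 r by (intro mult_right_mono) auto
      ultimately have "r \<le> exp (- (real b)\<^sup>2 / 4) / r * mass (i * r\<^sup>2) \<omega>" by linarith
      then have "r / r \<le> (exp (- (real b)\<^sup>2 / 4) / r * mass (i * r\<^sup>2) \<omega>) / r" using r by (intro divide_right_mono) auto
      then have "1 \<le> exp (- (real b)\<^sup>2 / 4) / r\<^sup>2 * mass (i * r\<^sup>2) \<omega>" using r by (simp add: power2_eq_square)
      then have "1 \<le> ennreal (exp (- (real b)\<^sup>2 / 4) / r\<^sup>2 * mass (i * r\<^sup>2) \<omega>)" using ennreal_leI[of 1] by simp
      then show ?thesis using True mass_nonneg[OF \<omega> s] r by (simp add: ennreal_mult[symmetric])
    qed simp
  qed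
  also have "\<dots> = ennreal (exp (- (real b)\<^sup>2 / 4) / r\<^sup>2) * ennreal m0"
    using s mass_integrable[OF s] by (subst nn_integral_cmult) (auto simp: mass_nn_expectation)
  finally show ?thesis using r by (simp add: ennreal_mult[symmetric])
qed

proposition bad_bound:
  "measure M (bad r b N) \<le> real N * (exp (- (real b)\<^sup>2 / 4) / r\<^sup>2 * m0 + 16 * (1 / (r * (exp (b / 4) - 1)) * (24 * (b ^ 4 + 3) / r) * m0))"
proof -
  have e0: "0 < exp (real b / 4) - 1" using b by simp
  let ?A = "exp (- (real b)\<^sup>2 / 4) / r\<^sup>2 * m0" and ?B = "2 * (1 / (r * (exp (b / 4) - 1)) * (24 * (b ^ 4 + 3) / r) * m0)"
  have AB: "0 \<le> ?A" "0 \<le> ?B" using r e0 by auto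
  let ?P = "\<lambda>i d \<sigma>. \<Union>l::nat. bad_point r b i (i + b ^ 4 + d) (\<sigma> * real l * r)"
  have Ps: "?P i d \<sigma> \<in> sets M" if "1 \<le> i" for i d and \<sigma> :: real
    using b that by (intro sets.countable_UN) (auto intro!: bad_point_sets(3))
  have Qs: "(\<Union>\<sigma>\<in>{1, - 1}. ?P i d \<sigma>) \<in> sets M" if "1 \<le> i" for i d
    using that by (intro sets.finite_UN Ps) auto
  have Pm: "measure M (?P i d \<sigma>) \<le> ?B" if "1 \<le> i" "d \<le> 3" "\<sigma> \<in> {1, -1}" for i d \<sigma>
    using bad_point_union_bound[OF that] AB unfolding emeasure_eq_measure by (subst (asm) ennreal_le_iff) auto
  have inner: "measure M (bad_mass r b i \<union> (\<Union>d\<in>{..3}. \<Union>\<sigma>\<in>{1, - 1}. ?P i d \<sigma>)) \<le> ?A + 8 * ?B" if i: "1 \<le> i" for i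
  proof -
    have "measure M (\<Union>d\<in>{..3}. \<Union>\<sigma>\<in>{1, - 1}. ?P i d \<sigma>) \<le> (\<Sum>d\<in>{..3::nat}. measure M (\<Union>\<sigma>\<in>{1, - 1}. ?P i d \<sigma>))"
      by (rule measure_UNION_le) (intro finite_atMost Qs[OF i])+
    also have "\<dots> \<le> (\<Sum>d\<in>{..3::nat}. \<Sum>\<sigma>\<in>{1, - 1::real}. measure M (?P i d \<sigma>))"
      by (intro sum_mono measure_UNION_le) (use Ps[OF i] in auto)
    also have "\<dots> \<le> (\<Sum>d\<in>{..3::nat}. \<Sum>\<sigma>\<in>{1, - 1::real}. ?B)"
      by (intro sum_mono Pm i) auto
    \<comment> \<open>Four values of \<open>d\<close> on each of two half-lines; the remaining
      factor 2 inside \<open>?B\<close> stands for the two directions of a deviation.\<close>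
    also have "\<dots> = 8 * ?B" by simp
    finally have "measure M (\<Union>d\<in>{..3}. \<Union>\<sigma>\<in>{1, - 1}. ?P i d \<sigma>) \<le> 8 * ?B" .
    moreover have "measure M (bad_mass r b i) \<le> ?A"
      using bad_mass_bound[OF i] AB unfolding emeasure_eq_measure by (subst (asm) ennreal_le_iff) auto
    moreover have "measure M (bad_mass r b i \<union> (\<Union>d\<in>{..3}. \<Union>\<sigma>\<in>{1, - 1}. ?P i d \<sigma>)) \<le> measure M (bad_mass r b i) + measure M (\<Union>d\<in>{..3}. \<Union>\<sigma>\<in>{1, - 1}. ?P i d \<sigma>)"
      by (rule measure_Un_le) (intro bad_mass_sets sets.finite_UN finite_atMost Qs i)+
    ultimately show ?thesis by linarith
  qed
  have "measure M (bad r b N) \<le> (\<Sum>i\<in>{1..N}. measure M (bad_mass r b i \<union> (\<Union>d\<in>{..3}. \<Union>\<sigma>\<in>{1, - 1}. ?P i d \<sigma>)))"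
    unfolding bad_def by (rule measure_UNION_le) (simp, intro sets.Un bad_mass_sets sets.finite_UN finite_atMost Qs, simp_all)
  also have "\<dots> \<le> (\<Sum>i\<in>{1..N}. ?A + 8 * ?B)" by (intro sum_mono inner) auto
  also have "\<dots> = real N * (?A + 8 * ?B)" by simp
  finally show ?thesis by (simp add: mult.assoc)
qed

end

section \<open>Comparison of neighbouring grid points\<close>

lemma U_compare:
  fixes b :: real
  assumes \<omega>: "\<omega> \<in> space M" and s: "0 < s" and r: "0 < r" and b: "2 \<le> b"
    and t: "t = s + \<tau> * r\<^sup>2" "t' = s + \<tau>' * r\<^sup>2"
    and \<tau>: "b ^ 4 \<le> \<tau>" "\<tau> \<le> b ^ 4 + 3" and \<tau>': "b ^ 4 \<le> \<tau>'" "\<tau>' \<le> b ^ 4 + 3" and x: "\<bar>x' - x\<bar> \<le> r"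
  shows "U s t' x' \<omega> \<le> exp (4 / b) * U s t x \<omega> + exp (- b\<^sup>2 / 4) / r * mass s \<omega>"
proof -
  have "0 < b ^ 4" using b by (intro zero_less_power) simp
  then have "0 < \<tau>" "0 < \<tau>'" using \<tau>(1) \<tau>'(1) by linarith+
  then have p: "0 < \<tau> * r\<^sup>2" "0 < \<tau>' * r\<^sup>2" using r by simp_all
  have ts: "t - s = \<tau> * r\<^sup>2" "t' - s = \<tau>' * r\<^sup>2" using t by auto
  have pt: "hk (\<tau>' * r\<^sup>2) (x' - y) \<le> exp (4 / b) * hk (\<tau> * r\<^sup>2) (x - y) + exp (- b\<^sup>2 / 4) / r * 1" for y
  proof -
    have e: "\<bar>(x' - x) / r\<bar> \<le> 1" using x r by simp
    have "x - y = r * ((x - y) / r)" "x' - y = r * ((x - y) / r + (x' - x) / r)" using r by (simp_all add: add_divide_distrib[symmetric])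
    then have "hk (\<tau> * r\<^sup>2) (x - y) = hk \<tau> ((x - y) / r) / r" "hk (\<tau>' * r\<^sup>2) (x' - y) = hk \<tau>' ((x - y) / r + (x' - x) / r) / r"
      using hk_scale[OF r] by metis+
    then show ?thesis using divide_right_mono[OF hk_unit_compare[OF b \<tau> \<tau>' e, of "(x - y) / r"], of r] r
      by (simp add: add_divide_distrib)
  qed
  note B = hk_abs_le[OF p(1) order_refl] and B' = hk_abs_le[OF p(2) order_refl]
  have 1: "\<bar>exp (4 / b) * hk (\<tau> * r\<^sup>2) (x - y)\<bar> \<le> exp (4 / b) * (1 / sqrt (2 * pi * (\<tau> * r\<^sup>2)))" for y
    unfolding abs_mult abs_exp_cancel using B by (intro mult_left_mono) auto
  have 2: "\<bar>exp (- b\<^sup>2 / 4) / r * 1\<bar> \<le> exp (- b\<^sup>2 / 4) / r" using r by simp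
  have 3: "\<bar>exp (4 / b) * hk (\<tau> * r\<^sup>2) (x - y) + exp (- b\<^sup>2 / 4) / r * 1\<bar> \<le> exp (4 / b) * (1 / sqrt (2 * pi * (\<tau> * r\<^sup>2))) + exp (- b\<^sup>2 / 4) / r" for y
    by (rule order_trans[OF abs_triangle_ineq add_mono[OF 1 2]])
  have "U s t' x' \<omega> \<le> J s (\<lambda>y. exp (4 / b) * hk (\<tau> * r\<^sup>2) (x - y) + exp (- b\<^sup>2 / 4) / r * 1) \<omega>"
    unfolding U_def ts by (rule J_mono[OF \<omega> s _ B' _ 3 pt]) measurable
  also have "\<dots> = J s (\<lambda>y. exp (4 / b) * hk (\<tau> * r\<^sup>2) (x - y)) \<omega> + J s (\<lambda>y. exp (- b\<^sup>2 / 4) / r * 1) \<omega>"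
    by (rule J_add[OF \<omega> s _ 1 _ 2]) measurable
  also have "\<dots> = exp (4 / b) * U s t x \<omega> + exp (- b\<^sup>2 / 4) / r * mass s \<omega>"
    unfolding J_cmult U_def ts ..
  finally show ?thesis .
qed

lemma bad_pointD:
  assumes "\<omega> \<in> space M" "\<omega> \<notin> bad_point r b i j x"
  shows "X \<omega> (j * r\<^sup>2) x \<le> (1 + 1 / b) * U (i * r\<^sup>2) (j * r\<^sup>2) x \<omega> + real b ^ 4 * r"
    "U (i * r\<^sup>2) (j * r\<^sup>2) x \<omega> \<le> (1 + 1 / b) * X \<omega> (j * r\<^sup>2) x + real b ^ 4 * r"
  using assms unfolding bad_point_def by auto

text \<open>The comparison runs through the heat flow from a common earlier time: from
  \<open>X\<close> at the new point to \<open>U\<close> there, to \<open>U\<close> at the old point,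
  to \<open>X\<close> at the old point. The exponents \<open>1 / b\<close>, \<open>4 / b\<close> and
  \<open>1 / b\<close> add up to \<open>6 / b\<close>, and each passage adds one error
  \<open>b ^ 4 * r\<close>.\<close>

lemma good_step:
  fixes k k' :: int and j j' b N :: nat and r :: real
  assumes \<omega>: "\<omega> \<in> space M" "\<omega> \<notin> bad r b N" and r: "0 < r" and b: "2 \<le> b"
    and j: "b ^ 4 + 1 \<le> j" "j \<le> N" "b ^ 4 + 1 \<le> j'" "j' \<le> N" "j \<le> j' + 3" "j' \<le> j + 3" and k: "\<bar>k' - k\<bar> \<le> 1"
  shows "X \<omega> (j' * r\<^sup>2) (k' * r) \<le> exp (6 / b) * X \<omega> (j * r\<^sup>2) (k * r) + 3 * exp 3 * (real b ^ 4 * r)"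
proof -
  \<comment> \<open>Both times then lie between \<open>b ^ 4\<close> and \<open>b ^ 4 + 3\<close>
    steps after \<open>i\<close>, the range covered by \<open>bad\<close> and
    \<open>U_compare\<close>.\<close>
  define i where "i = min j j' - b ^ 4"
  define d d' where "d = j - (i + b ^ 4)" and "d' = j' - (i + b ^ 4)"
  have i: "i \<in> {1..N}" and d: "j = i + b ^ 4 + d" "j' = i + b ^ 4 + d'" "d \<in> {..3}" "d' \<in> {..3}"
    using j unfolding i_def d_def d'_def by auto
  define s where "s = real i * r\<^sup>2"
  have s: "0 < s" using i r by (simp add: s_def)
  have npt: "\<omega> \<notin> bad_point r b i (i + b ^ 4 + d) (k * r)" if "d \<in> {..3}" for d and k :: int
  proof -
    define \<sigma> :: real where "\<sigma> = (if 0 \<le> k then 1 else - 1)"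
    have eq: "k * r = \<sigma> * real (nat \<bar>k\<bar>) * r" and \<sigma>: "\<sigma> \<in> {1, - 1}" by (auto simp: \<sigma>_def)
    have "bad_point r b i (i + b ^ 4 + d) (\<sigma> * real (nat \<bar>k\<bar>) * r) \<subseteq> (\<Union>l::nat. bad_point r b i (i + b ^ 4 + d) (\<sigma> * real l * r))" by blast
    also have "\<dots> \<subseteq> bad r b N" unfolding bad_def using i that \<sigma> by blast
    finally show ?thesis using \<omega>(2) unfolding eq by blast
  qed
  have nm: "\<omega> \<notin> bad_mass r b i" using \<omega>(2) i unfolding bad_def by blast
  define a where "a = real b ^ 4 * r"
  have a: "0 \<le> a" using r by (simp add: a_def)
  have b2: "2 \<le> real b" using b by simp
  let ?x = "X \<omega> (j * r\<^sup>2) (k * r)" and ?x' = "X \<omega> (j' * r\<^sup>2) (k' * r)"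
  let ?u = "U s (j * r\<^sup>2) (k * r) \<omega>" and ?u' = "U s (j' * r\<^sup>2) (k' * r) \<omega>"
  have x0: "0 \<le> ?x" using nonneg[OF \<omega>(1)] j(1) r by simp
  have 1: "?x' \<le> (1 + 1 / b) * ?u' + a" and 2: "?u \<le> (1 + 1 / b) * ?x + a"
    using bad_pointD[OF \<omega>(1) npt[OF d(4), of k']] bad_pointD[OF \<omega>(1) npt[OF d(3), of k]] unfolding d(1,2)[symmetric] s_def a_def by auto
  have 3: "?u' \<le> exp (4 / b) * ?u + a"
  proof -
    have "\<bar>k' * r - k * r\<bar> \<le> r"
    proof -
      have "\<bar>real_of_int k' - k\<bar> * r \<le> 1 * r" using k r by (intro mult_right_mono) linarith+
      then show ?thesis using r by (simp add: left_diff_distrib[symmetric] abs_mult)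
    qed
    moreover have "real j * r\<^sup>2 = s + real (b ^ 4 + d) * r\<^sup>2" "real j' * r\<^sup>2 = s + real (b ^ 4 + d') * r\<^sup>2"
      unfolding s_def d(1,2) by (simp_all add: distrib_right)
    ultimately have "?u' \<le> exp (4 / b) * ?u + exp (- (real b)\<^sup>2 / 4) / r * mass s \<omega>"
      using d(3,4) b2 by (intro U_compare[OF \<omega>(1) s r b2]) auto
    moreover have "exp (- (real b)\<^sup>2 / 4) / r * mass s \<omega> \<le> a"
      using nm \<omega>(1) unfolding bad_mass_def s_def a_def by auto
    ultimately show ?thesis by linarith
  qed
  have e1: "1 + 1 / b \<le> exp (1 / real b)" by (rule exp_ge_add_one_self)
  have U0: "0 \<le> U s (m * r\<^sup>2) z \<omega>" if "i < m" for m :: nat and z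
    unfolding U_def using that r by (intro J_nonneg[OF \<omega>(1) s] less_imp_le[OF hk_pos]) (simp add: s_def)
  have "0 < b ^ 4" using b by (intro zero_less_power) simp
  then have "i < j" "i < j'" using d by linarith+
  then have u0: "0 \<le> ?u" "0 \<le> ?u'" using U0 by auto
  have "?x' \<le> exp (1 / b) * ?u' + a" using 1 mult_right_mono[OF e1 u0(2)] by linarith
  also have "\<dots> \<le> exp (1 / b) * (exp (4 / b) * (exp (1 / b) * ?x + a) + a) + a"
    using 2 3 mult_right_mono[OF e1 x0] by (intro add_right_mono mult_left_mono order_trans[OF 3]) auto
  also have "\<dots> = exp (6 / b) * ?x + (exp (5 / b) + exp (1 / b) + 1) * a"
    by (simp add: algebra_simps exp_add[symmetric] add_divide_distrib[symmetric])
  also have "\<dots> \<le> exp (6 / b) * ?x + (exp 3 + exp 3 + exp 3) * a"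
  proof -
    have "5 / real b \<le> 3" "1 / real b \<le> 3" using b2 by (simp_all add: field_simps)
    then show ?thesis using a by (intro add_left_mono mult_right_mono add_mono) auto
  qed
  finally show ?thesis by (simp add: a_def)
qed

end

section \<open>Chaining from a zero\<close>

text \<open>A discrete Gronwall inequality: the full product of the factors majorises the partial
  products in front of the additive errors.\<close>

lemma exp_chain:
  fixes u a c :: "nat \<Rightarrow> real"
  assumes step: "\<And>k. u (Suc k) \<le> exp (c k) * u k + a k" and u: "\<And>k. 0 \<le> u k" and a: "\<And>k. 0 \<le> a k" and c: "\<And>k. 0 \<le> c k"
  shows "u m \<le> exp (\<Sum>k<m. c k) * (u 0 + (\<Sum>k<m. a k))"
proof (induction m)
  case (Suc m)
  have nn: "0 \<le> (\<Sum>k<m. a k)" "0 \<le> (\<Sum>k<m. c k)" using a c by (auto intro: sum_nonneg)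
  have "u (Suc m) \<le> exp (c m) * (exp (\<Sum>k<m. c k) * (u 0 + (\<Sum>k<m. a k))) + a m"
    by (rule order_trans[OF step add_right_mono[OF mult_left_mono[OF Suc]]]) simp
  also have "\<dots> \<le> exp (\<Sum>k<Suc m. c k) * (u 0 + (\<Sum>k<m. a k)) + exp (\<Sum>k<Suc m. c k) * a m"
  proof (intro add_mono)
    show "a m \<le> exp (\<Sum>k<Suc m. c k) * a m"
      using mult_right_mono[of 1 "exp (\<Sum>k<Suc m. c k)" "a m"] a c[of m] nn by simp
  qed (simp add: exp_add mult_ac)
  also have "\<dots> = exp (\<Sum>k<Suc m. c k) * (u 0 + (\<Sum>k<Suc m. a k))" by (simp add: distrib_left add.assoc)
  finally show ?case .
qed simp

text \<open>The same chain read backwards: the coarse end is bounded by the fine end, where the zero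
  is reached in the limit.\<close>

lemma exp_chain_rev:
  fixes u a c :: "nat \<Rightarrow> real"
  assumes step: "\<And>k. u k \<le> exp (c k) * u (Suc k) + a k" and u: "\<And>k. 0 \<le> u k" and a: "\<And>k. 0 \<le> a k" and c: "\<And>k. 0 \<le> c k"
  shows "u 0 \<le> exp (\<Sum>k<m. c k) * (u m + (\<Sum>k<m. a k))"
proof (induction m)
  case (Suc m)
  have nn: "0 \<le> (\<Sum>k<m. a k)" using a by (auto intro: sum_nonneg)
  have e: "1 \<le> exp (c m)" using c by simp
  have "u m + (\<Sum>k<m. a k) \<le> exp (c m) * u (Suc m) + a m + (\<Sum>k<m. a k)" using step[of m] by simp
  also have "\<dots> \<le> exp (c m) * (u (Suc m) + (\<Sum>k<Suc m. a k))"
    using mult_right_mono[OF e, of "a m + (\<Sum>k<m. a k)"] a[of m] nn by (simp add: distrib_left add.assoc add.commute[of "a m"])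
  finally have "exp (\<Sum>k<m. c k) * (u m + (\<Sum>k<m. a k)) \<le> exp (\<Sum>k<m. c k) * (exp (c m) * (u (Suc m) + (\<Sum>k<Suc m. a k)))"
    by (intro mult_left_mono) auto
  also have "\<dots> = exp (\<Sum>k<Suc m. c k) * (u (Suc m) + (\<Sum>k<Suc m. a k))" by (simp add: exp_add mult_ac)
  finally show ?case using Suc by (rule order_trans[rotated])
qed simp

lemma floor_grid_refine:
  fixes z :: real
  assumes "0 < p"
  shows "int p * \<lfloor>real p ^ n * z\<rfloor> \<le> \<lfloor>real p ^ Suc n * z\<rfloor>"
    "\<lfloor>real p ^ Suc n * z\<rfloor> < int p * \<lfloor>real p ^ n * z\<rfloor> + int p"
proof -
  have *: "\<lfloor>real p ^ Suc n * z\<rfloor> div int p = \<lfloor>real p ^ n * z\<rfloor>"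
    using floor_divide_real_eq_div[of "int p" "real p ^ Suc n * z"] assms by simp
  show "int p * \<lfloor>real p ^ n * z\<rfloor> \<le> \<lfloor>real p ^ Suc n * z\<rfloor>"
    "\<lfloor>real p ^ Suc n * z\<rfloor> < int p * \<lfloor>real p ^ n * z\<rfloor> + int p"
    using assms pos_mod_bound[of "int p" "\<lfloor>real p ^ Suc n * z\<rfloor>"] pos_mod_sign[of "int p" "\<lfloor>real p ^ Suc n * z\<rfloor>"]
      mult_div_mod_eq[of "int p" "\<lfloor>real p ^ Suc n * z\<rfloor>"] unfolding * by linarith+
qed

lemma floor_grid_near:
  fixes z z' :: real
  assumes "\<bar>z' - z\<bar> \<le> 1 / p ^ n" "0 < p"
  shows "\<bar>\<lfloor>p ^ n * z'\<rfloor> - \<lfloor>p ^ n * z\<rfloor>\<bar> \<le> 1"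
proof -
  have "\<bar>p ^ n * z' - p ^ n * z\<bar> \<le> 1"
    using mult_left_mono[OF assms(1), of "p ^ n"] assms(2) by (simp add: abs_mult right_diff_distrib[symmetric])
  then show ?thesis by linarith
qed

lemma power_floor_tendsto:
  assumes "1 < (p :: real)"
  shows "(\<lambda>n. \<lfloor>p ^ (n + m) * z\<rfloor> * (1 / p ^ (n + m))) \<longlonglongrightarrow> z"
proof -
  have "(\<lambda>n. \<lfloor>p ^ n * z\<rfloor> / p ^ n) \<longlonglongrightarrow> z"
  proof (rule tendsto_sandwich[of "\<lambda>n. z - (1 / p) ^ n" _ _ "\<lambda>n. z"])
    have "p ^ n * z - 1 \<le> \<lfloor>p ^ n * z\<rfloor>" for n by linarith
    then have "(p ^ n * z - 1) / p ^ n \<le> \<lfloor>p ^ n * z\<rfloor> / p ^ n" for n using assms by (intro divide_right_mono) auto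
    then show "\<forall>\<^sub>F n in sequentially. z - (1 / p) ^ n \<le> \<lfloor>p ^ n * z\<rfloor> / p ^ n"
      using assms by (intro always_eventually allI) (simp add: diff_divide_distrib power_one_over)
    show "\<forall>\<^sub>F n in sequentially. \<lfloor>p ^ n * z\<rfloor> / p ^ n \<le> z"
      using assms by (intro always_eventually allI) (simp add: pos_divide_le_eq mult.commute)
    have "(\<lambda>n. z - (1 / p) ^ n) \<longlonglongrightarrow> z - 0"
      using assms by (intro tendsto_diff LIMSEQ_power_zero) (auto simp: field_simps)
    then show "(\<lambda>n. z - (1 / p) ^ n) \<longlonglongrightarrow> z" by simp
  qed simp
  from LIMSEQ_ignore_initial_segment[OF this, of m] show ?thesis by simp
qed

text \<open>Each point is joined to its dyadic approximations of all levels, so that an almost multiplicative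
  Harnack bound between grid neighbours transports a zero at the cost of the additive errors only.\<close>
proposition grid_chain:
  fixes f :: "real \<Rightarrow> real \<Rightarrow> real" and a c :: "nat \<Rightarrow> real" and L N :: "nat \<Rightarrow> nat" and t t' x x' \<tau> T :: real
  assumes cont: "continuous_on ({0<..} \<times> UNIV) (\<lambda>(t, x). f t x)" and nn: "\<And>t x. 0 < t \<Longrightarrow> 0 \<le> f t x"
    and a: "\<And>n. 0 \<le> a n" "summable a" and c: "\<And>n. 0 \<le> c n" "summable c"
    and step: "\<And>n j j' k k'. \<lbrakk>n0 \<le> n; L n \<le> j; j \<le> N n; L n \<le> j'; j' \<le> N n; j \<le> j' + 3; j' \<le> j + 3; \<bar>k' - k\<bar> \<le> 1\<rbrakk> \<Longrightarrow>
      f (real j' * (1 / 4 ^ n)) (of_int k' * (1 / 2 ^ n)) \<le> exp (c n) * f (real j * (1 / 4 ^ n)) (of_int k * (1 / 2 ^ n)) + a n"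
    and L: "\<And>n. n0 \<le> n \<Longrightarrow> real (L n) + 4 \<le> 4 ^ n * \<tau>" "\<And>n. n0 \<le> n \<Longrightarrow> 4 ^ n * T \<le> N n" "\<And>n. n0 \<le> n \<Longrightarrow> 1 \<le> L n"
    and t: "\<tau> \<le> t" "t \<le> T" "\<tau> \<le> t'" "t' \<le> T" "0 < \<tau>"
    and zero: "f t x = 0" and close: "\<bar>t' - t\<bar> \<le> 1 / 4 ^ n0" "\<bar>x' - x\<bar> \<le> 1 / 2 ^ n0"
  shows "f t' x' \<le> 3 * exp (3 * suminf c) * (\<Sum>n. a (n0 + n))"
proof -
  define jj where "jj n t = nat \<lfloor>4 ^ n * t\<rfloor>" for n and t :: real
  define kk where "kk n x = \<lfloor>2 ^ n * x\<rfloor>" for n and x :: real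
  define q where "q t x n = f (real (jj n t) * (1 / 4 ^ n)) (of_int (kk n x) * (1 / 2 ^ n))" for n and t x :: real
  define C A where "C = suminf c" and "A = (\<Sum>n. a (n0 + n))"
  have sa: "summable (\<lambda>k. a (n0 + k))" "summable (\<lambda>k. c (n0 + k))"
    using a(2) c(2) summable_iff_shift[of _ n0] by (auto simp: add.commute)
  have A: "(\<Sum>k<m. a (n0 + Suc k)) \<le> A" for m
  proof -
    have "(\<Sum>k<m. a (n0 + Suc k)) = (\<Sum>k\<in>{1..<Suc m}. a (n0 + k))" by (rule sum.reindex_bij_witness[of _ "\<lambda>k. k - 1" Suc]) auto
    also have "\<dots> \<le> A" unfolding A_def by (rule sum_le_suminf[OF sa(1)]) (use a in auto)
    finally show ?thesis .
  qed
  have C: "(\<Sum>k<m. c (n0 + Suc k)) \<le> C" for m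
  proof -
    have "(\<Sum>k<m. c (n0 + Suc k)) = (\<Sum>k\<in>{n0 + 1..<n0 + Suc m}. c k)"
      by (rule sum.reindex_bij_witness[of _ "\<lambda>k. k - Suc n0" "\<lambda>k. n0 + Suc k"]) auto
    also have "\<dots> \<le> C" unfolding C_def by (rule sum_le_suminf[OF c(2)]) (use c in auto)
    finally show ?thesis .
  qed
  have A0: "0 \<le> A" and C0: "0 \<le> C" using A[of 0] C[of 0] by auto
  have aA: "a n0 \<le> A" and cC: "c n0 \<le> C"
    using sum_le_suminf[OF sa(1), of "{0}"] sum_le_suminf[OF c(2), of "{n0}"] a c unfolding A_def C_def by auto
  have jjr: "L n \<le> jj n t" "jj n t \<le> N n" "int (jj n t) = \<lfloor>4 ^ n * t\<rfloor>" "4 * jj n t \<le> jj (Suc n) t" "jj (Suc n) t \<le> 4 * jj n t + 3"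
      "L (Suc n) \<le> 4 * jj n t" "4 * jj n t \<le> N (Suc n)"
    if tt: "\<tau> \<le> t" "t \<le> T" and n: "n0 \<le> n" for t n
  proof -
    have m: "4 ^ n * \<tau> \<le> 4 ^ n * t" "4 ^ n * t \<le> 4 ^ n * T" for n using tt by (auto intro!: mult_left_mono)
    have lo: "real (L n) + 4 \<le> 4 ^ n * t" and up: "4 ^ n * t \<le> N n" if "n0 \<le> n" for n using L(1,2)[OF that] m[of n] by linarith+
    have t0: "0 < t" using tt t by simp
    have i: "int (jj n t) = \<lfloor>4 ^ n * t\<rfloor>" for n unfolding jj_def using t0 by simp
    show "int (jj n t) = \<lfloor>4 ^ n * t\<rfloor>" by (rule i)
    show "L n \<le> jj n t" using lo[OF n] i[of n] by linarith
    have up': "jj n t \<le> N n" if "n0 \<le> n" for n using up[OF that] i[of n] by linarith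
    show "jj n t \<le> N n" by (rule up'[OF n])
    have r: "4 * int (jj n t) \<le> int (jj (Suc n) t)" "int (jj (Suc n) t) < 4 * int (jj n t) + 4"
      using floor_grid_refine[of 4 n t] unfolding i by auto
    show 1: "4 * jj n t \<le> jj (Suc n) t" "jj (Suc n) t \<le> 4 * jj n t + 3" using r by linarith+
    \<comment> \<open>The slack 4 in the hypothesis on \<open>L\<close> is spent here: rounding
      costs less than 1, and in fine units the coarse time may lie 3 below the fine one and must
      still be admissible.\<close>
    have "real (L (Suc n)) + 4 \<le> 4 ^ Suc n * t" by (rule lo) (use n in simp)
    then have "L (Suc n) + 3 \<le> jj (Suc n) t" using i[of "Suc n"] by linarith
    then show "L (Suc n) \<le> 4 * jj n t" using 1 by linarith
    show "4 * jj n t \<le> N (Suc n)" using 1(1) up'[of "Suc n"] n by linarith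
  qed
  have kkr: "\<bar>kk (Suc n) x - 2 * kk n x\<bar> \<le> 1" for n x
    using floor_grid_refine[of 2 n x] unfolding kk_def by auto
  \<comment> \<open>A point of level \<open>n\<close> is also a point of the next level, with
    indices multiplied by 4 and 2. Each link is thus an instance of \<open>step\<close> within one
    level, between time indices at most 3 apart.\<close>
  have coarse: "q t x n = f (real (4 * jj n t) * (1 / 4 ^ Suc n)) (of_int (2 * kk n x) * (1 / 2 ^ Suc n))" for t x n
    unfolding q_def by simp
  have q0: "0 \<le> q t x n" if "\<tau> \<le> t" "t \<le> T" "n0 \<le> n" for t x n
    unfolding q_def using jjr(1)[OF that] L(3)[OF that(3)] by (intro nn) simp
  have up: "q t x (Suc n) \<le> exp (c (Suc n)) * q t x n + a (Suc n)"
    and dn: "q t x n \<le> exp (c (Suc n)) * q t x (Suc n) + a (Suc n)" if tt: "\<tau> \<le> t" "t \<le> T" and n: "n0 \<le> n" for t x n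
  proof -
    have n': "n0 \<le> Suc n" using n by simp
    note J = jjr[OF tt n] and J' = jjr[OF tt n']
    show "q t x (Suc n) \<le> exp (c (Suc n)) * q t x n + a (Suc n)"
      unfolding coarse[of t x n] unfolding q_def using n' J J' kkr[of n x] by (intro step) auto
    show "q t x n \<le> exp (c (Suc n)) * q t x (Suc n) + a (Suc n)"
      unfolding coarse[of t x n] unfolding q_def using n' J J' kkr[of n x] by (intro step) (auto simp: abs_minus_commute)
  qed
  have lim: "(\<lambda>m. q t x (m + n0)) \<longlonglongrightarrow> f t x" if tt: "\<tau> \<le> t" "t \<le> T" for t x
  proof -
    have t0: "0 < t" using tt t by simp
    have "(\<lambda>m. (\<lambda>(t, x). f t x) (real (jj (m + n0) t) * (1 / 4 ^ (m + n0)), of_int (kk (m + n0) x) * (1 / 2 ^ (m + n0)))) \<longlonglongrightarrow> (\<lambda>(t, x). f t x) (t, x)"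
    proof (rule continuous_on_tendsto_compose[OF cont])
      have "(\<lambda>m. real_of_int \<lfloor>4 ^ (m + n0) * t\<rfloor> * (1 / 4 ^ (m + n0))) \<longlonglongrightarrow> t"
        by (rule power_floor_tendsto) simp
      moreover have "real_of_int \<lfloor>4 ^ (m + n0) * t\<rfloor> = real (jj (m + n0) t)" for m unfolding jj_def using t0 by simp
      ultimately have "(\<lambda>m. real (jj (m + n0) t) * (1 / 4 ^ (m + n0))) \<longlonglongrightarrow> t" by simp
      moreover have "(\<lambda>m. of_int (kk (m + n0) x) * (1 / 2 ^ (m + n0))) \<longlonglongrightarrow> x"
        unfolding kk_def by (rule power_floor_tendsto) simp
      ultimately show "(\<lambda>m. (real (jj (m + n0) t) * (1 / 4 ^ (m + n0)), of_int (kk (m + n0) x) * (1 / 2 ^ (m + n0)) :: real)) \<longlonglongrightarrow> (t, x)"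
        by (rule tendsto_Pair)
      show "(t, x) \<in> {0<..} \<times> UNIV" using t0 by simp
      have "0 < real (jj (m + n0) t) * (1 / 4 ^ (m + n0))" for m
        using jjr(1)[OF tt, of "m + n0"] L(3)[of "m + n0"] by simp
      then show "\<forall>\<^sub>F m in sequentially. (real (jj (m + n0) t) * (1 / 4 ^ (m + n0)), of_int (kk (m + n0) x) * (1 / 2 ^ (m + n0)) :: real) \<in> {0<..} \<times> UNIV"
        by simp
    qed
    then show ?thesis by (simp add: q_def)
  qed
  let ?a = "\<lambda>k. a (n0 + Suc k)" and ?c = "\<lambda>k. c (n0 + Suc k)"
  \<comment> \<open>From the fine levels at the zero to level \<open>n0\<close>: in the limit the
    multiplied term is \<open>f t x = 0\<close>, so only additive errors remain.\<close>
  have "q t x (0 + n0) \<le> exp C * (f t x + A)"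
  proof (rule LIMSEQ_le_const[OF tendsto_mult_left[OF tendsto_add[OF lim[OF t(1,2)] tendsto_const]]], intro exI allI impI)
    fix m
    have "q t x (0 + n0) \<le> exp (\<Sum>k<m. ?c k) * (q t x (m + n0) + (\<Sum>k<m. ?a k))"
      by (rule exp_chain_rev) (use dn[OF t(1,2)] q0[OF t(1,2)] a c in \<open>auto simp: add.commute\<close>)
    also have "\<dots> \<le> exp C * (q t x (m + n0) + A)"
      using A C q0[OF t(1,2)] a by (intro mult_mono add_left_mono) (auto intro!: add_nonneg_nonneg sum_nonneg)
    finally show "q t x (0 + n0) \<le> exp C * (q t x (m + n0) + A)" .
  qed
  then have 1: "q t x n0 \<le> exp C * A" using zero by simp
  \<comment> \<open>At level \<open>n0\<close> the approximations of the two points are neighbours,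
    and a single step crosses over.\<close>
  have 2: "q t' x' n0 \<le> exp (c n0) * q t x n0 + a n0"
  proof -
    have "\<bar>int (jj n0 t') - int (jj n0 t)\<bar> \<le> 1"
      unfolding jjr(3)[OF t(1,2) order_refl] jjr(3)[OF t(3,4) order_refl] by (rule floor_grid_near[OF close(1)]) simp
    moreover have "\<bar>kk n0 x' - kk n0 x\<bar> \<le> 1" unfolding kk_def by (rule floor_grid_near[OF close(2)]) simp
    ultimately show ?thesis unfolding q_def using jjr(1,2)[OF t(1,2), of n0] jjr(1,2)[OF t(3,4), of n0] by (intro step) auto
  qed
  have 3: "f t' x' \<le> exp C * (q t' x' n0 + A)"
  proof (rule LIMSEQ_le_const2[OF lim[OF t(3,4)]], intro exI allI impI)
    fix m
    have "q t' x' (m + n0) \<le> exp (\<Sum>k<m. ?c k) * (q t' x' (0 + n0) + (\<Sum>k<m. ?a k))"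
      by (rule exp_chain) (use up[OF t(3,4)] q0[OF t(3,4)] a c in \<open>auto simp: add.commute\<close>)
    also have "\<dots> \<le> exp C * (q t' x' (0 + n0) + A)"
      using A C q0[OF t(3,4), of n0] a by (intro mult_mono add_left_mono) (auto intro!: add_nonneg_nonneg sum_nonneg)
    finally show "q t' x' (m + n0) \<le> exp C * (q t' x' n0 + A)" by simp
  qed
  have e: "1 \<le> exp C" using C0 by simp
  have "q t' x' n0 \<le> exp C * (exp C * A) + A"
    using 1 2 aA cC q0[OF t(1,2), of n0 x] by (intro order_trans[OF 2] add_mono mult_mono) auto
  \<comment> \<open>One factor \<open>exp C\<close> from each of the two legs and one from the
    crossing, together with three error sums.\<close>
  then have "f t' x' \<le> exp C * (exp C * (exp C * A) + A + A)"
    by (intro order_trans[OF 3] mult_left_mono add_right_mono) auto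
  also have "\<dots> \<le> exp C * (exp C * (exp C * A) + exp C * (exp C * A) + exp C * (exp C * A))"
  proof -
    have "1 * (1 * A) \<le> exp C * (exp C * A)" using e A0 by (intro mult_mono) auto
    then show ?thesis by (intro mult_left_mono add_mono) auto
  qed
  also have "\<dots> = 3 * exp (3 * C) * A" by (simp add: exp_add[symmetric] mult.assoc[symmetric])
  finally show ?thesis unfolding C_def A_def .
qed

section \<open>Choice of the levels and the Borel-Cantelli lemma\<close>

definition level :: "real \<Rightarrow> nat \<Rightarrow> nat" where
  "level \<eta> n = nat \<lfloor>2 powr (\<eta> / 4 * n)\<rfloor>"

lemma level_bounds:
  assumes \<eta>: "0 < \<eta>" "\<eta> < 1"
  shows "real (level \<eta> n) ^ 4 \<le> 2 powr (\<eta> * n)" "level \<eta> n ^ 4 \<le> 2 ^ n" "2 powr (\<eta> / 4 * n) / 2 \<le> level \<eta> n"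
    "1 \<le> level \<eta> n" "4 / \<eta> \<le> n \<Longrightarrow> 2 \<le> level \<eta> n"
proof -
  let ?y = "2 powr (\<eta> / 4 * n)"
  have y: "1 \<le> ?y" using \<eta> by (simp add: ge_one_powr_ge_zero)
  have l: "real (level \<eta> n) = of_int \<lfloor>?y\<rfloor>" unfolding level_def using y by simp
  have y1: "1 \<le> real_of_int \<lfloor>?y\<rfloor>" using y by simp
  then show "?y / 2 \<le> level \<eta> n" using l by linarith
  show "1 \<le> level \<eta> n" using l y1 by linarith
  have "real (level \<eta> n) \<le> ?y" unfolding l by linarith
  then have "real (level \<eta> n) ^ 4 \<le> ?y ^ 4" by (intro power_mono) auto
  also have "?y ^ 4 = 2 powr (\<eta> * n)" by (simp add: powr_power)
  finally show 1: "real (level \<eta> n) ^ 4 \<le> 2 powr (\<eta> * n)" .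
  also have "\<eta> * real n \<le> 1 * real n" using \<eta> by (intro mult_right_mono) auto
  finally have "real (level \<eta> n) ^ 4 \<le> 2 powr (1 * real n)" by simp
  then have "real (level \<eta> n) ^ 4 \<le> 2 ^ n" by (simp add: powr_realpow)
  then have "real (level \<eta> n ^ 4) \<le> real (2 ^ n)" by simp
  then show "level \<eta> n ^ 4 \<le> 2 ^ n" unfolding of_nat_le_iff .
  show "2 \<le> level \<eta> n" if "4 / \<eta> \<le> n"
  proof -
    have "4 \<le> \<eta> * n" using that \<eta> by (simp add: pos_divide_le_eq mult.commute)
    then have "1 \<le> \<eta> / 4 * n" by simp
    then have "2 powr 1 \<le> ?y" by (intro powr_mono) auto
    then have "2 \<le> \<lfloor>?y\<rfloor>" by (simp add: le_floor_iff)
    then show ?thesis using l by linarith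
  qed
qed

text \<open>The series that arises in \<open>eventually_good\<close>: there are
  \<open>(n + 1) * 4 ^ n\<close> times, a further \<open>4 ^ n\<close> comes from dividing by the
  square of the mesh, and \<open>384 = 16 * 24\<close> comes from \<open>bad_bound\<close>.
  Exponentials of a power of \<open>2 ^ n\<close> beat all of this.\<close>

lemma level_series_summable:
  fixes \<beta> :: real
  assumes "0 < \<beta>"
  shows "summable (\<lambda>n. (real n + 1) * 16 ^ n * (exp (- (2 powr (\<beta> * n))\<^sup>2 / 16) + 384 * (2 ^ n + 3) / (exp (2 powr (\<beta> * n) / 8) - 1)))"
proof (rule summable_comparison_test_bigo)
  show "summable (\<lambda>n. norm ((1 / 2 :: real) ^ n))" by simp
  show "(\<lambda>n. (real n + 1) * 16 ^ n * (exp (- (2 powr (\<beta> * n))\<^sup>2 / 16) + 384 * (2 ^ n + 3) / (exp (2 powr (\<beta> * n) / 8) - 1))) \<in> O(\<lambda>n. (1 / 2) ^ n)"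
    using assms by real_asymp
qed

lemma half_power_sq: "(1 / 2 ^ n)\<^sup>2 = 1 / (4 ^ n :: real)"
  by (simp add: power_divide power2_eq_square power_mult_distrib[symmetric])

context sbm_process
begin

text \<open>The time horizon \<open>n + 1\<close> grows with the level, so that every bounded range
  of times is eventually covered while the probabilities remain summable.\<close>

lemma eventually_good:
  assumes \<eta>: "0 < \<eta>" "\<eta> < 1"
  shows "AE \<omega> in M. \<exists>N. \<forall>n\<ge>N. \<omega> \<notin> bad (1 / 2 ^ n) (level \<eta> n) ((n + 1) * 4 ^ n)"
proof -
  let ?B = "\<lambda>n. bad (1 / 2 ^ n) (level \<eta> n) ((n + 1) * 4 ^ n)"
  let ?g = "\<lambda>n. (real n + 1) * 16 ^ n * (exp (- (2 powr (\<eta> / 4 * n))\<^sup>2 / 16) + 384 * (2 ^ n + 3) / (exp (2 powr (\<eta> / 4 * n) / 8) - 1))"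
  have B: "?B n \<in> sets M" for n by (intro bad_sets level_bounds(4)[OF \<eta>]) simp
  have le: "measure M (?B n) \<le> m0 * ?g n" for n
  proof -
    define b where "b = level \<eta> n"
    define y where "y = 2 powr (\<eta> / 4 * n)"
    note L = level_bounds[OF \<eta>, of n, folded b_def y_def]
    have y: "1 \<le> y" unfolding y_def using \<eta> by (simp add: ge_one_powr_ge_zero)
    \<comment> \<open>After rounding down, \<open>b\<close> is at least \<open>y / 2\<close>; this
      turns \<open>b ^ 2 / 4\<close> into \<open>y ^ 2 / 16\<close> and \<open>b / 4\<close> into
      \<open>y / 8\<close>.\<close>
    have "(y / 2)\<^sup>2 \<le> (real b)\<^sup>2" using L(3) y by (intro power_mono) auto
    then have e1: "exp (- (real b)\<^sup>2 / 4) \<le> exp (- y\<^sup>2 / 16)" by (simp add: power_divide)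
    have ey: "0 < exp (y / 8) - 1" using y by simp
    have e2: "exp (y / 8) - 1 \<le> exp (real b / 4) - 1" using L(3) by simp
    have b4: "real b ^ 4 + 3 \<le> 2 ^ n + 3"
    proof -
      have "real (b ^ 4) \<le> real (2 ^ n)" using L(2) by (rule of_nat_mono)
      then show ?thesis by simp
    qed
    define P where "P = (2 :: real) ^ n"
    have P: "0 < P" by (simp add: P_def)
    have "1 / (1 / P * (exp (real b / 4) - 1)) * (24 * (real b ^ 4 + 3) / (1 / P)) = P * P * (24 * (real b ^ 4 + 3) / (exp (real b / 4) - 1))"
      using P by (simp add: field_simps)
    also have "\<dots> \<le> P * P * (24 * (2 ^ n + 3) / (exp (y / 8) - 1))"
      using P b4 e2 ey by (intro mult_left_mono frac_le) auto
    finally have 2: "1 / (1 / P * (exp (real b / 4) - 1)) * (24 * (real b ^ 4 + 3) / (1 / P)) * m0 \<le> P * P * (24 * (2 ^ n + 3) / (exp (y / 8) - 1)) * m0"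
      by (rule mult_right_mono) simp
    have "exp (- (real b)\<^sup>2 / 4) / (1 / P)\<^sup>2 = P * P * exp (- (real b)\<^sup>2 / 4)" using P by (simp add: power2_eq_square)
    also have "\<dots> \<le> P * P * exp (- y\<^sup>2 / 16)" using e1 P by (intro mult_left_mono) auto
    finally have 1: "exp (- (real b)\<^sup>2 / 4) / (1 / P)\<^sup>2 * m0 \<le> P * P * exp (- y\<^sup>2 / 16) * m0" by (rule mult_right_mono) simp
    have "measure M (?B n) \<le> real ((n + 1) * 4 ^ n) * (exp (- (real b)\<^sup>2 / 4) / (1 / P)\<^sup>2 * m0 + 16 * (1 / (1 / P * (exp (real b / 4) - 1)) * (24 * (real b ^ 4 + 3) / (1 / P)) * m0))"
      unfolding b_def P_def by (rule order_trans[OF bad_bound]) (use level_bounds(4)[OF \<eta>] in auto)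
    also have "\<dots> \<le> real ((n + 1) * 4 ^ n) * (P * P * exp (- y\<^sup>2 / 16) * m0 + 16 * (P * P * (24 * (2 ^ n + 3) / (exp (y / 8) - 1)) * m0))"
      using 1 2 by (intro mult_left_mono add_mono) auto
    also have "\<dots> = m0 * ((real n + 1) * (4 ^ n * (P * P)) * (exp (- y\<^sup>2 / 16) + 384 * (2 ^ n + 3) / (exp (y / 8) - 1)))"
    proof -
      have "p * q * (w * e * m + 16 * (w * (24 * u / v) * m)) = m * (p * (q * w) * (e + 384 * u / v))" for p q w e m u v :: real
        by (simp add: algebra_simps)
      moreover have "real ((n + 1) * 4 ^ n) = (real n + 1) * 4 ^ n" by (simp add: distrib_right)
      ultimately show ?thesis by (simp only:)
    qed
    also have "4 ^ n * (P * P) = (16 :: real) ^ n" unfolding P_def by (simp add: power_mult_distrib[symmetric])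
    finally show ?thesis unfolding y_def .
  qed
  have "summable (\<lambda>n. measure M (?B n))"
    by (rule summable_comparison_test'[OF summable_mult[OF level_series_summable[of "\<eta> / 4"], of m0], of 0]) (use \<eta> le in auto)
  then have "AE \<omega> in M. \<forall>\<^sub>F n in sequentially. \<omega> \<in> space M - ?B n"
    using B by (intro borel_cantelli_AE1) (auto simp: emeasure_eq_measure)
  then show ?thesis by (rule AE_mp) (auto simp: eventually_sequentially intro!: AE_I2)
qed

section \<open>The modulus of continuity at zeros\<close>

lemma good_modulus:
  assumes \<xi>: "0 < \<xi>" "\<xi> < 1" and K: "1 \<le> K"
  obtains C where "0 < C"
    "\<And>\<omega> N t x t' x'. \<lbrakk>\<omega> \<in> space M; 12 * K \<le> N; 4 / (1 - \<xi>) \<le> real N;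
      \<And>n. N \<le> n \<Longrightarrow> \<omega> \<notin> bad (1 / 2 ^ n) (level (1 - \<xi>) n) ((n + 1) * 4 ^ n);
      X \<omega> t x = 0; 1 / real K \<le> t; t' \<le> real N; 0 < pdist (t', x') (t, x); pdist (t', x') (t, x) \<le> 1 / 2 ^ N\<rbrakk>
      \<Longrightarrow> X \<omega> t' x' \<le> C * pdist (t', x') (t, x) powr \<xi>"
proof -
  define \<eta> where "\<eta> = 1 - \<xi>"
  have \<eta>: "0 < \<eta>" "\<eta> < 1" using \<xi> by (auto simp: \<eta>_def)
  note L = level_bounds[OF \<eta>]
  \<comment> \<open>At level \<open>n\<close> the additive error is \<open>b ^ 4 / 2 ^ n\<close>, up
    to a constant, hence at most a multiple of \<open>\<theta> ^ n\<close> because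
    \<open>\<eta> - 1 = - \<xi>\<close>; the exponent \<open>6 / b\<close> is at most
    \<open>12 * \<gamma> ^ n\<close>. Both series are geometric.\<close>
  define \<theta> \<gamma> :: real where "\<theta> = 2 powr (- \<xi>)" and "\<gamma> = 2 powr (- \<eta> / 4)"
  have \<theta>: "0 < \<theta>" "\<theta> < 1" and \<gamma>: "0 < \<gamma>" "\<gamma> < 1" using \<xi> \<eta> unfolding \<theta>_def \<gamma>_def by (auto simp: powr_less_one)
  define a c where "a n = 3 * exp 3 * \<theta> ^ n" and "c n = 12 * \<gamma> ^ n" for n
  have a: "0 \<le> a n" "summable a" and c: "0 \<le> c n" "summable c" for n
    using \<theta> \<gamma> unfolding a_def c_def by (auto intro!: summable_mult summable_geometric)
  define C where "C = 3 * exp (3 * suminf c) * (3 * exp 3 / (1 - \<theta>)) * 2 powr \<xi>"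
  show thesis
  proof (rule that)
    show "0 < C" using \<theta> unfolding C_def by (intro mult_pos_pos divide_pos_pos) auto
  next
    fix \<omega> N t x t' x'
    assume \<omega>: "\<omega> \<in> space M" and N: "12 * K \<le> N" "4 / (1 - \<xi>) \<le> real N"
      and good: "\<And>n. N \<le> n \<Longrightarrow> \<omega> \<notin> bad (1 / 2 ^ n) (level (1 - \<xi>) n) ((n + 1) * 4 ^ n)"
      and zero: "X \<omega> t x = 0" and t: "1 / real K \<le> t" and t': "t' \<le> real N"
      and d0: "0 < pdist (t', x') (t, x)" and dN: "pdist (t', x') (t, x) \<le> 1 / 2 ^ N"
    define d where "d = pdist (t', x') (t, x)"
    have d: "0 < d" "d \<le> 1 / 2 ^ N" using d0 dN by (simp_all add: d_def)
    \<comment> \<open>The scale of the distance: \<open>d\<close> lies between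
      \<open>1 / 2 ^ Suc n0\<close> and \<open>1 / 2 ^ n0\<close>. Such a level exists because
      \<open>d\<close> is positive.\<close>
    define n0 where "n0 = (LEAST n. 1 / 2 ^ Suc n < d)"
    obtain n where "(1 / 2) ^ n < d" using real_arch_pow_inv[OF d(1), of "1 / 2"] by auto
    moreover have "(1 / 2) ^ Suc n \<le> (1 / 2 :: real) ^ n" by (rule power_decreasing) auto
    ultimately have ex: "1 / 2 ^ Suc n < d" by (simp add: power_one_over)
    have n0: "1 / 2 ^ Suc n0 < d" unfolding n0_def by (rule LeastI[of _ n]) (rule ex)
    have Nn0: "N \<le> n0"
    proof (rule ccontr)
      assume "\<not> N \<le> n0"
      then have "(2 :: real) ^ Suc n0 \<le> 2 ^ N" by (intro power_increasing) auto
      then have "1 / (2 :: real) ^ N \<le> 1 / 2 ^ Suc n0" by (intro divide_left_mono) auto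
      then show False using n0 d(2) by linarith
    qed
    have dn0: "d \<le> 1 / 2 ^ n0"
    proof (cases "n0 = N")
      case False
      then have "Suc (n0 - 1) = n0" "n0 - 1 < n0" using Nn0 by auto
      then show ?thesis using not_less_Least[of "n0 - 1" "\<lambda>n. 1 / 2 ^ Suc n < d"] unfolding n0_def[symmetric] by simp
    qed (use d in simp)
    have tt: "\<bar>t' - t\<bar> \<le> 1 / 4 ^ n0"
    proof -
      have "sqrt \<bar>t' - t\<bar> \<le> 1 / 2 ^ n0" using dn0 by (simp add: d_def pdist_def)
      then show ?thesis unfolding half_power_sq[symmetric] by (rule sqrt_le_D)
    qed
    have xx: "\<bar>x' - x\<bar> \<le> 1 / 2 ^ n0"
    proof -
      have "0 \<le> sqrt \<bar>t' - t\<bar>" by simp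
      then show ?thesis using dn0 unfolding d_def pdist_def fst_conv snd_conv by linarith
    qed
    have pow: "12 * real K \<le> 2 ^ n" if "N \<le> n" for n
    proof -
      have "12 * real K \<le> real n" using N(1) that by linarith
      also have "\<dots> \<le> 2 ^ n" using of_nat_less_two_power[of n] by (rule less_imp_le)
      finally show ?thesis .
    qed
    have four: "(4 :: real) ^ n = 2 ^ n * 2 ^ n" for n by (simp add: power_mult_distrib[symmetric])
    have K0: "0 < real K" using K by simp
    \<comment> \<open>\<open>t'\<close> may precede \<open>1 / K\<close>, but by no more than half
      of it; hence the chain is run from time \<open>1 / (2 * K)\<close> on.\<close>
    have tK: "1 / 4 ^ n0 \<le> 1 / (2 * real K)"
    proof (rule divide_left_mono)
      have "1 * (12 * real K) \<le> 2 ^ n0 * 2 ^ n0" using pow[OF Nn0] K0 by (intro mult_mono) auto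
      then show "2 * real K \<le> 4 ^ n0" unfolding four using K0 by linarith
    qed (use K0 in auto)
    have half: "1 / (2 * real K) = 1 / real K / 2" by simp
    have p1: "1 / (4 :: real) ^ n0 \<le> 1" by simp
    have "X \<omega> t' x' \<le> 3 * exp (3 * suminf c) * (\<Sum>n. a (n0 + n))"
    proof (rule grid_chain[where f="X \<omega>" and L="\<lambda>n. level \<eta> n ^ 4 + 1" and N="\<lambda>n. (n + 1) * 4 ^ n" and T="real N + 1" and \<tau>="1 / (2 * real K)" and t=t and x=x])
      show "1 / (2 * real K) \<le> t" "1 / (2 * real K) \<le> t'" "t \<le> real N + 1" "t' \<le> real N + 1"
        using tt t t' tK p1 K0 half by linarith+
      fix n assume n: "n0 \<le> n"
      have Nn: "N \<le> n" using n Nn0 by simp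
      have P: "12 * real K \<le> 2 ^ n" by (rule pow[OF Nn])
      \<comment> \<open>The \<open>b ^ 4 + 5\<close> time steps must fit below
        \<open>1 / (2 * K)\<close>. They number at most \<open>6 * 2 ^ n\<close>, and
        \<open>12 * K \<le> 2 ^ n\<close> makes this at most \<open>4 ^ n / (2 * K)\<close>; this is
        the origin of \<open>12 * K \<le> N\<close>.\<close>
      show "real (level \<eta> n ^ 4 + 1) + 4 \<le> 4 ^ n * (1 / (2 * real K))"
      proof -
        have "real (level \<eta> n ^ 4) \<le> real (2 ^ n)" using L(2) by (rule of_nat_mono)
        moreover have "(1 :: real) \<le> 2 ^ n" by simp
        moreover have "real (level \<eta> n ^ 4 + 1) + 4 = real (level \<eta> n ^ 4) + 5" "real (2 ^ n) = 2 ^ n" by simp_all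
        ultimately have "real (level \<eta> n ^ 4 + 1) + 4 \<le> 6 * 2 ^ n" by linarith
        also have "\<dots> = 2 ^ n * (12 * real K) * (1 / (2 * real K))" using K0 by simp
        also have "\<dots> \<le> 2 ^ n * 2 ^ n * (1 / (2 * real K))" using P K0 by (intro mult_right_mono mult_left_mono) auto
        finally show ?thesis unfolding four .
      qed
      show "4 ^ n * (real N + 1) \<le> real ((n + 1) * 4 ^ n)"
      proof -
        have "4 ^ n * (real N + 1) \<le> 4 ^ n * (real n + 1)" using Nn by (intro mult_left_mono) auto
        then show ?thesis by (simp add: algebra_simps)
      qed
      show "1 \<le> level \<eta> n ^ 4 + 1" by simp
      fix j j' :: nat and k k' :: int
      assume h: "level \<eta> n ^ 4 + 1 \<le> j" "j \<le> (n + 1) * 4 ^ n" "level \<eta> n ^ 4 + 1 \<le> j'" "j' \<le> (n + 1) * 4 ^ n" "j \<le> j' + 3" "j' \<le> j + 3" "\<bar>k' - k\<bar> \<le> 1"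
      let ?b = "level \<eta> n"
      have "4 / \<eta> \<le> n" using N(2) Nn unfolding \<eta>_def[symmetric] by linarith
      then have b2: "2 \<le> ?b" by (rule L(5))
      have "X \<omega> (j' * (1 / 2 ^ n)\<^sup>2) (k' * (1 / 2 ^ n)) \<le> exp (6 / ?b) * X \<omega> (j * (1 / 2 ^ n)\<^sup>2) (k * (1 / 2 ^ n)) + 3 * exp 3 * (real ?b ^ 4 * (1 / 2 ^ n))"
        by (rule good_step[OF \<omega> good[OF Nn, folded \<eta>_def] _ b2 h]) simp
      also have "\<dots> \<le> exp (c n) * X \<omega> (j * (1 / 2 ^ n)\<^sup>2) (k * (1 / 2 ^ n)) + a n"
      proof (intro add_mono mult_right_mono)
        have "\<gamma> ^ n = 2 powr (- (\<eta> / 4 * n))" unfolding \<gamma>_def by (subst powr_power) (auto simp: mult.commute)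
        then have "\<gamma> ^ n = 1 / 2 powr (\<eta> / 4 * n)" unfolding powr_minus_divide .
        moreover have "6 / real ?b \<le> 6 / (2 powr (\<eta> / 4 * n) / 2)" using L(3)[of n] b2 by (intro divide_left_mono mult_pos_pos) auto
        ultimately show "exp (6 / real ?b) \<le> exp (c n)" by (simp add: c_def)
        show "0 \<le> X \<omega> (j * (1 / 2 ^ n)\<^sup>2) (k * (1 / 2 ^ n))" using nonneg[OF \<omega>] h(1) by simp
        have "real ?b ^ 4 * (1 / 2 ^ n) \<le> 2 powr (\<eta> * n) * (1 / 2 ^ n)" using L(1) by (intro mult_right_mono) auto
        also have "\<dots> = 2 powr (\<eta> * n) * 2 powr (- real n)" by (simp add: powr_minus_divide powr_realpow)
        also have "\<dots> = \<theta> ^ n" unfolding \<theta>_def \<eta>_def by (simp add: powr_power powr_add[symmetric] algebra_simps)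
        finally show "3 * exp 3 * (real ?b ^ 4 * (1 / 2 ^ n)) \<le> a n" unfolding a_def by (rule mult_left_mono) simp
      qed
      finally show "X \<omega> (j' * (1 / 4 ^ n)) (k' * (1 / 2 ^ n)) \<le> exp (c n) * X \<omega> (j * (1 / 4 ^ n)) (k * (1 / 2 ^ n)) + a n"
        unfolding half_power_sq .
    qed (use cont[OF \<omega>] nonneg[OF \<omega>] a c zero tt xx K0 in auto)
    also have "(\<Sum>n. a (n0 + n)) = 3 * exp 3 / (1 - \<theta>) * \<theta> ^ n0"
    proof -
      have "(\<lambda>n. 3 * exp 3 * \<theta> ^ n0 * \<theta> ^ n) sums (3 * exp 3 * \<theta> ^ n0 * (1 / (1 - \<theta>)))"
        using \<theta> by (intro sums_mult geometric_sums) simp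
      then show ?thesis unfolding a_def by (simp add: sums_iff power_add mult.assoc mult_ac)
    qed
    also have "3 * exp (3 * suminf c) * (3 * exp 3 / (1 - \<theta>) * \<theta> ^ n0) \<le> 3 * exp (3 * suminf c) * (3 * exp 3 / (1 - \<theta>) * (2 powr \<xi> * d powr \<xi>))"
    proof (intro mult_left_mono)
      \<comment> \<open>The geometric sum is of the size of its first term, and
        \<open>2 powr (- n0)\<close> is below \<open>2 * d\<close> by the choice of
        \<open>n0\<close>; this brings the error back to a power of the distance.\<close>
      have "\<theta> ^ n0 = (2 powr (- real n0)) powr \<xi>" unfolding \<theta>_def by (simp add: powr_power powr_powr mult.commute)
      also have "2 powr (- real n0) = 2 * (1 / 2 ^ Suc n0)" by (simp add: powr_minus_divide powr_realpow)
      also have "(2 * (1 / 2 ^ Suc n0)) powr \<xi> \<le> (2 * d) powr \<xi>" using n0 \<xi> by (intro powr_mono2 mult_left_mono) auto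
      also have "\<dots> = 2 powr \<xi> * d powr \<xi>" using d by (simp add: powr_mult)
      finally show "\<theta> ^ n0 \<le> 2 powr \<xi> * d powr \<xi>" .
    qed (use \<theta> in auto)
    also have "\<dots> = C * d powr \<xi>" unfolding C_def by (simp add: mult.assoc)
    finally show "X \<omega> t' x' \<le> C * pdist (t', x') (t, x) powr \<xi>" unfolding d_def .
  qed
qed

proposition zero_modulus:
  assumes \<xi>: "0 < \<xi>" "\<xi> < 1" and K: "1 \<le> K"
  shows "\<exists>\<rho> \<in> borel_measurable M. AE \<omega> in M. 0 < \<rho> \<omega> \<and>
    (\<forall>t x t' x'. X \<omega> t x = 0 \<and> 1 / real K \<le> t \<and> 0 < t' \<and> pdist (t', x') (t, x) \<le> \<rho> \<omega> \<longrightarrow>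
      X \<omega> t' x' \<le> pdist (t', x') (t, x) powr \<xi>)"
proof -
  \<comment> \<open>An exponent strictly between \<open>\<xi>\<close> and 1: the spare power
    \<open>\<zeta> - \<xi>\<close> of the distance absorbs the constant \<open>C\<close>, and
    \<open>\<kappa>\<close> below is a distance at which it does so.\<close>
  define \<zeta> where "\<zeta> = (1 + \<xi>) / 2"
  have \<zeta>: "0 < \<zeta>" "\<zeta> < 1" "0 < \<zeta> - \<xi>" using \<xi> by (auto simp: \<zeta>_def)
  obtain C where C: "0 < C"
    "\<And>\<omega> N t x t' x'. \<lbrakk>\<omega> \<in> space M; 12 * K \<le> N; 4 / (1 - \<zeta>) \<le> real N;
      \<And>n. N \<le> n \<Longrightarrow> \<omega> \<notin> bad (1 / 2 ^ n) (level (1 - \<zeta>) n) ((n + 1) * 4 ^ n);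
      X \<omega> t x = 0; 1 / real K \<le> t; t' \<le> real N; 0 < pdist (t', x') (t, x); pdist (t', x') (t, x) \<le> 1 / 2 ^ N\<rbrakk>
      \<Longrightarrow> X \<omega> t' x' \<le> C * pdist (t', x') (t, x) powr \<zeta>"
    using good_modulus[OF \<zeta>(1,2) K] by blast
  define N0 where "N0 = max (12 * K) (nat \<lceil>4 / (1 - \<zeta>)\<rceil>)"
  have N0: "12 * K \<le> N0" "4 / (1 - \<zeta>) \<le> N0" "1 \<le> N0" using K unfolding N0_def by linarith+
  let ?B = "\<lambda>n. bad (1 / 2 ^ n) (level (1 - \<zeta>) n) ((n + 1) * 4 ^ n)"
  \<comment> \<open>Each clause is a measurable condition, so the least such \<open>N\<close> is a
    measurable random level and \<open>\<rho>\<close> a random variable. Extinction by time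
    \<open>N\<close> disposes of all later times, which \<open>good_modulus\<close> does not
    cover.\<close>
  define Q where "Q N \<omega> \<longleftrightarrow> N0 \<le> N \<and> mass (real N) \<omega> = 0 \<and> (\<forall>n. N \<le> n \<longrightarrow> \<omega> \<notin> ?B n)" for N \<omega>
  have [measurable]: "?B n \<in> sets M" for n by (intro bad_sets level_bounds(4)) (use \<zeta> in auto)
  have Q_meas: "Measurable.pred M (Q N)" for N
  proof (cases "N0 \<le> N")
    case True
    then have [measurable]: "mass (real N) \<in> borel_measurable M" using N0 by (intro J_measurable) auto
    show ?thesis unfolding Q_def by measurable
  qed (simp add: Q_def[abs_def])
  define \<kappa> where "\<kappa> = min 1 ((1 / C) powr (1 / (\<zeta> - \<xi>)))"
  have \<kappa>: "0 < \<kappa>" "\<kappa> \<le> 1" using C(1) by (simp_all add: \<kappa>_def)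
  define \<rho> where "\<rho> \<omega> = \<kappa> / 2 ^ (LEAST N. Q N \<omega>)" for \<omega>
  have "\<rho> \<in> borel_measurable M"
    unfolding \<rho>_def by (rule measurable_compose[OF measurable_Least[OF Q_meas]]) simp
  moreover have "AE \<omega> in M. 0 < \<rho> \<omega> \<and>
    (\<forall>t x t' x'. X \<omega> t x = 0 \<and> 1 / real K \<le> t \<and> 0 < t' \<and> pdist (t', x') (t, x) \<le> \<rho> \<omega> \<longrightarrow>
      X \<omega> t' x' \<le> pdist (t', x') (t, x) powr \<xi>)"
  proof -
    have abs: "AE \<omega> in M. \<forall>N::nat. 0 < N \<longrightarrow> mass (real N) \<omega> = 0 \<longrightarrow> (\<forall>t\<ge>real N. \<forall>x. X \<omega> t x = 0)"
      unfolding AE_all_countable using extinct_absorbing by (intro allI AE_impI) simp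
    have good: "AE \<omega> in M. \<exists>N. \<forall>n\<ge>N. \<omega> \<notin> ?B n" using \<zeta> by (intro eventually_good) auto
    show ?thesis using abs good extinction AE_space
    proof eventually_elim
      case (elim \<omega>)
      note ab = elim(1) and \<omega> = elim(4)
      obtain N1 where N1: "\<forall>n\<ge>N1. \<omega> \<notin> ?B n" using elim(2) by blast
      obtain N2 :: nat where N2: "0 < N2" "mass (real N2) \<omega> = 0" using elim(3) by blast
      \<comment> \<open>Good levels persist above \<open>N1\<close> and extinction persists after
        \<open>N2\<close>, so the maximum satisfies all clauses.\<close>
      have "Q (max N0 (max N1 N2)) \<omega>"
      proof -
        let ?m = "max N0 (max N1 N2)"
        have "X \<omega> (real ?m) x = 0" for x using ab N2 by simp
        then have "mass (real ?m) \<omega> = 0" by (simp add: pair_dens_def)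
        then show ?thesis using N1 by (simp add: Q_def)
      qed
      define N where "N = (LEAST N. Q N \<omega>)"
      have QN: "Q N \<omega>" unfolding N_def by (rule LeastI) fact
      have NN: "N0 \<le> N" "mass (real N) \<omega> = 0" "\<And>n. N \<le> n \<Longrightarrow> \<omega> \<notin> ?B n" using QN by (auto simp: Q_def)
      have \<rho>: "\<rho> \<omega> = \<kappa> / 2 ^ N" by (simp add: \<rho>_def N_def)
      have ext: "X \<omega> t x = 0" if "real N \<le> t" for t x
      proof -
        have "0 < N" using N0(3) NN(1) by simp
        then show ?thesis using ab NN(2) that by blast
      qed
      show ?case
      proof (intro conjI allI impI)
        show "0 < \<rho> \<omega>" using \<kappa> by (simp add: \<rho>)
        fix t x t' x'
        assume h: "X \<omega> t x = 0 \<and> 1 / real K \<le> t \<and> 0 < t' \<and> pdist (t', x') (t, x) \<le> \<rho> \<omega>"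
        define d where "d = pdist (t', x') (t, x)"
        have d0: "0 \<le> d" by (simp add: d_def pdist_def)
        have "\<kappa> / 2 ^ N \<le> 1 / 2 ^ N" using \<kappa> by (intro divide_right_mono) auto
        moreover have "\<kappa> / 2 ^ N \<le> \<kappa> / 1" using \<kappa> by (intro divide_left_mono) auto
        ultimately have d: "d \<le> 1 / 2 ^ N" "d \<le> \<kappa>" using h unfolding d_def \<rho> by linarith+
        \<comment> \<open>After time \<open>N\<close> the process is extinct, and at distance zero
          the point is the given zero itself; the estimate is needed only in the third case.\<close>
        consider "real N \<le> t'" | "d = 0" | "t' \<le> real N" "0 < d" using d0 by linarith
        then have "X \<omega> t' x' \<le> d powr \<xi>"
        proof cases
          case 1
          then show ?thesis using ext by simp
        next
          case 2
          then have "t' = t \<and> x' = x" unfolding d_def pdist_def by (simp add: add_nonneg_eq_0_iff)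
          then show ?thesis using h by simp
        next
          case 3
          have "X \<omega> t' x' \<le> C * d powr \<zeta>"
            unfolding d_def by (rule C(2)[OF \<omega>, of N t x t' x']) (use NN N0 h 3 d in \<open>auto simp: d_def\<close>)
          also have "\<dots> = C * d powr (\<zeta> - \<xi>) * d powr \<xi>" using 3 by (simp add: powr_add[symmetric])
          also have "\<dots> \<le> 1 * d powr \<xi>"
          proof (intro mult_right_mono)
            have "d powr (\<zeta> - \<xi>) \<le> ((1 / C) powr (1 / (\<zeta> - \<xi>))) powr (\<zeta> - \<xi>)"
              using d(2) d0 \<zeta> by (intro powr_mono2) (auto simp: \<kappa>_def)
            also have "\<dots> = 1 / C" using \<zeta> C(1) by (simp add: powr_powr)
            finally show "C * d powr (\<zeta> - \<xi>) \<le> 1" using C(1) by (simp add: field_simps)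
          qed simp
          finally show ?thesis by simp
        qed
        then show "X \<omega> t' x' \<le> pdist (t', x') (t, x) powr \<xi>" by (simp add: d_def)
      qed
    qed
  qed
  ultimately show ?thesis by blast
qed

end

theorem theorem5p7:
  fixes M :: "'a measure" and F :: "real \<Rightarrow> 'a measure" and X0 :: "real measure"
    and X :: "'a \<Rightarrow> real \<Rightarrow> real \<Rightarrow> real" and \<xi> :: real and K :: nat
  assumes "finite_measure X0" and "sets X0 = sets borel"
    and "sbm_density M F X0 X"
    and "0 < \<xi>" and "\<xi> < 1"
    and "1 \<le> K"
  shows "\<exists>\<rho> :: 'a \<Rightarrow> real. \<rho> \<in> borel_measurable M \<and>
           (AE \<omega> in M. 0 < \<rho> \<omega> \<and>
              (\<forall>t x t' x'. X \<omega> t x = 0 \<and> 1 / real K \<le> t \<and> 0 < t' \<and>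
                   pdist (t', x') (t, x) \<le> \<rho> \<omega> \<longrightarrow>
                   X \<omega> t' x' \<le> pdist (t', x') (t, x) powr \<xi>))"
proof -
  interpret sbm_process M F X0 X by (rule sbm_process.intro) (use assms in auto)
  from zero_modulus[OF assms(4-6)] show ?thesis by blast
qed

end
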